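(* Let $D\subset\mathbb C$ be the closed unit disk and let $E=H^3(D,\mathbb R^N)$ carry the sc-structure $E_m=H^{3+m}(D,\mathbb R^N)$, $m\ge0$. Let $u\in E_\infty$ satisfy $u(0)=0$ with $Du(0):\mathbb C\to\mathbb R^N$ injective, and let $H\subset\mathbb R^N$ be an algebraic complement of the image of $Du(0)$. Let $U$ be an open neighborhood of $u$ in $C^1(D,\mathbb R^N)$ and $0<\varepsilon<1$, as provided by the implicit function theorem, such that for every $v\in U$ there is a unique point $z_v$ in the $\varepsilon$-disk around $0$ in $\mathbb C$ with $v(z_v)\in H$, the image of $Dv(z_v)$ is transversal to $H$, and the map $U\to D$, $v\mapsto z_v$, is $C^1$ (and is of class $C^k$ on $U\cap C^k(D,\mathbb R^N)$ with the $C^k$-topology). If $U\cap E$ is equipped with the induced sc-structure, then the map $$U\cap E\to\mathbb C,\qquad v\mapsto z_v,$$ is sc-smooth.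
   Context: An sc-structure on a Banach space $E$ is a nested sequence $E=E_0\supset E_1\supset\cdots$ of Banach spaces with all inclusions $E_{m+1}\to E_m$ compact and $E_\infty=\bigcap_mE_m$ dense in every $E_m$. Finite-dimensional spaces carry the constant structure. $E\oplus F$ has levels $E_m\oplus F_m$, and $E^1$ has levels $E_{1+m}$. An open subset $U\subset E$ has the induced levels $U_m=U\cap E_m$, $U^1$ has levels $U_{1+m}$, and $TU=U^1\oplus E$. A map $f:U\to V$ between open subsets of sc-Banach spaces $E,F$ is $\mathrm{sc}^0$ if $f:U_m\to V_m$ is well defined and continuous for all $m$. It is $\mathrm{sc}^1$ if it is $\mathrm{sc}^0$ and for every $x\in U_1$ there is a bounded linear operator $Df(x):E_0\to F_0$ with $\lim_{|h|_1\to0}|h|_1^{-1}|f(x+h)-f(x)-Df(x)h|_0=0$ ($h\in E_1$) such that $Tf:TU\to TV$, $(x,h)\mapsto(f(x),Df(x)h)$, is $\mathrm{sc}^0$. Inductively $f$ is $\mathrm{sc}^{k+1}$ if it is $\mathrm{sc}^1$ and $Tf$ is $\mathrm{sc}^k$; sc-smooth means $\mathrm{sc}^k$ for all $k$. Here $|\cdot|_m$ is the norm on level $m$. *)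

theory Defs
  imports "HOL-Analysis.Analysis" "HOL-Library.Function_Algebras"
begin

section \<open>Pointwise real vector space structure on function types\<close>

instantiation "fun" :: (type, real_vector) real_vector
begin

definition scaleR_fun :: "real \<Rightarrow> ('a \<Rightarrow> 'b) \<Rightarrow> 'a \<Rightarrow> 'b"
  where "scaleR_fun c f = (\<lambda>x. c *\<^sub>R f x)"

instance
  by standard (simp_all add: scaleR_fun_def fun_eq_iff scaleR_add_right scaleR_add_left)

end


section \<open>Normed spaces given by a carrier and a norm\<close>

definition norm_top :: "'a::real_vector set \<Rightarrow> ('a \<Rightarrow> real) \<Rightarrow> 'a topology"
  where "norm_top X n = Metric_space.mtopology X (\<lambda>x y. n (x - y))"

definition banach_on :: "'a::real_vector set \<Rightarrow> ('a \<Rightarrow> real) \<Rightarrow> bool"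
  where "banach_on X n \<longleftrightarrow>
    subspace X \<and>
    (\<forall>x\<in>X. \<forall>c. n (c *\<^sub>R x) = \<bar>c\<bar> * n x) \<and>
    Metric_space X (\<lambda>x y. n (x - y)) \<and>
    Metric_space.mcomplete X (\<lambda>x y. n (x - y))"

definition blinear_on ::
  "'a::real_vector set \<Rightarrow> ('a \<Rightarrow> real) \<Rightarrow> 'b::real_vector set \<Rightarrow> ('b \<Rightarrow> real) \<Rightarrow> ('a \<Rightarrow> 'b) \<Rightarrow> bool"
  where "blinear_on X n Y p A \<longleftrightarrow>
    A \<in> X \<rightarrow> Y \<and>
    (\<forall>x\<in>X. \<forall>y\<in>X. A (x + y) = A x + A y) \<and>
    (\<forall>x\<in>X. \<forall>c. A (c *\<^sub>R x) = c *\<^sub>R A x) \<and>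
    (\<exists>C. \<forall>x\<in>X. p (A x) \<le> C * n x)"

text \<open>A \<open>j\<close>-linear map on \<open>X\<close> is represented as a function on lists of length \<open>j\<close> over \<open>X\<close>.\<close>

definition bmultilinear_on ::
  "nat \<Rightarrow> 'a::real_vector set \<Rightarrow> ('a \<Rightarrow> real) \<Rightarrow> ('a list \<Rightarrow> 'b::real_normed_vector) \<Rightarrow> bool"
  where "bmultilinear_on j X n A \<longleftrightarrow>
    (\<forall>hs i x y c. length hs = j \<and> set hs \<subseteq> X \<and> i < j \<and> x \<in> X \<and> y \<in> X \<longrightarrow>
       A (hs[i := x + y]) = A (hs[i := x]) + A (hs[i := y]) \<and>
       A (hs[i := c *\<^sub>R x]) = c *\<^sub>R A (hs[i := x])) \<and>
    (\<exists>C. \<forall>hs. length hs = j \<and> set hs \<subseteq> X \<longrightarrow> norm (A hs) \<le> C * prod_list (map n hs))"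

text \<open>
  \<open>f\<close> is \<open>k\<close> times continuously Frechet differentiable on the open subset \<open>U\<close> of the normed
  space \<open>(X, n)\<close>. Since \<open>L(X, L(X, \<dots>))\<close> would need a new type for every order,
  the \<open>j\<close>-th derivative at \<open>v\<close> is the bounded \<open>j\<close>-linear map \<open>F j v\<close>; differentiability of
  \<open>F j\<close> and continuity of \<open>F k\<close> are with respect to the operator norm on \<open>j\<close>-linear maps.
\<close>

definition Ck_map ::
  "nat \<Rightarrow> 'a::real_vector set \<Rightarrow> ('a \<Rightarrow> real) \<Rightarrow> 'a set \<Rightarrow> ('a \<Rightarrow> 'b::real_normed_vector) \<Rightarrow> bool"
  where "Ck_map k X n U f \<longleftrightarrow>
    (\<exists>F :: nat \<Rightarrow> 'a \<Rightarrow> 'a list \<Rightarrow> 'b.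
       (\<forall>v\<in>U. F 0 v [] = f v) \<and>
       (\<forall>j\<le>k. \<forall>v\<in>U. bmultilinear_on j X n (F j v)) \<and>
       (\<forall>j<k. \<forall>v\<in>U. \<forall>e>0. \<exists>d>0. \<forall>h\<in>X. v + h \<in> U \<and> n h < d \<longrightarrow>
          (\<forall>hs. length hs = j \<and> set hs \<subseteq> X \<longrightarrow>
             norm (F j (v + h) hs - F j v hs - F (Suc j) v (h # hs))
               \<le> e * n h * prod_list (map n hs))) \<and>
       (\<forall>v\<in>U. \<forall>e>0. \<exists>d>0. \<forall>w\<in>U. n (w - v) < d \<longrightarrow>
          (\<forall>hs. length hs = k \<and> set hs \<subseteq> X \<longrightarrow>
             norm (F k w hs - F k v hs) \<le> e * prod_list (map n hs))))"


section \<open>sc-structures\<close>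

record 'a sc =
  level :: "nat \<Rightarrow> 'a set"
  lnorm :: "nat \<Rightarrow> 'a \<Rightarrow> real"

definition sc_infty :: "'a sc \<Rightarrow> 'a set"
  where "sc_infty E = (\<Inter>m. level E m)"

definition level_top :: "'a::real_vector sc \<Rightarrow> nat \<Rightarrow> 'a topology"
  where "level_top E m = norm_top (level E m) (lnorm E m)"

definition sc_structure :: "'a::real_vector sc \<Rightarrow> bool"
  where "sc_structure E \<longleftrightarrow>
    (\<forall>m. banach_on (level E m) (lnorm E m)) \<and>
    (\<forall>m. level E (Suc m) \<subseteq> level E m) \<and>
    (\<forall>m. compactin (level_top E m)
           (level_top E m closure_of {x \<in> level E (Suc m). lnorm E (Suc m) x \<le> 1})) \<and>
    (\<forall>m. level_top E m closure_of sc_infty E = level E m)"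

definition const_sc :: "'a::euclidean_space sc"
  where "const_sc = \<lparr>level = (\<lambda>m. UNIV), lnorm = (\<lambda>m. norm)\<rparr>"

lemma sc_structure_const_sc: "sc_structure (const_sc :: 'a::euclidean_space sc)"
proof -
  have d: "(\<lambda>x y :: 'a. norm (x - y)) = dist"
    by (simp add: fun_eq_iff dist_norm)
  have top: "level_top (const_sc :: 'a sc) m = euclidean" for m
    by (simp add: level_top_def norm_top_def const_sc_def d)
  have "Metric_space.mcomplete (UNIV :: 'a set) dist"
    using complete_UNIV mcomplete_iff_complete by blast
  then have "banach_on (UNIV :: 'a set) norm"
    by (simp add: banach_on_def d Met_TC.Metric_space_axioms)
  moreover have "{x :: 'a. norm x \<le> 1} = cball 0 1"
    by auto
  ultimately show ?thesis
    unfolding sc_structure_def top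
    by (simp add: const_sc_def sc_infty_def)
qed

definition sc_sum :: "'a sc \<Rightarrow> 'b sc \<Rightarrow> ('a \<times> 'b) sc"
  where "sc_sum E F =
    \<lparr>level = (\<lambda>m. level E m \<times> level F m),
     lnorm = (\<lambda>m (x, y). lnorm E m x + lnorm F m y)\<rparr>"

definition sc_up :: "'a sc \<Rightarrow> 'a sc"
  where "sc_up E = \<lparr>level = (\<lambda>m. level E (Suc m)), lnorm = (\<lambda>m. lnorm E (Suc m))\<rparr>"

definition tangent_sc :: "'a sc \<Rightarrow> ('a \<times> 'a) sc"
  where "tangent_sc E = sc_sum (sc_up E) E"

definition tangent_set :: "'a sc \<Rightarrow> 'a set \<Rightarrow> ('a \<times> 'a) set"
  where "tangent_set E U = (U \<inter> level E 1) \<times> level E 0"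

definition tangent_map :: "('a \<Rightarrow> 'b) \<Rightarrow> ('a \<Rightarrow> 'a \<Rightarrow> 'b) \<Rightarrow> 'a \<times> 'a \<Rightarrow> 'b \<times> 'b"
  where "tangent_map f Df = (\<lambda>(x, h). (f x, Df x h))"


section \<open>sc-differentiability\<close>

definition sc0 ::
  "'a::real_vector sc \<Rightarrow> 'a set \<Rightarrow> 'b::real_vector sc \<Rightarrow> 'b set \<Rightarrow> ('a \<Rightarrow> 'b) \<Rightarrow> bool"
  where "sc0 E U F V f \<longleftrightarrow>
    openin (level_top E 0) U \<and> openin (level_top F 0) V \<and>
    (\<forall>m. continuous_map (subtopology (level_top E m) U) (subtopology (level_top F m) V) f)"

definition sc_derivative ::
  "'a::real_vector sc \<Rightarrow> 'a set \<Rightarrow> 'b::real_vector sc \<Rightarrow> ('a \<Rightarrow> 'b) \<Rightarrow> ('a \<Rightarrow> 'a \<Rightarrow> 'b) \<Rightarrow> bool"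
  where "sc_derivative E U F f Df \<longleftrightarrow>
    (\<forall>x \<in> U \<inter> level E 1.
       blinear_on (level E 0) (lnorm E 0) (level F 0) (lnorm F 0) (Df x) \<and>
       (\<forall>e>0. \<exists>d>0. \<forall>h\<in>level E 1. 0 < lnorm E 1 h \<and> lnorm E 1 h < d \<longrightarrow>
          lnorm F 0 (f (x + h) - f x - Df x h) / lnorm E 1 h < e))"

text \<open>
  The recursion \<open>sc\<^sup>k\<^sup>+\<^sup>1\<close> for \<open>f\<close> versus \<open>sc\<^sup>k\<close> for \<open>Tf\<close> passes from \<open>'a\<close> to \<open>'a \<times> 'a\<close>, which a
  recursive definition cannot do. It is therefore carried out on sequences \<open>nat \<Rightarrow> 'a\<close>,
  with pairs of sequences identified with sequences by the linear bijection \<open>interleave\<close>: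
  the iterated tangent \<open>T\<^sup>k E\<close> becomes a space of sequences supported in \<open>{..<2 ^ k}\<close>.
\<close>

definition interleave :: "(nat \<Rightarrow> 'a) \<times> (nat \<Rightarrow> 'a) \<Rightarrow> nat \<Rightarrow> 'a"
  where "interleave p = (\<lambda>i. if even i then fst p (i div 2) else snd p (i div 2))"

definition deinterleave :: "(nat \<Rightarrow> 'a) \<Rightarrow> (nat \<Rightarrow> 'a) \<times> (nat \<Rightarrow> 'a)"
  where "deinterleave s = (\<lambda>i. s (2 * i), \<lambda>i. s (2 * i + 1))"

lemma deinterleave_interleave: "deinterleave (interleave p) = p"
  by (simp add: deinterleave_def interleave_def)

lemma interleave_deinterleave: "interleave (deinterleave s) = s"
  by (auto simp: deinterleave_def interleave_def fun_eq_iff elim: oddE)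

definition interleave_sc :: "((nat \<Rightarrow> 'a) \<times> (nat \<Rightarrow> 'a)) sc \<Rightarrow> (nat \<Rightarrow> 'a) sc"
  where "interleave_sc E =
    \<lparr>level = (\<lambda>m. interleave ` level E m), lnorm = (\<lambda>m s. lnorm E m (deinterleave s))\<rparr>"

text \<open>
  On an sc-structure \<open>E\<close> the derivative \<open>Df\<close> is unique, because \<open>E\<^sub>1\<close> is dense in \<open>E\<^sub>0\<close>; so
  quantifying it existentially agrees with speaking of ``the'' tangent map.
\<close>

primrec sc_k ::
  "nat \<Rightarrow> (nat \<Rightarrow> 'a::real_vector) sc \<Rightarrow> (nat \<Rightarrow> 'a) set \<Rightarrow>
   (nat \<Rightarrow> 'b::real_vector) sc \<Rightarrow> (nat \<Rightarrow> 'b) set \<Rightarrow> ((nat \<Rightarrow> 'a) \<Rightarrow> nat \<Rightarrow> 'b) \<Rightarrow> bool"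
  where
    "sc_k 0 E U F V f \<longleftrightarrow> sc0 E U F V f"
  | "sc_k (Suc k) E U F V f \<longleftrightarrow>
       sc0 E U F V f \<and>
       (\<exists>Df. sc_derivative E U F f Df \<and>
          sc0 (tangent_sc E) (tangent_set E U) (tangent_sc F) (tangent_set F V) (tangent_map f Df) \<and>
          sc_k k
            (interleave_sc (tangent_sc E)) (interleave ` tangent_set E U)
            (interleave_sc (tangent_sc F)) (interleave ` tangent_set F V)
            (interleave \<circ> tangent_map f Df \<circ> deinterleave))"

definition at_0 :: "'a \<Rightarrow> nat \<Rightarrow> 'a::zero"
  where "at_0 x = (\<lambda>i. if i = 0 then x else 0)"

definition at_0_sc :: "'a::zero sc \<Rightarrow> (nat \<Rightarrow> 'a) sc"
  where "at_0_sc E = \<lparr>level = (\<lambda>m. at_0 ` level E m), lnorm = (\<lambda>m s. lnorm E m (s 0))\<rparr>"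

definition sc_smooth ::
  "'a::real_vector sc \<Rightarrow> 'a set \<Rightarrow> 'b::real_vector sc \<Rightarrow> 'b set \<Rightarrow> ('a \<Rightarrow> 'b) \<Rightarrow> bool"
  where "sc_smooth E U F V f \<longleftrightarrow>
    (\<forall>k. sc_k k (at_0_sc E) (at_0 ` U) (at_0_sc F) (at_0 ` V) (\<lambda>s. at_0 (f (s 0))))"


section \<open>Functions of class \<open>C\<^sup>k\<close>\<close>

text \<open>
  Derivatives are taken within \<open>S\<close>. For the closed disk (convex with nonempty interior) they are
  unique also at boundary points, and \<open>C\<^sup>k\<close> in this sense means that the interior derivatives
  up to order \<open>k\<close> extend continuously to the boundary.
\<close>

definition pd :: "complex set \<Rightarrow> complex \<Rightarrow> (complex \<Rightarrow> 'b::real_normed_vector) \<Rightarrow> complex \<Rightarrow> 'b"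
  where "pd S e v = (\<lambda>z. if z \<in> S then frechet_derivative v (at z within S) e else 0)"

definition pds :: "complex set \<Rightarrow> nat \<Rightarrow> nat \<Rightarrow> (complex \<Rightarrow> 'b::real_normed_vector) \<Rightarrow> complex \<Rightarrow> 'b"
  where "pds S a b v = (pd S 1 ^^ a) ((pd S \<i> ^^ b) v)"

primrec Ck_on :: "nat \<Rightarrow> complex set \<Rightarrow> (complex \<Rightarrow> 'b::real_normed_vector) \<Rightarrow> bool"
  where
    "Ck_on 0 S v \<longleftrightarrow> continuous_on S v"
  | "Ck_on (Suc k) S v \<longleftrightarrow>
       v differentiable_on S \<and> Ck_on k S (pd S 1 v) \<and> Ck_on k S (pd S \<i> v)"

abbreviation disk :: "complex set"
  where "disk \<equiv> cball 0 1"

text \<open>Functions on the disk are represented by functions on \<open>\<complex>\<close> that vanish off the disk.\<close>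

definition Ck_space :: "nat \<Rightarrow> (complex \<Rightarrow> 'b::real_normed_vector) set"
  where "Ck_space k = {v. Ck_on k disk v \<and> (\<forall>z. z \<notin> disk \<longrightarrow> v z = 0)}"

definition Ck_norm :: "nat \<Rightarrow> (complex \<Rightarrow> 'b::real_normed_vector) \<Rightarrow> real"
  where "Ck_norm k v =
    (if v \<in> Ck_space k
     then \<Sum>(a, b) \<in> {(a, b). a + b \<le> k}. SUP z\<in>disk. norm (pds disk a b v z)
     else 0)"


section \<open>Sobolev spaces on the disk\<close>

definition test_function :: "(complex \<Rightarrow> real) \<Rightarrow> bool"
  where "test_function \<phi> \<longleftrightarrow>
    (\<forall>k. Ck_on k UNIV \<phi>) \<and>
    (\<exists>K. compact K \<and> K \<subseteq> interior disk \<and> (\<forall>z. z \<notin> K \<longrightarrow> \<phi> z = 0))"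

definition L2_disk :: "(complex \<Rightarrow> 'b::euclidean_space) set"
  where "L2_disk =
    {w. w \<in> borel_measurable (lebesgue_on disk) \<and>
        integrable (lebesgue_on disk) (\<lambda>z. (norm (w z))\<^sup>2)}"

definition weak_pds ::
  "nat \<Rightarrow> nat \<Rightarrow> (complex \<Rightarrow> 'b::euclidean_space) \<Rightarrow> (complex \<Rightarrow> 'b) \<Rightarrow> bool"
  where "weak_pds a b v w \<longleftrightarrow>
    (\<forall>\<phi>. test_function \<phi> \<longrightarrow>
       (LINT z|lebesgue_on disk. pds UNIV a b \<phi> z *\<^sub>R v z) =
       (- 1) ^ (a + b) *\<^sub>R (LINT z|lebesgue_on disk. \<phi> z *\<^sub>R w z))"

text \<open>
  \<open>H\<^sup>k\<close> of the disk, as a space of genuine functions: the continuous representatives, again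
  extended by 0. For \<open>k \<ge> 2\<close> every class of the usual space \<open>W\<^sup>k\<^sup>,\<^sup>2\<close> has exactly one representative
  continuous up to the boundary, so this is the usual space; it must not be used for \<open>k < 2\<close>.
\<close>

definition sobolev :: "nat \<Rightarrow> (complex \<Rightarrow> 'b::euclidean_space) set"
  where "sobolev k =
    {v. continuous_on disk v \<and> (\<forall>z. z \<notin> disk \<longrightarrow> v z = 0) \<and>
        (\<forall>a b. a + b \<le> k \<longrightarrow> (\<exists>w\<in>L2_disk. weak_pds a b v w))}"

text \<open>The weak derivative is unique almost everywhere, so the choice does not affect the norm.\<close>

definition sobolev_norm :: "nat \<Rightarrow> (complex \<Rightarrow> 'b::euclidean_space) \<Rightarrow> real"
  where "sobolev_norm k v =
    (if v \<in> sobolev k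
     then sqrt (\<Sum>(a, b) \<in> {(a, b). a + b \<le> k}.
            LINT z|lebesgue_on disk. (norm ((SOME w. w \<in> L2_disk \<and> weak_pds a b v w) z))\<^sup>2)
     else 0)"

definition H3_sc :: "(complex \<Rightarrow> real ^ 'n) sc"
  where "H3_sc = \<lparr>level = (\<lambda>m. sobolev (3 + m)), lnorm = (\<lambda>m. sobolev_norm (3 + m))\<rparr>"


section \<open>Complements and transversality\<close>

definition alg_complement :: "'a::real_vector set \<Rightarrow> 'a set \<Rightarrow> bool"
  where "alg_complement H V \<longleftrightarrow>
    subspace H \<and> subspace V \<and> V \<inter> H = {0} \<and> {x + y |x y. x \<in> V \<and> y \<in> H} = UNIV"

definition transversal :: "'a::real_vector set \<Rightarrow> 'a set \<Rightarrow> bool"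
  where "transversal V H \<longleftrightarrow> {x + y |x y. x \<in> V \<and> y \<in> H} = UNIV"

end

theory Submission
  imports Defs "HOL-Computational_Algebra.Polynomial"
begin

text \<open>
  The map \<open>v \<mapsto> z v\<close> is of class \<open>C\<^sup>k\<close> for the \<open>C\<^sup>k\<close> topology, and in two real dimensions
  \<open>H\<^sup>k\<^sup>+\<^sup>2\<close> of the disk embeds continuously into \<open>C\<^sup>k\<close> of the closed disk. Hence on the level \<open>E\<^sub>m = H\<^sup>3\<^sup>+\<^sup>m\<close>
  the map is of class \<open>C\<^sup>m\<^sup>+\<^sup>1\<close>: every further derivative costs exactly one level. That is what
  sc-smoothness asks of a map into a finite-dimensional space. The two halves of the proof are
  this principle and the embedding.

  The principle is \<open>sc_smooth_of_Ck_levels\<close>. The \<open>k\<close>-fold iterated tangent map of \<open>f\<close> is a vector of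
  sums of terms \<open>D\<^sup>j f(x)(h\<^sub>1, \<dots>, h\<^sub>j)\<close>. If the iterated tangent spaces are written as spaces of
  sequences, the entry with index \<open>i < 2 ^ k\<close> lives \<open>k - p\<close> levels up, where \<open>p\<close> is the number of binary
  ones of \<open>i\<close>. In a term with \<open>j\<close> arguments the arguments come from disjoint sets of ones, so each of
  them lies at least on level \<open>j - 1\<close>, where \<open>D\<^sup>j f\<close> exists (\<open>admissible\<close> records this). The product rule
  turns such a sum into another one on the next tangent space, and \<open>sc_k_mterm_sums\<close> is the resulting
  induction.

  The embedding rests on a formula for functions \<open>w\<close> with weak derivatives. Integrating
  the derivative of \<open>s \<mapsto> (1 - s) w(x + s h)\<close> over \<open>[0, 1]\<close> expresses \<open>w(x)\<close> by averages of \<open>w\<close> and of its derivative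
  along a segment (\<open>line_formula\<close>). Doing this in two independent directions \<open>h\<close>, \<open>k\<close> expresses \<open>w(x)\<close> by
  averages over the parallelogram spanned by \<open>h\<close>, \<open>k\<close> at \<open>x\<close>, of \<open>w\<close> and its derivatives of order at most two
  (\<open>two_step_formula\<close>). The averages depend continuously on \<open>x\<close> and are bounded by \<open>L\<^sup>1\<close> norms
  (\<open>cell_integral_properties\<close>). Near every point of the closed disk there are directions for which the
  parallelograms stay inside (\<open>inward_frame\<close>), so a function with square integrable weak derivatives up to order
  two has a representative that is continuous up to the boundary, with a bound. Applied to the
  first derivatives of \<open>v \<in> H\<^sup>k\<^sup>+\<^sup>1\<close>, \<open>k \<ge> 2\<close>, this makes \<open>v\<close> continuously differentiable with derivatives in \<open>H\<^sup>k\<close>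
  (\<open>sobolev_pd\<close>), and the embedding follows by induction.
\<close>

section \<open>Scales of normed spaces\<close>

text \<open>
  Homogeneity and the triangle inequality are asked for on the carrier only, but nonnegativity and
  symmetry everywhere: \<open>Metric_space\<close> wants its distance to be symmetric on the whole type.
\<close>

definition norm_on :: "'a::real_vector set \<Rightarrow> ('a \<Rightarrow> real) \<Rightarrow> bool"
  where "norm_on X n \<longleftrightarrow> subspace X \<and> (\<forall>x. 0 \<le> n x) \<and> (\<forall>x. n (- x) = n x) \<and>
    (\<forall>x\<in>X. n x = 0 \<longrightarrow> x = 0) \<and> (\<forall>x\<in>X. \<forall>y\<in>X. n (x + y) \<le> n x + n y) \<and>
    (\<forall>x\<in>X. \<forall>c. n (c *\<^sub>R x) = \<bar>c\<bar> * n x)"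

lemma norm_onD:
  assumes "norm_on X n"
  shows "subspace X" "0 \<le> n x" "n (- x) = n x" "x \<in> X \<Longrightarrow> n x = 0 \<Longrightarrow> x = 0"
    "x \<in> X \<Longrightarrow> y \<in> X \<Longrightarrow> n (x + y) \<le> n x + n y" "x \<in> X \<Longrightarrow> n (c *\<^sub>R x) = \<bar>c\<bar> * n x" "n 0 = 0"
proof -
  show "n 0 = 0" using assms subspace_0[of X] unfolding norm_on_def
    by (metis abs_zero mult_zero_left scaleR_zero_left)
qed (use assms in \<open>auto simp: norm_on_def\<close>)

lemma norm_on_metric:
  assumes N: "norm_on X n" shows "Metric_space X (\<lambda>x y. n (x - y))"
proof
  fix x y
  show "0 \<le> n (x - y)" by (rule norm_onD[OF N])
  show "n (x - y) = n (y - x)" using norm_onD(3)[OF N, of "x - y"] by simp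
  assume xy: "x \<in> X" "y \<in> X"
  then have "x - y \<in> X" using norm_onD(1)[OF N] by (simp add: subspace_diff)
  then show "n (x - y) = 0 \<longleftrightarrow> x = y" using norm_onD(4)[OF N, of "x - y"] norm_onD(7)[OF N] by auto
  fix z assume "z \<in> X"
  then have "y - z \<in> X" using xy norm_onD(1)[OF N] by (simp add: subspace_diff)
  from norm_onD(5)[OF N \<open>x - y \<in> X\<close> this] show "n (x - z) \<le> n (x - y) + n (y - z)" by simp
qed

lemma openin_norm_top:
  assumes N: "norm_on X n"
  shows "openin (norm_top X n) W \<longleftrightarrow> W \<subseteq> X \<and> (\<forall>x\<in>W. \<exists>r>0. \<forall>y\<in>X. n (y - x) < r \<longrightarrow> y \<in> W)"
proof -
  interpret Metric_space X "\<lambda>x y. n (x - y)" by (rule norm_on_metric[OF N])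
  have "mball x r \<subseteq> W \<longleftrightarrow> (\<forall>y\<in>X. n (y - x) < r \<longrightarrow> y \<in> W)" if "x \<in> X" for x r
    using that commute[of x] by (auto simp: subset_iff)
  then show ?thesis
    unfolding norm_top_def openin_mtopology by (meson subsetD)
qed

definition eps_cont :: "'a::real_vector set \<Rightarrow> ('a \<Rightarrow> real) \<Rightarrow> 'a set \<Rightarrow> 'b::real_vector set \<Rightarrow> ('b \<Rightarrow> real) \<Rightarrow> ('a \<Rightarrow> 'b) \<Rightarrow> bool"
  where "eps_cont X n U Y p g \<longleftrightarrow> (\<forall>x\<in>U \<inter> X. g x \<in> Y \<and>
    (\<forall>e>0. \<exists>d>0. \<forall>y\<in>U \<inter> X. n (y - x) < d \<longrightarrow> p (g y - g x) < e))"

lemma eps_cont_continuous_map: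
  assumes N: "norm_on X n" and P: "norm_on Y p" and g: "eps_cont X n U Y p g" and V: "Y \<subseteq> V"
  shows "continuous_map (subtopology (norm_top X n) U) (subtopology (norm_top Y p) V) g"
proof -
  interpret X: Metric_space X "\<lambda>x y. n (x - y)" by (rule norm_on_metric[OF N])
  interpret Y: Metric_space Y "\<lambda>x y. p (x - y)" by (rule norm_on_metric[OF P])
  interpret S: Submetric X "\<lambda>x y. n (x - y)" "U \<inter> X" by unfold_locales auto
  have eq: "subtopology (norm_top X n) U = S.sub.mtopology"
    using S.mtopology_submetric by (metis X.topspace_mtopology norm_top_def subtopology_restrict inf_commute)
  have "continuous_map S.sub.mtopology Y.mtopology g"
    unfolding S.sub.metric_continuous_map[OF Y.Metric_space_axioms]
    using g X.commute Y.commute unfolding eps_cont_def by (auto 4 4)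
  moreover have "g ` (U \<inter> X) \<subseteq> V" using V g by (auto simp: eps_cont_def)
  ultimately show ?thesis
    unfolding eq continuous_map_in_subtopology S.sub.topspace_mtopology by (auto simp: norm_top_def)
qed

text \<open>
  Only the comparison of neighbouring norms matters for passing between levels; the constant 1 is what
  Sobolev norms provide and keeps all later estimates free of level-dependent factors.
\<close>

definition normed_scale :: "'a::real_vector sc \<Rightarrow> bool"
  where "normed_scale E \<longleftrightarrow> (\<forall>m. norm_on (level E m) (lnorm E m)) \<and>
    (\<forall>m. level E (Suc m) \<subseteq> level E m) \<and> (\<forall>m. \<forall>x\<in>level E (Suc m). lnorm E m x \<le> lnorm E (Suc m) x)"

lemma normed_scale_norm_on: "normed_scale E \<Longrightarrow> norm_on (level E m) (lnorm E m)"
  by (simp add: normed_scale_def)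

lemma normed_scale_mono:
  assumes E: "normed_scale E" and "a \<le> b"
  shows "level E b \<subseteq> level E a \<and> (\<forall>x\<in>level E b. lnorm E a x \<le> lnorm E b x)"
  using \<open>a \<le> b\<close>
proof (induction rule: dec_induct)
  case (step k)
  then show ?case using E unfolding normed_scale_def by (meson order_trans subsetD subset_trans)
qed simp

lemma sc0_eps:
  assumes E: "normed_scale E" and F: "normed_scale F" and U: "U \<subseteq> level E 0"
    "\<And>x. x \<in> U \<Longrightarrow> \<exists>r>0. \<forall>y\<in>level E 0. lnorm E 0 (y - x) < r \<longrightarrow> y \<in> U"
    and g: "\<And>m. eps_cont (level E m) (lnorm E m) U (level F m) (lnorm F m) g"
  shows "sc0 E U F (level F 0) g"
  unfolding sc0_def level_top_def
proof (intro conjI allI)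
  show "openin (norm_top (level E 0) (lnorm E 0)) U"
    using U by (simp add: openin_norm_top[OF normed_scale_norm_on[OF E]])
  show "openin (norm_top (level F 0) (lnorm F 0)) (level F 0)"
    by (auto simp: openin_norm_top[OF normed_scale_norm_on[OF F]] intro: exI[of _ 1])
  show "continuous_map (subtopology (norm_top (level E m) (lnorm E m)) U) (subtopology (norm_top (level F m) (lnorm F m)) (level F 0)) g" for m
    using normed_scale_mono[OF F, of 0 m] by (intro eps_cont_continuous_map normed_scale_norm_on E F g) auto
qed

section \<open>Iterated tangent spaces as spaces of sequences\<close>

text \<open>
  The entry with index \<open>i\<close> is shifted by \<open>wt i\<close> levels. Starting from one entry of weight 0, the
  interleaved tangent construction stays within this class, which turns the recursion in \<open>sc_k\<close>
  into an induction over the number of entries and the weight function.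
\<close>

definition seq_sc :: "nat \<Rightarrow> (nat \<Rightarrow> nat) \<Rightarrow> 'a::real_vector sc \<Rightarrow> (nat \<Rightarrow> 'a) sc"
  where "seq_sc N wt E = \<lparr>level = (\<lambda>m. {s. (\<forall>i<N. s i \<in> level E (m + wt i)) \<and> (\<forall>i\<ge>N. s i = 0)}),
    lnorm = (\<lambda>m s. \<Sum>i<N. lnorm E (m + wt i) (s i))\<rparr>"

text \<open>
  Base entries sit at even indices and move up one level; directions sit at odd indices and keep
  theirs.
\<close>

definition tangent_wt :: "(nat \<Rightarrow> nat) \<Rightarrow> nat \<Rightarrow> nat"
  where "tangent_wt wt i = (if even i then Suc (wt (i div 2)) else wt (i div 2))"

lemma level_seq_sc: "s \<in> level (seq_sc N wt E) m \<longleftrightarrow> (\<forall>i<N. s i \<in> level E (m + wt i)) \<and> (\<forall>i\<ge>N. s i = 0)"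
  by (simp add: seq_sc_def)

lemma lnorm_seq_sc: "lnorm (seq_sc N wt E) m s = (\<Sum>i<N. lnorm E (m + wt i) (s i))"
  by (simp add: seq_sc_def)

lemma normed_scale_seq_sc: assumes E: "normed_scale E" shows "normed_scale (seq_sc N wt E)"
proof -
  note n = norm_onD[OF normed_scale_norm_on[OF E]]
  have "norm_on (level (seq_sc N wt E) m) (lnorm (seq_sc N wt E) m)" for m
    unfolding norm_on_def
  proof (intro conjI ballI allI impI)
    show "subspace (level (seq_sc N wt E) m)"
      using n(1) by (auto simp: subspace_def level_seq_sc scaleR_fun_def)
    show "0 \<le> lnorm (seq_sc N wt E) m x" "lnorm (seq_sc N wt E) m (- x) = lnorm (seq_sc N wt E) m x" for x
      by (auto simp: lnorm_seq_sc n intro: sum_nonneg)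
    fix x assume x: "x \<in> level (seq_sc N wt E) m"
    show "x = 0" if "lnorm (seq_sc N wt E) m x = 0"
    proof
      fix i
      have "\<forall>i\<in>{..<N}. lnorm E (m + wt i) (x i) = 0"
        using that unfolding lnorm_seq_sc by (subst (asm) sum_nonneg_eq_0_iff) (auto simp: n)
      then show "x i = 0 i" using x n(4)[of "x i" "m + wt i"] by (cases "i < N") (auto simp: level_seq_sc)
    qed
    show "lnorm (seq_sc N wt E) m (x + y) \<le> lnorm (seq_sc N wt E) m x + lnorm (seq_sc N wt E) m y" if "y \<in> level (seq_sc N wt E) m" for y
      using x that by (auto simp: lnorm_seq_sc level_seq_sc sum.distrib[symmetric] intro!: sum_mono n(5))
    show "lnorm (seq_sc N wt E) m (c *\<^sub>R x) = \<bar>c\<bar> * lnorm (seq_sc N wt E) m x" for c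
      using x by (auto simp: lnorm_seq_sc level_seq_sc sum_distrib_left scaleR_fun_def n intro!: sum.cong)
  qed
  moreover have "level E (Suc m) \<subseteq> level E m" "x \<in> level E (Suc m) \<Longrightarrow> lnorm E m x \<le> lnorm E (Suc m) x" for m x
    using E by (auto simp: normed_scale_def)
  ultimately show ?thesis unfolding normed_scale_def
    by (fastforce simp: level_seq_sc lnorm_seq_sc intro!: sum_mono)
qed

lemma sum_double: "(\<Sum>i<2 * N. f i) = (\<Sum>i<N. f (2 * i) + f (Suc (2 * i)) :: real)" for N :: nat
  by (induction N) (auto simp: algebra_simps)

lemma level_tangent: "level (tangent_sc E) m = level E (Suc m) \<times> level E m"
  by (simp add: tangent_sc_def sc_sum_def sc_up_def)

lemma lnorm_tangent: "lnorm (tangent_sc E) m = (\<lambda>(x, h). lnorm E (Suc m) x + lnorm E m h)"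
  by (simp add: tangent_sc_def sc_sum_def sc_up_def)

lemma interleave_simps [simp]: "interleave (x, h) (2 * i) = x i" "interleave (x, h) (Suc (2 * i)) = h i"
  by (simp_all add: interleave_def)

lemma interleave_mem_seq_sc:
  "interleave (x, h) \<in> level (seq_sc (2 * N) (tangent_wt wt) E) m \<longleftrightarrow> x \<in> level (seq_sc N wt E) (Suc m) \<and> h \<in> level (seq_sc N wt E) m"
proof -
  have all2: "(\<forall>i. P i) \<longleftrightarrow> (\<forall>i. P (2 * i) \<and> P (Suc (2 * i)))" for P :: "nat \<Rightarrow> bool"
  proof (intro iffI allI)
    fix i assume "\<forall>i. P (2 * i) \<and> P (Suc (2 * i))"
    then have "P (2 * (i div 2))" "P (Suc (2 * (i div 2)))" by blast+
    then show "P i" by (cases "even i") simp_all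
  qed auto
  show ?thesis unfolding level_seq_sc by (subst (1 2) all2) (auto simp: tangent_wt_def)
qed

lemma seq_sc_tangent:
  fixes E :: "'a::real_vector sc"
  shows "interleave_sc (tangent_sc (seq_sc N wt E)) = seq_sc (2 * N) (tangent_wt wt) E"
proof -
  have "interleave ` level (tangent_sc (seq_sc N wt E)) m = level (seq_sc (2 * N) (tangent_wt wt) E) m" for m
  proof -
    have "s \<in> interleave ` level (tangent_sc (seq_sc N wt E)) m \<longleftrightarrow> deinterleave s \<in> level (tangent_sc (seq_sc N wt E)) m" for s :: "nat \<Rightarrow> 'a"
    proof
      assume "deinterleave s \<in> level (tangent_sc (seq_sc N wt E)) m"
      then show "s \<in> interleave ` level (tangent_sc (seq_sc N wt E)) m"
        using image_eqI[of s interleave "deinterleave s"] by (simp add: interleave_deinterleave)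
    qed (auto simp: deinterleave_interleave)
    moreover have "deinterleave s \<in> level (tangent_sc (seq_sc N wt E)) m \<longleftrightarrow> s \<in> level (seq_sc (2 * N) (tangent_wt wt) E) m" for s :: "nat \<Rightarrow> 'a"
      using interleave_mem_seq_sc[of "fst (deinterleave s)" "snd (deinterleave s)" N wt E m]
      by (simp add: level_tangent interleave_deinterleave mem_Times_iff)
    ultimately show ?thesis by auto
  qed
  moreover have "lnorm (tangent_sc (seq_sc N wt E)) m (deinterleave s) = lnorm (seq_sc (2 * N) (tangent_wt wt) E) m s" for m s
    by (simp add: lnorm_tangent lnorm_seq_sc deinterleave_def sum_double sum.distrib tangent_wt_def)
  ultimately show ?thesis
    by (intro sc.equality ext) (simp_all add: interleave_sc_def)
qed

lemma norm_on_Times: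
  assumes X: "norm_on X n" and Y: "norm_on Y p"
  shows "norm_on (X \<times> Y) (\<lambda>(x, y). n x + p y)"
proof -
  note a = norm_onD[OF X] and b = norm_onD[OF Y]
  show ?thesis unfolding norm_on_def
  proof (intro conjI ballI allI impI)
    show "subspace (X \<times> Y)" using a(1) b(1) by (rule subspace_Times)
    show "0 \<le> (case x of (x, y) \<Rightarrow> n x + p y)" "(case - x of (x, y) \<Rightarrow> n x + p y) = (case x of (x, y) \<Rightarrow> n x + p y)" for x
      by (auto simp: a b split: prod.splits)
    fix x assume x: "x \<in> X \<times> Y"
    show "x = 0" if "(case x of (x, y) \<Rightarrow> n x + p y) = 0"
      using that x a(2)[of "fst x"] b(2)[of "snd x"] a(4)[of "fst x"] b(4)[of "snd x"]
      by (auto simp: case_prod_beta prod_eq_iff)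
    show "(case x + y of (x, y) \<Rightarrow> n x + p y) \<le> (case x of (x, y) \<Rightarrow> n x + p y) + (case y of (x, y) \<Rightarrow> n x + p y)" if "y \<in> X \<times> Y" for y
      using that x a(5)[of "fst x" "fst y"] b(5)[of "snd x" "snd y"] by (auto simp: case_prod_beta)
    show "(case c *\<^sub>R x of (x, y) \<Rightarrow> n x + p y) = \<bar>c\<bar> * (case x of (x, y) \<Rightarrow> n x + p y)" for c
      using x by (auto simp: a b algebra_simps)
  qed
qed

lemma normed_scale_tangent: assumes E: "normed_scale E" shows "normed_scale (tangent_sc E)"
  unfolding normed_scale_def level_tangent lnorm_tangent
proof (intro conjI allI ballI)
  show "norm_on (level E (Suc m) \<times> level E m) (\<lambda>(x, h). lnorm E (Suc m) x + lnorm E m h)" for m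
    by (intro norm_on_Times normed_scale_norm_on E)
qed (use E in \<open>auto simp: normed_scale_def intro: add_mono\<close>)

section \<open>Bounded multilinear maps\<close>

lemma bmultilinear_bound:
  assumes A: "bmultilinear_on j X n A" and n: "\<And>x. 0 \<le> n x"
  obtains C where "0 \<le> C" "\<And>hs. length hs = j \<Longrightarrow> set hs \<subseteq> X \<Longrightarrow> norm (A hs) \<le> C * prod_list (map n hs)"
proof -
  obtain C where C: "\<And>hs. length hs = j \<Longrightarrow> set hs \<subseteq> X \<Longrightarrow> norm (A hs) \<le> C * prod_list (map n hs)"
    using A unfolding bmultilinear_on_def by (elim conjE exE) blast
  have p: "0 \<le> prod_list (map n hs)" for hs by (induction hs) (auto simp: n)
  have "norm (A hs) \<le> max C 0 * prod_list (map n hs)" if "length hs = j" "set hs \<subseteq> X" for hs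
    using C[OF that] mult_right_mono[of C "max C 0", OF _ p[of hs]] by linarith
  then show ?thesis by (intro that[of "max C 0"]) auto
qed

lemma bmultilinear_add: "bmultilinear_on j X n A \<Longrightarrow> length hs = j \<Longrightarrow> set hs \<subseteq> X \<Longrightarrow> i < j \<Longrightarrow> x \<in> X \<Longrightarrow> y \<in> X \<Longrightarrow>
    A (hs[i := x + y]) = A (hs[i := x]) + A (hs[i := y])"
  by (auto simp: bmultilinear_on_def)

lemma bmultilinear_scale: "bmultilinear_on j X n A \<Longrightarrow> length hs = j \<Longrightarrow> set hs \<subseteq> X \<Longrightarrow> i < j \<Longrightarrow> x \<in> X \<Longrightarrow>
    A (hs[i := c *\<^sub>R x]) = c *\<^sub>R A (hs[i := x])"
  unfolding bmultilinear_on_def by blast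

lemma bmultilinear_mono:
  assumes A: "bmultilinear_on j X n A" and n: "\<And>x. 0 \<le> n x" and X': "X' \<subseteq> X" and n': "\<And>x. x \<in> X' \<Longrightarrow> n x \<le> n' x"
  shows "bmultilinear_on j X' n' A"
proof -
  obtain C where C: "0 \<le> C" "\<And>hs. length hs = j \<Longrightarrow> set hs \<subseteq> X \<Longrightarrow> norm (A hs) \<le> C * prod_list (map n hs)"
    using bmultilinear_bound[OF A n] by blast
  have p: "0 \<le> prod_list (map n hs)" for hs by (induction hs) (auto simp: n)
  have m: "prod_list (map n hs) \<le> prod_list (map n' hs)" if "set hs \<subseteq> X'" for hs using that
  proof (induction hs)
    case (Cons a hs)
    have "0 \<le> n' a" using n' Cons.prems n[of a] by (meson list.set_intros(1) order_trans subsetD)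
    then show ?case using Cons n' p[of hs] by (auto intro!: mult_mono)
  qed simp
  have "norm (A hs) \<le> C * prod_list (map n' hs)" if "length hs = j" "set hs \<subseteq> X'" for hs
    using C(2)[of hs] that X' mult_left_mono[OF m[OF that(2)] C(1)] by (meson order_trans subset_trans)
  then have 1: "\<exists>C. \<forall>hs. length hs = j \<and> set hs \<subseteq> X' \<longrightarrow> norm (A hs) \<le> C * prod_list (map n' hs)"
    by blast
  show ?thesis unfolding bmultilinear_on_def
  proof (intro conjI allI impI 1)
    fix hs i x y c assume "length hs = j \<and> set hs \<subseteq> X' \<and> i < j \<and> x \<in> X' \<and> y \<in> X'"
    then have *: "length hs = j" "set hs \<subseteq> X" "i < j" "x \<in> X" "y \<in> X" using X' by auto
    show "A (hs[i := x + y]) = A (hs[i := x]) + A (hs[i := y])" by (rule bmultilinear_add[OF A *])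
    show "A (hs[i := c *\<^sub>R x]) = c *\<^sub>R A (hs[i := x])" by (rule bmultilinear_scale[OF A *(1-4)])
  qed
qed

lemma prod_list_le_power:
  assumes "\<And>x. x \<in> set xs \<Longrightarrow> 0 \<le> n x \<and> n x \<le> (R::real)"
  shows "prod_list (map n xs) \<le> R ^ length xs"
  using assms
proof (induction xs)
  case (Cons a xs)
  have "0 \<le> prod_list (map n xs)" using Cons.prems by (intro prod_list_nonneg) auto
  moreover have "prod_list (map n xs) \<le> R ^ length xs" using Cons by auto
  moreover have "0 \<le> n a" "n a \<le> R" using Cons.prems by auto
  ultimately show ?case by (simp add: mult_mono)
qed simp

text \<open>
  Replacing the entries of \<open>xs\<close> by those of \<open>ys\<close> one after the other, from the left; multilinearity turns
  each replacement into a single value.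
\<close>

lemma telescope_lists:
  assumes A: "bmultilinear_on j X n A" and X: "subspace X"
    and xs: "length xs = j" "set xs \<subseteq> X" and ys: "length ys = j" "set ys \<subseteq> X"
  shows "A ys - A xs = (\<Sum>l<j. A ((take l ys @ drop l xs)[l := ys ! l - xs ! l]))"
proof -
  define Z where "Z l = take l ys @ drop l xs" for l
  have step: "A (Z (Suc l)) - A (Z l) = A ((Z l)[l := ys ! l - xs ! l])" if l: "l < j" for l
  proof -
    have 1: "Z (Suc l) = (Z l)[l := ys ! l]" and 2: "(Z l)[l := xs ! l] = Z l"
      using l xs ys by (auto simp: Z_def take_Suc_conv_app_nth list_update_append Cons_nth_drop_Suc[symmetric])
    have Z: "length (Z l) = j" "set (Z l) \<subseteq> X"
      using xs ys l by (auto simp: Z_def dest!: in_set_takeD in_set_dropD)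
    have m: "xs ! l \<in> X" "ys ! l \<in> X" using l xs ys by (auto simp: subset_iff)
    then have "ys ! l - xs ! l \<in> X" using X by (simp add: subspace_diff)
    from bmultilinear_add[OF A Z l m(1) this]
    have "A ((Z l)[l := ys ! l]) = A ((Z l)[l := xs ! l]) + A ((Z l)[l := ys ! l - xs ! l])" by simp
    then show ?thesis unfolding 1 2 by simp
  qed
  have "(\<Sum>l<j. A ((Z l)[l := ys ! l - xs ! l])) = (\<Sum>l<j. A (Z (Suc l)) - A (Z l))"
    by (intro sum.cong) (auto simp: step)
  also have "\<dots> = A (Z j) - A (Z 0)" by (rule sum_lessThan_telescope)
  finally show ?thesis using xs ys by (simp add: Z_def)
qed

text \<open>
  The bound is \<open>C R\<^sup>j \<delta>\<close> rather than \<open>C R\<^sup>j\<^sup>-\<^sup>1 \<delta>\<close>: pulling the factor \<open>\<delta>\<close> out of the small entry leaves an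
  entry of norm at most \<open>1 \<le> R\<close>, and no case distinction for \<open>j = 0\<close> arises.
\<close>

lemma bmultilinear_slot:
  assumes A: "bmultilinear_on j X n A" and N: "norm_on X n"
    and C: "0 \<le> C" "\<And>hs. length hs = j \<Longrightarrow> set hs \<subseteq> X \<Longrightarrow> norm (A hs) \<le> C * prod_list (map n hs)"
    and zs: "length zs = j" "set zs \<subseteq> X" "\<And>x. x \<in> set zs \<Longrightarrow> n x \<le> R" "1 \<le> R"
    and l: "l < j" and h: "h \<in> X" "n h \<le> \<delta>" "0 < \<delta>"
  shows "norm (A (zs[l := h])) \<le> C * R ^ j * \<delta>"
proof -
  define h' where "h' = (1 / \<delta>) *\<^sub>R h"
  have h': "h' \<in> X" "n h' \<le> 1" "h = \<delta> *\<^sub>R h'"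
    using h norm_onD(1,6)[OF N] by (auto simp: h'_def subspace_scale)
  have s: "set (zs[l := h']) \<subseteq> insert h' (set zs)" by (rule set_update_subset_insert)
  have "norm (A (zs[l := h'])) \<le> C * prod_list (map n (zs[l := h']))"
    using zs s h' by (intro C) auto
  also have "prod_list (map n (zs[l := h'])) \<le> R ^ j"
    using prod_list_le_power[of "zs[l := h']" n R] s zs h' norm_onD(2)[OF N] by force
  finally have "norm (A (zs[l := h'])) \<le> C * R ^ j" using C(1) by (simp add: mult_left_mono)
  moreover have "A (zs[l := h]) = \<delta> *\<^sub>R A (zs[l := h'])"
    unfolding h'(3) by (rule bmultilinear_scale[OF A zs(1,2) l h'(1)])
  ultimately show ?thesis using h by (simp add: mult.commute)
qed

lemma bmultilinear_diff1:
  assumes A: "bmultilinear_on j X n A" and N: "norm_on X n"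
    and C: "0 \<le> C" "\<And>hs. length hs = j \<Longrightarrow> set hs \<subseteq> X \<Longrightarrow> norm (A hs) \<le> C * prod_list (map n hs)"
    and xs: "length xs = j" "set xs \<subseteq> X" "\<And>x. x \<in> set xs \<Longrightarrow> n x \<le> R"
    and ys: "length ys = j" "set ys \<subseteq> X" "\<And>x. x \<in> set ys \<Longrightarrow> n x \<le> R"
    and R: "1 \<le> R" and d: "\<And>l. l < j \<Longrightarrow> n (ys ! l - xs ! l) \<le> \<delta>" "0 < \<delta>"
  shows "norm (A ys - A xs) \<le> real j * (C * R ^ j * \<delta>)"
proof -
  have X: "subspace X" by (rule norm_onD(1)[OF N])
  have "norm (A ys - A xs) \<le> (\<Sum>l<j. norm (A ((take l ys @ drop l xs)[l := ys ! l - xs ! l])))"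
    unfolding telescope_lists[OF A X xs(1,2) ys(1,2)] by (rule norm_sum)
  also have "\<dots> \<le> (\<Sum>l<j. C * R ^ j * \<delta>)"
  proof (intro sum_mono)
    fix l assume "l \<in> {..<j}"
    then have l: "l < j" by simp
    define Z where "Z = take l ys @ drop l xs"
    have "set Z \<subseteq> set ys \<union> set xs" by (auto simp: Z_def dest: in_set_takeD in_set_dropD)
    then have Z: "length Z = j" "set Z \<subseteq> X" "\<And>x. x \<in> set Z \<Longrightarrow> n x \<le> R"
      using xs(1,2) ys(1,2) l xs(3) ys(3) by (simp add: Z_def, blast, blast)
    have "xs ! l \<in> X" "ys ! l \<in> X" using l xs ys by (auto simp: subset_iff)
    then have "ys ! l - xs ! l \<in> X" using X by (simp add: subspace_diff)
    from bmultilinear_slot[OF A N C Z R l this d(1)[OF l] d(2)]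
    show "norm (A ((take l ys @ drop l xs)[l := ys ! l - xs ! l])) \<le> C * R ^ j * \<delta>"
      by (simp add: Z_def)
  qed
  finally show ?thesis by simp
qed

text \<open>
  The summands of the telescoping sum differ from those of the derivative by a first-order increment in the
  other entries, with \<open>\<delta>\<close> pulled out of the distinguished entry.
\<close>

lemma bmultilinear_diff2:
  assumes A: "bmultilinear_on j X n A" and N: "norm_on X n"
    and C: "0 \<le> C" "\<And>hs. length hs = j \<Longrightarrow> set hs \<subseteq> X \<Longrightarrow> norm (A hs) \<le> C * prod_list (map n hs)"
    and xs: "length xs = j" "set xs \<subseteq> X" "\<And>x. x \<in> set xs \<Longrightarrow> n x \<le> R"
    and ys: "length ys = j" "set ys \<subseteq> X" "\<And>x. x \<in> set ys \<Longrightarrow> n x \<le> R"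
    and R: "1 \<le> R" and d: "\<And>l. l < j \<Longrightarrow> n (ys ! l - xs ! l) \<le> \<delta>" "0 < \<delta>"
  shows "norm (A ys - A xs - (\<Sum>l<j. A (xs[l := ys ! l - xs ! l]))) \<le> real j * (\<delta> * (real j * (C * R ^ j * \<delta>)))"
proof -
  have X: "subspace X" by (rule norm_onD(1)[OF N])
  have "norm (A ys - A xs - (\<Sum>l<j. A (xs[l := ys ! l - xs ! l])))
    \<le> (\<Sum>l<j. norm (A ((take l ys @ drop l xs)[l := ys ! l - xs ! l]) - A (xs[l := ys ! l - xs ! l])))"
    unfolding telescope_lists[OF A X xs(1,2) ys(1,2)] sum_subtractf[symmetric] by (rule norm_sum)
  also have "\<dots> \<le> (\<Sum>l<j. \<delta> * (real j * (C * R ^ j * \<delta>)))"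
  proof (intro sum_mono)
    fix l assume "l \<in> {..<j}"
    then have l: "l < j" by simp
    define h where "h = ys ! l - xs ! l"
    define h' where "h' = (1 / \<delta>) *\<^sub>R h"
    have m: "xs ! l \<in> X" "ys ! l \<in> X" using l xs ys by (auto simp: subset_iff)
    then have "h \<in> X" using X by (simp add: h_def subspace_diff)
    then have h': "h' \<in> X" "n h' \<le> 1" "h = \<delta> *\<^sub>R h'"
      using d(1)[OF l] d(2) X norm_onD(6)[OF N] by (auto simp: h'_def h_def subspace_scale)
    define Z where "Z = take l ys @ drop l xs"
    have "set Z \<subseteq> set ys \<union> set xs" by (auto simp: Z_def dest: in_set_takeD in_set_dropD)
    then have Z: "length Z = j" "set Z \<subseteq> X" "\<And>x. x \<in> set Z \<Longrightarrow> n x \<le> R"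
      using xs(1,2) ys(1,2) l xs(3) ys(3) by (simp add: Z_def, blast, blast)
    have s: "set (Z[l := h']) \<subseteq> insert h' (set Z)" "set (xs[l := h']) \<subseteq> insert h' (set xs)"
      by (rule set_update_subset_insert)+
    have "norm (A (Z[l := h']) - A (xs[l := h'])) \<le> real j * (C * R ^ j * \<delta>)"
    proof (rule bmultilinear_diff1[OF A N C _ _ _ _ _ _ R])
      fix i assume i: "i < j"
      show "n (Z[l := h'] ! i - xs[l := h'] ! i) \<le> \<delta>"
        using i l xs ys d norm_onD(7)[OF N] by (cases "i = l") (auto simp: Z_def nth_append nth_list_update)
    qed (use s h' R Z xs d in \<open>auto dest!: subsetD\<close>)
    then have "\<delta> * norm (A (Z[l := h']) - A (xs[l := h'])) \<le> \<delta> * (real j * (C * R ^ j * \<delta>))"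
      using d by (intro mult_left_mono) auto
    moreover have "A (Z[l := h]) - A (xs[l := h]) = \<delta> *\<^sub>R (A (Z[l := h']) - A (xs[l := h']))"
      unfolding h'(3) using bmultilinear_scale[OF A Z(1,2) l h'(1)] bmultilinear_scale[OF A xs(1,2) l h'(1)] by (simp add: scaleR_diff_right)
    ultimately show "norm (A ((take l ys @ drop l xs)[l := ys ! l - xs ! l]) - A (xs[l := ys ! l - xs ! l]))
      \<le> \<delta> * (real j * (C * R ^ j * \<delta>))"
      using d by (simp add: Z_def h_def)
  qed
  finally show ?thesis by simp
qed

section \<open>Compatible derivatives along a scale\<close>

lemma bmultilinear_slice:
  "length hs = j \<Longrightarrow> bmultilinear_on (Suc j) X n A \<Longrightarrow> set hs \<subseteq> X \<Longrightarrow> x \<in> X \<Longrightarrow> A (c *\<^sub>R x # hs) = c *\<^sub>R A (x # hs)"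
  using bmultilinear_scale[of "Suc j" X n A "x # hs" 0 x c] by auto

text \<open>
  The next derivative in the direction \<open>h\<close> is the limit of difference quotients along \<open>t h\<close>, so it is determined by
  the previous one. This lets the families of derivatives belonging to different levels be
  compared: on the smaller space the two agree.
\<close>

lemma derivatives_unique:
  fixes F F' :: "nat \<Rightarrow> 'a::real_vector \<Rightarrow> 'a list \<Rightarrow> 'b::real_normed_vector"
  assumes N: "norm_on X n" "norm_on X' n'" and X: "X' \<subseteq> X" and n: "\<And>x. x \<in> X' \<Longrightarrow> n x \<le> n' x"
    and U: "\<And>v. v \<in> U \<Longrightarrow> v \<in> X' \<Longrightarrow> \<exists>r>0. \<forall>h\<in>X'. n' h < r \<longrightarrow> v + h \<in> U"
    and F0: "\<And>v. v \<in> U \<Longrightarrow> v \<in> X' \<Longrightarrow> F 0 v [] = F' 0 v []"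
    and ml: "\<And>j v. j \<le> k \<Longrightarrow> v \<in> U \<Longrightarrow> v \<in> X' \<Longrightarrow> bmultilinear_on j X n (F j v) \<and> bmultilinear_on j X' n' (F' j v)"
    and dF: "\<And>j v e. j < k \<Longrightarrow> v \<in> U \<Longrightarrow> v \<in> X' \<Longrightarrow> e > 0 \<Longrightarrow> \<exists>d>0. \<forall>h\<in>X. v + h \<in> U \<and> n h < d \<longrightarrow>
          (\<forall>hs. length hs = j \<and> set hs \<subseteq> X \<longrightarrow>
             norm (F j (v + h) hs - F j v hs - F (Suc j) v (h # hs)) \<le> e * n h * prod_list (map n hs))"
    and dF': "\<And>j v e. j < k \<Longrightarrow> v \<in> U \<Longrightarrow> v \<in> X' \<Longrightarrow> e > 0 \<Longrightarrow> \<exists>d>0. \<forall>h\<in>X'. v + h \<in> U \<and> n' h < d \<longrightarrow>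
          (\<forall>hs. length hs = j \<and> set hs \<subseteq> X' \<longrightarrow>
             norm (F' j (v + h) hs - F' j v hs - F' (Suc j) v (h # hs)) \<le> e * n' h * prod_list (map n' hs))"
  shows "j \<le> k \<Longrightarrow> v \<in> U \<Longrightarrow> v \<in> X' \<Longrightarrow> length hs = j \<Longrightarrow> set hs \<subseteq> X' \<Longrightarrow> F j v hs = F' j v hs"
proof (induction j arbitrary: v hs)
  case 0
  then show ?case using F0 by simp
next
  case (Suc j)
  then obtain h hs' where hs: "hs = h # hs'" "length hs' = j" "h \<in> X'" "set hs' \<subseteq> X'"
    by (cases hs) auto
  define P where "P = n h * prod_list (map n hs') + n' h * prod_list (map n' hs')"
  have P: "0 \<le> P" unfolding P_def
    by (intro add_nonneg_nonneg mult_nonneg_nonneg prod_list_nonneg) (auto simp: norm_onD(2)[OF N(1)] norm_onD(2)[OF N(2)])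
  have "norm (F (Suc j) v (h # hs') - F' (Suc j) v (h # hs')) \<le> e * P" if e: "e > 0" for e
  proof -
    obtain d where d: "d > 0" "\<And>h hs. h\<in>X \<Longrightarrow> v + h \<in> U \<Longrightarrow> n h < d \<Longrightarrow> length hs = j \<Longrightarrow> set hs \<subseteq> X \<Longrightarrow>
             norm (F j (v + h) hs - F j v hs - F (Suc j) v (h # hs)) \<le> e * n h * prod_list (map n hs)"
      using dF[of j v e] Suc.prems e by (metis Suc_le_lessD)
    obtain d' where d': "d' > 0" "\<And>h hs. h\<in>X' \<Longrightarrow> v + h \<in> U \<Longrightarrow> n' h < d' \<Longrightarrow> length hs = j \<Longrightarrow> set hs \<subseteq> X' \<Longrightarrow>
             norm (F' j (v + h) hs - F' j v hs - F' (Suc j) v (h # hs)) \<le> e * n' h * prod_list (map n' hs)"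
      using dF'[of j v e] Suc.prems e by (metis Suc_le_lessD)
    obtain r where r: "r > 0" "\<And>h. h \<in> X' \<Longrightarrow> n' h < r \<Longrightarrow> v + h \<in> U" using U[of v] Suc.prems by blast
    \<comment> \<open>Both difference quotients are compared along the same small multiple \<open>t h\<close> of \<open>h\<close>.\<close>
    define M where "M = min (min d d') r"
    have M: "M > 0" using d(1) d'(1) r(1) by (simp add: M_def)
    define t where "t = M / (n' h + 1)"
    have nh: "0 \<le> n' h" "n h \<le> n' h" using n hs norm_onD(2)[OF N(2)] by auto
    have t: "t > 0" using M nh by (simp add: t_def)
    have tn: "t * n' h < M" using M nh by (simp add: t_def field_simps)
    define th where "th = t *\<^sub>R h"
    have th: "th \<in> X'" "n' th = t * n' h" "n th = t * n h" "th \<in> X"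
      using hs X t norm_onD(1,6)[OF N(1)] norm_onD(1,6)[OF N(2)] by (auto simp: th_def subspace_scale subsetD)
    have "t * n h \<le> t * n' h" using nh t by simp
    then have small: "n' th < d'" "n th < d" "v + th \<in> U"
      using tn th by (auto simp: M_def intro!: r(2))
    have vX: "v + th \<in> X'" using Suc.prems th norm_onD(1)[OF N(2)] by (simp add: subspace_add)
    have a: "norm (F j (v + th) hs' - F j v hs' - F (Suc j) v (th # hs')) \<le> e * n th * prod_list (map n hs')"
      using hs X th small by (intro d(2)) auto
    have b: "norm (F' j (v + th) hs' - F' j v hs' - F' (Suc j) v (th # hs')) \<le> e * n' th * prod_list (map n' hs')"
      using hs th small by (intro d'(2)) auto
    have c: "F j (v + th) hs' = F' j (v + th) hs'" "F j v hs' = F' j v hs'"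
      using Suc.IH[of "v + th" hs'] Suc.IH[of v hs'] Suc.prems(1-3) hs(2-4) vX small by simp_all
    have m: "bmultilinear_on (Suc j) X n (F (Suc j) v)" "bmultilinear_on (Suc j) X' n' (F' (Suc j) v)"
      using ml Suc.prems by auto
    have s: "F (Suc j) v (th # hs') = t *\<^sub>R F (Suc j) v (h # hs')" "F' (Suc j) v (th # hs') = t *\<^sub>R F' (Suc j) v (h # hs')"
      unfolding th_def using bmultilinear_slice[OF hs(2) m(1), of h t] bmultilinear_slice[OF hs(2) m(2), of h t] hs(3,4) X by blast+
    have "norm (F (Suc j) v (th # hs') - F' (Suc j) v (th # hs')) \<le> e * n th * prod_list (map n hs') + e * n' th * prod_list (map n' hs')"
    proof -
      have "F (Suc j) v (th # hs') - F' (Suc j) v (th # hs') =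
        (F' j (v + th) hs' - F' j v hs' - F' (Suc j) v (th # hs')) - (F j (v + th) hs' - F j v hs' - F (Suc j) v (th # hs'))"
        by (simp add: c)
      then show ?thesis using a b norm_triangle_ineq4 by (smt (verit, best))
    qed
    then have "norm (t *\<^sub>R (F (Suc j) v (h # hs') - F' (Suc j) v (h # hs'))) \<le> t * (e * P)"
      by (simp add: s th P_def algebra_simps)
    then have "t * norm (F (Suc j) v (h # hs') - F' (Suc j) v (h # hs')) \<le> t * (e * P)"
      using t by simp
    then show ?thesis using t by simp
  qed
  note H = this
  have "norm (F (Suc j) v (h # hs') - F' (Suc j) v (h # hs')) \<le> 0"
  proof (rule field_le_epsilon)
    fix e :: real assume e: "0 < e"
    have "e / (P + 1) * P \<le> e" using e P by (simp add: field_simps)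
    then show "norm (F (Suc j) v (h # hs') - F' (Suc j) v (h # hs')) \<le> 0 + e"
      using H[of "e / (P + 1)"] e P by simp
  qed
  then show ?case by (simp add: hs)
qed

text \<open>
  A single family of derivatives for all levels. The \<open>j\<close>-th derivative is a continuous function into bounded
  \<open>j\<close>-linear maps on level \<open>j - 1\<close>, the lowest level on which \<open>f\<close> is known to be \<open>C\<^sup>j\<close>, but is itself
  differentiable only one level higher. For \<open>j = 0\<close> the truncated subtraction gives level 0, as it should.
\<close>

definition tower :: "'a::real_vector sc \<Rightarrow> 'a set \<Rightarrow> ('a \<Rightarrow> 'b::real_normed_vector) \<Rightarrow> (nat \<Rightarrow> 'a \<Rightarrow> 'a list \<Rightarrow> 'b) \<Rightarrow> bool"
  where "tower E U f D \<longleftrightarrow>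
    (\<forall>v\<in>U. D 0 v [] = f v) \<and>
    (\<forall>j. \<forall>v\<in>U \<inter> level E (j - 1). bmultilinear_on j (level E (j - 1)) (lnorm E (j - 1)) (D j v)) \<and>
    (\<forall>j. \<forall>v\<in>U \<inter> level E j. \<forall>e>0. \<exists>d>0. \<forall>h\<in>level E j. v + h \<in> U \<and> lnorm E j h < d \<longrightarrow>
       (\<forall>hs. length hs = j \<and> set hs \<subseteq> level E j \<longrightarrow>
         norm (D j (v + h) hs - D j v hs - D (Suc j) v (h # hs)) \<le> e * lnorm E j h * prod_list (map (lnorm E j) hs))) \<and>
    (\<forall>j. \<forall>v\<in>U \<inter> level E (j - 1). \<forall>e>0. \<exists>d>0. \<forall>w\<in>U \<inter> level E (j - 1). lnorm E (j - 1) (w - v) < d \<longrightarrow>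
       (\<forall>hs. length hs = j \<and> set hs \<subseteq> level E (j - 1) \<longrightarrow>
         norm (D j w hs - D j v hs) \<le> e * prod_list (map (lnorm E (j - 1)) hs)))"

text \<open>
  The \<open>j\<close>-th derivative is taken from the family on level \<open>j - 1\<close>; by uniqueness it coincides on level \<open>j\<close> with the
  one belonging to the \<open>C\<^sup>j\<^sup>+\<^sup>1\<close> structure there, and the latter is differentiable.
\<close>

lemma tower_exists:
  fixes f :: "'a::real_vector \<Rightarrow> 'b::real_normed_vector"
  assumes E: "normed_scale E" and U: "U \<subseteq> level E 0"
    "\<And>x. x \<in> U \<Longrightarrow> \<exists>r>0. \<forall>y\<in>level E 0. lnorm E 0 (y - x) < r \<longrightarrow> y \<in> U"
    and C: "\<And>m. Ck_map (Suc m) (level E m) (lnorm E m) (U \<inter> level E m) f"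
  obtains D where "tower E U f D"
proof -
  note N = normed_scale_norm_on[OF E]
  have sub: "subspace (level E m)" for m by (rule norm_onD(1)[OF N])
  \<comment> \<open>\<open>Q m F\<close>: the maps \<open>F j\<close> are the derivatives of \<open>f\<close> up to order \<open>m + 1\<close> on level \<open>m\<close>.\<close>
  define Q :: "nat \<Rightarrow> (nat \<Rightarrow> 'a \<Rightarrow> 'a list \<Rightarrow> 'b) \<Rightarrow> bool" where "Q m F \<longleftrightarrow> (\<forall>v\<in>U \<inter> level E m. F 0 v [] = f v) \<and>
       (\<forall>j\<le>Suc m. \<forall>v\<in>U \<inter> level E m. bmultilinear_on j (level E m) (lnorm E m) (F j v)) \<and>
       (\<forall>j<Suc m. \<forall>v\<in>U \<inter> level E m. \<forall>e>0. \<exists>d>0. \<forall>h\<in>level E m. v + h \<in> U \<inter> level E m \<and> lnorm E m h < d \<longrightarrow>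
          (\<forall>hs. length hs = j \<and> set hs \<subseteq> level E m \<longrightarrow>
             norm (F j (v + h) hs - F j v hs - F (Suc j) v (h # hs))
               \<le> e * lnorm E m h * prod_list (map (lnorm E m) hs))) \<and>
       (\<forall>v\<in>U \<inter> level E m. \<forall>e>0. \<exists>d>0. \<forall>w\<in>U \<inter> level E m. lnorm E m (w - v) < d \<longrightarrow>
          (\<forall>hs. length hs = Suc m \<and> set hs \<subseteq> level E m \<longrightarrow>
             norm (F (Suc m) w hs - F (Suc m) v hs) \<le> e * prod_list (map (lnorm E m) hs)))" for m F
  have "\<forall>m. \<exists>F. Q m F" using C unfolding Ck_map_def Q_def by (rule allI)
  then obtain F where FF: "\<And>m. Q m (F m)" by metis
  have F1: "v\<in>U \<Longrightarrow> v \<in> level E m \<Longrightarrow> F m 0 v [] = f v" for m v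
    using FF[of m] unfolding Q_def by (elim conjE) simp
  have F2: "j\<le>Suc m \<Longrightarrow> v\<in>U \<Longrightarrow> v \<in> level E m \<Longrightarrow> bmultilinear_on j (level E m) (lnorm E m) (F m j v)" for m v j
    using FF[of m] unfolding Q_def by (elim conjE) simp
  have F3: "\<exists>d>0. \<forall>h\<in>level E m. v + h \<in> U \<inter> level E m \<and> lnorm E m h < d \<longrightarrow>
          (\<forall>hs. length hs = j \<and> set hs \<subseteq> level E m \<longrightarrow>
             norm (F m j (v + h) hs - F m j v hs - F m (Suc j) v (h # hs))
               \<le> e * lnorm E m h * prod_list (map (lnorm E m) hs))"
    if "j<Suc m" "v\<in>U" "v \<in> level E m" "e>0" for m j v e
    using FF[unfolded Q_def, THEN conjunct2, THEN conjunct2, THEN conjunct1, rule_format, of j m v e, OF _ IntI] by (meson that)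
  have F4: "\<exists>d>0. \<forall>w\<in>U \<inter> level E m. lnorm E m (w - v) < d \<longrightarrow>
          (\<forall>hs. length hs = Suc m \<and> set hs \<subseteq> level E m \<longrightarrow>
             norm (F m (Suc m) w hs - F m (Suc m) v hs) \<le> e * prod_list (map (lnorm E m) hs))"
    if "v\<in>U" "v \<in> level E m" "e > 0" for m v e
    using FF[unfolded Q_def, THEN conjunct2, THEN conjunct2, THEN conjunct2, rule_format, of v m e, OF IntI] by (meson that)
  note F = F1 F2 F3 F4
  have F3: "\<exists>d>0. \<forall>h\<in>level E m. v + h \<in> U \<and> lnorm E m h < d \<longrightarrow>
          (\<forall>hs. length hs = j \<and> set hs \<subseteq> level E m \<longrightarrow>
             norm (F m j (v + h) hs - F m j v hs - F m (Suc j) v (h # hs))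
               \<le> e * lnorm E m h * prod_list (map (lnorm E m) hs))"
    if "j<Suc m" "v\<in>U" "v \<in> level E m" "e>0" for m j v e
    using F(3)[OF that] subspace_add[OF sub that(3)] by (metis IntI)
  have nest: "level E (Suc m) \<subseteq> level E m" "x \<in> level E (Suc m) \<Longrightarrow> lnorm E m x \<le> lnorm E (Suc m) x" for m x
    using E by (auto simp: normed_scale_def)
  have mono: "level E m \<subseteq> level E 0" "x \<in> level E m \<Longrightarrow> lnorm E 0 x \<le> lnorm E m x" for m x
    using normed_scale_mono[OF E, of 0 m] by auto
  have Um: "\<exists>r>0. \<forall>h\<in>level E m. lnorm E m h < r \<longrightarrow> v + h \<in> U" if v: "v \<in> U" "v \<in> level E m" for v m
  proof -
    obtain r where r: "r > 0" "\<And>y. y\<in>level E 0 \<Longrightarrow> lnorm E 0 (y - v) < r \<Longrightarrow> y \<in> U" using U(2)[OF v(1)] by blast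
    have "v + h \<in> U" if "h \<in> level E m" "lnorm E m h < r" for h
    proof (rule r(2))
      show "v + h \<in> level E 0" using that v mono(1)[of m] sub by (meson subsetD subspace_add)
      show "lnorm E 0 (v + h - v) < r" using mono(2)[OF that(1)] that by simp
    qed
    then show ?thesis using r(1) by blast
  qed
  have eq: "F m j v hs = F (Suc m) j v hs"
    if "j \<le> Suc m" "v \<in> U" "v \<in> level E (Suc m)" "length hs = j" "set hs \<subseteq> level E (Suc m)" for m j v hs
  proof (rule derivatives_unique[OF N N nest(1) nest(2), of m U "F m" "F (Suc m)" "Suc m" j v hs])
    show "\<exists>r>0. \<forall>h\<in>level E (Suc m). lnorm E (Suc m) h < r \<longrightarrow> v + h \<in> U" if "v \<in> U" "v \<in> level E (Suc m)" for v
      using Um that by blast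
    show "F m 0 v [] = F (Suc m) 0 v []" if "v \<in> U" "v \<in> level E (Suc m)" for v
      using that nest(1)[of m] F(1) by (metis subsetD)
    show "bmultilinear_on j (level E m) (lnorm E m) (F m j v) \<and>
           bmultilinear_on j (level E (Suc m)) (lnorm E (Suc m)) (F (Suc m) j v)"
      if "j \<le> Suc m" "v \<in> U" "v \<in> level E (Suc m)" for j v
      using that nest(1)[of m] F(2)[of j m v] F(2)[of j "Suc m" v] by auto
    show "\<exists>d>0. \<forall>h\<in>level E m. v + h \<in> U \<and> lnorm E m h < d \<longrightarrow>
          (\<forall>hs. length hs = j \<and> set hs \<subseteq> level E m \<longrightarrow>
             norm (F m j (v + h) hs - F m j v hs - F m (Suc j) v (h # hs))
               \<le> e * lnorm E m h * prod_list (map (lnorm E m) hs))"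
      if "j < Suc m" "v \<in> U" "v \<in> level E (Suc m)" "0 < e" for j v e
      using that nest(1)[of m] by (intro F3) auto
    show "\<exists>d>0. \<forall>h\<in>level E (Suc m). v + h \<in> U \<and> lnorm E (Suc m) h < d \<longrightarrow>
          (\<forall>hs. length hs = j \<and> set hs \<subseteq> level E (Suc m) \<longrightarrow>
             norm (F (Suc m) j (v + h) hs - F (Suc m) j v hs - F (Suc m) (Suc j) v (h # hs))
               \<le> e * lnorm E (Suc m) h * prod_list (map (lnorm E (Suc m)) hs))"
      if "j < Suc m" "v \<in> U" "v \<in> level E (Suc m)" "0 < e" for j v e
      using that by (intro F3) auto
  qed (use that in auto)
  define D where "D j = F (j - 1) j" for j
  have DF: "D j v hs = F j j v hs" if "v \<in> U" "v \<in> level E j" "length hs = j" "set hs \<subseteq> level E j" for j v hs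
    using that eq[of j "j - 1" v hs] by (cases j) (auto simp: D_def)
  have diff: "\<exists>d>0. \<forall>h\<in>level E j. v + h \<in> U \<and> lnorm E j h < d \<longrightarrow>
       (\<forall>hs. length hs = j \<and> set hs \<subseteq> level E j \<longrightarrow>
         norm (D j (v + h) hs - D j v hs - D (Suc j) v (h # hs)) \<le> e * lnorm E j h * prod_list (map (lnorm E j) hs))"
    if v: "v \<in> U" "v \<in> level E j" "e > 0" for j v e
  proof -
    obtain d where d: "d>0" "\<And>h hs. h \<in> level E j \<Longrightarrow> v + h \<in> U \<Longrightarrow> lnorm E j h < d \<Longrightarrow> length hs = j \<Longrightarrow> set hs \<subseteq> level E j \<Longrightarrow>
         norm (F j j (v + h) hs - F j j v hs - F j (Suc j) v (h # hs)) \<le> e * lnorm E j h * prod_list (map (lnorm E j) hs)"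
      using F3[of j j v e] v by (metis lessI)
    have "norm (D j (v + h) hs - D j v hs - D (Suc j) v (h # hs)) \<le> e * lnorm E j h * prod_list (map (lnorm E j) hs)"
      if "h \<in> level E j" "v + h \<in> U" "lnorm E j h < d" "length hs = j" "set hs \<subseteq> level E j" for h hs
    proof -
      have "D j (v + h) hs = F j j (v + h) hs" "D j v hs = F j j v hs"
        using that v subspace_add[OF sub v(2)] by (auto intro!: DF)
      then show ?thesis using d(2)[OF that] by (simp add: D_def)
    qed
    then show ?thesis using d(1) by blast
  qed
  have "tower E U f D"
    unfolding tower_def
  proof (intro conjI allI ballI impI)
    show "D 0 v [] = f v" if "v \<in> U" for v using that U(1) by (auto simp: D_def intro!: F(1))
    show "bmultilinear_on j (level E (j - 1)) (lnorm E (j - 1)) (D j v)" if "v \<in> U \<inter> level E (j - 1)" for j v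
      using that unfolding D_def by (intro F(2)) auto
    show "\<exists>d>0. \<forall>h\<in>level E j. v + h \<in> U \<and> lnorm E j h < d \<longrightarrow>
       (\<forall>hs. length hs = j \<and> set hs \<subseteq> level E j \<longrightarrow>
         norm (D j (v + h) hs - D j v hs - D (Suc j) v (h # hs)) \<le> e * lnorm E j h * prod_list (map (lnorm E j) hs))"
      if "v \<in> U \<inter> level E j" "e > 0" for j v e using that by (intro diff) auto
    fix j v and e :: real assume v: "v \<in> U \<inter> level E (j - 1)" and e: "e > 0"
    show "\<exists>d>0. \<forall>w\<in>U \<inter> level E (j - 1). lnorm E (j - 1) (w - v) < d \<longrightarrow>
       (\<forall>hs. length hs = j \<and> set hs \<subseteq> level E (j - 1) \<longrightarrow>
         norm (D j w hs - D j v hs) \<le> e * prod_list (map (lnorm E (j - 1)) hs))"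
    proof (cases j)
      case (Suc m)
      then show ?thesis using F(4)[of v m e] v e by (simp add: D_def)
    next
      case 0
      then have v: "v \<in> U" "v \<in> level E 0" using v by auto
      obtain d where d: "d>0" "\<And>h. h \<in> level E 0 \<Longrightarrow> v + h \<in> U \<Longrightarrow> lnorm E 0 h < d \<Longrightarrow>
         norm (D 0 (v + h) [] - D 0 v [] - D (Suc 0) v [h]) \<le> 1 * lnorm E 0 h"
        using diff[OF v zero_less_one] by fastforce
      have "bmultilinear_on 1 (level E 0) (lnorm E 0) (D 1 v)"
        using v F(2)[of 1 0 v] by (simp add: D_def)
      then obtain C where C: "0 \<le> C" "\<And>hs. length hs = 1 \<Longrightarrow> set hs \<subseteq> level E 0 \<Longrightarrow> norm (D 1 v hs) \<le> C * prod_list (map (lnorm E 0) hs)"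
        using bmultilinear_bound[of 1 "level E 0" "lnorm E 0" "D 1 v"] norm_onD(2)[OF N] by blast
      have "norm (D 0 w [] - D 0 v []) \<le> e" if w: "w \<in> U" "w \<in> level E 0" "lnorm E 0 (w - v) < min d (e / (C + 1))" for w
      proof -
        have wv: "w - v \<in> level E 0" using w v sub by (simp add: subspace_diff)
        have "norm (D 0 w [] - D 0 v [] - D 1 v [w - v]) \<le> lnorm E 0 (w - v)"
          using d(2)[OF wv] w by simp
        moreover have "norm (D 1 v [w - v]) \<le> C * lnorm E 0 (w - v)" using C(2)[of "[w - v]"] wv by simp
        moreover have "lnorm E 0 (w - v) * (C + 1) \<le> e" using w C(1) by (simp add: field_simps)
        ultimately show ?thesis
          using norm_triangle_ineq[of "D 0 w [] - D 0 v [] - D 1 v [w - v]" "D 1 v [w - v]"] by (simp add: algebra_simps)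
      qed
      then show ?thesis using 0 d(1) e C(1) by (intro exI[of _ "min d (e / (C + 1))"]) auto
    qed
  qed
  then show thesis by (rule that)
qed

section \<open>Multilinear terms and their tangent maps\<close>

text \<open>
  The list \<open>is\<close> names the entries of the sequence that are plugged into the derivative at the base point \<open>s 0\<close>.
\<close>

definition mterm :: "(nat \<Rightarrow> 'a \<Rightarrow> 'a list \<Rightarrow> 'b) \<Rightarrow> nat list \<Rightarrow> (nat \<Rightarrow> 'a) \<Rightarrow> 'b"
  where "mterm D is s = D (length is) (s 0) (map s is)"

definition mterm_sums :: "(nat \<Rightarrow> 'a \<Rightarrow> 'a list \<Rightarrow> 'b::real_vector) \<Rightarrow> nat \<Rightarrow> (nat \<Rightarrow> nat list list) \<Rightarrow> (nat \<Rightarrow> 'a) \<Rightarrow> nat \<Rightarrow> 'b"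
  where "mterm_sums D M L s j = (if j < M then \<Sum>is\<leftarrow>L j. mterm D is s else 0)"

text \<open>
  The product rule on index lists: either the base point is differentiated, with its direction \<open>h 0\<close> at
  index 1, or one of the arguments \<open>s i\<close>, at index \<open>2 * i\<close>, is replaced by its direction, at \<open>2 * i + 1\<close>.
\<close>

definition mterm_diff :: "nat list \<Rightarrow> nat list list"
  where "mterm_diff is = (1 # map ((*) 2) is) # map (\<lambda>l. (map ((*) 2) is)[l := Suc (2 * (is ! l))]) [0..<length is]"

text \<open>
  With \<open>j\<close> arguments, the term makes sense if they lie on level \<open>j - 1\<close>. Differentiating it brings in the direction
  of the base point as an additional argument, so the base point must be one level better.
\<close>

definition admissible :: "nat \<Rightarrow> (nat \<Rightarrow> nat) \<Rightarrow> nat list \<Rightarrow> bool"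
  where "admissible N wt is \<longleftrightarrow> 0 < N \<and> length is \<le> wt 0 \<and> (\<forall>i\<in>set is. i < N \<and> length is \<le> Suc (wt i))"

lemma admissible_double: "admissible N wt is \<Longrightarrow> admissible (2 * N) (tangent_wt wt) (map ((*) 2) is)"
  by (auto simp: admissible_def tangent_wt_def)

lemma admissible_mterm_diff:
  assumes v: "admissible N wt is" and "is' \<in> set (mterm_diff is)"
  shows "admissible (2 * N) (tangent_wt wt) is'"
proof -
  consider "is' = 1 # map ((*) 2) is" | l where "l < length is" "is' = (map ((*) 2) is)[l := Suc (2 * (is ! l))]"
    using assms(2) by (auto simp: mterm_diff_def)
  then show ?thesis
  proof cases
    case 1 then show ?thesis using v by (auto simp: admissible_def tangent_wt_def)
  next
    case (2 l)
    have "set is' \<subseteq> insert (Suc (2 * (is ! l))) (set (map ((*) 2) is))" unfolding 2 by (rule set_update_subset_insert)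
    moreover have "length is' = length is" by (simp add: 2)
    moreover have "is ! l \<in> set is" using 2 by simp
    ultimately show ?thesis using v by (fastforce simp: admissible_def tangent_wt_def)
  qed
qed

text \<open>
  The derivative of a term, before its two kinds of summands are coded as terms in the interleaved sequence.
\<close>

definition mterm_deriv :: "(nat \<Rightarrow> 'a \<Rightarrow> 'a list \<Rightarrow> 'b::real_vector) \<Rightarrow> nat list \<Rightarrow> (nat \<Rightarrow> 'a) \<Rightarrow> (nat \<Rightarrow> 'a) \<Rightarrow> 'b"
  where "mterm_deriv D is x h = D (Suc (length is)) (x 0) (h 0 # map x is) +
     (\<Sum>l<length is. D (length is) (x 0) ((map x is)[l := h (is ! l)]))"

lemma mterm_double: "mterm D (map ((*) 2) is) (interleave (x, h)) = mterm D is x"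
  using interleave_simps(1)[of x h 0] by (simp add: mterm_def o_def)

lemma sum_mterm_diff: "(\<Sum>is'\<leftarrow>mterm_diff is. mterm D is' (interleave (x, h))) = mterm_deriv D is x h"
proof -
  have 1: "interleave (x, h) 0 = x 0" "interleave (x, h) (Suc 0) = h 0"
    using interleave_simps[of x h 0] by simp_all
  have 2: "map (interleave (x, h)) (map ((*) 2) is) = map x is" by simp
  have "mterm D (1 # map ((*) 2) is) (interleave (x, h)) = D (Suc (length is)) (x 0) (h 0 # map x is)"
    by (simp add: mterm_def 1 o_def)
  moreover have "mterm D ((map ((*) 2) is)[l := Suc (2 * (is ! l))]) (interleave (x, h)) = D (length is) (x 0) ((map x is)[l := h (is ! l)])" for l
    unfolding mterm_def map_update 2 by (simp add: 1)
  ultimately show ?thesis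
    by (simp add: mterm_diff_def mterm_deriv_def o_def interv_sum_list_conv_sum_set_nat atLeast0LessThan)
qed

lemma bmultilinear_Cons:
  assumes "bmultilinear_on (Suc j) X n A" "length hs = j" "set hs \<subseteq> X" "x \<in> X" "y \<in> X"
  shows "A ((x + y) # hs) = A (x # hs) + A (y # hs)" "A (c *\<^sub>R x # hs) = c *\<^sub>R A (x # hs)"
  using bmultilinear_add[OF assms(1), of "x # hs" 0 x y] bmultilinear_slice[OF assms(2,1,3,4)] assms by auto

lemma at_0_sc_eq: "at_0_sc (H :: 'c::real_vector sc) = seq_sc 1 (\<lambda>_. 0) H"
proof (intro sc.equality ext)
  fix m
  have "s \<in> at_0 ` level H m" if "s 0 \<in> level H m" "\<forall>i\<ge>1. s i = 0" for s :: "nat \<Rightarrow> 'c"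
    using that by (intro image_eqI[of _ _ "s 0"]) (auto simp: at_0_def)
  then show "level (at_0_sc H) m = level (seq_sc 1 (\<lambda>_. 0) H) m"
    by (auto simp: at_0_sc_def level_seq_sc at_0_def)
qed (simp_all add: at_0_sc_def lnorm_seq_sc)

locale sc_tower =
  fixes E :: "'a::real_vector sc" and U :: "'a set" and f :: "'a \<Rightarrow> 'b::euclidean_space" and D
  assumes E: "normed_scale E" and U0: "U \<subseteq> level E 0"
    and Uopen: "\<And>x. x \<in> U \<Longrightarrow> \<exists>r>0. \<forall>y\<in>level E 0. lnorm E 0 (y - x) < r \<longrightarrow> y \<in> U"
    and tower: "tower E U f D"
begin

abbreviation "L \<equiv> level E"
abbreviation "nm \<equiv> lnorm E"

lemmas N = normed_scale_norm_on[OF E]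
lemmas n_nonneg [simp] = norm_onD(2)[OF N]

lemma D_bmultilinear: "v \<in> U \<Longrightarrow> v \<in> L (j - 1) \<Longrightarrow> bmultilinear_on j (L (j - 1)) (nm (j - 1)) (D j v)"
  using tower unfolding tower_def by blast

lemma D_cont:
  assumes "v \<in> U" "v \<in> L (j - 1)" "e > 0"
  obtains d where "d > 0" "\<And>w hs. w \<in> U \<Longrightarrow> w \<in> L (j - 1) \<Longrightarrow> nm (j - 1) (w - v) < d \<Longrightarrow> length hs = j \<Longrightarrow> set hs \<subseteq> L (j - 1) \<Longrightarrow>
         norm (D j w hs - D j v hs) \<le> e * prod_list (map (nm (j - 1)) hs)"
proof -
  have "\<exists>d>0. \<forall>w\<in>U \<inter> L (j - 1). nm (j - 1) (w - v) < d \<longrightarrow>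
       (\<forall>hs. length hs = j \<and> set hs \<subseteq> L (j - 1) \<longrightarrow>
         norm (D j w hs - D j v hs) \<le> e * prod_list (map (nm (j - 1)) hs))"
    using tower assms unfolding tower_def by (meson IntI)
  then show thesis using that by (metis (no_types, lifting) IntI)
qed

lemma D_diff:
  assumes "v \<in> U" "v \<in> L j" "e > 0"
  obtains d where "d > 0" "\<And>h hs. h \<in> L j \<Longrightarrow> v + h \<in> U \<Longrightarrow> nm j h < d \<Longrightarrow> length hs = j \<Longrightarrow> set hs \<subseteq> L j \<Longrightarrow>
         norm (D j (v + h) hs - D j v hs - D (Suc j) v (h # hs)) \<le> e * nm j h * prod_list (map (nm j) hs)"
proof -
  have "\<exists>d>0. \<forall>h\<in>L j. v + h \<in> U \<and> nm j h < d \<longrightarrow>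
       (\<forall>hs. length hs = j \<and> set hs \<subseteq> L j \<longrightarrow>
         norm (D j (v + h) hs - D j v hs - D (Suc j) v (h # hs)) \<le> e * nm j h * prod_list (map (nm j) hs))"
    using tower assms unfolding tower_def by (meson IntI)
  then show thesis using that by (metis (no_types, lifting))
qed

lemma seq_sc_coord:
  assumes "s \<in> level (seq_sc N wt E) m" "i < N" "a \<le> m + wt i"
  shows "s i \<in> L a" "nm a (s i) \<le> lnorm (seq_sc N wt E) m s"
proof -
  have 1: "s i \<in> L (m + wt i)" using assms by (simp add: level_seq_sc)
  then show "s i \<in> L a" using normed_scale_mono[OF E assms(3)] by auto
  have "nm a (s i) \<le> nm (m + wt i) (s i)" using normed_scale_mono[OF E assms(3)] 1 by auto
  also have "\<dots> \<le> lnorm (seq_sc N wt E) m s"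
    unfolding lnorm_seq_sc using assms by (intro member_le_sum) auto
  finally show "nm a (s i) \<le> lnorm (seq_sc N wt E) m s" .
qed

lemma admissible_idx: "admissible N wt is \<Longrightarrow> i \<in> insert 0 (set is) \<Longrightarrow> i < N \<and> length is - 1 \<le> m + wt i"
  unfolding admissible_def by force

lemma admissible_idx1: "admissible N wt is \<Longrightarrow> i \<in> insert 0 (set is) \<Longrightarrow> i < N \<and> length is \<le> Suc m + wt i"
  unfolding admissible_def by force

lemma finite_common_bound: "finite A \<Longrightarrow> \<exists>R\<ge>1. \<forall>i\<in>A. (g i :: real) + 1 \<le> R"
proof (induction rule: finite_induct)
  case (insert x F)
  then obtain R where "R \<ge> 1" "\<forall>i\<in>F. g i + 1 \<le> R" by blast
  then show ?case by (intro exI[of _ "max R (g x + 1)"]) auto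
qed auto

text \<open>
  The derivative is continuous in the base point for the operator norm, and each single multilinear map is
  continuous in its arguments; both at level \<open>j - 1\<close>, which is controlled by every level of the sequence space.
\<close>

lemma mterm_cont:
  assumes v: "admissible N wt is" and s: "s \<in> level (seq_sc N wt E) m" "s 0 \<in> U" and e: "e > 0"
  shows "\<exists>d>0. \<forall>s'\<in>level (seq_sc N wt E) m. s' 0 \<in> U \<longrightarrow> lnorm (seq_sc N wt E) m (s' - s) < d \<longrightarrow> norm (mterm D is s' - mterm D is s) < e"
proof -
  define j where "j = length is"
  define n where "n = nm (j - 1)"
  define X where "X = L (j - 1)"
  have NX: "norm_on X n" by (simp add: X_def n_def N)
  note NS = norm_onD[OF normed_scale_norm_on[OF normed_scale_seq_sc[OF E, of N wt]]]
  have c: "t i \<in> X" "n (t i) \<le> lnorm (seq_sc N wt E) m t" if "t \<in> level (seq_sc N wt E) m" "i \<in> insert 0 (set is)" for t i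
    using seq_sc_coord[OF that(1)] admissible_idx[OF v that(2)] by (auto simp: X_def n_def j_def)
  obtain R where R: "R \<ge> 1" "\<And>i. i \<in> set is \<Longrightarrow> n (s i) + 1 \<le> R" using finite_common_bound[of "set is" "\<lambda>i. n (s i)"] by auto
  have A: "bmultilinear_on j X n (D j (s 0))" unfolding X_def n_def using s c(1)[OF s(1)] by (intro D_bmultilinear) (auto simp: X_def)
  obtain C where C: "0 \<le> C" "\<And>hs. length hs = j \<Longrightarrow> set hs \<subseteq> X \<Longrightarrow> norm (D j (s 0) hs) \<le> C * prod_list (map n hs)"
    using bmultilinear_bound[OF A] norm_onD(2)[OF NX] by blast
  define e' where "e' = e / (4 * R ^ j)"
  have Rj: "R ^ j > 0" using R by simp
  have e': "e' > 0" "e' * R ^ j = e / 4" using e Rj R(1) by (auto simp: e'_def)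
  obtain d where d: "d > 0" "\<And>w hs. w \<in> U \<Longrightarrow> w \<in> X \<Longrightarrow> n (w - s 0) < d \<Longrightarrow> length hs = j \<Longrightarrow> set hs \<subseteq> X \<Longrightarrow>
         norm (D j w hs - D j (s 0) hs) \<le> e' * prod_list (map n hs)"
    using D_cont[of "s 0" j e'] s c(1)[OF s(1)] e' unfolding X_def n_def by auto
  define K where "K = real j * (C * R ^ j)"
  have K: "K \<ge> 0" using C Rj by (simp add: K_def)
  define d' where "d' = min (min 1 d) (e / (4 * (K + 1)))"
  have d': "d' > 0" "d' \<le> 1" "d' \<le> d" "K * d' \<le> e / 4"
  proof -
    have "K * d' \<le> K * (e / (4 * (K + 1)))" using K by (intro mult_left_mono) (auto simp: d'_def)
    also have "\<dots> \<le> e / 4" using K e by (simp add: field_simps)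
    finally show "K * d' \<le> e / 4" .
  qed (use d e K in \<open>auto simp: d'_def\<close>)
  have "norm (mterm D is s' - mterm D is s) < e"
    if s': "s' \<in> level (seq_sc N wt E) m" "s' 0 \<in> U" "lnorm (seq_sc N wt E) m (s' - s) < d'" for s'
  proof -
    have dm: "s' - s \<in> level (seq_sc N wt E) m" using s s' NS(1) by (simp add: subspace_diff)
    have dn: "n (s' i - s i) \<le> d'" "n (s' i - s i) < d'" if "i \<in> insert 0 (set is)" for i
      using c(2)[OF dm that] s' by auto
    have b: "n (s' i) \<le> R" "n (s i) \<le> R" if "i \<in> set is" for i
    proof -
      have "n (s' i) \<le> n (s i) + n (s' i - s i)"
        using norm_onD(5)[OF NX c(1)[OF s(1)] c(1)[OF dm], of i i] that by simp
      then show "n (s' i) \<le> R" "n (s i) \<le> R" using R(2)[OF that] dn(1)[of i] d'(2) that by auto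
    qed
    have xs: "length (map s is) = j" "set (map s is) \<subseteq> X" "\<And>x. x \<in> set (map s is) \<Longrightarrow> n x \<le> R"
      and ys: "length (map s' is) = j" "set (map s' is) \<subseteq> X" "\<And>x. x \<in> set (map s' is) \<Longrightarrow> n x \<le> R"
      using c(1)[OF s(1)] c(1)[OF s'(1)] b by (auto simp: j_def)
    have "norm (D j (s' 0) (map s' is) - D j (s 0) (map s' is)) \<le> e' * prod_list (map n (map s' is))"
      using s' c(1)[OF s'(1)] dn(2)[of 0] d' ys by (intro d(2)) auto
    also have "\<dots> \<le> e' * R ^ j"
      using prod_list_le_power[of "map s' is" n R] ys norm_onD(2)[OF NX] e' by (intro mult_left_mono) auto
    finally have 1: "norm (D j (s' 0) (map s' is) - D j (s 0) (map s' is)) \<le> e / 4" using e' by simp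
    have "norm (D j (s 0) (map s' is) - D j (s 0) (map s is)) \<le> real j * (C * R ^ j * d')"
      using dn(1) d' by (intro bmultilinear_diff1[OF A NX C xs ys R(1)]) (auto simp: j_def)
    then have 2: "norm (D j (s 0) (map s' is) - D j (s 0) (map s is)) \<le> e / 4"
      using d' by (simp add: K_def mult.assoc)
    have "norm (D j (s' 0) (map s' is) - D j (s 0) (map s is)) \<le> e / 4 + e / 4"
      using norm_diff_triangle_le[OF 1 2] .
    then show ?thesis using e by (simp add: mterm_def j_def)
  qed
  then show ?thesis using d'(1) by blast
qed

lemma mterm_deriv_linear:
  assumes v: "admissible N wt is" and x: "x \<in> level (seq_sc N wt E) 1" "x 0 \<in> U"
  shows "h \<in> level (seq_sc N wt E) 0 \<Longrightarrow> h' \<in> level (seq_sc N wt E) 0 \<Longrightarrow> mterm_deriv D is x (h + h') = mterm_deriv D is x h + mterm_deriv D is x h'"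
    "h \<in> level (seq_sc N wt E) 0 \<Longrightarrow> mterm_deriv D is x (c *\<^sub>R h) = c *\<^sub>R mterm_deriv D is x h"
    "\<exists>C. \<forall>h\<in>level (seq_sc N wt E) 0. norm (mterm_deriv D is x h) \<le> C * lnorm (seq_sc N wt E) 0 h"
proof -
  define j where "j = length is"
  have cx: "x i \<in> L j" "x i \<in> L (j - 1)" if "i \<in> insert 0 (set is)" for i
    using seq_sc_coord[OF x(1)] admissible_idx1[OF v that, of 0] by (auto simp: j_def)
  have ch: "t i \<in> L (j - 1)" "nm (j - 1) (t i) \<le> lnorm (seq_sc N wt E) 0 t" if "t \<in> level (seq_sc N wt E) 0" "i \<in> insert 0 (set is)" for t i
    using seq_sc_coord[OF that(1)] admissible_idx[OF v that(2), of 0] by (auto simp: j_def)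
  have ch0: "t 0 \<in> L j" "nm j (t 0) \<le> lnorm (seq_sc N wt E) 0 t" if "t \<in> level (seq_sc N wt E) 0" for t
    using seq_sc_coord[OF that, of 0] v by (auto simp: j_def admissible_def)
  have A: "bmultilinear_on (Suc j) (L j) (nm j) (D (Suc j) (x 0))" using D_bmultilinear[of "x 0" "Suc j"] x cx by simp
  have B: "bmultilinear_on j (L (j - 1)) (nm (j - 1)) (D j (x 0))" using D_bmultilinear[of "x 0" j] x cx by simp
  have xs: "length (map x is) = j" "set (map x is) \<subseteq> L j" "set (map x is) \<subseteq> L (j - 1)" using cx by (auto simp: j_def)
  have il: "is ! l \<in> insert 0 (set is)" if "l < j" for l using that by (auto simp: j_def)
  have eq: "mterm_deriv D is x h = D (Suc j) (x 0) (h 0 # map x is) + (\<Sum>l<j. D j (x 0) ((map x is)[l := h (is ! l)]))" for h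
    by (simp add: mterm_deriv_def j_def)
  show "mterm_deriv D is x (h + h') = mterm_deriv D is x h + mterm_deriv D is x h'" if h: "h \<in> level (seq_sc N wt E) 0" "h' \<in> level (seq_sc N wt E) 0"
    unfolding eq plus_fun_def
    using bmultilinear_Cons(1)[OF A xs(1,2) ch0(1)[OF h(1)] ch0(1)[OF h(2)]]
      bmultilinear_add[OF B xs(1,3) _ ch(1)[OF h(1) il] ch(1)[OF h(2) il]] by (simp add: sum.distrib)
  show "mterm_deriv D is x (c *\<^sub>R h) = c *\<^sub>R mterm_deriv D is x h" if h: "h \<in> level (seq_sc N wt E) 0"
    unfolding eq scaleR_fun_def
    using bmultilinear_slice[OF xs(1) A xs(2) ch0(1)[OF h]] bmultilinear_scale[OF B xs(1,3) _ ch(1)[OF h il]]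
    by (simp add: scaleR_add_right scaleR_sum_right)
  obtain C where C: "0 \<le> C" "\<And>hs. length hs = Suc j \<Longrightarrow> set hs \<subseteq> L j \<Longrightarrow> norm (D (Suc j) (x 0) hs) \<le> C * prod_list (map (nm j) hs)"
    using bmultilinear_bound[OF A n_nonneg] by blast
  obtain C' where C': "0 \<le> C'" "\<And>hs. length hs = j \<Longrightarrow> set hs \<subseteq> L (j - 1) \<Longrightarrow> norm (D j (x 0) hs) \<le> C' * prod_list (map (nm (j - 1)) hs)"
    using bmultilinear_bound[OF B n_nonneg] by blast
  obtain R where R: "R \<ge> 1" "\<And>i. i \<in> set is \<Longrightarrow> nm (j - 1) (x i) + 1 \<le> R" using finite_common_bound[of "set is" "\<lambda>i. nm (j - 1) (x i)"] by auto
  define P where "P = prod_list (map (nm j) (map x is))"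
  have P: "0 \<le> P" unfolding P_def by (intro prod_list_nonneg) auto
  have "norm (mterm_deriv D is x h) \<le> (C * P + real j * (C' * R ^ j)) * lnorm (seq_sc N wt E) 0 h" if h: "h \<in> level (seq_sc N wt E) 0" for h
  proof -
    define \<delta> where "\<delta> = lnorm (seq_sc N wt E) 0 h"
    have \<delta>: "0 \<le> \<delta>" unfolding \<delta>_def by (rule norm_onD(2)[OF normed_scale_norm_on[OF normed_scale_seq_sc[OF E]]])
    have "norm (D (Suc j) (x 0) (h 0 # map x is)) \<le> C * prod_list (map (nm j) (h 0 # map x is))"
      using xs ch0(1)[OF h] by (intro C) auto
    also have "\<dots> \<le> C * (\<delta> * P)"
    proof -
      have "prod_list (map (nm j) (h 0 # map x is)) = nm j (h 0) * P" by (simp add: P_def o_def)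
      then show ?thesis using ch0(2)[OF h] C P by (auto simp: \<delta>_def intro!: mult_left_mono mult_right_mono)
    qed
    finally have 1: "norm (D (Suc j) (x 0) (h 0 # map x is)) \<le> C * P * \<delta>" by (simp add: mult_ac)
    have 2: "norm (D j (x 0) ((map x is)[l := h (is ! l)])) \<le> C' * R ^ j * \<delta>" if l: "l < j" for l
    proof (rule field_le_epsilon)
      fix e :: real assume e: "0 < e"
      define e' where "e' = e / (C' * R ^ j + 1)"
      have K: "C' * R ^ j \<ge> 0" using C' R by simp
      have e': "e' > 0" "C' * R ^ j * e' \<le> e" using e K by (auto simp: e'_def field_simps)
      have "norm (D j (x 0) ((map x is)[l := h (is ! l)])) \<le> C' * R ^ j * (\<delta> + e')"
      proof (rule bmultilinear_slot[OF B N C' xs(1,3) _ R(1) l ch(1)[OF h il[OF l]]])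
        show "nm (j - 1) y \<le> R" if "y \<in> set (map x is)" for y using that R(2) by force
        show "nm (j - 1) (h (is ! l)) \<le> \<delta> + e'" using ch(2)[OF h il[OF l]] e' by (simp add: \<delta>_def)
        show "0 < \<delta> + e'" using \<delta> e' by simp
      qed
      then show "norm (D j (x 0) ((map x is)[l := h (is ! l)])) \<le> C' * R ^ j * \<delta> + e" using e' by (simp add: distrib_left)
    qed
    have "norm (mterm_deriv D is x h) \<le> C * P * \<delta> + (\<Sum>l<j. C' * R ^ j * \<delta>)"
      unfolding eq by (intro norm_triangle_le add_mono 1 order_trans[OF norm_sum] sum_mono 2) auto
    then show ?thesis by (simp add: \<delta>_def algebra_simps)
  qed
  then show "\<exists>C. \<forall>h\<in>level (seq_sc N wt E) 0. norm (mterm_deriv D is x h) \<le> C * lnorm (seq_sc N wt E) 0 h" by blast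
qed

text \<open>
  The increment is split into three parts: the increment of the \<open>j\<close>-th derivative minus its linear part, both at the new
  arguments; the error of putting the old arguments into that linear part; and the error of second order of a multilinear map.
  Everything takes place on level \<open>j\<close>.
\<close>

lemma mterm_differentiable:
  assumes v: "admissible N wt is" and x: "x \<in> level (seq_sc N wt E) 1" "x 0 \<in> U" and e: "e > 0"
  shows "\<exists>d>0. \<forall>h\<in>level (seq_sc N wt E) 1. 0 < lnorm (seq_sc N wt E) 1 h \<longrightarrow> lnorm (seq_sc N wt E) 1 h < d \<longrightarrow> (x + h) 0 \<in> U \<longrightarrow>
    norm (mterm D is (x + h) - mterm D is x - mterm_deriv D is x h) \<le> e * lnorm (seq_sc N wt E) 1 h"
proof -
  define j where "j = length is"
  define n where "n = nm j"
  define X where "X = L j"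
  have NX: "norm_on X n" by (simp add: X_def n_def N)
  have c: "t i \<in> X" "n (t i) \<le> lnorm (seq_sc N wt E) 1 t" if "t \<in> level (seq_sc N wt E) 1" "i \<in> insert 0 (set is)" for t i
    using seq_sc_coord[OF that(1)] admissible_idx1[OF v that(2), of 0] by (auto simp: X_def n_def j_def)
  obtain R where R: "R \<ge> 1" "\<And>i. i \<in> set is \<Longrightarrow> n (x i) + 1 \<le> R" using finite_common_bound[of "set is" "\<lambda>i. n (x i)"] by auto
  have sub: "L j \<subseteq> L (j - 1)" "y \<in> L j \<Longrightarrow> nm (j - 1) y \<le> nm j y" for y
    using normed_scale_mono[OF E, of "j - 1" j] by auto
  have x0: "x 0 \<in> X" "x 0 \<in> L (j - 1)" using c(1)[OF x(1)] sub by (auto simp: X_def)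
  have B: "bmultilinear_on j X n (D j (x 0))"
    unfolding X_def n_def by (rule bmultilinear_mono[OF D_bmultilinear[OF x(2) x0(2)] n_nonneg sub])
  have A: "bmultilinear_on (Suc j) X n (D (Suc j) (x 0))"
    unfolding X_def n_def using D_bmultilinear[OF x(2), of "Suc j"] x0 by (simp add: X_def)
  obtain C where C: "0 \<le> C" "\<And>hs. length hs = Suc j \<Longrightarrow> set hs \<subseteq> X \<Longrightarrow> norm (D (Suc j) (x 0) hs) \<le> C * prod_list (map n hs)"
    using bmultilinear_bound[OF A] norm_onD(2)[OF NX] by blast
  obtain C' where C': "0 \<le> C'" "\<And>hs. length hs = j \<Longrightarrow> set hs \<subseteq> X \<Longrightarrow> norm (D j (x 0) hs) \<le> C' * prod_list (map n hs)"
    using bmultilinear_bound[OF B] norm_onD(2)[OF NX] by blast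
  have Rj: "R ^ j > 0" using R by simp
  define e' where "e' = e / (2 * R ^ j)"
  have e': "e' > 0" "e' * R ^ j = e / 2" using e Rj R(1) by (auto simp: e'_def)
  obtain d where d: "d > 0" "\<And>h hs. h \<in> X \<Longrightarrow> x 0 + h \<in> U \<Longrightarrow> n h < d \<Longrightarrow> length hs = j \<Longrightarrow> set hs \<subseteq> X \<Longrightarrow>
         norm (D j (x 0 + h) hs - D j (x 0) hs - D (Suc j) (x 0) (h # hs)) \<le> e' * n h * prod_list (map n hs)"
    using D_diff[OF x(2), of j e'] x0 e' unfolding X_def n_def by auto
  define K where "K = real (Suc j) * (C * R ^ Suc j) + real j * (real j * (C' * R ^ j))"
  have K: "K \<ge> 0" using C C' Rj R by (simp add: K_def)
  define d' where "d' = min (min 1 d) (e / (2 * (K + 1)))"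
  have d': "d' > 0" "d' \<le> 1" "d' \<le> d" "K * d' \<le> e / 2"
  proof -
    have "K * d' \<le> K * (e / (2 * (K + 1)))" using K by (intro mult_left_mono) (auto simp: d'_def)
    also have "\<dots> \<le> e / 2" using K e by (simp add: field_simps)
    finally show "K * d' \<le> e / 2" .
  qed (use d e K in \<open>auto simp: d'_def\<close>)
  have "norm (mterm D is (x + h) - mterm D is x - mterm_deriv D is x h) \<le> e * lnorm (seq_sc N wt E) 1 h"
    if h: "h \<in> level (seq_sc N wt E) 1" "0 < lnorm (seq_sc N wt E) 1 h" "lnorm (seq_sc N wt E) 1 h < d'" "(x + h) 0 \<in> U" for h
  proof -
    define \<delta> where "\<delta> = lnorm (seq_sc N wt E) 1 h"
    have \<delta>: "0 < \<delta>" "\<delta> < d'" using h by (auto simp: \<delta>_def)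
    have dn: "n (h i) \<le> \<delta>" "h i \<in> X" if "i \<in> insert 0 (set is)" for i
      using c[OF h(1) that] by (auto simp: \<delta>_def)
    define xs ys where "xs = map x is" and "ys = map (x + h) is"
    have b: "n ((x + h) i) \<le> R" "n (x i) \<le> R" "(x + h) i \<in> X" if "i \<in> set is" for i
    proof -
      have "n (x i + h i) \<le> n (x i) + n (h i)"
        using norm_onD(5)[OF NX c(1)[OF x(1)] c(1)[OF h(1)], of i i] that by simp
      then show "n ((x + h) i) \<le> R" "n (x i) \<le> R" using R(2)[OF that] dn(1)[of i] d'(2) \<delta> that by auto
      show "(x + h) i \<in> X" using c(1)[OF x(1)] dn that norm_onD(1)[OF NX] by (auto simp: subspace_add)
    qed
    have xs: "length xs = j" "set xs \<subseteq> X" "\<And>x. x \<in> set xs \<Longrightarrow> n x \<le> R"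
      using c(1)[OF x(1)] b by (auto simp: j_def xs_def)
    have ys: "length ys = j" "set ys \<subseteq> X" "\<And>x. x \<in> set ys \<Longrightarrow> n x \<le> R"
      using b by (auto simp: j_def ys_def)
    have df: "ys ! l - xs ! l = h (is ! l)" if "l < j" for l using that by (simp add: xs_def ys_def j_def)
    have mterm_diff: "n (ys ! l - xs ! l) \<le> \<delta>" if "l < j" for l using that dn(1)[of "is ! l"] by (simp add: df j_def)
    have "norm (D j (x 0 + h 0) ys - D j (x 0) ys - D (Suc j) (x 0) (h 0 # ys)) \<le> e' * n (h 0) * prod_list (map n ys)"
      using h dn[of 0] \<delta> d' ys by (intro d(2)) auto
    also have "\<dots> \<le> e' * \<delta> * R ^ j"
      using prod_list_le_power[of ys n R] ys norm_onD(2)[OF NX] e' dn(1)[of 0] \<delta>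
      by (intro mult_mono) (auto intro!: prod_list_nonneg)
    finally have 1: "norm (D j (x 0 + h 0) ys - D j (x 0) ys - D (Suc j) (x 0) (h 0 # ys)) \<le> e / 2 * \<delta>"
      using e' by (simp add: mult_ac)
    have 2: "norm (D (Suc j) (x 0) (h 0 # ys) - D (Suc j) (x 0) (h 0 # xs)) \<le> real (Suc j) * (C * R ^ Suc j * \<delta>) * \<delta>"
    proof -
      define h' where "h' = (1 / \<delta>) *\<^sub>R h 0"
      have h': "h' \<in> X" "n h' \<le> 1" "h 0 = \<delta> *\<^sub>R h'"
        using \<delta> dn[of 0] norm_onD(1,6)[OF NX] by (auto simp: h'_def subspace_scale)
      have "norm (D (Suc j) (x 0) (h' # ys) - D (Suc j) (x 0) (h' # xs)) \<le> real (Suc j) * (C * R ^ Suc j * \<delta>)"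
      proof (rule bmultilinear_diff1[OF A NX C _ _ _ _ _ _ R(1)])
        show "n ((h' # ys) ! l - (h' # xs) ! l) \<le> \<delta>" if "l < Suc j" for l
          using that mterm_diff \<delta> norm_onD(7)[OF NX] by (cases l) auto
      qed (use xs ys h' R \<delta> in auto)
      moreover have "D (Suc j) (x 0) (h 0 # ys) - D (Suc j) (x 0) (h 0 # xs) = \<delta> *\<^sub>R (D (Suc j) (x 0) (h' # ys) - D (Suc j) (x 0) (h' # xs))"
        unfolding h'(3) using bmultilinear_slice[OF xs(1) A xs(2) h'(1)] bmultilinear_slice[OF ys(1) A ys(2) h'(1)] by (simp add: scaleR_diff_right)
      ultimately show ?thesis using \<delta> by (simp add: mult.commute mult_left_mono)
    qed
    have 3: "norm (D j (x 0) ys - D j (x 0) xs - (\<Sum>l<j. D j (x 0) (xs[l := h (is ! l)]))) \<le> real j * (\<delta> * (real j * (C' * R ^ j * \<delta>)))"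
      using bmultilinear_diff2[OF B NX C' xs ys R(1) mterm_diff \<delta>(1)] by (simp add: df)
    have "mterm D is (x + h) - mterm D is x - mterm_deriv D is x h =
      (D j (x 0 + h 0) ys - D j (x 0) ys - D (Suc j) (x 0) (h 0 # ys)) +
      (D (Suc j) (x 0) (h 0 # ys) - D (Suc j) (x 0) (h 0 # xs)) +
      (D j (x 0) ys - D j (x 0) xs - (\<Sum>l<j. D j (x 0) (xs[l := h (is ! l)])))"
      by (simp add: mterm_def mterm_deriv_def j_def[symmetric] xs_def[symmetric] ys_def[symmetric])
    then have "norm (mterm D is (x + h) - mterm D is x - mterm_deriv D is x h) \<le> e / 2 * \<delta> +
      real (Suc j) * (C * R ^ Suc j * \<delta>) * \<delta> + real j * (\<delta> * (real j * (C' * R ^ j * \<delta>)))"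
      using 1 2 3 by (metis (no_types, lifting) add_mono norm_triangle_mono)
    also have "\<dots> = (e / 2 + K * \<delta>) * \<delta>" by (simp add: K_def algebra_simps)
    also have "\<dots> \<le> e * \<delta>"
    proof (rule mult_right_mono)
      have "K * \<delta> \<le> K * d'" using K \<delta> by (intro mult_left_mono) auto
      then show "e / 2 + K * \<delta> \<le> e" using d' by linarith
    qed (use \<delta> in simp)
    finally show ?thesis by (simp add: \<delta>_def)
  qed
  then show ?thesis using d'(1) by blast
qed

definition over_U :: "nat \<Rightarrow> (nat \<Rightarrow> nat) \<Rightarrow> (nat \<Rightarrow> 'a) set"
  where "over_U M wt = {s \<in> level (seq_sc M wt E) 0. s 0 \<in> U}"

lemma finite_common_delta:
  assumes "finite A" "\<And>i. i \<in> A \<Longrightarrow> \<exists>d>0. \<forall>x\<in>X. q x < (d::real) \<longrightarrow> P i x"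
  shows "\<exists>d>0. \<forall>x\<in>X. q x < d \<longrightarrow> (\<forall>i\<in>A. P i x)"
  using assms
proof (induction rule: finite_induct)
  case (insert a A)
  obtain d where d: "d > 0" "\<forall>x\<in>X. q x < d \<longrightarrow> (\<forall>i\<in>A. P i x)" using insert by auto
  obtain d' where d': "d' > 0" "\<forall>x\<in>X. q x < d' \<longrightarrow> P a x" using insert by blast
  show ?case using d d' by (intro exI[of _ "min d d'"]) auto
qed (auto intro: exI[of _ 1])

lemma norm_sum_list_le:
  fixes a :: "'c \<Rightarrow> 'd::real_normed_vector"
  assumes "\<And>x. x \<in> set xs \<Longrightarrow> norm (a x) \<le> c"
  shows "norm (\<Sum>x\<leftarrow>xs. a x) \<le> real (length xs) * c"
  using assms
proof (induction xs)
  case (Cons x xs)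
  have "norm (a x + (\<Sum>x\<leftarrow>xs. a x)) \<le> c + real (length xs) * c"
    using Cons by (intro norm_triangle_le add_mono) auto
  then show ?case by (simp add: algebra_simps)
qed simp

lemma level_const: "s \<in> level (seq_sc M wtF const_sc) m \<longleftrightarrow> (\<forall>i\<ge>M. s i = 0)"
  by (simp add: level_seq_sc const_sc_def)

lemma lnorm_const: "lnorm (seq_sc M wtF const_sc) m s = (\<Sum>i<M. norm (s i))"
  by (simp add: lnorm_seq_sc const_sc_def)

lemma normed_scale_const: "normed_scale (const_sc :: 'c::euclidean_space sc)"
  by (auto simp: normed_scale_def const_sc_def norm_on_def norm_triangle_ineq)

lemma over_U_open:
  assumes M: "0 < M" and x: "x \<in> over_U M wt"
  shows "\<exists>r>0. \<forall>y\<in>level (seq_sc M wt E) 0. lnorm (seq_sc M wt E) 0 (y - x) < r \<longrightarrow> y \<in> over_U M wt"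
proof -
  have x: "x \<in> level (seq_sc M wt E) 0" "x 0 \<in> U" using x by (auto simp: over_U_def)
  obtain r where r: "r > 0" "\<And>y. y \<in> level E 0 \<Longrightarrow> lnorm E 0 (y - x 0) < r \<Longrightarrow> y \<in> U" using Uopen[OF x(2)] by blast
  have "y \<in> over_U M wt" if y: "y \<in> level (seq_sc M wt E) 0" "lnorm (seq_sc M wt E) 0 (y - x) < r" for y
  proof -
    have d: "y - x \<in> level (seq_sc M wt E) 0"
      using y x norm_onD(1)[OF normed_scale_norm_on[OF normed_scale_seq_sc[OF E]]] by (simp add: subspace_diff)
    have "y 0 \<in> U" using seq_sc_coord[OF y(1), of 0 0] seq_sc_coord(2)[OF d, of 0 0] y(2) M by (intro r(2)) auto
    then show ?thesis using y by (simp add: over_U_def)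
  qed
  then show ?thesis using r(1) by blast
qed

lemma mterm_sums_eps:
  assumes val: "\<And>j is. j < M \<Longrightarrow> is \<in> set (Ls j) \<Longrightarrow> admissible N wt is"
  shows "eps_cont (level (seq_sc N wt E) m) (lnorm (seq_sc N wt E) m) (over_U N wt) (level (seq_sc M wtF const_sc) m) (lnorm (seq_sc M wtF const_sc) m) (mterm_sums D M Ls)"
  unfolding eps_cont_def
proof (intro ballI conjI allI impI)
  fix x assume x: "x \<in> over_U N wt \<inter> level (seq_sc N wt E) m"
  show "mterm_sums D M Ls x \<in> level (seq_sc M wtF const_sc) m" by (simp add: level_const mterm_sums_def)
  fix e :: real assume e: "0 < e"
  define K where "K = (\<Sum>j<M. real (length (Ls j)))"
  have K: "K \<ge> 0" by (auto simp: K_def intro: sum_nonneg)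
  define e' where "e' = e / (K + 1)"
  have e': "e' > 0" "K * e' < e" using e K by (auto simp: e'_def field_simps)
  have "\<exists>d>0. \<forall>y\<in>over_U N wt \<inter> level (seq_sc N wt E) m. lnorm (seq_sc N wt E) m (y - x) < d \<longrightarrow>
     (\<forall>is\<in>(\<Union>j<M. set (Ls j)). norm (mterm D is y - mterm D is x) < e')"
  proof (rule finite_common_delta)
    fix "is" assume "is \<in> (\<Union>j<M. set (Ls j))"
    then have "admissible N wt is" using val by auto
    from mterm_cont[OF this, of x m e'] x e'
    show "\<exists>d>0. \<forall>y\<in>over_U N wt \<inter> level (seq_sc N wt E) m. lnorm (seq_sc N wt E) m (y - x) < d \<longrightarrow> norm (mterm D is y - mterm D is x) < e'"
      by (auto simp: over_U_def)
  qed auto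
  then obtain d where d: "d > 0" "\<And>y is j. y \<in> over_U N wt \<inter> level (seq_sc N wt E) m \<Longrightarrow> lnorm (seq_sc N wt E) m (y - x) < d \<Longrightarrow>
     j < M \<Longrightarrow> is \<in> set (Ls j) \<Longrightarrow> norm (mterm D is y - mterm D is x) < e'" by blast
  have "lnorm (seq_sc M wtF const_sc) m (mterm_sums D M Ls y - mterm_sums D M Ls x) < e"
    if y: "y \<in> over_U N wt \<inter> level (seq_sc N wt E) m" "lnorm (seq_sc N wt E) m (y - x) < d" for y
  proof -
    have "lnorm (seq_sc M wtF const_sc) m (mterm_sums D M Ls y - mterm_sums D M Ls x) =
       (\<Sum>j<M. norm (\<Sum>is\<leftarrow>Ls j. mterm D is y - mterm D is x))"
      by (simp add: lnorm_const mterm_sums_def sum_list_subtractf)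
    also have "\<dots> \<le> (\<Sum>j<M. real (length (Ls j)) * e')"
      using d(2)[OF y] by (intro sum_mono norm_sum_list_le) (auto intro: less_imp_le)
    also have "\<dots> = K * e'" by (simp add: K_def sum_distrib_right)
    finally show ?thesis using e' by simp
  qed
  then show "\<exists>d>0. \<forall>y\<in>over_U N wt \<inter> level (seq_sc N wt E) m. lnorm (seq_sc N wt E) m (y - x) < d \<longrightarrow>
      lnorm (seq_sc M wtF const_sc) m (mterm_sums D M Ls y - mterm_sums D M Ls x) < e"
    using d(1) by blast
qed

definition mterm_sums_deriv :: "nat \<Rightarrow> (nat \<Rightarrow> nat list list) \<Rightarrow> (nat \<Rightarrow> 'a) \<Rightarrow> (nat \<Rightarrow> 'a) \<Rightarrow> nat \<Rightarrow> 'b"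
  where "mterm_sums_deriv M Ls x h j = (if j < M then \<Sum>is\<leftarrow>Ls j. mterm_deriv D is x h else 0)"

lemma mterm_sums_deriv:
  assumes val: "\<And>j is. j < M \<Longrightarrow> is \<in> set (Ls j) \<Longrightarrow> admissible N wt is" and N: "0 < N"
  shows "sc_derivative (seq_sc N wt E) (over_U N wt) (seq_sc M wtF const_sc) (mterm_sums D M Ls) (mterm_sums_deriv M Ls)"
  unfolding sc_derivative_def
proof (intro ballI conjI allI impI)
  fix x assume "x \<in> over_U N wt \<inter> level (seq_sc N wt E) 1"
  then have x: "x \<in> over_U N wt" "x \<in> level (seq_sc N wt E) 1" "x 0 \<in> U" by (auto simp: over_U_def)
  have n0: "0 \<le> lnorm (seq_sc N wt E) m h" for m h
    by (rule norm_onD(2)[OF normed_scale_norm_on[OF normed_scale_seq_sc[OF E]]])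
  show "blinear_on (level (seq_sc N wt E) 0) (lnorm (seq_sc N wt E) 0) (level (seq_sc M wtF const_sc) 0) (lnorm (seq_sc M wtF const_sc) 0) (mterm_sums_deriv M Ls x)"
    unfolding blinear_on_def
  proof (intro conjI ballI allI)
    show "mterm_sums_deriv M Ls x \<in> level (seq_sc N wt E) 0 \<rightarrow> level (seq_sc M wtF const_sc) 0"
      by (simp add: level_const mterm_sums_deriv_def)
    fix h assume h: "h \<in> level (seq_sc N wt E) 0"
    show "mterm_sums_deriv M Ls x (h + h') = mterm_sums_deriv M Ls x h + mterm_sums_deriv M Ls x h'" if h': "h' \<in> level (seq_sc N wt E) 0" for h'
    proof
      fix j
      have "j < M \<Longrightarrow> (\<Sum>is\<leftarrow>Ls j. mterm_deriv D is x (h + h')) = (\<Sum>is\<leftarrow>Ls j. mterm_deriv D is x h + mterm_deriv D is x h')"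
        using val mterm_deriv_linear(1)[OF _ x(2,3) h h'] by (intro arg_cong[of _ _ sum_list] map_cong) auto
      then show "mterm_sums_deriv M Ls x (h + h') j = (mterm_sums_deriv M Ls x h + mterm_sums_deriv M Ls x h') j"
        by (simp add: mterm_sums_deriv_def sum_list_addf)
    qed
    show "mterm_sums_deriv M Ls x (c *\<^sub>R h) = c *\<^sub>R mterm_sums_deriv M Ls x h" for c
    proof
      fix j
      have "j < M \<Longrightarrow> (\<Sum>is\<leftarrow>Ls j. mterm_deriv D is x (c *\<^sub>R h)) = (\<Sum>is\<leftarrow>Ls j. c *\<^sub>R mterm_deriv D is x h)"
        using val mterm_deriv_linear(2)[OF _ x(2,3) h] by (intro arg_cong[of _ _ sum_list] map_cong) auto
      moreover have "(\<Sum>is\<leftarrow>xs. c *\<^sub>R mterm_deriv D is x h) = c *\<^sub>R (\<Sum>is\<leftarrow>xs. mterm_deriv D is x h)" for xs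
        by (induction xs) (auto simp: scaleR_add_right)
      ultimately show "mterm_sums_deriv M Ls x (c *\<^sub>R h) j = (c *\<^sub>R mterm_sums_deriv M Ls x h) j"
        by (simp add: mterm_sums_deriv_def scaleR_fun_def)
    qed
  next
    have "\<forall>is. \<exists>C. admissible N wt is \<longrightarrow> (\<forall>h\<in>level (seq_sc N wt E) 0. norm (mterm_deriv D is x h) \<le> C * lnorm (seq_sc N wt E) 0 h)"
      using mterm_deriv_linear(3)[OF _ x(2,3)] by blast
    then obtain C where C: "\<And>is h. admissible N wt is \<Longrightarrow> h\<in>level (seq_sc N wt E) 0 \<Longrightarrow> norm (mterm_deriv D is x h) \<le> C is * lnorm (seq_sc N wt E) 0 h"
      by metis
    have "lnorm (seq_sc M wtF const_sc) 0 (mterm_sums_deriv M Ls x h) \<le> (\<Sum>j<M. \<Sum>is\<leftarrow>Ls j. C is) * lnorm (seq_sc N wt E) 0 h"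
      if h: "h\<in>level (seq_sc N wt E) 0" for h
    proof -
      have "norm (\<Sum>is\<leftarrow>xs. mterm_deriv D is x h) \<le> (\<Sum>is\<leftarrow>xs. C is) * lnorm (seq_sc N wt E) 0 h" if "\<And>is. is \<in> set xs \<Longrightarrow> admissible N wt is" for xs
        using that
      proof (induction xs)
        case (Cons a xs)
        then have "norm (\<Sum>is\<leftarrow>xs. mterm_deriv D is x h) \<le> (\<Sum>is\<leftarrow>xs. C is) * lnorm (seq_sc N wt E) 0 h"
          "norm (mterm_deriv D a x h) \<le> C a * lnorm (seq_sc N wt E) 0 h" using C[OF _ h] by auto
        then show ?case by (auto simp: distrib_right intro: norm_triangle_le)
      qed simp
      then show ?thesis using val
        by (auto simp: lnorm_const mterm_sums_deriv_def sum_distrib_right intro!: sum_mono)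
    qed
    then show "\<exists>C. \<forall>h\<in>level (seq_sc N wt E) 0. lnorm (seq_sc M wtF const_sc) 0 (mterm_sums_deriv M Ls x h) \<le> C * lnorm (seq_sc N wt E) 0 h"
      by blast
  qed
  fix e :: real assume e: "0 < e"
  define K where "K = (\<Sum>j<M. real (length (Ls j)))"
  have K: "K \<ge> 0" by (auto simp: K_def intro: sum_nonneg)
  define e' where "e' = e / (K + 1)"
  have e': "e' > 0" "K * e' < e" using e K by (auto simp: e'_def field_simps)
  have "\<exists>d>0. \<forall>h\<in>{h \<in> level (seq_sc N wt E) 1. 0 < lnorm (seq_sc N wt E) 1 h \<and> (x + h) 0 \<in> U}. lnorm (seq_sc N wt E) 1 h < d \<longrightarrow>
     (\<forall>is\<in>(\<Union>j<M. set (Ls j)). norm (mterm D is (x + h) - mterm D is x - mterm_deriv D is x h) \<le> e' * lnorm (seq_sc N wt E) 1 h)"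
  proof (rule finite_common_delta)
    fix "is" assume "is \<in> (\<Union>j<M. set (Ls j))"
    then have "admissible N wt is" using val by auto
    from mterm_differentiable[OF this x(2,3) e'(1)]
    show "\<exists>d>0. \<forall>h\<in>{h \<in> level (seq_sc N wt E) 1. 0 < lnorm (seq_sc N wt E) 1 h \<and> (x + h) 0 \<in> U}. lnorm (seq_sc N wt E) 1 h < d \<longrightarrow>
        norm (mterm D is (x + h) - mterm D is x - mterm_deriv D is x h) \<le> e' * lnorm (seq_sc N wt E) 1 h"
      by blast
  qed auto
  then obtain d where d: "d > 0" "\<And>h is j. h \<in> level (seq_sc N wt E) 1 \<Longrightarrow> 0 < lnorm (seq_sc N wt E) 1 h \<Longrightarrow> (x + h) 0 \<in> U \<Longrightarrow> lnorm (seq_sc N wt E) 1 h < d \<Longrightarrow>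
     j < M \<Longrightarrow> is \<in> set (Ls j) \<Longrightarrow> norm (mterm D is (x + h) - mterm D is x - mterm_deriv D is x h) \<le> e' * lnorm (seq_sc N wt E) 1 h" by blast
  obtain r where r: "r > 0" "\<And>y. y \<in> level (seq_sc N wt E) 0 \<Longrightarrow> lnorm (seq_sc N wt E) 0 (y - x) < r \<Longrightarrow> y \<in> over_U N wt"
    using over_U_open[OF N x(1)] by blast
  have "lnorm (seq_sc M wtF const_sc) 0 (mterm_sums D M Ls (x + h) - mterm_sums D M Ls x - mterm_sums_deriv M Ls x h) / lnorm (seq_sc N wt E) 1 h < e"
    if h: "h \<in> level (seq_sc N wt E) 1" "0 < lnorm (seq_sc N wt E) 1 h" "lnorm (seq_sc N wt E) 1 h < min d r" for h
  proof -
    have s: "level (seq_sc N wt E) 1 \<subseteq> level (seq_sc N wt E) 0" "lnorm (seq_sc N wt E) 0 h \<le> lnorm (seq_sc N wt E) 1 h"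
      using normed_scale_mono[OF normed_scale_seq_sc[OF E, of N wt], of 0 1] h by auto
    have "x + h \<in> level (seq_sc N wt E) 0"
      using s x h norm_onD(1)[OF normed_scale_norm_on[OF normed_scale_seq_sc[OF E]]] by (meson subsetD subspace_add)
    then have "x + h \<in> over_U N wt" using s h by (intro r(2)) auto
    then have u: "(x + h) 0 \<in> U" by (simp add: over_U_def)
    have "mterm_sums D M Ls (x + h) j - mterm_sums D M Ls x j - mterm_sums_deriv M Ls x h j = (\<Sum>is\<leftarrow>Ls j. mterm D is (x + h) - mterm D is x - mterm_deriv D is x h)" if "j < M" for j
      using that by (simp add: mterm_sums_def mterm_sums_deriv_def sum_list_subtractf)
    then have "lnorm (seq_sc M wtF const_sc) 0 (mterm_sums D M Ls (x + h) - mterm_sums D M Ls x - mterm_sums_deriv M Ls x h) =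
       (\<Sum>j<M. norm (\<Sum>is\<leftarrow>Ls j. mterm D is (x + h) - mterm D is x - mterm_deriv D is x h))"
      by (simp add: lnorm_const)
    also have "\<dots> \<le> (\<Sum>j<M. real (length (Ls j)) * (e' * lnorm (seq_sc N wt E) 1 h))"
      using d(2)[OF h(1,2) u] h by (intro sum_mono norm_sum_list_le) auto
    also have "\<dots> = K * e' * lnorm (seq_sc N wt E) 1 h" by (simp add: K_def sum_distrib_right sum_distrib_left mult_ac)
    also have "\<dots> < e * lnorm (seq_sc N wt E) 1 h" using e' h by (intro mult_strict_right_mono) auto
    finally show ?thesis using h by (simp add: field_simps)
  qed
  then show "\<exists>d>0. \<forall>h\<in>level (seq_sc N wt E) 1. 0 < lnorm (seq_sc N wt E) 1 h \<and> lnorm (seq_sc N wt E) 1 h < d \<longrightarrow>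
      lnorm (seq_sc M wtF const_sc) 0 (mterm_sums D M Ls (x + h) - mterm_sums D M Ls x - mterm_sums_deriv M Ls x h) / lnorm (seq_sc N wt E) 1 h < e"
    using d(1) r(1) by (intro exI[of _ "min d r"]) auto
qed

definition tangent_terms :: "(nat \<Rightarrow> nat list list) \<Rightarrow> nat \<Rightarrow> nat list list"
  where "tangent_terms Ls j = (if even j then map (map ((*) 2)) (Ls (j div 2)) else concat (map mterm_diff (Ls (j div 2))))"

lemma tangent_terms_admissible:
  assumes val: "\<And>j is. j < M \<Longrightarrow> is \<in> set (Ls j) \<Longrightarrow> admissible N wt is" and j: "j < 2 * M" "is \<in> set (tangent_terms Ls j)"
  shows "admissible (2 * N) (tangent_wt wt) is"
proof -
  have "j div 2 < M" using j by auto
  then show ?thesis using j val[of "j div 2"] admissible_double admissible_mterm_diff by (fastforce simp: tangent_terms_def split: if_splits)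
qed

lemma interleave_tangent_map:
  "interleave (tangent_map (mterm_sums D M Ls) (mterm_sums_deriv M Ls) (x, h)) = mterm_sums D (2 * M) (tangent_terms Ls) (interleave (x, h))"
proof
  fix j
  have c: "(\<Sum>is\<leftarrow>concat (map mterm_diff xs). mterm D is s) = (\<Sum>is\<leftarrow>xs. \<Sum>is'\<leftarrow>mterm_diff is. mterm D is' s)" for xs s
    by (induction xs) auto
  have "j div 2 < M \<longleftrightarrow> j < 2 * M" by auto
  then show "interleave (tangent_map (mterm_sums D M Ls) (mterm_sums_deriv M Ls) (x, h)) j = mterm_sums D (2 * M) (tangent_terms Ls) (interleave (x, h)) j"
    by (auto simp: interleave_def[of "(mterm_sums D M Ls x, mterm_sums_deriv M Ls x h)"] tangent_map_def mterm_sums_def mterm_sums_deriv_def tangent_terms_def c sum_mterm_diff o_def mterm_double)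
qed

lemma interleave_over_U: "interleave (x, h) \<in> over_U (2 * M) (tangent_wt wt) \<longleftrightarrow> (x, h) \<in> tangent_set (seq_sc M wt E) (over_U M wt)"
proof -
  have "interleave (x, h) 0 = x 0" using interleave_simps(1)[of x h 0] by simp
  moreover have "level (seq_sc M wt E) 1 \<subseteq> level (seq_sc M wt E) 0" using normed_scale_mono[OF normed_scale_seq_sc[OF E], of 0 1] by auto
  ultimately show ?thesis by (auto simp: over_U_def interleave_mem_seq_sc tangent_set_def)
qed

lemma tangent_const: "tangent_set (seq_sc M wtF const_sc) (level (seq_sc M wtF const_sc) 0) = level (tangent_sc (seq_sc M wtF (const_sc :: 'b sc))) 0"
  by (auto simp: tangent_set_def level_tangent level_const)

text \<open>
  Interleaving is a linear isometry between the tangent space, whose elements are pairs, and the sequence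
  space that codes it, so continuity may be checked on sequences.
\<close>

lemma eps_cont_tangent:
  fixes F :: "'c::real_vector sc"
  assumes g: "eps_cont (level (seq_sc (2 * N) (tangent_wt wt) E) m) (lnorm (seq_sc (2 * N) (tangent_wt wt) E) m) W'
      (level (seq_sc (2 * M) (tangent_wt wtF) F) m) (lnorm (seq_sc (2 * M) (tangent_wt wtF) F) m) g"
    and G: "\<And>p. interleave (G p) = g (interleave p)" and W: "\<And>p. p \<in> W \<longleftrightarrow> interleave p \<in> W'"
  shows "eps_cont (level (tangent_sc (seq_sc N wt E)) m) (lnorm (tangent_sc (seq_sc N wt E)) m) W
      (level (tangent_sc (seq_sc M wtF F)) m) (lnorm (tangent_sc (seq_sc M wtF F)) m) G"
proof -
  have l: "p \<in> level (tangent_sc (seq_sc A w H)) m \<longleftrightarrow> interleave p \<in> level (seq_sc (2 * A) (tangent_wt w) H) m" for A w p and H :: "'d::real_vector sc"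
    by (cases p) (simp add: interleave_mem_seq_sc level_tangent)
  have n: "lnorm (tangent_sc (seq_sc A w H)) m p = lnorm (seq_sc (2 * A) (tangent_wt w) H) m (interleave p)" for A w p and H :: "'d::real_vector sc"
    unfolding seq_sc_tangent[symmetric] by (simp add: interleave_sc_def deinterleave_interleave)
  have d: "interleave (p - q) = interleave p - interleave q" for p q :: "(nat \<Rightarrow> 'd::real_vector) \<times> (nat \<Rightarrow> 'd)"
    by (auto simp: interleave_def)
  show ?thesis
    unfolding eps_cont_def
  proof (intro ballI conjI allI impI)
    fix x assume x: "x \<in> W \<inter> level (tangent_sc (seq_sc N wt E)) m"
    then have x': "interleave x \<in> W' \<inter> level (seq_sc (2 * N) (tangent_wt wt) E) m" by (simp add: l W)
    show "G x \<in> level (tangent_sc (seq_sc M wtF F)) m" using g x' by (simp add: l G eps_cont_def)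
    fix e :: real assume "e > 0"
    then obtain r where "r > 0" "\<And>y. y \<in> W' \<inter> level (seq_sc (2 * N) (tangent_wt wt) E) m \<Longrightarrow> lnorm (seq_sc (2 * N) (tangent_wt wt) E) m (y - interleave x) < r \<Longrightarrow>
       lnorm (seq_sc (2 * M) (tangent_wt wtF) F) m (g y - g (interleave x)) < e"
      using g x' unfolding eps_cont_def by blast
    then show "\<exists>d>0. \<forall>y\<in>W \<inter> level (tangent_sc (seq_sc N wt E)) m. lnorm (tangent_sc (seq_sc N wt E)) m (y - x) < d \<longrightarrow>
        lnorm (tangent_sc (seq_sc M wtF F)) m (G y - G x) < e"
      by (intro exI[of _ r]) (simp add: l n W d G)
  qed
qed

text \<open>
  The statement has to be proved for all numbers of entries, weights and lists of terms at once, since the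
  tangent map of a vector of term sums is a vector of term sums on a larger sequence space.
\<close>

lemma sc_k_mterm_sums:
  assumes "0 < N" "\<And>j is. j < M \<Longrightarrow> is \<in> set (Ls j) \<Longrightarrow> admissible N wt is"
  shows "sc_k k (seq_sc N wt E) (over_U N wt) (seq_sc M wtF const_sc) (level (seq_sc M wtF const_sc) 0) (mterm_sums D M Ls)"
  using assms
proof (induction k arbitrary: N M wt wtF Ls)
  have base: "sc0 (seq_sc N wt E) (over_U N wt) (seq_sc M wtF const_sc) (level (seq_sc M wtF const_sc) 0) (mterm_sums D M Ls)"
    if N: "0 < N" and val: "\<And>j is. j < M \<Longrightarrow> is \<in> set (Ls j) \<Longrightarrow> admissible N wt is" for N M wt wtF Ls
  proof (rule sc0_eps[OF normed_scale_seq_sc[OF E] normed_scale_seq_sc[OF normed_scale_const]])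
    show "over_U N wt \<subseteq> level (seq_sc N wt E) 0" by (auto simp: over_U_def)
  qed (use over_U_open[OF N] mterm_sums_eps[OF val] in auto)
  {
    case 0
    then show ?case using base by simp
  next
    case (Suc k)
    let ?L = "tangent_terms Ls"
    have valT: "admissible (2 * N) (tangent_wt wt) is" if "j < 2 * M" "is \<in> set (?L j)" for j "is"
      by (rule tangent_terms_admissible[OF Suc.prems(2) that])
    have IH: "sc_k k (seq_sc (2 * N) (tangent_wt wt) E) (over_U (2 * N) (tangent_wt wt)) (seq_sc (2 * M) (tangent_wt wtF) const_sc)
       (level (seq_sc (2 * M) (tangent_wt wtF) const_sc) 0) (mterm_sums D (2 * M) ?L)"
      using Suc.prems(1) valT by (intro Suc.IH) auto
    have VVi: "interleave ` tangent_set (seq_sc N wt E) (over_U N wt) = over_U (2 * N) (tangent_wt wt)"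
    proof -
      have "s \<in> interleave ` tangent_set (seq_sc N wt E) (over_U N wt)" if "s \<in> over_U (2 * N) (tangent_wt wt)" for s
        using that interleave_over_U[of "fst (deinterleave s)" "snd (deinterleave s)" N wt]
        by (intro image_eqI[of s interleave "deinterleave s"]) (auto simp: interleave_deinterleave)
      then show ?thesis using interleave_over_U by auto
    qed
    have lvl: "interleave ` level (tangent_sc (seq_sc M wtF const_sc)) 0 = level (seq_sc (2 * M) (tangent_wt wtF) (const_sc :: 'b sc)) 0"
      unfolding seq_sc_tangent[symmetric] by (simp add: interleave_sc_def)
    have comp: "interleave \<circ> tangent_map (mterm_sums D M Ls) (mterm_sums_deriv M Ls) \<circ> deinterleave = mterm_sums D (2 * M) ?L"
    proof
      fix s
      show "(interleave \<circ> tangent_map (mterm_sums D M Ls) (mterm_sums_deriv M Ls) \<circ> deinterleave) s = mterm_sums D (2 * M) ?L s"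
        using interleave_tangent_map[of M Ls "fst (deinterleave s)" "snd (deinterleave s)"] by (simp add: interleave_deinterleave)
    qed
    have T0: "sc0 (tangent_sc (seq_sc N wt E)) (tangent_set (seq_sc N wt E) (over_U N wt)) (tangent_sc (seq_sc M wtF const_sc))
       (level (tangent_sc (seq_sc M wtF const_sc)) 0) (tangent_map (mterm_sums D M Ls) (mterm_sums_deriv M Ls))"
    proof (rule sc0_eps)
      show "normed_scale (tangent_sc (seq_sc N wt E))" "normed_scale (tangent_sc (seq_sc M wtF (const_sc :: 'b sc)))"
        by (intro normed_scale_tangent normed_scale_seq_sc E normed_scale_const)+
      show "tangent_set (seq_sc N wt E) (over_U N wt) \<subseteq> level (tangent_sc (seq_sc N wt E)) 0"
        by (auto simp: tangent_set_def level_tangent)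
      show "eps_cont (level (tangent_sc (seq_sc N wt E)) m) (lnorm (tangent_sc (seq_sc N wt E)) m) (tangent_set (seq_sc N wt E) (over_U N wt))
          (level (tangent_sc (seq_sc M wtF const_sc)) m) (lnorm (tangent_sc (seq_sc M wtF const_sc)) m) (tangent_map (mterm_sums D M Ls) (mterm_sums_deriv M Ls))" for m
      proof (rule eps_cont_tangent[OF mterm_sums_eps[OF valT]])
        show "interleave (tangent_map (mterm_sums D M Ls) (mterm_sums_deriv M Ls) p) = mterm_sums D (2 * M) ?L (interleave p)" for p
          by (cases p) (simp add: interleave_tangent_map)
        show "p \<in> tangent_set (seq_sc N wt E) (over_U N wt) \<longleftrightarrow> interleave p \<in> over_U (2 * N) (tangent_wt wt)" for p
          by (cases p) (simp add: interleave_over_U)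
      qed
      fix p assume p: "p \<in> tangent_set (seq_sc N wt E) (over_U N wt)"
      then have p1: "fst p \<in> over_U N wt" "fst p \<in> level (seq_sc N wt E) 1" by (auto simp: tangent_set_def)
      obtain r where r: "r > 0" "\<And>y. y\<in>level (seq_sc N wt E) 0 \<Longrightarrow> lnorm (seq_sc N wt E) 0 (y - fst p) < r \<Longrightarrow> y \<in> over_U N wt"
        using over_U_open[OF Suc.prems(1) p1(1)] by blast
      have "y \<in> tangent_set (seq_sc N wt E) (over_U N wt)"
        if y: "y \<in> level (tangent_sc (seq_sc N wt E)) 0" "lnorm (tangent_sc (seq_sc N wt E)) 0 (y - p) < r" for y
      proof -
        have y1: "fst y \<in> level (seq_sc N wt E) 1" "snd y \<in> level (seq_sc N wt E) 0" using y by (auto simp: level_tangent)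
        note NS = norm_onD[OF normed_scale_norm_on[OF normed_scale_seq_sc[OF E, of N wt]]]
        have d: "fst y - fst p \<in> level (seq_sc N wt E) 1" using y1 p1 NS(1) by (simp add: subspace_diff)
        have s: "level (seq_sc N wt E) 1 \<subseteq> level (seq_sc N wt E) 0" "lnorm (seq_sc N wt E) 0 (fst y - fst p) \<le> lnorm (seq_sc N wt E) 1 (fst y - fst p)"
          using normed_scale_mono[OF normed_scale_seq_sc[OF E, of N wt], of 0 1] d by auto
        have "lnorm (seq_sc N wt E) 1 (fst y - fst p) \<le> lnorm (tangent_sc (seq_sc N wt E)) 0 (y - p)"
          by (simp add: lnorm_tangent case_prod_beta NS(2))
        then have "fst y \<in> over_U N wt" using s y y1 by (intro r(2)) auto
        then show ?thesis using y1 by (cases y) (auto simp: tangent_set_def)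
      qed
      then show "\<exists>r>0. \<forall>y\<in>level (tangent_sc (seq_sc N wt E)) 0. lnorm (tangent_sc (seq_sc N wt E)) 0 (y - p) < r \<longrightarrow> y \<in> tangent_set (seq_sc N wt E) (over_U N wt)"
        using r(1) by blast
    qed
    show ?case
      unfolding sc_k.simps tangent_const VVi lvl seq_sc_tangent
    proof (intro conjI exI[of _ "mterm_sums_deriv M Ls"])
      show "sc_k k (seq_sc (2 * N) (tangent_wt wt) E) (over_U (2 * N) (tangent_wt wt)) (seq_sc (2 * M) (tangent_wt wtF) const_sc) (level (seq_sc (2 * M) (tangent_wt wtF) const_sc) 0)
        (interleave \<circ> tangent_map (mterm_sums D M Ls) (mterm_sums_deriv M Ls) \<circ> deinterleave)" unfolding comp by (rule IH)
    qed (use base[OF Suc.prems] mterm_sums_deriv[OF Suc.prems(2,1)] T0 in auto)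
  }
qed

text \<open>
  The map itself is the term without arguments. The equation is assumed off \<open>U\<close> as well, because \<open>sc_smooth\<close> takes the
  map as a total function on sequences.
\<close>

lemma sc_smooth_tower:
  assumes D0: "\<And>v. D 0 v [] = f v"
  shows "sc_smooth E U const_sc UNIV f"
  unfolding sc_smooth_def
proof
  fix k
  have "sc_k k (seq_sc 1 (\<lambda>_. 0) E) (over_U 1 (\<lambda>_. 0)) (seq_sc 1 (\<lambda>_. 0) const_sc) (level (seq_sc 1 (\<lambda>_. 0) const_sc) 0) (mterm_sums D 1 (\<lambda>_. [[]]))"
    by (rule sc_k_mterm_sums) (auto simp: admissible_def)
  moreover have "at_0 ` U = over_U 1 (\<lambda>_. 0)"
  proof -
    have "s \<in> at_0 ` U" if "s 0 \<in> U" "\<forall>i\<ge>1. s i = 0" for s :: "nat \<Rightarrow> 'a"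
      using that by (intro image_eqI[of _ _ "s 0"]) (auto simp: at_0_def)
    then show ?thesis using U0 by (auto simp: over_U_def level_seq_sc at_0_def)
  qed
  moreover have "at_0 ` UNIV = level (seq_sc 1 (\<lambda>_. 0) (const_sc :: 'b sc)) 0"
    unfolding at_0_sc_eq[symmetric] by (simp add: at_0_sc_def const_sc_def)
  moreover have "(\<lambda>s. at_0 (f (s 0))) = mterm_sums D 1 (\<lambda>_. [[]])"
    by (auto simp: mterm_sums_def mterm_def at_0_def D0 fun_eq_iff)
  ultimately show "sc_k k (at_0_sc E) (at_0 ` U) (at_0_sc const_sc) (at_0 ` UNIV) (\<lambda>s. at_0 (f (s 0)))" by (simp add: at_0_sc_eq)
qed

end

text \<open>
  For maps into a Euclidean space, one more derivative for each level is enough for sc-smoothness.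
\<close>

lemma sc_smooth_of_Ck_levels:
  fixes f :: "'a::real_vector \<Rightarrow> 'b::euclidean_space"
  assumes E: "normed_scale E" and U: "U \<subseteq> level E 0"
    "\<And>x. x \<in> U \<Longrightarrow> \<exists>r>0. \<forall>y\<in>level E 0. lnorm E 0 (y - x) < r \<longrightarrow> y \<in> U"
    and C: "\<And>m. Ck_map (Suc m) (level E m) (lnorm E m) (U \<inter> level E m) f"
  shows "sc_smooth E U const_sc UNIV f"
proof -
  obtain D where D: "tower E U f D" using tower_exists[OF assms] by blast
  \<comment> \<open>The derivatives matter on \<open>U\<close> only. Off \<open>U\<close> they are set to \<open>f\<close>, so that the 0-th one is \<open>f\<close> on the whole type.\<close>
  define D' where "D' j v hs = (if v \<in> U then D j v hs else f v)" for j v hs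
  have eq: "D' j v = D j v" if "v \<in> U" for j v using that by (simp add: D'_def fun_eq_iff)
  have "tower E U f D'"
    using D unfolding tower_def by (simp add: eq Ball_def cong: conj_cong imp_cong)
  then interpret sc_tower E U f D' using E U by unfold_locales auto
  show ?thesis by (rule sc_smooth_tower) (use D in \<open>auto simp: D'_def tower_def\<close>)
qed

section \<open>Bump functions and the fundamental lemma of the calculus of variations\<close>

lemma pd_UNIV_eq:
  assumes "(f has_derivative D) (at z)"
  shows "pd UNIV e f z = D e"
  using frechet_derivative_at[OF assms] by (simp add: pd_def)

lemma Ck_on_Suc_imp: "Ck_on (Suc k) S v \<Longrightarrow> Ck_on k S v"
proof (induction k arbitrary: v)
  case 0 then show ?case by (auto intro: differentiable_imp_continuous_on)
next
  case (Suc k) 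
  then show ?case by (metis Ck_on.simps(2))
qed

lemma Ck_on_le: "Ck_on k S v \<Longrightarrow> l \<le> k \<Longrightarrow> Ck_on l S v"
  by (induction k) (auto simp: le_Suc_eq simp del: Ck_on.simps dest: Ck_on_Suc_imp)

lemma has_derivative_pd:
  assumes "v differentiable_on S" "z \<in> S"
  shows "(v has_derivative (\<lambda>h. Re h *\<^sub>R pd S 1 v z + Im h *\<^sub>R pd S \<i> v z)) (at z within S)"
proof -
  define D where "D = frechet_derivative v (at z within S)"
  have D: "(v has_derivative D) (at z within S)"
    using assms by (auto simp: D_def differentiable_on_def frechet_derivative_works)
  interpret DD: bounded_linear D using D by (rule has_derivative_bounded_linear)
  have "D h = Re h *\<^sub>R D 1 + Im h *\<^sub>R D \<i>" for h
  proof -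
    have "D (Re h *\<^sub>R 1 + Im h *\<^sub>R \<i>) = D (Re h *\<^sub>R 1) + D (Im h *\<^sub>R \<i>)"
      by (rule DD.add)
    moreover have "D (Re h *\<^sub>R 1) = Re h *\<^sub>R D 1" by (rule DD.scaleR)
    moreover have "D (Im h *\<^sub>R \<i>) = Im h *\<^sub>R D \<i>" by (rule DD.scaleR)
    moreover have "Re h *\<^sub>R 1 + Im h *\<^sub>R \<i> = h" by (simp add: complex_eq_iff)
    ultimately show ?thesis by metis
  qed
  moreover have "D e = pd S e v z" for e using assms by (simp add: pd_def D_def)
  ultimately have "D = (\<lambda>h. Re h *\<^sub>R pd S 1 v z + Im h *\<^sub>R pd S \<i> v z)"
    by metis
  with D show ?thesis by simp
qed

lemma Ck_on_add:
  fixes f g :: "complex \<Rightarrow> 'b::real_normed_vector"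
  shows "Ck_on k UNIV f \<Longrightarrow> Ck_on k UNIV g \<Longrightarrow> Ck_on k UNIV (\<lambda>z. f z + g z)"
proof (induction k arbitrary: f g)
  case 0 then show ?case by (auto intro: continuous_intros)
next
  case (Suc k)
  from Suc.prems have df: "f differentiable_on UNIV" and dg: "g differentiable_on UNIV" by auto
  have "pd UNIV e (\<lambda>z. f z + g z) = (\<lambda>z. pd UNIV e f z + pd UNIV e g z)" for e
  proof
    fix z
    have f: "(f has_derivative frechet_derivative f (at z)) (at z)"
     and g: "(g has_derivative frechet_derivative g (at z)) (at z)"
      using df dg by (auto simp: differentiable_on_def frechet_derivative_works)
    show "pd UNIV e (\<lambda>z. f z + g z) z = pd UNIV e f z + pd UNIV e g z"
      using pd_UNIV_eq[OF has_derivative_add[OF f g]] by (simp add: pd_def)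
  qed
  with Suc df dg show ?case by (auto intro: differentiable_on_add)
qed

lemma Ck_on_mult:
  fixes f g :: "complex \<Rightarrow> real"
  shows "Ck_on k UNIV f \<Longrightarrow> Ck_on k UNIV g \<Longrightarrow> Ck_on k UNIV (\<lambda>z. f z * g z)"
proof (induction k arbitrary: f g)
  case 0 then show ?case by (auto intro: continuous_intros)
next
  case (Suc k)
  from Suc.prems have df: "f differentiable_on UNIV" and dg: "g differentiable_on UNIV" by auto
  have e: "pd UNIV e (\<lambda>z. f z * g z) = (\<lambda>z. f z * pd UNIV e g z + pd UNIV e f z * g z)" for e
  proof
    fix z
    have f: "(f has_derivative frechet_derivative f (at z)) (at z)"
     and g: "(g has_derivative frechet_derivative g (at z)) (at z)"
      using df dg by (auto simp: differentiable_on_def frechet_derivative_works)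
    show "pd UNIV e (\<lambda>z. f z * g z) z = f z * pd UNIV e g z + pd UNIV e f z * g z"
      using pd_UNIV_eq[OF has_derivative_mult[OF f g]] by (simp add: pd_def)
  qed
  have "Ck_on k UNIV f" "Ck_on k UNIV g" using Suc.prems by (auto simp del: Ck_on.simps intro: Ck_on_Suc_imp)
  then have "Ck_on k UNIV (pd UNIV e (\<lambda>z. f z * g z))" if "e = 1 \<or> e = \<i>" for e
    unfolding e using Suc.prems that by (intro Ck_on_add Suc.IH) auto
  with df dg show ?case by (auto intro: differentiable_on_mult)
qed

text \<open>
  The derivatives of \<open>exp (- c / x)\<close>, extended by 0 to the left, are of this shape for suitable polynomials
  \<open>p\<close>; the case \<open>p = 1\<close> is the function itself. Keeping \<open>c\<close> variable makes \<open>c \<rightarrow> 0\<close> available, which approximates the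
  indicator of the half-line.
\<close>

definition flat_fun :: "real poly \<Rightarrow> real \<Rightarrow> real \<Rightarrow> real"
  where "flat_fun p c x = (if x > 0 then poly p (1/x) * exp (- c / x) else 0)"

lemma poly_exp_tendsto_0:
  fixes p :: "real poly"
  assumes "c > 0" shows "((\<lambda>y. poly p y * exp (- c * y)) \<longlongrightarrow> 0) at_top"
proof -
  have 1: "((\<lambda>y. y ^ k * exp (- c * y)) \<longlongrightarrow> 0) at_top" for k
  proof -
    have "filterlim (\<lambda>y. c * y) at_top at_top"
      using assms by (intro filterlim_tendsto_pos_mult_at_top[OF tendsto_const]) (auto simp: filterlim_ident)
    from filterlim_compose[OF tendsto_power_div_exp_0 this, of k]
    have "((\<lambda>y. (1 / c ^ k) * ((c * y) ^ k / exp (c * y))) \<longlongrightarrow> (1 / c ^ k) * 0) at_top"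
      by (intro tendsto_mult tendsto_const)
    moreover have "(1 / c ^ k) * ((c * y) ^ k / exp (c * y)) = y ^ k * exp (- c * y)" for y
      using assms by (simp add: power_mult_distrib exp_minus divide_inverse)
    ultimately show ?thesis by simp
  qed
  have "((\<lambda>y. \<Sum>i\<le>degree p. coeff p i * (y ^ i * exp (- c * y))) \<longlongrightarrow> (\<Sum>i\<le>degree p. coeff p i * 0)) at_top"
    by (intro tendsto_sum tendsto_mult tendsto_const 1)
  then show ?thesis by (simp add: poly_altdef sum_distrib_right mult.assoc)
qed

text \<open>
  At 0 the difference quotient from the right is a polynomial in \<open>y = 1 / h\<close> times \<open>exp (- c y)\<close>.
\<close>

lemma flat_fun_has_derivative:
  assumes c: "c > 0"
  shows "(flat_fun p c has_real_derivative flat_fun (monom 1 2 * (smult c p - pderiv p)) c x) (at x)"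
proof -
  consider "x > 0" | "x < 0" | "x = 0" by linarith
  then show ?thesis
  proof cases
    case 1
    have "((\<lambda>x. poly p (1/x) * exp (- c / x)) has_real_derivative
       flat_fun (monom 1 2 * (smult c p - pderiv p)) c x) (at x)"
      using 1 by (auto intro!: derivative_eq_intros poly_DERIV[THEN DERIV_chain2] simp: flat_fun_def poly_monom field_simps power2_eq_square)
    then show ?thesis
      by (rule has_field_derivative_transform_within_open[of _ _ _ "{0<..}"])
         (use 1 in \<open>auto simp: flat_fun_def\<close>)
  next
    case 2
    have "((\<lambda>x. 0) has_real_derivative flat_fun (monom 1 2 * (smult c p - pderiv p)) c x) (at x)"
      using 2 by (auto simp: flat_fun_def)
    then show ?thesis
      by (rule has_field_derivative_transform_within_open[of _ _ _ "{..<0}"])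
         (use 2 in \<open>auto simp: flat_fun_def\<close>)
  next
    case 3
    have "((\<lambda>h. flat_fun p c h / h) \<longlongrightarrow> 0) (at_right 0)"
    proof -
      have "filterlim (\<lambda>h::real. 1/h) at_top (at_right 0)"
        by (simp add: filterlim_inverse_at_top_right divide_inverse)
      from filterlim_compose[OF poly_exp_tendsto_0[OF c, of "pCons 0 p"] this]
      have "((\<lambda>h. poly (pCons 0 p) (1/h) * exp (- c * (1/h))) \<longlongrightarrow> 0) (at_right 0)" .
      then show ?thesis
        by (rule Lim_transform_eventually) (auto simp: eventually_at_filter flat_fun_def)
    qed
    moreover have "((\<lambda>h. flat_fun p c h / h) \<longlongrightarrow> 0) (at_left 0)"
      by (rule Lim_transform_eventually[OF tendsto_const]) (auto simp: eventually_at_filter flat_fun_def)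
    ultimately have "((\<lambda>h. flat_fun p c h / h) \<longlongrightarrow> 0) (at 0)"
      by (simp add: filterlim_at_split)
    then show ?thesis using 3 by (simp add: DERIV_def flat_fun_def)
  qed
qed

lemma Ck_on_flat_fun:
  assumes c: "c > 0"
  shows "Ck_on k UNIV (\<lambda>z::complex. flat_fun p c (z \<bullet> l + a))"
proof -
  have D: "((\<lambda>z. flat_fun p c (z \<bullet> l + a)) has_derivative
     (\<lambda>h. flat_fun (smult (h \<bullet> l) (monom 1 2 * (smult c p - pderiv p))) c (z \<bullet> l + a))) (at z)" for p z
  proof -
    have "((\<lambda>z. flat_fun p c (z \<bullet> l + a)) has_derivative
      (\<lambda>h. flat_fun (monom 1 2 * (smult c p - pderiv p)) c (z \<bullet> l + a) * (h \<bullet> l))) (at z)"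
      by (rule has_derivative_compose[OF _ flat_fun_has_derivative[OF c, unfolded has_field_derivative_def], of "\<lambda>z. z \<bullet> l + a", simplified])
         (auto intro!: derivative_eq_intros)
    then show ?thesis by (auto simp: flat_fun_def fun_eq_iff mult_ac elim!: has_derivative_eq_rhs)
  qed
  show ?thesis
  proof (induction k arbitrary: p)
    case 0
    show ?case using has_derivative_continuous_on[of UNIV, OF has_derivative_at_withinI[OF D]] by simp
  next
    case (Suc k)
    have "pd UNIV e (\<lambda>z. flat_fun p c (z \<bullet> l + a)) = (\<lambda>z. flat_fun (smult (e \<bullet> l) (monom 1 2 * (smult c p - pderiv p))) c (z \<bullet> l + a))" for e
      using pd_UNIV_eq[OF D] by auto
    moreover have "(\<lambda>z. flat_fun p c (z \<bullet> l + a)) differentiable_on UNIV"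
      unfolding differentiable_on_def using D differentiableI by blast
    ultimately show ?case using Suc by simp
  qed
qed

definition box_bump :: "complex \<Rightarrow> complex \<Rightarrow> real \<Rightarrow> complex \<Rightarrow> real"
  where "box_bump p q c z =
    (flat_fun 1 c (z \<bullet> 1 + - Re p) * flat_fun 1 c (z \<bullet> (-1) + Re q)) *
    (flat_fun 1 c (z \<bullet> \<i> + - Im p) * flat_fun 1 c (z \<bullet> (- \<i>) + Im q))"

lemma Ck_on_box_bump: "c > 0 \<Longrightarrow> Ck_on k UNIV (box_bump p q c)"
  unfolding box_bump_def by (intro Ck_on_mult Ck_on_flat_fun)

lemma box_bump_outside: "z \<notin> box p q \<Longrightarrow> box_bump p q c z = 0"
  by (auto simp: box_bump_def flat_fun_def in_box_complex_iff inner_complex_def)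

text \<open>
  The exponents tend to 0, so the bumps fill up the open box on which they are positive.
\<close>

lemma box_bump_tendsto:
  "(\<lambda>n. box_bump p q (1 / real (Suc n)) z) \<longlonglongrightarrow> indicat_real (box p q) z"
proof -
  have f: "(\<lambda>n. flat_fun 1 (1 / real (Suc n)) x) \<longlonglongrightarrow> (if x > 0 then 1 else 0)" for x
  proof -
    have "(\<lambda>n. exp (- (1 / real (Suc n)) / x)) \<longlonglongrightarrow> exp (- 0 / x)" if "x > 0"
      using that LIMSEQ_inverse_real_of_nat by (intro tendsto_intros) (auto simp: divide_inverse)
    then show ?thesis by (auto simp: flat_fun_def)
  qed
  define L :: real where "L = ((if z \<bullet> 1 + - Re p > 0 then 1 else 0) * (if z \<bullet> (-1) + Re q > 0 then 1 else 0)) *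
     ((if z \<bullet> \<i> + - Im p > 0 then 1 else 0) * (if z \<bullet> (-\<i>) + Im q > 0 then 1 else 0))"
  have "(\<lambda>n. box_bump p q (1 / real (Suc n)) z) \<longlonglongrightarrow> L"
    unfolding box_bump_def L_def by (intro tendsto_mult f)
  moreover have "L = indicat_real (box p q) z"
    by (auto simp: L_def indicator_def in_box_complex_iff inner_complex_def)
  ultimately show ?thesis by simp
qed

lemma box_bump_bound: "c > 0 \<Longrightarrow> \<bar>box_bump p q c z\<bar> \<le> 1"
proof -
  assume c: "c > 0"
  have "0 \<le> flat_fun 1 c x" "flat_fun 1 c x \<le> 1" for x using c by (auto simp: flat_fun_def)
  then show ?thesis by (simp add: box_bump_def abs_mult mult_le_one)
qed

text \<open>
  Boxes generate the Borel sets and are stable under intersection, so a function with vanishing integrals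
  over boxes has vanishing integrals over all Borel sets.
\<close>

lemma AE_zero_from_boxes:
  fixes f :: "'a::euclidean_space \<Rightarrow> 'b::euclidean_space"
  assumes f: "integrable lborel f"
    and 0: "\<And>p q. (LBINT z. indicator (box p q \<inter> box a b) z *\<^sub>R f z) = 0"
  shows "AE z in lborel. z \<in> box a b \<longrightarrow> f z = 0"
proof -
  define g where "g z = indicator (box a b) z *\<^sub>R f z" for z
  have g: "integrable lborel g" unfolding g_def using f by (intro integrable_mult_indicator) auto
  have eq: "indicator A z *\<^sub>R g z = indicator (A \<inter> box a b) z *\<^sub>R f z" for A z
    by (auto simp: g_def indicator_def)
  have *: "(LBINT z. indicator A z *\<^sub>R g z) = 0" if "A \<in> sigma_sets UNIV (range (\<lambda>(a, b). box a b::'a set))" for A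
  proof -
    have 1: "Int_stable (range (\<lambda>(a, b). box a b::'a set))"
      by (auto simp: Int_stable_def box_Int_box)
    have 2: "range (\<lambda>(a, b). box a b::'a set) \<subseteq> Pow UNIV" by simp
    from 1 2 that show ?thesis
  proof (induction rule: sigma_sets_induct_disjoint)
    case (basic A) then show ?case using 0 by (auto simp: eq)
  next
    case empty then show ?case by simp
  next
    case (compl A)
    then have A: "A \<in> sets borel" by (simp add: borel_eq_box)
    have "(LBINT z. indicator (UNIV - A) z *\<^sub>R g z) = (LBINT z. g z - indicator A z *\<^sub>R g z)"
      by (intro Bochner_Integration.integral_cong) (auto simp: indicator_def)
    also have "\<dots> = (LBINT z. g z) - (LBINT z. indicator A z *\<^sub>R g z)"
      using A by (intro Bochner_Integration.integral_diff g integrable_mult_indicator) auto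
    also have "\<dots> = 0" using compl 0[of a b] by (simp add: g_def[abs_def])
    finally show ?case .
  next
    case (union A)
    then have A: "A i \<in> sets lborel" for i using sigma_sets_into_sp by (auto simp: borel_eq_box image_subset_iff)
    have "set_lebesgue_integral lborel (\<Union>(range A)) g = (\<Sum>i. set_lebesgue_integral lborel (A i) g)"
    proof (rule lebesgue_integral_countable_add)
      show "set_integrable lborel (\<Union> (range A)) g"
        unfolding set_integrable_def using A by (intro integrable_mult_indicator g) blast
    qed (use union A in \<open>auto simp: disjoint_family_on_def\<close>)
    then show ?case using union by (simp add: set_lebesgue_integral_def)
  qed
  qed
  have "AE z in lborel. g z = 0"
    by (rule sigma_finite_measure.density_zero[OF sigma_finite_lborel g]) (simp add: set_lebesgue_integral_def * borel_eq_box)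
  then show ?thesis by eventually_elim (auto simp: g_def indicator_def)
qed

text \<open>
  Bump functions converge boundedly to indicators of boxes, and countably many boxes exhaust \<open>\<Omega>\<close>.
\<close>

lemma fundamental_lemma:
  fixes f :: "complex \<Rightarrow> 'b::euclidean_space"
  assumes f: "integrable lborel f" and "open \<Omega>"
    and 0: "\<And>\<phi> K. (\<And>k. Ck_on k UNIV \<phi>) \<Longrightarrow> compact K \<Longrightarrow> K \<subseteq> \<Omega> \<Longrightarrow> (\<And>z. z \<notin> K \<Longrightarrow> \<phi> z = 0) \<Longrightarrow>
       (LBINT z. \<phi> z *\<^sub>R f z) = 0"
  shows "AE z in lborel. z \<in> \<Omega> \<longrightarrow> f z = 0"
proof -
  have box0: "(LBINT z. indicator (box p q) z *\<^sub>R f z) = 0" if pq: "cbox p q \<subseteq> \<Omega>" for p q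
  proof -
    have m: "box_bump p q (1 / real (Suc n)) \<in> borel_measurable borel" for n
      using Ck_on_box_bump[of _ 0] by (intro borel_measurable_continuous_onI) auto
    have "(\<lambda>n. LBINT z. box_bump p q (1 / real (Suc n)) z *\<^sub>R f z) \<longlonglongrightarrow> (LBINT z. indicator (box p q) z *\<^sub>R f z)"
    proof (rule integral_dominated_convergence[where w = "\<lambda>z. norm (f z)"])
      show "AE x in lborel. (\<lambda>i. box_bump p q (1 / real (Suc i)) x *\<^sub>R f x) \<longlonglongrightarrow> indicat_real (box p q) x *\<^sub>R f x"
        by (intro AE_I2 tendsto_scaleR box_bump_tendsto tendsto_const)
      show "AE x in lborel. norm (box_bump p q (1 / real (Suc i)) x *\<^sub>R f x) \<le> norm (f x)" for i
        by (auto simp: mult_left_le_one_le box_bump_bound)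
    qed (use f m in \<open>auto simp: borel_measurable_integrable\<close>)
    moreover have "(LBINT z. box_bump p q (1 / real (Suc n)) z *\<^sub>R f z) = 0" for n
      by (rule 0[of _ "cbox p q"]) (use pq box_subset_cbox[of p q] in \<open>auto intro!: Ck_on_box_bump box_bump_outside\<close>)
    ultimately show ?thesis by (simp add: LIMSEQ_const_iff)
  qed
  obtain \<D> where D: "countable \<D>" "\<D> \<subseteq> Pow \<Omega>" "\<And>X. X \<in> \<D> \<Longrightarrow> \<exists>a b. X = cbox a b" "\<Union>\<D> = \<Omega>"
    using open_countable_Union_open_cbox[OF \<open>open \<Omega>\<close>] by metis
  have "AE z in lborel. z \<in> X \<longrightarrow> f z = 0" if X0: "X \<in> \<D>" for X
  proof -
    obtain a b where X: "X = cbox a b" "cbox a b \<subseteq> \<Omega>" using D(2) D(3)[of X] X0 by blast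
    have "AE z in lborel. z \<in> box a b \<longrightarrow> f z = 0"
    proof (rule AE_zero_from_boxes[OF f])
      fix p q
      obtain p' q' where e: "box p q \<inter> box a b = box p' q'" by (simp add: box_Int_box)
      have "(LBINT z. indicator (box p' q') z *\<^sub>R f z) = 0"
      proof (cases "box p' q' = {}")
        case False
        then have "cbox p' q' = closure (box p q \<inter> box a b)" by (simp add: e)
        also have "\<dots> \<subseteq> cbox a b" by (intro closure_minimal) (use box_subset_cbox in auto)
        finally show ?thesis using X by (intro box0) auto
      qed simp
      then show "(LBINT z. indicator (box p q \<inter> box a b) z *\<^sub>R f z) = 0" by (simp add: e)
    qed
    moreover have "AE z in lborel. z \<notin> cbox a b - box a b"
      using negligible_frontier_interval[of a b]
      by (intro AE_not_in) (auto simp: negligible_iff_null_sets null_sets_completion_iff)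
    ultimately show ?thesis by eventually_elim (use X in auto)
  qed
  then have "AE z in lborel. \<forall>X\<in>\<D>. z \<in> X \<longrightarrow> f z = 0"
    by (intro AE_ball_countable[OF D(1), THEN iffD2]) blast
  then show ?thesis by eventually_elim (use D in auto)
qed

section \<open>Weak directional derivatives and integration along segments\<close>

text \<open>
  Test functions on an arbitrary set. For the open unit disk these are the functions of \<open>test_function\<close>; smaller sets are needed
  to localise, and to shift test functions without leaving the disk.
\<close>

definition smooth_supp :: "complex set \<Rightarrow> (complex \<Rightarrow> real) \<Rightarrow> bool"
  where "smooth_supp \<Omega> \<phi> \<longleftrightarrow> (\<forall>k. Ck_on k UNIV \<phi>) \<and> (\<exists>K. compact K \<and> K \<subseteq> \<Omega> \<and> (\<forall>z. z \<notin> K \<longrightarrow> \<phi> z = 0))"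

lemma test_function_iff: "test_function \<phi> \<longleftrightarrow> smooth_supp (ball 0 1) \<phi>"
  by (simp add: test_function_def smooth_supp_def)

lemma smooth_supp_continuous: "smooth_supp \<Omega> \<phi> \<Longrightarrow> continuous_on UNIV \<phi>"
  unfolding smooth_supp_def by (metis Ck_on.simps(1))

lemma smooth_supp_measurable: "smooth_supp \<Omega> \<phi> \<Longrightarrow> \<phi> \<in> borel_measurable borel"
  by (intro borel_measurable_continuous_onI smooth_supp_continuous)

lemma smooth_supp_bounded: assumes "smooth_supp \<Omega> \<phi>" obtains C where "\<And>z. \<bar>\<phi> z\<bar> \<le> C"
proof -
  obtain K where K: "compact K" "\<And>z. z \<notin> K \<Longrightarrow> \<phi> z = 0" using assms by (auto simp: smooth_supp_def)
  have "compact (\<phi> ` K)" using K smooth_supp_continuous[OF assms] by (intro compact_continuous_image) (auto intro: continuous_on_subset)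
  then obtain C where "\<And>z. z \<in> K \<Longrightarrow> \<bar>\<phi> z\<bar> \<le> C" by (metis compact_imp_bounded bounded_iff imageI real_norm_def)
  then have "\<bar>\<phi> z\<bar> \<le> max C 0" for z using K(2)[of z] by (cases "z \<in> K") (auto simp: max.coboundedI1)
  then show ?thesis by (rule that)
qed

lemma smooth_supp_pd_eq:
  assumes "smooth_supp \<Omega> \<phi>"
  shows "pd UNIV h \<phi> z = Re h * pd UNIV 1 \<phi> z + Im h * pd UNIV \<i> \<phi> z"
proof -
  have "\<phi> differentiable_on UNIV" using assms unfolding smooth_supp_def by (metis Ck_on.simps(2))
  from has_derivative_pd[OF this, of z]
  have 1: "(\<phi> has_derivative (\<lambda>h. Re h *\<^sub>R pd UNIV 1 \<phi> z + Im h *\<^sub>R pd UNIV \<i> \<phi> z)) (at z)" by simp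
  show ?thesis using pd_UNIV_eq[OF 1, of h] by simp
qed

lemma smooth_supp_deriv:
  assumes "smooth_supp \<Omega> \<phi>"
  shows "(\<phi> has_derivative (\<lambda>h. pd UNIV h \<phi> z)) (at z)"
proof -
  have "\<phi> differentiable_on UNIV" using assms unfolding smooth_supp_def by (metis Ck_on.simps(2))
  from has_derivative_pd[OF this, of z]
  have 1: "(\<phi> has_derivative (\<lambda>h. Re h *\<^sub>R pd UNIV 1 \<phi> z + Im h *\<^sub>R pd UNIV \<i> \<phi> z)) (at z)" by simp
  have "(\<lambda>h. Re h *\<^sub>R pd UNIV 1 \<phi> z + Im h *\<^sub>R pd UNIV \<i> \<phi> z) = (\<lambda>h. pd UNIV h \<phi> z)"
    by (rule ext) (metis smooth_supp_pd_eq[OF assms] real_scaleR_def)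
  with 1 show ?thesis by metis
qed

lemma smooth_supp_pd:
  assumes "smooth_supp \<Omega> \<phi>" "e = 1 \<or> e = \<i>"
  shows "smooth_supp \<Omega> (pd UNIV e \<phi>)"
proof -
  obtain K where K: "compact K" "K \<subseteq> \<Omega>" "\<And>z. z \<notin> K \<Longrightarrow> \<phi> z = 0" using assms by (auto simp: smooth_supp_def)
  have "pd UNIV e \<phi> z = 0" if "z \<notin> K" for z
  proof -
    have "((\<lambda>_. 0) has_derivative (\<lambda>_. 0)) (at z)" by simp
    then have "(\<phi> has_derivative (\<lambda>_. 0)) (at z)"
      by (rule has_derivative_transform_within_open[of _ _ _ _ "- K"]) (use that K in \<open>auto simp: compact_imp_closed open_Compl\<close>)
    then show ?thesis by (simp add: pd_UNIV_eq)
  qed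
  moreover have "Ck_on k UNIV (pd UNIV e \<phi>)" for k
    using assms unfolding smooth_supp_def by (metis Ck_on.simps(2))
  ultimately show ?thesis using K by (auto simp: smooth_supp_def)
qed

lemma smooth_supp_pd_dir_continuous:
  assumes "smooth_supp \<Omega> \<phi>" shows "continuous_on UNIV (pd UNIV h \<phi>)"
proof -
  have "pd UNIV h \<phi> = (\<lambda>z. Re h * pd UNIV 1 \<phi> z + Im h * pd UNIV \<i> \<phi> z)"
    by (rule ext, rule smooth_supp_pd_eq[OF assms])
  moreover have "continuous_on UNIV \<dots>"
    by (intro continuous_intros smooth_supp_continuous[OF smooth_supp_pd[OF assms]]; simp)
  ultimately show ?thesis by metis
qed

lemma smooth_supp_pd_dir_bounded: assumes "smooth_supp \<Omega> \<phi>" obtains C where "\<And>z. \<bar>pd UNIV h \<phi> z\<bar> \<le> C"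
proof -
  obtain A where A: "\<And>z. \<bar>pd UNIV 1 \<phi> z\<bar> \<le> A" using smooth_supp_bounded[OF smooth_supp_pd[OF assms, of 1]] by auto
  obtain B where B: "\<And>z. \<bar>pd UNIV \<i> \<phi> z\<bar> \<le> B" using smooth_supp_bounded[OF smooth_supp_pd[OF assms, of \<i>]] by auto
  have "\<bar>pd UNIV h \<phi> z\<bar> \<le> \<bar>Re h\<bar> * A + \<bar>Im h\<bar> * B" for z
    by (subst smooth_supp_pd_eq[OF assms], rule order_trans[OF abs_triangle_ineq]) (auto simp: abs_mult intro!: add_mono mult_left_mono A B)
  then show ?thesis by (rule that)
qed

lemma pd_shift:
  fixes \<phi> :: "complex \<Rightarrow> 'b::real_normed_vector"
  assumes "\<phi> differentiable_on UNIV"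
  shows "pd UNIV e (\<lambda>y. \<phi> (y - p)) z = pd UNIV e \<phi> (z - p)"
proof -
  have 1: "(\<phi> has_derivative frechet_derivative \<phi> (at (z - p))) (at (z - p))"
    using assms by (auto simp: differentiable_on_def frechet_derivative_works)
  have "((\<lambda>y. \<phi> (y - p)) has_derivative (\<lambda>h. frechet_derivative \<phi> (at (z - p)) h)) (at z)"
    by (rule has_derivative_compose[of "\<lambda>y. y - p" "\<lambda>h. h" z UNIV \<phi> "frechet_derivative \<phi> (at (z - p))"])
       (use 1 in \<open>auto intro!: derivative_eq_intros\<close>)
  from pd_UNIV_eq[OF this] show ?thesis by (simp add: pd_def)
qed

lemma Ck_on_shift: "Ck_on k UNIV \<phi> \<Longrightarrow> Ck_on k UNIV (\<lambda>y. \<phi> (y - p))"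
proof (induction k arbitrary: \<phi>)
  case 0 then show ?case by (auto intro!: continuous_on_compose2[of UNIV \<phi>] continuous_intros)
next
  case (Suc k)
  have "(\<lambda>y. \<phi> (y - p)) differentiable_on UNIV"
    unfolding differentiable_on_def
  proof (intro ballI)
    fix z
    have "\<phi> differentiable (at (z - p))" using Suc.prems by (simp add: differentiable_on_def)
    then have "(\<phi> \<circ> (\<lambda>y. y - p)) differentiable (at z)"
      by (intro differentiable_chain_at differentiable_diff differentiable_ident differentiable_const)
    then show "(\<lambda>y. \<phi> (y - p)) differentiable (at z)" by (simp add: o_def)
  qed
  moreover have "pd UNIV e (\<lambda>y. \<phi> (y - p)) = (\<lambda>z. pd UNIV e \<phi> (z - p))" for e
    using Suc.prems by (auto simp: pd_shift)
  moreover have "Ck_on k UNIV (\<lambda>z. pd UNIV 1 \<phi> (z - p))" "Ck_on k UNIV (\<lambda>z. pd UNIV \<i> \<phi> (z - p))"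
    using Suc.prems Suc.IH[of "pd UNIV 1 \<phi>"] Suc.IH[of "pd UNIV \<i> \<phi>"] by simp_all
  ultimately show ?case by simp
qed

lemma smooth_supp_shift:
  assumes "smooth_supp \<Omega> \<phi>" "\<And>x. x \<in> \<Omega> \<Longrightarrow> x + p \<in> \<Omega>'"
  shows "smooth_supp \<Omega>' (\<lambda>y. \<phi> (y - p))"
proof -
  obtain K where K: "compact K" "K \<subseteq> \<Omega>" "\<And>z. z \<notin> K \<Longrightarrow> \<phi> z = 0" using assms by (auto simp: smooth_supp_def)
  have "\<phi> (z - p) = 0" if "z \<notin> (\<lambda>x. x + p) ` K" for z
    using that K(3)[of "z - p"] by (force simp: image_iff)
  moreover have "compact ((\<lambda>x. x + p) ` K)" using K by (intro compact_continuous_image continuous_intros)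
  moreover have "(\<lambda>x. x + p) ` K \<subseteq> \<Omega>'" using K assms by auto
  ultimately show ?thesis using assms(1) unfolding smooth_supp_def by (blast intro: Ck_on_shift)
qed

lemma integral_shift:
  fixes g :: "'a::euclidean_space \<Rightarrow> 'b::euclidean_space"
  assumes "g \<in> borel_measurable borel"
  shows "(LBINT x. g (x + p)) = (LBINT x. g x)"
proof -
  have "(LBINT x. g x) = (LINT x|distr lborel borel ((+) p). g x)" by (simp add: lborel_distr_plus)
  also have "\<dots> = (LBINT x. g (p + x))" using assms by (intro integral_distr) auto
  finally show ?thesis by (simp add: add.commute)
qed

lemma integrable_shift:
  fixes g :: "'a::euclidean_space \<Rightarrow> 'b::euclidean_space"
  assumes "integrable lborel g"
  shows "integrable lborel (\<lambda>x. g (x + p))"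
proof -
  have "integrable (distr lborel borel ((+) p)) g" using assms by (simp add: lborel_distr_plus)
  then have "integrable lborel (\<lambda>x. g (p + x))" using borel_measurable_integrable[OF assms] by (subst (asm) integrable_distr_eq) auto
  then show ?thesis by (simp add: add.commute)
qed

lemma integrable_bounded_mult:
  fixes g :: "'a \<Rightarrow> 'b::euclidean_space"
  assumes "integrable M g" "k \<in> borel_measurable M" "\<And>x. \<bar>k x\<bar> \<le> C"
  shows "integrable M (\<lambda>x. k x *\<^sub>R g x)"
proof (rule Bochner_Integration.integrable_bound)
  show "integrable M (\<lambda>x. C * norm (g x))" using assms by auto
  have "0 \<le> C" using assms(3)[of undefined] by linarith
  then show "AE x in M. norm (k x *\<^sub>R g x) \<le> norm (C * norm (g x))"
    using assms(3) by (auto intro!: mult_right_mono)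
qed (use assms in auto)

text \<open>
  The product integral needed to exchange integration along a segment with integration over the plane:
  for fixed \<open>s\<close> the integral over the plane is translation invariant.
\<close>

lemma integrable_slab:
  fixes g :: "complex \<Rightarrow> 'b::euclidean_space"
  assumes g: "integrable lborel g"
  shows "integrable (lborel \<Otimes>\<^sub>M lborel) (\<lambda>(s::real, x). indicator {0..1} s *\<^sub>R g (x + s *\<^sub>R h))"
proof -
  have [measurable]: "g \<in> borel_measurable borel" using g by auto
  show ?thesis
  proof (rule lborel_pair.Fubini_integrable)
    show "(\<lambda>(s::real, x). indicator {0..1} s *\<^sub>R g (x + s *\<^sub>R h)) \<in> borel_measurable (lborel \<Otimes>\<^sub>M lborel)"
      by measurable
    have "integrable lborel (\<lambda>s::real. indicator {0..1} s *\<^sub>R (LBINT y. norm (g y)))"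
      by simp
    moreover have "(LBINT y. norm (g (y + s *\<^sub>R h))) = (LBINT y. norm (g y))" for s
      by (rule integral_shift[of "\<lambda>y. norm (g y)"]) simp
    ultimately show "integrable lborel (\<lambda>s. LBINT y. norm (case (s, y) of (s::real, x) \<Rightarrow> indicator {0..1} s *\<^sub>R g (x + s *\<^sub>R h)))"
      by simp
    show "AE s in lborel. integrable lborel (\<lambda>y. case (s, y) of (s::real, x) \<Rightarrow> indicator {0..1} s *\<^sub>R g (x + s *\<^sub>R h))"
      using integrable_shift[OF g] by auto
  qed
qed

text \<open>
  The weak derivative of \<open>w\<close> in the direction \<open>h\<close> on the open unit disk. Functions live on the whole plane, so that integrals are
  translation invariant; only test functions supported in the disk are used.
\<close>

definition weak_dir :: "complex \<Rightarrow> (complex \<Rightarrow> 'b::euclidean_space) \<Rightarrow> (complex \<Rightarrow> 'b) \<Rightarrow> bool"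
  where "weak_dir h w wh \<longleftrightarrow> integrable lborel w \<and> integrable lborel wh \<and>
    (\<forall>\<phi>. smooth_supp (ball 0 1) \<phi> \<longrightarrow> (LBINT z. pd UNIV h \<phi> z *\<^sub>R w z) = - (LBINT z. \<phi> z *\<^sub>R wh z))"

text \<open>
  The fundamental theorem of calculus for \<open>s \<mapsto> (\<alpha> + \<beta> s) w(x + s h)\<close>. It holds because it holds for test functions:
  tested against \<open>\<psi>\<close>, a translation moves the shift from \<open>w\<close> to \<open>\<psi>\<close>, the weak derivative moves onto \<open>\<psi>\<close>, and what remains is the
  fundamental theorem for \<open>\<psi>\<close>. The weight with \<open>\<alpha> = 1\<close>, \<open>\<beta> = 0\<close> gives differences of \<open>w\<close>, the weight with \<open>\<alpha> = 1\<close>,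
  \<open>\<beta> = -1\<close> kills the far endpoint and gives a formula for \<open>w(x)\<close>.
\<close>

lemma line_formula:
  fixes w wh :: "complex \<Rightarrow> 'b::euclidean_space" and \<alpha> \<beta> :: real
  assumes wd: "weak_dir h w wh" and O: "open \<Omega>"
    and seg: "\<And>x s. x \<in> \<Omega> \<Longrightarrow> 0 \<le> s \<Longrightarrow> s \<le> 1 \<Longrightarrow> x + s *\<^sub>R h \<in> ball 0 1"
  shows "AE x in lborel. x \<in> \<Omega> \<longrightarrow> (\<alpha> + \<beta>) *\<^sub>R w (x + h) - \<alpha> *\<^sub>R w x =
    (LBINT s. indicator {0..1} s *\<^sub>R (\<beta> *\<^sub>R w (x + s *\<^sub>R h) + (\<alpha> + \<beta> * s) *\<^sub>R wh (x + s *\<^sub>R h)))"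
proof -
  have w: "integrable lborel w" and wh: "integrable lborel wh" using wd by (auto simp: weak_dir_def)
  have [measurable]: "w \<in> borel_measurable borel" "wh \<in> borel_measurable borel" using w wh by auto
  define G :: "real \<Rightarrow> complex \<Rightarrow> 'b" where "G s x = indicator {0..1} s *\<^sub>R (\<beta> *\<^sub>R w (x + s *\<^sub>R h) + (\<alpha> + \<beta> * s) *\<^sub>R wh (x + s *\<^sub>R h))" for s x
  define R where "R x = (LBINT s. G s x)" for x
  have G: "integrable (lborel \<Otimes>\<^sub>M lborel) (\<lambda>(s, x). G s x)"
  proof -
    have 1: "integrable (lborel \<Otimes>\<^sub>M lborel) (\<lambda>p. (indicator {0..1} (fst p) * (\<alpha> + \<beta> * fst p)) *\<^sub>R (case p of (s::real, x) \<Rightarrow> indicator {0..1} s *\<^sub>R wh (x + s *\<^sub>R h)))"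
    proof (rule integrable_bounded_mult[OF integrable_slab[OF wh], where C = "\<bar>\<alpha>\<bar> + \<bar>\<beta>\<bar>"])
      fix p :: "real \<times> complex"
      have "\<bar>\<beta> * fst p\<bar> \<le> \<bar>\<beta>\<bar>" if "0 \<le> fst p" "fst p \<le> 1"
        using that by (simp add: abs_mult mult_left_le)
      then show "\<bar>indicator {0..1} (fst p) * (\<alpha> + \<beta> * fst p)\<bar> \<le> \<bar>\<alpha>\<bar> + \<bar>\<beta>\<bar>"
        by (auto simp: indicator_def)
    qed measurable
    have "integrable (lborel \<Otimes>\<^sub>M lborel) (\<lambda>p. \<beta> *\<^sub>R (case p of (s::real, x) \<Rightarrow> indicator {0..1} s *\<^sub>R w (x + s *\<^sub>R h)) + (indicator {0..1} (fst p) * (\<alpha> + \<beta> * fst p)) *\<^sub>R (case p of (s::real, x) \<Rightarrow> indicator {0..1} s *\<^sub>R wh (x + s *\<^sub>R h)))"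
      by (intro Bochner_Integration.integrable_add 1 integrable_scaleR_right integrable_slab w)
    then show ?thesis
      by (rule Bochner_Integration.integrable_cong[THEN iffD1, rotated -1]) (auto simp: G_def indicator_def)
  qed
  have Ri: "integrable lborel R"
    unfolding R_def using lborel_pair.integrable_snd[OF G] by simp
  define D where "D x = (\<alpha> + \<beta>) *\<^sub>R w (x + h) - \<alpha> *\<^sub>R w x - R x" for x
  have D: "integrable lborel D"
    unfolding D_def by (intro Bochner_Integration.integrable_diff integrable_scaleR_right integrable_shift w Ri)
  have "AE x in lborel. x \<in> \<Omega> \<longrightarrow> D x = 0"
  proof (rule fundamental_lemma[OF D O])
    fix \<psi> :: "complex \<Rightarrow> real" and K assume \<psi>: "\<And>k. Ck_on k UNIV \<psi>" and K: "compact K" "K \<subseteq> \<Omega>" "\<And>z. z \<notin> K \<Longrightarrow> \<psi> z = 0"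
    then have cs: "smooth_supp \<Omega> \<psi>" by (auto simp: smooth_supp_def)
    note [measurable] = smooth_supp_measurable[OF cs]
    have d_cont: "continuous_on UNIV (pd UNIV h \<psi>)" by (rule smooth_supp_pd_dir_continuous[OF cs])
    then have [measurable]: "pd UNIV h \<psi> \<in> borel_measurable borel" by (rule borel_measurable_continuous_onI)
    obtain C where C: "\<And>z. \<bar>\<psi> z\<bar> \<le> C" using smooth_supp_bounded[OF cs] by blast
    obtain C' where C': "\<And>z. \<bar>pd UNIV h \<psi> z\<bar> \<le> C'" using smooth_supp_pd_dir_bounded[OF cs] by blast
    have C0: "0 \<le> C" "0 \<le> C'" using C[of 0] C'[of 0] by linarith+
    \<comment> \<open>\<open>k s y\<close> is the derivative of \<open>s \<mapsto> (\<alpha> + \<beta> s) \<psi>(y - s h)\<close> on \<open>[0, 1]\<close>.\<close>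
    define k :: "real \<Rightarrow> complex \<Rightarrow> real" where "k s y = indicator {0..1} s * (\<beta> * \<psi> (y - s *\<^sub>R h) - (\<alpha> + \<beta> * s) * pd UNIV h \<psi> (y - s *\<^sub>R h))" for s y
    have kb: "\<bar>k s y\<bar> \<le> \<bar>\<beta>\<bar> * C + (\<bar>\<alpha>\<bar> + \<bar>\<beta>\<bar>) * C'" for s y
    proof (cases "0 \<le> s \<and> s \<le> 1")
      case True
      have "\<bar>\<beta> * s\<bar> \<le> \<bar>\<beta>\<bar>" using True by (simp add: abs_mult mult_left_le)
      then have "\<bar>\<alpha> + \<beta> * s\<bar> \<le> \<bar>\<alpha>\<bar> + \<bar>\<beta>\<bar>" by linarith
      then have "\<bar>(\<alpha> + \<beta> * s) * pd UNIV h \<psi> (y - s *\<^sub>R h)\<bar> \<le> (\<bar>\<alpha>\<bar> + \<bar>\<beta>\<bar>) * C'"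
        unfolding abs_mult by (intro mult_mono C') auto
      moreover have "\<bar>\<beta> * \<psi> (y - s *\<^sub>R h)\<bar> \<le> \<bar>\<beta>\<bar> * C" unfolding abs_mult by (intro mult_left_mono C) auto
      ultimately show ?thesis using True by (simp add: k_def)
    next
      case False
      then show ?thesis using C0 by (auto simp: k_def)
    qed
    have inner: "(LBINT x. \<psi> x *\<^sub>R G s x) = (LBINT y. k s y *\<^sub>R w y)" for s
    proof (cases "0 \<le> s \<and> s \<le> 1")
      case True
      define \<rho> where "\<rho> = \<alpha> + \<beta> * s"
      have cs': "smooth_supp (ball 0 1) (\<lambda>y. \<psi> (y - s *\<^sub>R h))"
        by (rule smooth_supp_shift[OF cs]) (use seg True in auto)
      have dif: "\<psi> differentiable_on UNIV" using \<psi>[of "Suc 0"] by simp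
      have ii: "integrable lborel (\<lambda>y. \<psi> (y - s *\<^sub>R h) *\<^sub>R w y)" "integrable lborel (\<lambda>y. \<psi> (y - s *\<^sub>R h) *\<^sub>R wh y)"
        "integrable lborel (\<lambda>y. pd UNIV h \<psi> (y - s *\<^sub>R h) *\<^sub>R w y)"
        by (rule integrable_bounded_mult[OF _ _ C] integrable_bounded_mult[OF _ _ C'], rule w wh, measurable)+
      have "(LBINT x. \<psi> x *\<^sub>R G s x) = (LBINT x. \<psi> ((x + s *\<^sub>R h) - s *\<^sub>R h) *\<^sub>R (\<beta> *\<^sub>R w (x + s *\<^sub>R h) + \<rho> *\<^sub>R wh (x + s *\<^sub>R h)))"
        using True by (simp add: G_def \<rho>_def)
      also have "\<dots> = (LBINT y. \<psi> (y - s *\<^sub>R h) *\<^sub>R (\<beta> *\<^sub>R w y + \<rho> *\<^sub>R wh y))"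
        by (rule integral_shift) measurable
      also have "\<dots> = (LBINT y. \<beta> *\<^sub>R (\<psi> (y - s *\<^sub>R h) *\<^sub>R w y) + \<rho> *\<^sub>R (\<psi> (y - s *\<^sub>R h) *\<^sub>R wh y))"
        by (simp add: scaleR_add_right mult.commute)
      also have "\<dots> = \<beta> *\<^sub>R (LBINT y. \<psi> (y - s *\<^sub>R h) *\<^sub>R w y) + \<rho> *\<^sub>R (LBINT y. \<psi> (y - s *\<^sub>R h) *\<^sub>R wh y)"
        using ii by (simp del: scaleR_scaleR)
      also have "(LBINT y. \<psi> (y - s *\<^sub>R h) *\<^sub>R wh y) = - (LBINT y. pd UNIV h \<psi> (y - s *\<^sub>R h) *\<^sub>R w y)"
      proof -
        have "(LBINT z. pd UNIV h (\<lambda>y. \<psi> (y - s *\<^sub>R h)) z *\<^sub>R w z) = - (LBINT z. \<psi> (z - s *\<^sub>R h) *\<^sub>R wh z)"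
          using wd cs' unfolding weak_dir_def by blast
        then show ?thesis by (simp add: pd_shift[OF dif])
      qed
      also have "\<beta> *\<^sub>R (LBINT y. \<psi> (y - s *\<^sub>R h) *\<^sub>R w y) + \<rho> *\<^sub>R - (LBINT y. pd UNIV h \<psi> (y - s *\<^sub>R h) *\<^sub>R w y)
        = (LBINT y. \<beta> *\<^sub>R (\<psi> (y - s *\<^sub>R h) *\<^sub>R w y) - \<rho> *\<^sub>R (pd UNIV h \<psi> (y - s *\<^sub>R h) *\<^sub>R w y))"
        using ii by (simp del: scaleR_scaleR)
      also have "\<dots> = (LBINT y. k s y *\<^sub>R w y)"
        using True by (simp add: k_def \<rho>_def scaleR_diff_left)
      finally show ?thesis .
    next
      case False
      then show ?thesis by (auto simp: G_def k_def indicator_def)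
    qed
    have FTC: "(LBINT s. k s y) = (\<alpha> + \<beta>) * \<psi> (y - h) - \<alpha> * \<psi> y" for y
    proof -
      have "(LBINT s. indicator {0..1} s *\<^sub>R (\<beta> * \<psi> (y - s *\<^sub>R h) - (\<alpha> + \<beta> * s) * pd UNIV h \<psi> (y - s *\<^sub>R h)))
        = (\<alpha> + \<beta> * 1) * \<psi> (y - 1 *\<^sub>R h) - (\<alpha> + \<beta> * 0) * \<psi> (y - 0 *\<^sub>R h)"
      proof (rule integral_FTC_atLeastAtMost)
        fix s :: real
        have "((\<lambda>s. \<psi> (y - s *\<^sub>R h)) has_derivative (\<lambda>t. pd UNIV (- (t *\<^sub>R h)) \<psi> (y - s *\<^sub>R h))) (at s)"
          by (rule has_derivative_compose[OF _ smooth_supp_deriv[OF cs], of "\<lambda>s. y - s *\<^sub>R h"]) (auto intro!: derivative_eq_intros)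
        moreover have "pd UNIV (- (t *\<^sub>R h)) \<psi> z = - pd UNIV h \<psi> z * t" for t z
          using smooth_supp_pd_eq[OF cs, of h z] smooth_supp_pd_eq[OF cs, of "-(t *\<^sub>R h)" z] by (simp add: algebra_simps)
        ultimately have p2: "((\<lambda>s. \<psi> (y - s *\<^sub>R h)) has_real_derivative (- pd UNIV h \<psi> (y - s *\<^sub>R h))) (at s)"
          by (simp add: has_field_derivative_def fun_eq_iff mult_minus_left[abs_def])
        have p1: "((\<lambda>s. \<alpha> + \<beta> * s) has_real_derivative \<beta>) (at s)"
          by (auto intro!: derivative_eq_intros)
        have "((\<lambda>s. (\<alpha> + \<beta> * s) * \<psi> (y - s *\<^sub>R h)) has_real_derivative
            \<beta> * \<psi> (y - s *\<^sub>R h) - (\<alpha> + \<beta> * s) * pd UNIV h \<psi> (y - s *\<^sub>R h)) (at s)"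
          by (rule DERIV_cong[OF DERIV_mult[OF p1 p2]]) simp
        then show "((\<lambda>s. (\<alpha> + \<beta> * s) * \<psi> (y - s *\<^sub>R h)) has_vector_derivative
            \<beta> * \<psi> (y - s *\<^sub>R h) - (\<alpha> + \<beta> * s) * pd UNIV h \<psi> (y - s *\<^sub>R h)) (at s within {0..1})"
          by (simp add: has_real_derivative_iff_has_vector_derivative[symmetric] has_field_derivative_at_within)
      next
        show "continuous_on {0..1} (\<lambda>s. \<beta> * \<psi> (y - s *\<^sub>R h) - (\<alpha> + \<beta> * s) * pd UNIV h \<psi> (y - s *\<^sub>R h))"
          by (intro continuous_intros continuous_on_compose2[OF d_cont] continuous_on_compose2[OF smooth_supp_continuous[OF cs]]) auto
      qed auto
      then show ?thesis by (simp add: k_def)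
    qed
    have i1: "integrable (lborel \<Otimes>\<^sub>M lborel) (\<lambda>(s, x). \<psi> x *\<^sub>R G s x)"
      using integrable_bounded_mult[OF G, of "\<lambda>p. \<psi> (snd p)" C] C by (simp add: case_prod_unfold)
    have i2: "integrable (lborel \<Otimes>\<^sub>M lborel) (\<lambda>(s, y). k s y *\<^sub>R w y)"
    proof -
      have "integrable (lborel \<Otimes>\<^sub>M lborel) (\<lambda>p. k (fst p) (snd p) *\<^sub>R (case p of (s::real, x) \<Rightarrow> indicator {0..1} s *\<^sub>R w (x + s *\<^sub>R 0)))"
        by (rule integrable_bounded_mult[OF integrable_slab[OF w]]) (unfold k_def[abs_def], measurable, rule kb[unfolded k_def])
      then show ?thesis
        by (rule Bochner_Integration.integrable_cong[THEN iffD1, rotated -1]) (auto simp: k_def indicator_def)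
    qed
    have j: "integrable lborel (\<lambda>x. \<psi> x *\<^sub>R w (x + h))" "integrable lborel (\<lambda>x. \<psi> x *\<^sub>R w x)" "integrable lborel (\<lambda>x. \<psi> x *\<^sub>R R x)"
      "integrable lborel (\<lambda>x. \<psi> (x - h) *\<^sub>R w x)"
      by (rule integrable_bounded_mult[OF _ _ C], rule w Ri integrable_shift, (rule w)?, measurable)+
    have "(LBINT x. \<psi> x *\<^sub>R R x) = (LBINT x. (LBINT s. \<psi> x *\<^sub>R G s x))"
      by (simp add: R_def)
    also have "\<dots> = (LBINT s. (LBINT x. \<psi> x *\<^sub>R G s x))"
      by (rule lborel_pair.Fubini_integral[OF i1])
    also have "\<dots> = (LBINT s. (LBINT y. k s y *\<^sub>R w y))" by (simp add: inner)
    also have "\<dots> = (LBINT y. (LBINT s. k s y *\<^sub>R w y))"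
      by (rule lborel_pair.Fubini_integral[OF i2, symmetric])
    also have "\<dots> = (LBINT y. (LBINT s. k s y) *\<^sub>R w y)"
    proof (rule Bochner_Integration.integral_cong)
      fix y
      show "(LBINT s. k s y *\<^sub>R w y) = (LBINT s. k s y) *\<^sub>R w y"
      proof (rule integral_scaleR_left)
        have "integrable lborel (\<lambda>s. k s y *\<^sub>R indicat_real {0..1} s)"
          by (rule integrable_bounded_mult[OF _ _ kb]) (simp_all add: k_def[abs_def])
        then show "integrable lborel (\<lambda>s. k s y)"
          by (rule Bochner_Integration.integrable_cong[THEN iffD1, rotated -1]) (auto simp: k_def indicator_def)
      qed
    qed simp
    also have "\<dots> = (LBINT y. (\<alpha> + \<beta>) *\<^sub>R (\<psi> (y - h) *\<^sub>R w y) - \<alpha> *\<^sub>R (\<psi> y *\<^sub>R w y))"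
      by (simp add: FTC scaleR_diff_left)
    also have "\<dots> = (\<alpha> + \<beta>) *\<^sub>R (LBINT y. \<psi> (y - h) *\<^sub>R w y) - \<alpha> *\<^sub>R (LBINT y. \<psi> y *\<^sub>R w y)"
      using j by (simp del: scaleR_scaleR)
    also have "(LBINT y. \<psi> (y - h) *\<^sub>R w y) = (LBINT y. \<psi> ((y + h) - h) *\<^sub>R w (y + h))"
      by (rule integral_shift[symmetric, of "\<lambda>y. \<psi> (y - h) *\<^sub>R w y"]) measurable
    finally have "(LBINT x. \<psi> x *\<^sub>R R x) = (\<alpha> + \<beta>) *\<^sub>R (LBINT y. \<psi> y *\<^sub>R w (y + h)) - \<alpha> *\<^sub>R (LBINT y. \<psi> y *\<^sub>R w y)"
      by simp
    moreover have "(LBINT x. \<psi> x *\<^sub>R D x) = (LBINT x. (\<alpha> + \<beta>) *\<^sub>R (\<psi> x *\<^sub>R w (x + h)) - \<alpha> *\<^sub>R (\<psi> x *\<^sub>R w x) - \<psi> x *\<^sub>R R x)"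
      by (simp add: D_def scaleR_diff_right mult.commute)
    moreover have "\<dots> = (\<alpha> + \<beta>) *\<^sub>R (LBINT y. \<psi> y *\<^sub>R w (y + h)) - \<alpha> *\<^sub>R (LBINT y. \<psi> y *\<^sub>R w y) - (LBINT x. \<psi> x *\<^sub>R R x)"
      using j by (simp del: scaleR_scaleR)
    ultimately show "(LBINT x. \<psi> x *\<^sub>R D x) = 0" by simp
  qed
  then show ?thesis by eventually_elim (simp add: D_def R_def G_def)
qed

section \<open>Averages over parallelograms\<close>

text \<open>
  Identifies the plane with pairs of reals, so that Tonelli applies to integrals over the plane.
\<close>

lemma lborel_complex_distr: "distr (lborel \<Otimes>\<^sub>M lborel) borel (\<lambda>(x, y). Complex x y) = lborel"
proof (rule lborel_eqI[symmetric])
  have [measurable]: "(\<lambda>(x, y). Complex x y) \<in> borel_measurable (lborel \<Otimes>\<^sub>M lborel)"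
    unfolding split_beta Complex_eq by measurable
  fix l u :: complex assume lu: "\<And>b. b \<in> Basis \<Longrightarrow> l \<bullet> b \<le> u \<bullet> b"
  have lu: "Re l \<le> Re u" "Im l \<le> Im u" using lu[of 1] lu[of \<i>] by (auto simp: Basis_complex_def inner_complex_def)
  have "(\<lambda>(x, y). Complex x y) -` box l u \<inter> space (lborel \<Otimes>\<^sub>M lborel) = {Re l<..<Re u} \<times> {Im l<..<Im u}"
    by (auto simp: in_box_complex_iff space_pair_measure)
  then have "emeasure (distr (lborel \<Otimes>\<^sub>M lborel) borel (\<lambda>(x, y). Complex x y)) (box l u) = emeasure (lborel \<Otimes>\<^sub>M lborel) ({Re l<..<Re u} \<times> {Im l<..<Im u})"
    by (simp add: emeasure_distr)
  also have "\<dots> = ennreal (Re u - Re l) * ennreal (Im u - Im l)"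
    using lu by (simp add: lborel.emeasure_pair_measure_Times)
  also have "\<dots> = ennreal (\<Prod>b\<in>Basis. (u - l) \<bullet> b)"
    using lu by (simp add: Basis_complex_def inner_complex_def ennreal_mult)
  finally show "emeasure (distr (lborel \<Otimes>\<^sub>M lborel) borel (\<lambda>(x, y). Complex x y)) (box l u) = ennreal (\<Prod>b\<in>Basis. (u - l) \<bullet> b)" .
qed simp

lemma measurable_Complex [measurable (raw)]:
  assumes "f \<in> borel_measurable M" "g \<in> borel_measurable M"
  shows "(\<lambda>x. Complex (f x) (g x)) \<in> borel_measurable M"
  unfolding Complex_eq using assms by measurable

lemma nn_integral_complex:
  fixes f :: "complex \<Rightarrow> ennreal"
  assumes [measurable]: "f \<in> borel_measurable borel"
  shows "(\<integral>\<^sup>+x. \<integral>\<^sup>+y. f (Complex x y) \<partial>lborel \<partial>lborel) = (\<integral>\<^sup>+z. f z \<partial>lborel)"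
proof -
  have "(\<integral>\<^sup>+z. f z \<partial>lborel) = (\<integral>\<^sup>+z. f z \<partial>distr (lborel \<Otimes>\<^sub>M lborel) borel (\<lambda>(x, y). Complex x y))"
    by (simp add: lborel_complex_distr)
  also have "\<dots> = (\<integral>\<^sup>+p. f (case p of (x, y) \<Rightarrow> Complex x y) \<partial>(lborel \<Otimes>\<^sub>M lborel))"
    by (intro nn_integral_distr) measurable
  also have "\<dots> = (\<integral>\<^sup>+x. \<integral>\<^sup>+y. f (Complex x y) \<partial>lborel \<partial>lborel)"
    by (subst lborel.nn_integral_fst[symmetric]) auto
  finally show ?thesis ..
qed

definition frame_det :: "complex \<Rightarrow> complex \<Rightarrow> real"
  where "frame_det h k = Re h * Im k - Im h * Re k"

text \<open>
  With \<open>Re h \<noteq> 0\<close> the linear map \<open>(s, t) \<mapsto> s h + t k\<close> is a composition of a one-dimensional affine substitution in \<open>s\<close>, for fixed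
  \<open>t\<close>, and one in \<open>t\<close>, for fixed real part.
\<close>

lemma nn_integral_linear_aux:
  fixes f :: "complex \<Rightarrow> ennreal"
  assumes [measurable]: "f \<in> borel_measurable borel" and d: "frame_det h k \<noteq> 0" and a: "Re h \<noteq> 0"
  shows "ennreal \<bar>frame_det h k\<bar> * (\<integral>\<^sup>+s. \<integral>\<^sup>+t. f (s *\<^sub>R h + t *\<^sub>R k) \<partial>lborel \<partial>lborel) = (\<integral>\<^sup>+z. f z \<partial>lborel)"
proof -
  define e where "e = frame_det h k / Re h"
  have e: "e \<noteq> 0" using d a by (simp add: e_def)
  have "(\<integral>\<^sup>+s. \<integral>\<^sup>+t. f (s *\<^sub>R h + t *\<^sub>R k) \<partial>lborel \<partial>lborel) = (\<integral>\<^sup>+t. \<integral>\<^sup>+s. f (s *\<^sub>R h + t *\<^sub>R k) \<partial>lborel \<partial>lborel)"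
    by (rule lborel_pair.Fubini') measurable
  also have "\<dots> = (\<integral>\<^sup>+t. ennreal \<bar>1 / Re h\<bar> * (\<integral>\<^sup>+x. f (Complex x (x * Im h / Re h + e * t)) \<partial>lborel) \<partial>lborel)"
  proof (intro nn_integral_cong)
    fix t
    have "(\<integral>\<^sup>+s. f (s *\<^sub>R h + t *\<^sub>R k) \<partial>lborel) = \<bar>1 / Re h\<bar> * (\<integral>\<^sup>+x. f ((- t * Re k / Re h + (1 / Re h) * x) *\<^sub>R h + t *\<^sub>R k) \<partial>lborel)"
      using a by (intro nn_integral_real_affine) auto
    also have "(\<lambda>x. (- t * Re k / Re h + (1 / Re h) * x) *\<^sub>R h + t *\<^sub>R k) = (\<lambda>x. Complex x (x * Im h / Re h + e * t))"
      using a by (auto simp: complex_eq_iff e_def frame_det_def field_simps)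
    finally show "(\<integral>\<^sup>+s. f (s *\<^sub>R h + t *\<^sub>R k) \<partial>lborel) = ennreal \<bar>1 / Re h\<bar> * (\<integral>\<^sup>+x. f (Complex x (x * Im h / Re h + e * t)) \<partial>lborel)"
      by (simp add: fun_eq_iff)
  qed
  also have "\<dots> = ennreal \<bar>1 / Re h\<bar> * (\<integral>\<^sup>+t. \<integral>\<^sup>+x. f (Complex x (x * Im h / Re h + e * t)) \<partial>lborel \<partial>lborel)"
    by (intro nn_integral_cmult) measurable
  also have "(\<integral>\<^sup>+t. \<integral>\<^sup>+x. f (Complex x (x * Im h / Re h + e * t)) \<partial>lborel \<partial>lborel) = (\<integral>\<^sup>+x. \<integral>\<^sup>+t. f (Complex x (x * Im h / Re h + e * t)) \<partial>lborel \<partial>lborel)"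
    by (rule lborel_pair.Fubini') measurable
  finally have "(\<integral>\<^sup>+s. \<integral>\<^sup>+t. f (s *\<^sub>R h + t *\<^sub>R k) \<partial>lborel \<partial>lborel) =
     ennreal \<bar>1 / Re h\<bar> * (\<integral>\<^sup>+x. \<integral>\<^sup>+t. f (Complex x (x * Im h / Re h + e * t)) \<partial>lborel \<partial>lborel)" .
  moreover have "(\<integral>\<^sup>+z. f z \<partial>lborel) = ennreal \<bar>e\<bar> * (\<integral>\<^sup>+x. \<integral>\<^sup>+t. f (Complex x (x * Im h / Re h + e * t)) \<partial>lborel \<partial>lborel)"
  proof -
    have "(\<integral>\<^sup>+z. f z \<partial>lborel) = (\<integral>\<^sup>+x. \<integral>\<^sup>+y. f (Complex x y) \<partial>lborel \<partial>lborel)" by (simp add: nn_integral_complex)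
    also have "\<dots> = (\<integral>\<^sup>+x. ennreal \<bar>e\<bar> * (\<integral>\<^sup>+t. f (Complex x (x * Im h / Re h + e * t)) \<partial>lborel) \<partial>lborel)"
      by (intro nn_integral_cong nn_integral_real_affine e) measurable
    also have "\<dots> = ennreal \<bar>e\<bar> * (\<integral>\<^sup>+x. \<integral>\<^sup>+t. f (Complex x (x * Im h / Re h + e * t)) \<partial>lborel \<partial>lborel)"
      by (intro nn_integral_cmult) measurable
    finally show ?thesis .
  qed
  moreover have "ennreal \<bar>frame_det h k\<bar> * ennreal \<bar>1 / Re h\<bar> = ennreal \<bar>e\<bar>"
    by (simp add: ennreal_mult[symmetric] e_def abs_mult[symmetric])
  ultimately show ?thesis by (simp add: mult.assoc[symmetric])
qed

lemma nn_integral_linear: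
  fixes f :: "complex \<Rightarrow> ennreal"
  assumes [measurable]: "f \<in> borel_measurable borel" and d: "frame_det h k \<noteq> 0"
  shows "ennreal \<bar>frame_det h k\<bar> * (\<integral>\<^sup>+s. \<integral>\<^sup>+t. f (s *\<^sub>R h + t *\<^sub>R k) \<partial>lborel \<partial>lborel) = (\<integral>\<^sup>+z. f z \<partial>lborel)"
proof (cases "Re h = 0")
  case False
  then show ?thesis using nn_integral_linear_aux assms by blast
next
  case True
  then have k: "Re k \<noteq> 0" and d': "frame_det k h \<noteq> 0" using d by (auto simp: frame_det_def)
  have "(\<integral>\<^sup>+s. \<integral>\<^sup>+t. f (s *\<^sub>R h + t *\<^sub>R k) \<partial>lborel \<partial>lborel) = (\<integral>\<^sup>+t. \<integral>\<^sup>+s. f (s *\<^sub>R h + t *\<^sub>R k) \<partial>lborel \<partial>lborel)"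
    by (rule lborel_pair.Fubini') measurable
  also have "\<dots> = (\<integral>\<^sup>+t. \<integral>\<^sup>+s. f (t *\<^sub>R k + s *\<^sub>R h) \<partial>lborel \<partial>lborel)" by (simp add: add.commute)
  finally show ?thesis using nn_integral_linear_aux[OF assms(1) d' k]
    by (simp add: frame_det_def abs_minus_commute mult.commute)
qed

lemma distr_linear:
  assumes d: "frame_det h k \<noteq> 0"
  shows "density (distr (lborel \<Otimes>\<^sub>M lborel) borel (\<lambda>p. fst p *\<^sub>R h + snd p *\<^sub>R k)) (\<lambda>_. ennreal \<bar>frame_det h k\<bar>) = lborel"
proof (rule measure_eqI)
  have [measurable]: "(\<lambda>p. fst p *\<^sub>R h + snd p *\<^sub>R k) \<in> borel_measurable (lborel \<Otimes>\<^sub>M lborel)" by measurable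
  fix A assume "A \<in> sets (density (distr (lborel \<Otimes>\<^sub>M lborel) borel (\<lambda>p. fst p *\<^sub>R h + snd p *\<^sub>R k)) (\<lambda>_. ennreal \<bar>frame_det h k\<bar>))"
  then have [measurable]: "A \<in> sets borel" by simp
  have "emeasure (density (distr (lborel \<Otimes>\<^sub>M lborel) borel (\<lambda>p. fst p *\<^sub>R h + snd p *\<^sub>R k)) (\<lambda>_. ennreal \<bar>frame_det h k\<bar>)) A
     = ennreal \<bar>frame_det h k\<bar> * (\<integral>\<^sup>+p. indicator A (fst p *\<^sub>R h + snd p *\<^sub>R k) \<partial>(lborel \<Otimes>\<^sub>M lborel))"
    by (subst emeasure_density) (auto simp: nn_integral_cmult nn_integral_distr simp del: nn_integral_indicator)
  also have "(\<integral>\<^sup>+p. indicator A (fst p *\<^sub>R h + snd p *\<^sub>R k) \<partial>(lborel \<Otimes>\<^sub>M lborel)) = (\<integral>\<^sup>+s. \<integral>\<^sup>+t. indicator A (s *\<^sub>R h + t *\<^sub>R k) \<partial>lborel \<partial>lborel)"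
    by (subst lborel.nn_integral_fst[symmetric]) auto
  also have "ennreal \<bar>frame_det h k\<bar> * \<dots> = emeasure lborel A"
    using nn_integral_linear[OF _ d, of "indicator A"] by simp
  finally show "emeasure (density (distr (lborel \<Otimes>\<^sub>M lborel) borel (\<lambda>p. fst p *\<^sub>R h + snd p *\<^sub>R k)) (\<lambda>_. ennreal \<bar>frame_det h k\<bar>)) A = emeasure lborel A" .
qed simp

lemma integral_linear:
  fixes F :: "complex \<Rightarrow> 'b::euclidean_space"
  assumes d: "frame_det h k \<noteq> 0" and F: "integrable lborel F"
  shows "integrable (lborel \<Otimes>\<^sub>M lborel) (\<lambda>p. F (fst p *\<^sub>R h + snd p *\<^sub>R k))"
    "(LINT p|(lborel \<Otimes>\<^sub>M lborel). F (fst p *\<^sub>R h + snd p *\<^sub>R k)) = (1 / \<bar>frame_det h k\<bar>) *\<^sub>R (LBINT z. F z)"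
proof -
  have [measurable]: "F \<in> borel_measurable borel" using F by auto
  have m: "(\<lambda>p. fst p *\<^sub>R h + snd p *\<^sub>R k) \<in> measurable (lborel \<Otimes>\<^sub>M lborel) borel" by measurable
  let ?M = "distr (lborel \<Otimes>\<^sub>M lborel) borel (\<lambda>p. fst p *\<^sub>R h + snd p *\<^sub>R k)"
  have "integrable (density ?M (\<lambda>_. ennreal \<bar>frame_det h k\<bar>)) F" unfolding distr_linear[OF d] by (rule F)
  then have "integrable ?M (\<lambda>z. \<bar>frame_det h k\<bar> *\<^sub>R F z)" by (subst (asm) integrable_density) auto
  then have "integrable ?M (\<lambda>z. (1 / \<bar>frame_det h k\<bar>) *\<^sub>R \<bar>frame_det h k\<bar> *\<^sub>R F z)" by (rule integrable_scaleR_right)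
  then have "integrable ?M F" using d by simp
  then show "integrable (lborel \<Otimes>\<^sub>M lborel) (\<lambda>p. F (fst p *\<^sub>R h + snd p *\<^sub>R k))"
    by (subst (asm) integrable_distr_eq[OF m]) auto
  have "(LBINT z. F z) = (LINT z|density ?M (\<lambda>_. ennreal \<bar>frame_det h k\<bar>). F z)" unfolding distr_linear[OF d] ..
  also have "\<dots> = (LINT z|?M. \<bar>frame_det h k\<bar> *\<^sub>R F z)" by (intro integral_density) auto
  also have "\<dots> = \<bar>frame_det h k\<bar> *\<^sub>R (LINT z|?M. F z)" by simp
  also have "(LINT z|?M. F z) = (LINT p|(lborel \<Otimes>\<^sub>M lborel). F (fst p *\<^sub>R h + snd p *\<^sub>R k))"
    by (intro integral_distr m) auto
  finally show "(LINT p|(lborel \<Otimes>\<^sub>M lborel). F (fst p *\<^sub>R h + snd p *\<^sub>R k)) = (1 / \<bar>frame_det h k\<bar>) *\<^sub>R (LBINT z. F z)"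
    using d by simp
qed

text \<open>
  Cramer's rule: the coefficient of \<open>h\<close> in the basis \<open>h\<close>, \<open>k\<close>.
\<close>

definition frame_coord1 :: "complex \<Rightarrow> complex \<Rightarrow> complex \<Rightarrow> real"
  where "frame_coord1 h k q = (Re q * Im k - Im q * Re k) / frame_det h k"

definition frame_coord2 :: "complex \<Rightarrow> complex \<Rightarrow> complex \<Rightarrow> real"
  where "frame_coord2 h k q = (Re h * Im q - Im h * Re q) / frame_det h k"

lemma frame_coord: "frame_det h k \<noteq> 0 \<Longrightarrow> frame_coord1 h k (s *\<^sub>R h + t *\<^sub>R k) = s" "frame_det h k \<noteq> 0 \<Longrightarrow> frame_coord2 h k (s *\<^sub>R h + t *\<^sub>R k) = t"
  by (simp_all add: frame_coord1_def frame_coord2_def frame_det_def divide_simps) (simp_all add: algebra_simps)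

text \<open>
  Average over the parallelogram with corner \<open>x\<close> and sides \<open>h\<close>, \<open>k\<close>, with weight \<open>\<kappa>\<close> in the coordinates of the
  parallelogram.
\<close>

definition cell_integral :: "complex \<Rightarrow> complex \<Rightarrow> (real \<times> real \<Rightarrow> real) \<Rightarrow> (complex \<Rightarrow> 'b::euclidean_space) \<Rightarrow> complex \<Rightarrow> 'b"
  where "cell_integral h k \<kappa> g x = (LINT p|(lborel \<Otimes>\<^sub>M lborel).
     (indicator ({0..1} \<times> {0..1}) p * \<kappa> p) *\<^sub>R g (x + fst p *\<^sub>R h + snd p *\<^sub>R k))"

lemma AE_frame_coord:
  assumes "frame_det h k \<noteq> 0"
  shows "AE y in lborel. frame_coord1 h k (y - x) \<noteq> c" "AE y in lborel. frame_coord2 h k (y - x) \<noteq> c"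
proof -
  have e: "Complex a b \<noteq> 0 \<Longrightarrow> AE y in lborel. y \<bullet> Complex a b \<noteq> r" for a b r
    using negligible_hyperplane[of "Complex a b" r]
    by (intro AE_not_in[of "{y. y \<bullet> Complex a b = r}", simplified]) (auto simp: negligible_iff_null_sets null_sets_completion_iff inner_commute)
  have 1: "frame_coord1 h k (y - x) = c \<longleftrightarrow> y \<bullet> Complex (Im k) (- Re k) = c * frame_det h k + (Re x * Im k - Im x * Re k)" for y
    using assms by (auto simp: frame_coord1_def inner_complex_def field_simps)
  have 2: "frame_coord2 h k (y - x) = c \<longleftrightarrow> y \<bullet> Complex (- Im h) (Re h) = c * frame_det h k + (Re h * Im x - Im h * Re x)" for y
    using assms by (auto simp: frame_coord2_def inner_complex_def field_simps)
  show "AE y in lborel. frame_coord1 h k (y - x) \<noteq> c" unfolding 1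
    by (rule e) (use assms in \<open>auto simp: frame_det_def complex_eq_iff\<close>)
  show "AE y in lborel. frame_coord2 h k (y - x) \<noteq> c" unfolding 2
    by (rule e) (use assms in \<open>auto simp: frame_det_def complex_eq_iff\<close>)
qed

text \<open>
  In the coordinates of the plane the average is the integral of \<open>K(y - x) g(y)\<close> for a bounded kernel \<open>K\<close> that is continuous off four lines.
  So it depends continuously on \<open>x\<close>, by dominated convergence, although \<open>g\<close> is only integrable.
\<close>

lemma cell_integral_properties:
  fixes g :: "complex \<Rightarrow> 'b::euclidean_space"
  assumes d: "frame_det h k \<noteq> 0" and g: "integrable lborel g"
    and \<kappa>: "continuous_on UNIV \<kappa>" "\<And>p. p \<in> {0..1} \<times> {0..1} \<Longrightarrow> \<bar>\<kappa> p\<bar> \<le> 1"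
  shows "integrable (lborel \<Otimes>\<^sub>M lborel) (\<lambda>p. (indicator ({0..1} \<times> {0..1}) p * \<kappa> p) *\<^sub>R g (x + fst p *\<^sub>R h + snd p *\<^sub>R k))"
    and "continuous_on UNIV (cell_integral h k \<kappa> g)"
    and "norm (cell_integral h k \<kappa> g x) \<le> (1 / \<bar>frame_det h k\<bar>) * (LBINT z. norm (g z))"
proof -
  \<comment> \<open>The weight as a function on the plane, zero off the parallelogram spanned at 0.\<close>
  define K where "K q = indicator ({0..1} \<times> {0..1}) (frame_coord1 h k q, frame_coord2 h k q) * \<kappa> (frame_coord1 h k q, frame_coord2 h k q)" for q
  have [measurable]: "\<kappa> \<in> borel_measurable borel" by (rule borel_measurable_continuous_onI[OF \<kappa>(1)])
  have [measurable]: "frame_coord1 h k \<in> borel_measurable borel" "frame_coord2 h k \<in> borel_measurable borel"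
    unfolding frame_coord1_def[abs_def] frame_coord2_def[abs_def] by measurable
  have [measurable]: "{0..1::real} \<times> {0..1::real} \<in> sets borel" by (simp add: borel_Times)
  have [measurable]: "K \<in> borel_measurable borel" unfolding K_def[abs_def] by measurable
  have [measurable]: "g \<in> borel_measurable borel" using g by auto
  have K1: "\<bar>K q\<bar> \<le> 1" for q using \<kappa>(2)[of "(frame_coord1 h k q, frame_coord2 h k q)"] by (auto simp: K_def indicator_def)
  have KT: "K (fst p *\<^sub>R h + snd p *\<^sub>R k) = indicator ({0..1} \<times> {0..1}) p * \<kappa> p" for p
    by (simp add: K_def frame_coord[OF d])
  have i: "integrable lborel (\<lambda>q. K q *\<^sub>R g (x + q))" for x
    by (rule integrable_bounded_mult[OF _ _ K1]) (use integrable_shift[OF g, of x] in \<open>auto simp: add.commute\<close>)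
  have "integrable (lborel \<Otimes>\<^sub>M lborel) (\<lambda>p. (indicator ({0..1} \<times> {0..1}) p * \<kappa> p) *\<^sub>R g (x + (fst p *\<^sub>R h + snd p *\<^sub>R k)))" for x
    using integral_linear(1)[OF d i[of x]] by (simp add: KT)
  then show "integrable (lborel \<Otimes>\<^sub>M lborel) (\<lambda>p. (indicator ({0..1} \<times> {0..1}) p * \<kappa> p) *\<^sub>R g (x + fst p *\<^sub>R h + snd p *\<^sub>R k))"
    by (simp add: add.assoc)
  have eq: "cell_integral h k \<kappa> g x = (1 / \<bar>frame_det h k\<bar>) *\<^sub>R (LBINT y. K (y - x) *\<^sub>R g y)" for x
  proof -
    have "cell_integral h k \<kappa> g x = (1 / \<bar>frame_det h k\<bar>) *\<^sub>R (LBINT q. K q *\<^sub>R g (x + q))"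
      using integral_linear(2)[OF d i[of x]] by (simp add: cell_integral_def KT add.assoc)
    also have "(LBINT q. K q *\<^sub>R g (x + q)) = (LBINT q. K ((q + x) - x) *\<^sub>R g (q + x))" by (simp add: add.commute)
    also have "\<dots> = (LBINT y. K (y - x) *\<^sub>R g y)"
      by (rule integral_shift[of "\<lambda>y. K (y - x) *\<^sub>R g y"]) measurable
    finally show ?thesis .
  qed
  show "norm (cell_integral h k \<kappa> g x) \<le> (1 / \<bar>frame_det h k\<bar>) * (LBINT z. norm (g z))"
  proof -
    have "norm (LBINT y. K (y - x) *\<^sub>R g y) \<le> (LBINT y. norm (K (y - x) *\<^sub>R g y))" by (rule integral_norm_bound)
    also have "\<dots> \<le> (LBINT z. norm (g z))"
    proof (rule integral_mono)
      have "integrable lborel (\<lambda>y. K (y - x) *\<^sub>R g y)"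
        by (rule integrable_bounded_mult[OF g _ K1]) measurable
      then show "integrable lborel (\<lambda>y. norm (K (y - x) *\<^sub>R g y))" by (rule integrable_norm)
      show "norm (K (y - x) *\<^sub>R g y) \<le> norm (g y)" for y using K1[of "y - x"] by (simp add: mult_left_le_one_le)
    qed (use g in simp)
    finally show ?thesis unfolding eq by (simp add: divide_right_mono)
  qed
  have cc: "isCont (frame_coord1 h k) q" "isCont (frame_coord2 h k) q" for q
    using d unfolding frame_coord1_def[abs_def] frame_coord2_def[abs_def] by (auto intro!: continuous_intros)
  show "continuous_on UNIV (cell_integral h k \<kappa> g)"
    unfolding continuous_on_sequentially
  proof (intro allI ballI impI)
    fix X :: "nat \<Rightarrow> complex" and x assume "(\<forall>n. X n \<in> UNIV) \<and> X \<longlonglongrightarrow> x"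
    then have X: "X \<longlonglongrightarrow> x" by blast
    have "(\<lambda>n. LBINT y. K (y - X n) *\<^sub>R g y) \<longlonglongrightarrow> (LBINT y. K (y - x) *\<^sub>R g y)"
    proof (rule integral_dominated_convergence[where w = "\<lambda>y. norm (g y)"])
      show "AE y in lborel. norm (K (y - X n) *\<^sub>R g y) \<le> norm (g y)" for n
        using K1 by (simp add: mult_left_le_one_le)
      have "AE y in lborel. frame_coord1 h k (y - x) \<noteq> 0 \<and> frame_coord1 h k (y - x) \<noteq> 1 \<and> frame_coord2 h k (y - x) \<noteq> 0 \<and> frame_coord2 h k (y - x) \<noteq> 1"
        using AE_frame_coord[OF d, of x 0] AE_frame_coord[OF d, of x 1] by eventually_elim blast
      then show "AE y in lborel. (\<lambda>n. K (y - X n) *\<^sub>R g y) \<longlonglongrightarrow> K (y - x) *\<^sub>R g y"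
      proof eventually_elim
        case (elim y)
        have L: "(\<lambda>n. frame_coord1 h k (y - X n)) \<longlonglongrightarrow> frame_coord1 h k (y - x)" "(\<lambda>n. frame_coord2 h k (y - X n)) \<longlonglongrightarrow> frame_coord2 h k (y - x)"
          by (intro isCont_tendsto_compose[OF cc(1)] isCont_tendsto_compose[OF cc(2)] tendsto_intros X)+
        have ind: "(\<lambda>n. indicat_real {0..1} (a n)) \<longlonglongrightarrow> indicat_real {0..1} b" if "a \<longlonglongrightarrow> b" "b \<noteq> 0" "b \<noteq> 1" for a and b :: real
        proof -
          have "isCont (indicat_real {0..1}) b" using that by (simp add: isCont_indicator frontier_def)
          from isCont_tendsto_compose[OF this that(1)] show ?thesis .
        qed
        have "(\<lambda>n. indicat_real {0..1} (frame_coord1 h k (y - X n)) * indicat_real {0..1} (frame_coord2 h k (y - X n)) * \<kappa> (frame_coord1 h k (y - X n), frame_coord2 h k (y - X n))) \<longlonglongrightarrow>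
           indicat_real {0..1} (frame_coord1 h k (y - x)) * indicat_real {0..1} (frame_coord2 h k (y - x)) * \<kappa> (frame_coord1 h k (y - x), frame_coord2 h k (y - x))"
          using elim by (intro tendsto_mult ind L continuous_on_tendsto_compose[OF \<kappa>(1)] tendsto_Pair) auto
        then have "(\<lambda>n. K (y - X n)) \<longlonglongrightarrow> K (y - x)" by (simp add: K_def indicator_times)
        then show ?case by (intro tendsto_scaleR tendsto_const)
      qed
    qed (use g in auto)
    then show "(cell_integral h k \<kappa> g \<circ> X) \<longlonglongrightarrow> cell_integral h k \<kappa> g x"
      unfolding o_def eq by (intro tendsto_scaleR tendsto_const)
  qed
qed


text \<open>
  A null set is met in a null set by almost all parallels to a given line. This is what allows a formula that holds
  almost everywhere to be inserted under an integral along a segment.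
\<close>

lemma AE_lines:
  fixes h :: complex
  assumes "AE y in lborel. Q y"
  shows "AE x in lborel. AE s in lborel. Q (x + (s::real) *\<^sub>R h)"
proof -
  obtain N where N: "{y. \<not> Q y} \<subseteq> N" "N \<in> null_sets lborel"
    using assms by (auto simp: eventually_ae_filter)
  then have [measurable]: "N \<in> sets borel" by auto
  have "AE x in lborel. x + s *\<^sub>R h \<notin> N" for s :: real
  proof -
    have "AE y in lborel. y \<notin> N" using N by (intro AE_not_in)
    then have "AE y in distr lborel borel ((+) (s *\<^sub>R h)). y \<notin> N" unfolding lborel_distr_plus .
    then have "AE x in lborel. s *\<^sub>R h + x \<notin> N" by (subst (asm) AE_distr_iff) auto
    then show ?thesis by (simp add: add.commute)
  qed
  then have "AE s in lborel. AE x in lborel. x + (s::real) *\<^sub>R h \<notin> N" by simp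
  then have "AE x in lborel. AE s in lborel. x + (s::real) *\<^sub>R h \<notin> N"
  proof (subst (asm) lborel_pair.AE_commute)
    have "(\<lambda>p::real \<times> complex. snd p + fst p *\<^sub>R h) \<in> borel_measurable (lborel \<Otimes>\<^sub>M lborel)" by measurable
    from measurable_sets[OF this, of "- N"]
    show "{p \<in> space (lborel \<Otimes>\<^sub>M lborel). snd p + (fst p::real) *\<^sub>R h \<notin> N} \<in> sets (lborel \<Otimes>\<^sub>M lborel)"
      by (simp add: vimage_def Int_def conj_commute)
  qed
  then show ?thesis by (rule AE_mp) (use N in \<open>auto elim!: eventually_mono\<close>)
qed

lemma ball_convex_segment:
  fixes x h :: complex
  assumes "x \<in> ball 0 1" "x + h \<in> ball 0 1" "0 \<le> s" "s \<le> 1"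
  shows "x + s *\<^sub>R h \<in> ball 0 1"
proof -
  have "(1 - s) *\<^sub>R x + s *\<^sub>R (x + h) \<in> ball 0 1"
    using assms by (intro convexD[OF convex_ball]) auto
  then show ?thesis by (simp add: algebra_simps)
qed

text \<open>
  The line formula with weight \<open>1 - s\<close> along \<open>h\<close>, into which the line formulas with weight \<open>1 - t\<close> along \<open>k\<close> for \<open>w\<close> and for
  its derivative are inserted. Only the mixed second derivative occurs.
\<close>

lemma two_step_formula:
  fixes w wh wk whk :: "complex \<Rightarrow> 'b::euclidean_space"
  assumes wd: "weak_dir h w wh" "weak_dir k w wk" "weak_dir k wh whk" and d: "frame_det h k \<noteq> 0" and O: "open \<Omega>"
    and par: "\<And>x. x \<in> \<Omega> \<Longrightarrow> x \<in> ball 0 1 \<and> x + h \<in> ball 0 1 \<and> x + k \<in> ball 0 1 \<and> x + h + k \<in> ball 0 1"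
  shows "AE x in lborel. x \<in> \<Omega> \<longrightarrow> w x =
    cell_integral h k (\<lambda>_. 1) w x - cell_integral h k (\<lambda>p. 1 - snd p) wk x -
    (cell_integral h k (\<lambda>p. 1 - fst p) wh x - cell_integral h k (\<lambda>p. (1 - fst p) * (1 - snd p)) whk x)"
proof -
  have int: "integrable lborel w" "integrable lborel wh" "integrable lborel wk" "integrable lborel whk"
    using wd by (auto simp: weak_dir_def)
  then have [measurable]: "w \<in> borel_measurable borel" "wh \<in> borel_measurable borel" "wk \<in> borel_measurable borel" "whk \<in> borel_measurable borel"
    by auto
  \<comment> \<open>Segments along \<open>h\<close> that start in \<open>\<Omega>\<close> stay in this set, and segments along \<open>k\<close> that start in this set stay in the disk.\<close>
  define \<Omega>' where "\<Omega>' = ball 0 1 \<inter> {y. y + k \<in> ball 0 1}"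
  have "open {y. y + k \<in> ball 0 1}"
    by (simp, intro open_Collect_less continuous_intros)
  then have O': "open \<Omega>'" by (auto simp: \<Omega>'_def)
  have A1: "AE x in lborel. x \<in> \<Omega> \<longrightarrow> (1 + - 1) *\<^sub>R w (x + h) - 1 *\<^sub>R w x =
    (LBINT s. indicator {0..1} s *\<^sub>R (- 1 *\<^sub>R w (x + s *\<^sub>R h) + (1 + - 1 * s) *\<^sub>R wh (x + s *\<^sub>R h)))"
    using par ball_convex_segment by (intro line_formula[OF wd(1) O]) blast
  have seg': "y + s *\<^sub>R k \<in> ball 0 1" if "y \<in> \<Omega>'" "0 \<le> s" "s \<le> 1" for y s
    using that by (intro ball_convex_segment) (auto simp: \<Omega>'_def)
  have A2: "AE x in lborel. x \<in> \<Omega>' \<longrightarrow> (1 + - 1) *\<^sub>R w (x + k) - 1 *\<^sub>R w x =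
    (LBINT s. indicator {0..1} s *\<^sub>R (- 1 *\<^sub>R w (x + s *\<^sub>R k) + (1 + - 1 * s) *\<^sub>R wk (x + s *\<^sub>R k)))"
    using seg' by (intro line_formula[OF wd(2) O'])
  have A3: "AE x in lborel. x \<in> \<Omega>' \<longrightarrow> (1 + - 1) *\<^sub>R wh (x + k) - 1 *\<^sub>R wh x =
    (LBINT s. indicator {0..1} s *\<^sub>R (- 1 *\<^sub>R wh (x + s *\<^sub>R k) + (1 + - 1 * s) *\<^sub>R whk (x + s *\<^sub>R k)))"
    using seg' by (intro line_formula[OF wd(3) O'])
  have seg: "x + s *\<^sub>R h \<in> \<Omega>'" if "x \<in> \<Omega>" "0 \<le> s" "s \<le> 1" for x s
  proof -
    have "x + s *\<^sub>R h \<in> ball 0 1" "(x + k) + s *\<^sub>R h \<in> ball 0 1"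
      using par[OF that(1)] that ball_convex_segment[of x h s] ball_convex_segment[of "x + k" h s]
      by (simp_all add: add_ac del: mem_ball)
    then show ?thesis by (simp add: \<Omega>'_def add_ac)
  qed
  define c :: "(real \<times> real \<Rightarrow> real) \<Rightarrow> (complex \<Rightarrow> 'b) \<Rightarrow> complex \<Rightarrow> real \<times> real \<Rightarrow> 'b" where
    "c \<kappa> g x p = (indicator ({0..1} \<times> {0..1}) p * \<kappa> p) *\<^sub>R g (x + fst p *\<^sub>R h + snd p *\<^sub>R k)" for \<kappa> g x p
  have ci: "integrable (lborel \<Otimes>\<^sub>M lborel) (c (\<lambda>_. 1) w x)" "integrable (lborel \<Otimes>\<^sub>M lborel) (c (\<lambda>p. 1 - snd p) wk x)"
    "integrable (lborel \<Otimes>\<^sub>M lborel) (c (\<lambda>p. 1 - fst p) wh x)" "integrable (lborel \<Otimes>\<^sub>M lborel) (c (\<lambda>p. (1 - fst p) * (1 - snd p)) whk x)" for x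
    unfolding c_def by (rule cell_integral_properties(1)[OF d]; (intro int continuous_intros | auto simp: abs_mult mult_le_one))+
  define T where "T x p = c (\<lambda>_. 1) w x p - c (\<lambda>p. 1 - snd p) wk x p - (c (\<lambda>p. 1 - fst p) wh x p - c (\<lambda>p. (1 - fst p) * (1 - snd p)) whk x p)" for x p
  have Ti: "integrable (lborel \<Otimes>\<^sub>M lborel) (T x)" for x
    unfolding T_def by (intro Bochner_Integration.integrable_diff ci)
  have "AE x in lborel. AE s in lborel. (x + s *\<^sub>R h \<in> \<Omega>' \<longrightarrow> w (x + s *\<^sub>R h) =
       (LBINT t. indicator {0..1} t *\<^sub>R (w (x + s *\<^sub>R h + t *\<^sub>R k) - (1 - t) *\<^sub>R wk (x + s *\<^sub>R h + t *\<^sub>R k)))) \<and>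
      (x + s *\<^sub>R h \<in> \<Omega>' \<longrightarrow> wh (x + s *\<^sub>R h) =
       (LBINT t. indicator {0..1} t *\<^sub>R (wh (x + s *\<^sub>R h + t *\<^sub>R k) - (1 - t) *\<^sub>R whk (x + s *\<^sub>R h + t *\<^sub>R k))))"
  proof (rule AE_lines)
    have neg: "(LBINT t. indicator {0..1} t *\<^sub>R (- 1 *\<^sub>R a t + (1 + - 1 * t) *\<^sub>R b t)) = - (LBINT t. indicator {0..1} t *\<^sub>R (a t - (1 - t) *\<^sub>R b t))"
      for a b :: "real \<Rightarrow> 'b"
      unfolding integral_minus[symmetric] by (intro Bochner_Integration.integral_cong) (auto simp: algebra_simps)
    show "AE y in lborel. (y \<in> \<Omega>' \<longrightarrow> w y = (LBINT t. indicator {0..1} t *\<^sub>R (w (y + t *\<^sub>R k) - (1 - t) *\<^sub>R wk (y + t *\<^sub>R k)))) \<and>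
      (y \<in> \<Omega>' \<longrightarrow> wh y = (LBINT t. indicator {0..1} t *\<^sub>R (wh (y + t *\<^sub>R k) - (1 - t) *\<^sub>R whk (y + t *\<^sub>R k))))"
      using A2 A3 unfolding neg by eventually_elim auto
  qed
  then show ?thesis using A1
  proof eventually_elim
    case (elim x)
    show ?case
    proof
      assume x: "x \<in> \<Omega>"
      have "(1 + - 1) *\<^sub>R w (x + h) - 1 *\<^sub>R w x = - (LBINT s. indicator {0..1} s *\<^sub>R (w (x + s *\<^sub>R h) - (1 - s) *\<^sub>R wh (x + s *\<^sub>R h)))"
        using elim(2) x unfolding integral_minus[symmetric]
        by (auto intro!: Bochner_Integration.integral_cong simp: algebra_simps)
      then have "w x = (LBINT s. indicator {0..1} s *\<^sub>R (w (x + s *\<^sub>R h) - (1 - s) *\<^sub>R wh (x + s *\<^sub>R h)))"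
        by simp
      also have "\<dots> = (LBINT s. LBINT t. T x (s, t))"
      proof (rule integral_cong_AE)
        show "(\<lambda>s. LBINT t. T x (s, t)) \<in> borel_measurable lborel"
          using lborel_pair.integrable_fst'[OF Ti[of x]] by auto
        from elim(1)
        show "AE s in lborel. indicator {0..1} s *\<^sub>R (w (x + s *\<^sub>R h) - (1 - s) *\<^sub>R wh (x + s *\<^sub>R h)) = (LBINT t. T x (s, t))"
          using lborel_pair.AE_integrable_fst'[OF ci(1)[of x]] lborel_pair.AE_integrable_fst'[OF ci(2)[of x]]
            lborel_pair.AE_integrable_fst'[OF ci(3)[of x]] lborel_pair.AE_integrable_fst'[OF ci(4)[of x]]
        proof eventually_elim
          case (elim s)
          show ?case
          proof (cases "0 \<le> s \<and> s \<le> 1")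
            case True
            have i1: "integrable lborel (\<lambda>t. c (\<lambda>_. 1) w x (s, t) - c (\<lambda>p. 1 - snd p) wk x (s, t))"
              and i2: "integrable lborel (\<lambda>t. c (\<lambda>p. 1 - fst p) wh x (s, t) - c (\<lambda>p. (1 - fst p) * (1 - snd p)) whk x (s, t))"
              using elim by auto
            have "w (x + s *\<^sub>R h) = (LBINT t. c (\<lambda>_. 1) w x (s, t) - c (\<lambda>p. 1 - snd p) wk x (s, t))"
              using elim(1) seg[OF x] True
              by (auto simp: c_def indicator_def intro!: Bochner_Integration.integral_cong)
            moreover have "(1 - s) *\<^sub>R wh (x + s *\<^sub>R h) = (LBINT t. c (\<lambda>p. 1 - fst p) wh x (s, t) - c (\<lambda>p. (1 - fst p) * (1 - snd p)) whk x (s, t))"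
            proof -
              have "(1 - s) *\<^sub>R wh (x + s *\<^sub>R h) = (LBINT t. (1 - s) *\<^sub>R (indicator {0..1} t *\<^sub>R (wh (x + s *\<^sub>R h + t *\<^sub>R k) - (1 - t) *\<^sub>R whk (x + s *\<^sub>R h + t *\<^sub>R k))))"
                using elim(1) seg[OF x] True by (simp del: scaleR_scaleR)
              also have "\<dots> = (LBINT t. c (\<lambda>p. 1 - fst p) wh x (s, t) - c (\<lambda>p. (1 - fst p) * (1 - snd p)) whk x (s, t))"
                using True by (intro Bochner_Integration.integral_cong) (auto simp: c_def indicator_def scaleR_diff_right)
              finally show ?thesis .
            qed
            ultimately show ?thesis
              unfolding T_def using True by (simp add: Bochner_Integration.integral_diff[OF i1 i2])
          next
            case False
            then have "T x (s, t) = 0" for t by (auto simp: T_def c_def)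
            then show ?thesis using False by auto
          qed
        qed
      qed measurable
      also have "\<dots> = (LINT p|(lborel \<Otimes>\<^sub>M lborel). T x p)"
        by (rule lborel_pair.integral_fst'[OF Ti])
      also have "\<dots> = cell_integral h k (\<lambda>_. 1) w x - cell_integral h k (\<lambda>p. 1 - snd p) wk x -
    (cell_integral h k (\<lambda>p. 1 - fst p) wh x - cell_integral h k (\<lambda>p. (1 - fst p) * (1 - snd p)) whk x)"
      proof -
        have "cell_integral h k \<kappa> g x = (LINT p|(lborel \<Otimes>\<^sub>M lborel). c \<kappa> g x p)" for \<kappa> and g :: "complex \<Rightarrow> 'b"
          by (simp add: cell_integral_def c_def)
        then show ?thesis unfolding T_def using ci[of x] by simp
      qed
      finally show "w x = cell_integral h k (\<lambda>_. 1) w x - cell_integral h k (\<lambda>p. 1 - snd p) wk x -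
    (cell_integral h k (\<lambda>p. 1 - fst p) wh x - cell_integral h k (\<lambda>p. (1 - fst p) * (1 - snd p)) whk x)" .
    qed
  qed
qed

section \<open>Representatives near a point of the closed disk\<close>

lemma weak_dir_combine_directions:
  assumes 1: "weak_dir 1 w w1" and 2: "weak_dir \<i> w w2"
  shows "weak_dir h w (\<lambda>z. Re h *\<^sub>R w1 z + Im h *\<^sub>R w2 z)"
  unfolding weak_dir_def
proof (intro conjI allI impI)
  have i: "integrable lborel w" "integrable lborel w1" "integrable lborel w2" using 1 2 by (auto simp: weak_dir_def)
  then show "integrable lborel w" "integrable lborel (\<lambda>z. Re h *\<^sub>R w1 z + Im h *\<^sub>R w2 z)" by auto
  fix \<phi> assume c: "smooth_supp (ball 0 1) \<phi>"
  have b: "integrable lborel (\<lambda>z. \<psi> z *\<^sub>R u z)" if cs: "smooth_supp (ball 0 1) \<psi>" and u: "integrable lborel u" for \<psi> and u :: "complex \<Rightarrow> 'a"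
  proof -
    obtain C where C: "\<And>z. \<bar>\<psi> z\<bar> \<le> C" using smooth_supp_bounded[OF cs] by blast
    show ?thesis by (rule integrable_bounded_mult[OF u _ C]) (use smooth_supp_measurable[OF cs] in simp)
  qed
  have c1: "smooth_supp (ball 0 1) (pd UNIV 1 \<phi>)" and c2: "smooth_supp (ball 0 1) (pd UNIV \<i> \<phi>)" using c by (auto intro: smooth_supp_pd)
  have e1: "(LBINT z. pd UNIV 1 \<phi> z *\<^sub>R w z) = - (LBINT z. \<phi> z *\<^sub>R w1 z)"
    and e2: "(LBINT z. pd UNIV \<i> \<phi> z *\<^sub>R w z) = - (LBINT z. \<phi> z *\<^sub>R w2 z)"
    using 1 2 c by (auto simp: weak_dir_def)
  have "(LBINT z. pd UNIV h \<phi> z *\<^sub>R w z) = (LBINT z. Re h *\<^sub>R (pd UNIV 1 \<phi> z *\<^sub>R w z) + Im h *\<^sub>R (pd UNIV \<i> \<phi> z *\<^sub>R w z))"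
    using smooth_supp_pd_eq[OF c, of h] by (intro Bochner_Integration.integral_cong) (auto simp: scaleR_add_left)
  also have "\<dots> = Re h *\<^sub>R (LBINT z. pd UNIV 1 \<phi> z *\<^sub>R w z) + Im h *\<^sub>R (LBINT z. pd UNIV \<i> \<phi> z *\<^sub>R w z)"
    using b[OF c1 i(1)] b[OF c2 i(1)] by (simp del: scaleR_scaleR)
  also have "\<dots> = - (Re h *\<^sub>R (LBINT z. \<phi> z *\<^sub>R w1 z) + Im h *\<^sub>R (LBINT z. \<phi> z *\<^sub>R w2 z))"
    unfolding e1 e2 by simp
  also have "Re h *\<^sub>R (LBINT z. \<phi> z *\<^sub>R w1 z) + Im h *\<^sub>R (LBINT z. \<phi> z *\<^sub>R w2 z) = (LBINT z. Re h *\<^sub>R (\<phi> z *\<^sub>R w1 z) + Im h *\<^sub>R (\<phi> z *\<^sub>R w2 z))"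
    using b[OF c i(2)] b[OF c i(3)] by (simp del: scaleR_scaleR)
  also have "\<dots> = (LBINT z. \<phi> z *\<^sub>R (Re h *\<^sub>R w1 z + Im h *\<^sub>R w2 z))"
    by (simp add: scaleR_add_right mult.commute)
  finally show "(LBINT z. pd UNIV h \<phi> z *\<^sub>R w z) = - (LBINT z. \<phi> z *\<^sub>R (Re h *\<^sub>R w1 z + Im h *\<^sub>R w2 z))" .
qed

lemma weak_dir_linear:
  assumes u: "weak_dir h u u'" and v: "weak_dir h v v'"
  shows "weak_dir h (\<lambda>z. a *\<^sub>R u z + b *\<^sub>R v z) (\<lambda>z. a *\<^sub>R u' z + b *\<^sub>R v' z)"
  unfolding weak_dir_def
proof (intro conjI allI impI)
  have i: "integrable lborel u" "integrable lborel v" "integrable lborel u'" "integrable lborel v'" using u v by (auto simp: weak_dir_def)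
  then show "integrable lborel (\<lambda>z. a *\<^sub>R u z + b *\<^sub>R v z)" "integrable lborel (\<lambda>z. a *\<^sub>R u' z + b *\<^sub>R v' z)" by auto
  fix \<phi> assume c: "smooth_supp (ball 0 1) \<phi>"
  obtain C where C: "\<And>z. \<bar>\<phi> z\<bar> \<le> C" using smooth_supp_bounded[OF c] by blast
  obtain C' where C': "\<And>z. \<bar>pd UNIV h \<phi> z\<bar> \<le> C'" using smooth_supp_pd_dir_bounded[OF c] by blast
  have [measurable]: "\<phi> \<in> borel_measurable borel" "pd UNIV h \<phi> \<in> borel_measurable borel"
    using smooth_supp_measurable[OF c] borel_measurable_continuous_onI[OF smooth_supp_pd_dir_continuous[OF c]] by auto
  have j: "integrable lborel (\<lambda>z. \<phi> z *\<^sub>R u' z)" "integrable lborel (\<lambda>z. \<phi> z *\<^sub>R v' z)"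
    "integrable lborel (\<lambda>z. pd UNIV h \<phi> z *\<^sub>R u z)" "integrable lborel (\<lambda>z. pd UNIV h \<phi> z *\<^sub>R v z)"
    by (rule integrable_bounded_mult[OF _ _ C] integrable_bounded_mult[OF _ _ C'], rule i, measurable)+
  have "(LBINT z. pd UNIV h \<phi> z *\<^sub>R (a *\<^sub>R u z + b *\<^sub>R v z)) = (LBINT z. a *\<^sub>R (pd UNIV h \<phi> z *\<^sub>R u z) + b *\<^sub>R (pd UNIV h \<phi> z *\<^sub>R v z))"
    by (simp add: scaleR_add_right mult.commute)
  also have "\<dots> = a *\<^sub>R (LBINT z. pd UNIV h \<phi> z *\<^sub>R u z) + b *\<^sub>R (LBINT z. pd UNIV h \<phi> z *\<^sub>R v z)"
    using j by (simp del: scaleR_scaleR)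
  also have "(LBINT z. pd UNIV h \<phi> z *\<^sub>R u z) = - (LBINT z. \<phi> z *\<^sub>R u' z)" using u c by (simp add: weak_dir_def)
  also have "(LBINT z. pd UNIV h \<phi> z *\<^sub>R v z) = - (LBINT z. \<phi> z *\<^sub>R v' z)" using v c by (simp add: weak_dir_def)
  also have "a *\<^sub>R - (LBINT z. \<phi> z *\<^sub>R u' z) + b *\<^sub>R - (LBINT z. \<phi> z *\<^sub>R v' z) = - (LBINT z. a *\<^sub>R (\<phi> z *\<^sub>R u' z) + b *\<^sub>R (\<phi> z *\<^sub>R v' z))"
    using j by (simp del: scaleR_scaleR)
  also have "(LBINT z. a *\<^sub>R (\<phi> z *\<^sub>R u' z) + b *\<^sub>R (\<phi> z *\<^sub>R v' z)) = (LBINT z. \<phi> z *\<^sub>R (a *\<^sub>R u' z + b *\<^sub>R v' z))"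
    by (simp add: scaleR_add_right mult.commute)
  finally show "(LBINT z. pd UNIV h \<phi> z *\<^sub>R (a *\<^sub>R u z + b *\<^sub>R v z)) = - (LBINT z. \<phi> z *\<^sub>R (a *\<^sub>R u' z + b *\<^sub>R v' z))" .
qed

text \<open>
  Away from the centre take the two directions at an angle of 45 degrees to the inward normal: all corners of the
  parallelogram stay inside because both sides have sufficiently negative inner products with the position. Near the centre any
  short directions do. The lower bound on the determinant makes the constants uniform in \<open>x0\<close>.
\<close>

lemma inward_frame:
  fixes x0 :: complex
  assumes "x0 \<in> cball 0 1"
  obtains V h k where "open V" "x0 \<in> V" "\<bar>frame_det h k\<bar> \<ge> 1 / 64" "norm h \<le> 1" "norm k \<le> 1"
    "\<And>x. x \<in> V \<inter> ball 0 1 \<Longrightarrow> x \<in> ball 0 1 \<and> x + h \<in> ball 0 1 \<and> x + k \<in> ball 0 1 \<and> x + h + k \<in> ball 0 1"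
proof (cases "norm x0 \<le> 1/2")
  case True
  show thesis
  proof (rule that[of "ball 0 (5/8)" "1/8" "\<i>/8"])
    fix x :: complex assume "x \<in> ball 0 (5/8) \<inter> ball 0 1"
    then have x: "norm x < 5/8" by simp
    have "norm (x + 1/8) \<le> norm x + 1/8" "norm (x + \<i>/8) \<le> norm x + 1/8" "norm (x + 1/8 + \<i>/8) \<le> norm (x + 1/8) + 1/8"
      using norm_triangle_ineq[of x "1/8"] norm_triangle_ineq[of x "\<i>/8"] norm_triangle_ineq[of "x + 1/8" "\<i>/8"] by (simp_all add: norm_divide)
    then show "x \<in> ball 0 1 \<and> x + 1/8 \<in> ball 0 1 \<and> x + \<i>/8 \<in> ball 0 1 \<and> x + 1/8 + \<i>/8 \<in> ball 0 1"
      using x by simp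
  qed (use True in \<open>auto simp: frame_det_def norm_divide\<close>)
next
  case False
  define u where "u = sgn x0"
  have u: "Re u ^ 2 + Im u ^ 2 = 1" "x0 = norm x0 *\<^sub>R u"
  proof -
    have "x0 \<noteq> 0" using False by auto
    then have "norm u = 1" by (simp add: u_def norm_sgn)
    then show "Re u ^ 2 + Im u ^ 2 = 1" by (simp add: cmod_def)
    show "x0 = norm x0 *\<^sub>R u" using \<open>x0 \<noteq> 0\<close> by (simp add: u_def sgn_div_norm)
  qed
  define h where "h = - (u * Complex 1 1) / 4"
  define k where "k = - (u * Complex 1 (-1)) / 4"
  have R: "Re h = - (Re u - Im u) / 4" "Im h = - (Re u + Im u) / 4" "Re k = - (Re u + Im u) / 4" "Im k = - (Im u - Re u) / 4"
    by (simp_all add: h_def k_def field_simps)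
  have n: "h \<bullet> h = 1/8" "k \<bullet> k = 1/8" "h \<bullet> k = 0" "frame_det h k = - 1/8" "h \<bullet> u = - 1/4" "k \<bullet> u = - 1/4"
    using u(1) unfolding inner_complex_def frame_det_def R by (simp_all add: field_simps power2_eq_square)
  have sq: "norm x < 1 \<longleftrightarrow> x \<bullet> x < 1" for x :: complex
    by (metis norm_eq_sqrt_inner real_sqrt_lt_1_iff)
  have x0h: "x0 \<bullet> h < - 1/8" "x0 \<bullet> k < - 1/8"
    using False n(5,6) by (subst u(2), simp add: inner_commute)+
  show thesis
  proof (rule that[of "{x. x \<bullet> h < - 1/8} \<inter> {x. x \<bullet> k < - 1/8}" h k])
    show "open ({x. x \<bullet> h < - 1/8} \<inter> {x. x \<bullet> k < - 1/8})"
      by (intro open_Int open_Collect_less continuous_intros)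
    show "x0 \<in> {x. x \<bullet> h < - 1/8} \<inter> {x. x \<bullet> k < - 1/8}" using x0h by simp
    show "norm h \<le> 1" "norm k \<le> 1" using n(1,2) sq[of h] sq[of k] by auto
    show "1 / 64 \<le> \<bar>frame_det h k\<bar>" using n by simp
    fix x assume "x \<in> {x. x \<bullet> h < - 1/8} \<inter> {x. x \<bullet> k < - 1/8} \<inter> ball 0 1"
    then have x: "x \<bullet> h < - 1/8" "x \<bullet> k < - 1/8" "x \<bullet> x < 1" by (auto simp: sq)
    then show "x \<in> ball 0 1 \<and> x + h \<in> ball 0 1 \<and> x + k \<in> ball 0 1 \<and> x + h + k \<in> ball 0 1"
      using n by (simp add: sq inner_add_left inner_add_right inner_commute)
  qed
qed

text \<open>
  A family of functions that are weak derivatives of each other in the pattern of derivatives of orders at most two.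
\<close>

definition weak_jet :: "(nat \<Rightarrow> nat \<Rightarrow> complex \<Rightarrow> 'b::euclidean_space) \<Rightarrow> bool"
  where "weak_jet W \<longleftrightarrow> weak_dir 1 (W 0 0) (W 1 0) \<and> weak_dir \<i> (W 0 0) (W 0 1) \<and> weak_dir 1 (W 1 0) (W 2 0) \<and>
    weak_dir \<i> (W 1 0) (W 1 1) \<and> weak_dir 1 (W 0 1) (W 1 1) \<and> weak_dir \<i> (W 0 1) (W 0 2)"

definition jet_L1_norm :: "(nat \<Rightarrow> nat \<Rightarrow> complex \<Rightarrow> 'b::euclidean_space) \<Rightarrow> real"
  where "jet_L1_norm W = (LBINT z. norm (W 0 0 z) + norm (W 1 0 z) + norm (W 0 1 z) + norm (W 2 0 z) + norm (W 1 1 z) + norm (W 0 2 z))"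

text \<open>
  The parallelogram formula for the directions of an inward frame; its right-hand side is a continuous function on the
  whole plane. The constant is \<open>64 * (1 + 1 + 1 + 2)\<close>: the determinant contributes 64, and the mixed derivative along the frame
  is bounded by twice the sum of the derivatives of order two.
\<close>

lemma local_representative:
  fixes W :: "nat \<Rightarrow> nat \<Rightarrow> complex \<Rightarrow> 'b::euclidean_space"
  assumes W: "weak_jet W" and x0: "x0 \<in> cball 0 1"
  shows "\<exists>V g. open V \<and> x0 \<in> V \<and> continuous_on UNIV g \<and> (\<forall>x. norm (g x) \<le> 320 * jet_L1_norm W) \<and>
    (AE x in lborel. x \<in> V \<inter> ball 0 1 \<longrightarrow> W 0 0 x = g x)"
proof -
  obtain V h k where V: "open V" "x0 \<in> V" "\<bar>frame_det h k\<bar> \<ge> 1 / 64" "norm h \<le> 1" "norm k \<le> 1"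
    "\<And>x. x \<in> V \<inter> ball 0 1 \<Longrightarrow> x \<in> ball 0 1 \<and> x + h \<in> ball 0 1 \<and> x + k \<in> ball 0 1 \<and> x + h + k \<in> ball 0 1"
    using inward_frame[OF x0] by metis
  have d: "frame_det h k \<noteq> 0" using V(3) by auto
  have I: "integrable lborel (W 0 0)" "integrable lborel (W 1 0)" "integrable lborel (W 0 1)" "integrable lborel (W 2 0)"
    "integrable lborel (W 1 1)" "integrable lborel (W 0 2)"
    using W by (auto simp: weak_jet_def weak_dir_def)
  define wh wk whk where "wh z = Re h *\<^sub>R W 1 0 z + Im h *\<^sub>R W 0 1 z" and "wk z = Re k *\<^sub>R W 1 0 z + Im k *\<^sub>R W 0 1 z"
    and "whk z = Re h *\<^sub>R (Re k *\<^sub>R W 2 0 z + Im k *\<^sub>R W 1 1 z) + Im h *\<^sub>R (Re k *\<^sub>R W 1 1 z + Im k *\<^sub>R W 0 2 z)" for z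
  have wd: "weak_dir h (W 0 0) wh" "weak_dir k (W 0 0) wk" "weak_dir k wh whk"
    unfolding wh_def wk_def whk_def using W by (auto simp: weak_jet_def intro!: weak_dir_combine_directions weak_dir_linear)
  define S where "S z = norm (W 0 0 z) + norm (W 1 0 z) + norm (W 0 1 z) + norm (W 2 0 z) + norm (W 1 1 z) + norm (W 0 2 z)" for z
  have Si: "integrable lborel S" unfolding S_def using I by auto
  have hk: "\<bar>Re h\<bar> \<le> 1" "\<bar>Im h\<bar> \<le> 1" "\<bar>Re k\<bar> \<le> 1" "\<bar>Im k\<bar> \<le> 1"
    using V(4,5) abs_Re_le_cmod[of h] abs_Im_le_cmod[of h] abs_Re_le_cmod[of k] abs_Im_le_cmod[of k] by linarith+
  have lc: "norm (a *\<^sub>R u + b *\<^sub>R v) \<le> norm u + norm v" if "\<bar>a\<bar> \<le> 1" "\<bar>b\<bar> \<le> 1" for a b and u v :: 'b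
    using that by (intro norm_triangle_le add_mono) (auto simp: mult_left_le_one_le)
  have S: "norm (W 0 0 z) \<le> S z" "norm (wh z) \<le> S z" "norm (wk z) \<le> S z" for z
    using lc[OF hk(1,2), of "W 1 0 z" "W 0 1 z"] lc[OF hk(3,4), of "W 1 0 z" "W 0 1 z"]
      norm_ge_zero[of "W 0 0 z"] norm_ge_zero[of "W 1 0 z"] norm_ge_zero[of "W 0 1 z"] norm_ge_zero[of "W 2 0 z"] norm_ge_zero[of "W 1 1 z"] norm_ge_zero[of "W 0 2 z"]
    unfolding S_def wh_def wk_def by linarith+
  have S2: "norm (whk z) \<le> 2 * S z" for z
  proof -
    have "norm (whk z) \<le> norm (Re k *\<^sub>R W 2 0 z + Im k *\<^sub>R W 1 1 z) + norm (Re k *\<^sub>R W 1 1 z + Im k *\<^sub>R W 0 2 z)"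
      unfolding whk_def by (rule lc[OF hk(1,2)])
    also have "\<dots> \<le> (norm (W 2 0 z) + norm (W 1 1 z)) + (norm (W 1 1 z) + norm (W 0 2 z))"
      by (intro add_mono lc[OF hk(3,4)])
    also have "\<dots> \<le> 2 * S z" by (simp add: S_def)
    finally show ?thesis .
  qed
  have i4: "integrable lborel (W 0 0)" "integrable lborel wk" "integrable lborel wh" "integrable lborel whk"
    using wd by (auto simp: weak_dir_def)
  have L: "(LBINT z. norm (W 0 0 z)) \<le> jet_L1_norm W" "(LBINT z. norm (wk z)) \<le> jet_L1_norm W"
    "(LBINT z. norm (wh z)) \<le> jet_L1_norm W" "(LBINT z. norm (whk z)) \<le> 2 * jet_L1_norm W"
  proof -
    have e: "jet_L1_norm W = (LBINT z. S z)" by (simp add: jet_L1_norm_def S_def)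
    show "(LBINT z. norm (W 0 0 z)) \<le> jet_L1_norm W" "(LBINT z. norm (wk z)) \<le> jet_L1_norm W" "(LBINT z. norm (wh z)) \<le> jet_L1_norm W"
      unfolding e using i4 S Si by (auto intro!: integral_mono)
    have "(LBINT z. norm (whk z)) \<le> (LBINT z. 2 * S z)"
      using i4 S2 Si by (intro integral_mono) auto
    then show "(LBINT z. norm (whk z)) \<le> 2 * jet_L1_norm W" by (simp add: e)
  qed
  define g where "g x = cell_integral h k (\<lambda>_. 1) (W 0 0) x - cell_integral h k (\<lambda>p. 1 - snd p) wk x -
    (cell_integral h k (\<lambda>p. 1 - fst p) wh x - cell_integral h k (\<lambda>p. (1 - fst p) * (1 - snd p)) whk x)" for x
  have "continuous_on UNIV g"
    unfolding g_def by (intro continuous_intros cell_integral_properties(2)[OF d] i4) (auto simp: abs_mult mult_le_one)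
  moreover have "AE x in lborel. x \<in> V \<inter> ball 0 1 \<longrightarrow> W 0 0 x = g x"
    unfolding g_def by (intro two_step_formula[OF wd d]) (use V in auto)
  moreover have "norm (g x) \<le> 320 * jet_L1_norm W" for x
  proof -
    have D: "1 / \<bar>frame_det h k\<bar> \<le> 64" using V(3) d by (simp add: field_simps)
    have b: "norm (cell_integral h k \<kappa> u x) \<le> 64 * c"
      if u: "integrable lborel u" "(LBINT z. norm (u z)) \<le> c" and \<kappa>: "continuous_on UNIV \<kappa>" "\<And>p. p \<in> {0..1} \<times> {0..1} \<Longrightarrow> \<bar>\<kappa> p\<bar> \<le> 1"
      for \<kappa> c and u :: "complex \<Rightarrow> 'b"
    proof -
      have "norm (cell_integral h k \<kappa> u x) \<le> (1 / \<bar>frame_det h k\<bar>) * (LBINT z. norm (u z))"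
        by (rule cell_integral_properties(3)[OF d u(1) \<kappa>])
      also have "\<dots> \<le> 64 * c" using D u(2) by (intro mult_mono) auto
      finally show ?thesis .
    qed
    have "norm (cell_integral h k (\<lambda>_. 1) (W 0 0) x) \<le> 64 * jet_L1_norm W" "norm (cell_integral h k (\<lambda>p. 1 - snd p) wk x) \<le> 64 * jet_L1_norm W"
      "norm (cell_integral h k (\<lambda>p. 1 - fst p) wh x) \<le> 64 * jet_L1_norm W"
      "norm (cell_integral h k (\<lambda>p. (1 - fst p) * (1 - snd p)) whk x) \<le> 64 * (2 * jet_L1_norm W)"
      by (rule b; (intro i4 L continuous_intros)?; auto simp: abs_mult mult_le_one)+
    note c = this
    have tri: "norm ((a - b) - (c - d)) \<le> norm a + norm b + (norm c + norm d)" for a b c d :: 'b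
      using norm_triangle_ineq4[of "a - b" "c - d"] norm_triangle_ineq4[of a b] norm_triangle_ineq4[of c d] by linarith
    show ?thesis
      unfolding g_def by (rule order_trans[OF tri]) (use c in linarith)
  qed
  ultimately show ?thesis using V(1,2) by (intro exI[of _ V] exI[of _ g]) auto
qed

section \<open>Gluing local representatives\<close>

text \<open>
  A non-strict inequality between continuous functions that fails somewhere fails on a nonempty open set,
  which has positive measure.
\<close>

lemma AE_open_le:
  fixes F :: "complex \<Rightarrow> real"
  assumes O: "open \<Omega>" and F: "continuous_on \<Omega> F" and AE: "AE x in lborel. x \<in> \<Omega> \<longrightarrow> F x \<le> c" and x: "x \<in> \<Omega>"
  shows "F x \<le> c"
proof (rule ccontr)
  assume "\<not> F x \<le> c"
  define S where "S = {x \<in> \<Omega>. c < F x}"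
  have "open S"
  proof -
    have "open (F -` {c<..} \<inter> \<Omega>)"
      by (rule continuous_on_open_vimage[OF O, THEN iffD1, rule_format, OF F open_greaterThan])
    then show ?thesis by (simp add: S_def vimage_def Int_def conj_commute)
  qed
  have "AE x \<in> S in lebesgue. x \<in> {}"
    by (rule AE_completion) (use AE in \<open>auto simp: S_def elim!: eventually_mono\<close>)
  from mem_closed_if_AE_lebesgue_open[OF \<open>open S\<close> _ this] have "S = {}" by blast
  then show False using x \<open>\<not> F x \<le> c\<close> by (auto simp: S_def)
qed

lemma AE_open_eq:
  fixes f g :: "complex \<Rightarrow> 'b::real_normed_vector"
  assumes "open \<Omega>" "continuous_on \<Omega> f" "continuous_on \<Omega> g" "AE x in lborel. x \<in> \<Omega> \<longrightarrow> f x = g x" "x \<in> \<Omega>"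
  shows "f x = g x"
proof -
  have "norm (f x - g x) \<le> 0"
    by (rule AE_open_le[OF assms(1) _ _ assms(5)])
       (use assms in \<open>auto intro!: continuous_intros elim!: eventually_mono\<close>)
  then show ?thesis by simp
qed

lemma AE_not_sphere: "AE z::complex in lborel. z \<notin> sphere 0 1"
  using negligible_sphere[of "0::complex" 1]
  by (intro AE_not_in) (auto simp: negligible_iff_null_sets null_sets_completion_iff)

text \<open>
  Two local representatives agree almost everywhere on the common part of the open disk, hence everywhere on it, and by
  continuity also at the boundary points that both cover.
\<close>

lemma glue_representatives:
  fixes w :: "complex \<Rightarrow> 'b::real_normed_vector"
  assumes loc: "\<And>x0. x0 \<in> cball 0 1 \<Longrightarrow> \<exists>V g. open V \<and> x0 \<in> V \<and> continuous_on UNIV g \<and> (\<forall>x. norm (g x) \<le> B) \<and>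
    (AE x in lborel. x \<in> V \<inter> ball 0 1 \<longrightarrow> w x = g x)"
  obtains G where "continuous_on (cball 0 1) G" "\<And>x. norm (G x) \<le> B" "AE x in lborel. x \<in> ball 0 1 \<longrightarrow> w x = G x"
proof -
  define P where "P x0 V g \<longleftrightarrow> open V \<and> x0 \<in> V \<and> continuous_on UNIV g \<and> (\<forall>x. norm (g x) \<le> B) \<and>
    (AE x in lborel. x \<in> V \<inter> ball 0 1 \<longrightarrow> w x = g x)" for x0 V g
  have "\<forall>x0\<in>cball 0 1. \<exists>V g. P x0 V g" using loc unfolding P_def by blast
  then obtain V g where VP: "\<And>x0. x0 \<in> cball 0 1 \<Longrightarrow> P x0 (V x0) (g x0)" by metis
  have V: "\<And>x0. x0 \<in> cball 0 1 \<Longrightarrow> open (V x0)" "\<And>x0. x0 \<in> cball 0 1 \<Longrightarrow> x0 \<in> V x0"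
    "\<And>x0. x0 \<in> cball 0 1 \<Longrightarrow> continuous_on UNIV (g x0)" "\<And>x0 x. x0 \<in> cball 0 1 \<Longrightarrow> norm (g x0 x) \<le> B"
    "\<And>x0. x0 \<in> cball 0 1 \<Longrightarrow> AE x in lborel. x \<in> V x0 \<inter> ball 0 1 \<longrightarrow> w x = g x0 x"
    using VP unfolding P_def by blast+
  \<comment> \<open>Every point uses the representative belonging to itself; off the closed disk that of the centre.\<close>
  define G where "G x = g (if x \<in> cball 0 1 then x else 0) x" for x
  have agree: "g a x = g b x" if ab: "a \<in> cball 0 1" "b \<in> cball 0 1" and x: "x \<in> V a" "x \<in> V b" "x \<in> cball 0 1" for a b x
  proof -
    define S where "S = V a \<inter> V b \<inter> ball 0 1"
    have "open S" using V ab by (auto simp: S_def)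
    have eq: "g a y = g b y" if "y \<in> S" for y
    proof (rule AE_open_eq[OF \<open>open S\<close> _ _ _ that])
      show "continuous_on S (g a)" "continuous_on S (g b)"
        using V(3)[OF ab(1)] V(3)[OF ab(2)] continuous_on_subset by blast+
      show "AE x in lborel. x \<in> S \<longrightarrow> g a x = g b x"
        using V(5)[OF ab(1)] V(5)[OF ab(2)] by eventually_elim (auto simp: S_def)
    qed
    have "x \<in> closure S"
    proof -
      have "x \<in> closure (ball 0 1)" using x by simp
      moreover have "open (V a \<inter> V b)" using V ab by auto
      ultimately have "x \<in> closure ((V a \<inter> V b) \<inter> ball 0 1)" using open_Int_closure_subset[of "V a \<inter> V b" "ball 0 1"] x by blast
      then show ?thesis by (simp add: S_def)
    qed
    moreover have "closed {y. g a y = g b y}"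
      using V(3)[OF ab(1)] V(3)[OF ab(2)] by (intro closed_Collect_eq) auto
    ultimately show ?thesis using closure_minimal[of S "{y. g a y = g b y}"] eq by blast
  qed
  have GV: "G x = g a x" if "a \<in> cball 0 1" "x \<in> V a" "x \<in> cball 0 1" for a x
    using that agree[of x a x] V(2)[of x] by (simp add: G_def)
  show thesis
  proof (rule that[of G])
    show "norm (G x) \<le> B" for x using V(4)[of x x] V(4)[of 0 x] by (auto simp: G_def)
    show "continuous_on (cball 0 1) G"
      unfolding continuous_on_eq_continuous_within
    proof
      fix x :: complex assume x: "x \<in> cball 0 1"
      have cg: "continuous (at x within cball 0 1) (g x)"
        using V(3)[OF x] by (auto simp: continuous_on_eq_continuous_within intro: continuous_within_subset)
      obtain d where d: "d > 0" "\<And>y. dist y x < d \<Longrightarrow> y \<in> V x"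
        using V(1)[OF x] V(2)[OF x] unfolding open_dist by blast
      show "continuous (at x within cball 0 1) G"
      proof (rule continuous_transform_within[OF cg d(1) x])
        show "g x y = G y" if "y \<in> cball 0 1" "dist y x < d" for y
          using GV[OF x d(2)[OF that(2)] that(1)] by simp
      qed
    qed
    obtain T where T: "T \<subseteq> cball 0 1" "finite T" "cball 0 1 \<subseteq> (\<Union>a\<in>T. V a)"
      by (rule compactE_image[OF compact_cball[of 0 1], of "cball 0 1" V]) (use V(1,2) in auto)
    have "AE x in lborel. \<forall>a\<in>T. x \<in> V a \<inter> ball 0 1 \<longrightarrow> w x = g a x"
      using T V(5) by (intro AE_finite_allI) auto
    then show "AE x in lborel. x \<in> ball 0 1 \<longrightarrow> w x = G x"
    proof eventually_elim
      case (elim x)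
      show ?case
      proof
        assume x: "x \<in> ball 0 1"
        then obtain a where "a \<in> T" "x \<in> V a" using T(3) ball_subset_cball by blast
        then show "w x = G x" using elim x T GV[of a x] by auto
      qed
    qed
  qed
qed


section \<open>Symmetry of second derivatives\<close>

lemma smooth_supp_line_deriv:
  assumes "smooth_supp \<Omega> \<phi>"
  shows "((\<lambda>s. \<phi> (x + s *\<^sub>R e)) has_real_derivative pd UNIV e \<phi> (x + s *\<^sub>R e)) (at s)"
proof -
  have "((\<lambda>s. \<phi> (x + s *\<^sub>R e)) has_derivative (\<lambda>t. pd UNIV (t *\<^sub>R e) \<phi> (x + s *\<^sub>R e))) (at s)"
    by (rule has_derivative_compose[OF _ smooth_supp_deriv[OF assms], of "\<lambda>s. x + s *\<^sub>R e"]) (auto intro!: derivative_eq_intros)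
  moreover have "pd UNIV (t *\<^sub>R e) \<phi> z = pd UNIV e \<phi> z * t" for t z
    using smooth_supp_pd_eq[OF assms, of e z] smooth_supp_pd_eq[OF assms, of "t *\<^sub>R e" z] by (simp add: algebra_simps)
  ultimately show ?thesis by (simp add: has_field_derivative_def)
qed

text \<open>
  The mean value theorem twice. The second difference is symmetric in the two directions, the right-hand side is
  not; this is the classical proof that mixed derivatives agree.
\<close>

lemma second_difference:
  assumes c: "smooth_supp \<Omega> \<phi>" and e: "e1 = 1 \<or> e1 = \<i>" "norm e2 = 1" and r: "r > 0"
  shows "\<exists>p. dist p x < 2 * r \<and>
    \<phi> (x + r *\<^sub>R e1 + r *\<^sub>R e2) - \<phi> (x + r *\<^sub>R e1) - \<phi> (x + r *\<^sub>R e2) + \<phi> x = r * (r * pd UNIV e2 (pd UNIV e1 \<phi>) p)"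
proof -
  define f where "f s = \<phi> ((x + r *\<^sub>R e2) + s *\<^sub>R e1) - \<phi> (x + s *\<^sub>R e1)" for s
  have "\<exists>s. 0 < s \<and> s < r \<and> f r - f 0 = (r - 0) * (pd UNIV e1 \<phi> ((x + r *\<^sub>R e2) + s *\<^sub>R e1) - pd UNIV e1 \<phi> (x + s *\<^sub>R e1))"
    using r unfolding f_def by (intro MVT2) (auto intro!: DERIV_diff smooth_supp_line_deriv[OF c])
  then obtain s where s: "0 < s" "s < r" "f r - f 0 = r * (pd UNIV e1 \<phi> ((x + r *\<^sub>R e2) + s *\<^sub>R e1) - pd UNIV e1 \<phi> (x + s *\<^sub>R e1))" by auto
  have c1: "smooth_supp \<Omega> (pd UNIV e1 \<phi>)" by (rule smooth_supp_pd[OF c e(1)])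
  have "\<exists>t. 0 < t \<and> t < r \<and> pd UNIV e1 \<phi> ((x + s *\<^sub>R e1) + r *\<^sub>R e2) - pd UNIV e1 \<phi> ((x + s *\<^sub>R e1) + 0 *\<^sub>R e2) = (r - 0) * pd UNIV e2 (pd UNIV e1 \<phi>) ((x + s *\<^sub>R e1) + t *\<^sub>R e2)"
    using r by (intro MVT2) (auto intro!: smooth_supp_line_deriv[OF c1])
  then obtain t where t: "0 < t" "t < r"
    "pd UNIV e1 \<phi> ((x + s *\<^sub>R e1) + r *\<^sub>R e2) - pd UNIV e1 \<phi> (x + s *\<^sub>R e1) = r * pd UNIV e2 (pd UNIV e1 \<phi>) ((x + s *\<^sub>R e1) + t *\<^sub>R e2)" by auto
  have "norm e1 = 1" using e by auto
  then have "norm (s *\<^sub>R e1 + t *\<^sub>R e2) < 2 * r"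
    using norm_triangle_ineq[of "s *\<^sub>R e1" "t *\<^sub>R e2"] s t e by simp
  then have "dist (x + s *\<^sub>R e1 + t *\<^sub>R e2) x < 2 * r" by (simp add: dist_norm add.assoc)
  moreover have "\<phi> (x + r *\<^sub>R e1 + r *\<^sub>R e2) - \<phi> (x + r *\<^sub>R e1) - \<phi> (x + r *\<^sub>R e2) + \<phi> x = f r - f 0"
    by (simp add: f_def algebra_simps)
  moreover have "(x + r *\<^sub>R e2) + s *\<^sub>R e1 = (x + s *\<^sub>R e1) + r *\<^sub>R e2" by (simp add: algebra_simps)
  ultimately show ?thesis using s(3) t(3) by (intro exI[of _ "x + s *\<^sub>R e1 + t *\<^sub>R e2"]) simp
qed

lemma smooth_supp_pd_commute:
  assumes c: "smooth_supp \<Omega> \<phi>"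
  shows "pd UNIV \<i> (pd UNIV 1 \<phi>) = pd UNIV 1 (pd UNIV \<i> \<phi>)"
proof
  fix x
  let ?A = "pd UNIV \<i> (pd UNIV 1 \<phi>)" and ?B = "pd UNIV 1 (pd UNIV \<i> \<phi>)"
  have cA: "isCont ?A x" and cB: "isCont ?B x"
    using smooth_supp_continuous[OF smooth_supp_pd[OF smooth_supp_pd[OF c]], of \<i> 1] smooth_supp_continuous[OF smooth_supp_pd[OF smooth_supp_pd[OF c]], of 1 \<i>]
    by (auto simp: continuous_on_eq_continuous_at)
  show "?A x = ?B x"
  proof (rule ccontr)
    assume "?A x \<noteq> ?B x"
    define e where "e = \<bar>?A x - ?B x\<bar> / 2"
    have e: "e > 0" using \<open>?A x \<noteq> ?B x\<close> by (simp add: e_def)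
    obtain d where d: "d > 0" "\<And>p. dist p x < d \<Longrightarrow> \<bar>?A p - ?A x\<bar> < e"
      using cA e unfolding continuous_at_eps_delta by (auto simp: dist_real_def)
    obtain d' where d': "d' > 0" "\<And>p. dist p x < d' \<Longrightarrow> \<bar>?B p - ?B x\<bar> < e"
      using cB e unfolding continuous_at_eps_delta by (auto simp: dist_real_def)
    define r where "r = min d d' / 2"
    have r: "r > 0" "2 * r \<le> d" "2 * r \<le> d'" using d d' by (auto simp: r_def)
    obtain p where p: "dist p x < 2 * r" "\<phi> (x + r *\<^sub>R 1 + r *\<^sub>R \<i>) - \<phi> (x + r *\<^sub>R 1) - \<phi> (x + r *\<^sub>R \<i>) + \<phi> x = r * (r * ?A p)"
      using second_difference[OF c _ _ r(1), of 1 \<i> x] by auto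
    obtain q where q: "dist q x < 2 * r" "\<phi> (x + r *\<^sub>R \<i> + r *\<^sub>R 1) - \<phi> (x + r *\<^sub>R \<i>) - \<phi> (x + r *\<^sub>R 1) + \<phi> x = r * (r * ?B q)"
      using second_difference[OF c _ _ r(1), of \<i> 1 x] by auto
    have "x + r *\<^sub>R \<i> + r *\<^sub>R 1 = x + r *\<^sub>R 1 + r *\<^sub>R \<i>" by (simp add: algebra_simps)
    then have "r * (r * ?A p) = r * (r * ?B q)" using p(2) q(2) by (simp add: algebra_simps)
    then have "?A p = ?B q" using r by simp
    moreover have "\<bar>?A p - ?A x\<bar> < e" "\<bar>?B q - ?B x\<bar> < e" using p q r by (auto intro!: d d')
    ultimately have "\<bar>?A x - ?B x\<bar> < 2 * e" by linarith
    then show False by (simp add: e_def)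
  qed
qed

lemma smooth_supp_funpow_pd: "smooth_supp \<Omega> \<phi> \<Longrightarrow> e = 1 \<or> e = \<i> \<Longrightarrow> smooth_supp \<Omega> ((pd UNIV e ^^ a) \<phi>)"
  by (induction a) (auto intro: smooth_supp_pd)

lemma smooth_supp_pds: "smooth_supp \<Omega> \<phi> \<Longrightarrow> smooth_supp \<Omega> (pds UNIV a b \<phi>)"
  unfolding pds_def by (intro smooth_supp_funpow_pd) auto

lemma pds_pd_i: "pds UNIV a b (pd UNIV \<i> \<phi>) = pds UNIV a (Suc b) \<phi>"
  by (simp add: pds_def funpow_swap1)

lemma funpow_pd_i_1: "smooth_supp \<Omega> \<phi> \<Longrightarrow> (pd UNIV \<i> ^^ b) (pd UNIV 1 \<phi>) = pd UNIV 1 ((pd UNIV \<i> ^^ b) \<phi>)"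
proof (induction b)
  case (Suc b)
  then show ?case using smooth_supp_pd_commute[OF smooth_supp_funpow_pd, of \<Omega> \<phi> \<i> b] by simp
qed simp

lemma funpow_pd_1_i: "smooth_supp \<Omega> \<phi> \<Longrightarrow> pd UNIV \<i> ((pd UNIV 1 ^^ a) \<phi>) = (pd UNIV 1 ^^ a) (pd UNIV \<i> \<phi>)"
proof (induction a)
  case (Suc a)
  then show ?case using smooth_supp_pd_commute[OF smooth_supp_funpow_pd, of \<Omega> \<phi> 1 a] by simp
qed simp

lemma pds_pd_1: "smooth_supp \<Omega> \<phi> \<Longrightarrow> pds UNIV a b (pd UNIV 1 \<phi>) = pds UNIV (Suc a) b \<phi>"
  by (simp add: pds_def funpow_pd_i_1 funpow_swap1)

lemma pd_1_pds: "pd UNIV 1 (pds UNIV a b \<phi>) = pds UNIV (Suc a) b \<phi>"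
  by (simp add: pds_def)

lemma pd_i_pds: "smooth_supp \<Omega> \<phi> \<Longrightarrow> pd UNIV \<i> (pds UNIV a b \<phi>) = pds UNIV a (Suc b) \<phi>"
  unfolding pds_def using funpow_pd_1_i[OF smooth_supp_funpow_pd, of \<Omega> \<phi> \<i> a b] by simp

section \<open>The Sobolev spaces in terms of Borel functions\<close>

definition sq_integrable :: "(complex \<Rightarrow> 'b::euclidean_space) \<Rightarrow> bool"
  where "sq_integrable w \<longleftrightarrow> w \<in> borel_measurable borel \<and> (\<forall>z. z \<notin> disk \<longrightarrow> w z = 0) \<and> integrable lborel (\<lambda>z. (norm (w z))\<^sup>2)"

text \<open>
  On a set of finite measure \<open>L\<^sup>2\<close> is contained in \<open>L\<^sup>1\<close>, here by \<open>t \<le> 1 + t\<^sup>2\<close>. The resulting inequality is not homogeneous; it is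
  scaled afterwards.
\<close>

lemma sq_integrable_imp_integrable:
  assumes "sq_integrable w"
  shows "integrable lborel w" "(LBINT z. norm (w z)) \<le> measure lborel disk + (LBINT z. (norm (w z))\<^sup>2)"
proof -
  have [measurable]: "w \<in> borel_measurable borel" and 2: "integrable lborel (\<lambda>z. (norm (w z))\<^sup>2)" and z: "\<And>z. z \<notin> disk \<Longrightarrow> w z = 0"
    using assms by (auto simp: sq_integrable_def)
  have i: "integrable lborel (indicat_real disk)"
    using emeasure_compact_finite[OF compact_cball[of "0::complex" 1]] by (intro integrable_real_indicator) auto
  have le: "norm (w x) \<le> indicat_real disk x + (norm (w x))\<^sup>2" for x
  proof (cases "x \<in> disk")
    case True
    have "0 \<le> (norm (w x) - 1)\<^sup>2" by simp
    also have "\<dots> = (norm (w x))\<^sup>2 + 1 - 2 * norm (w x)" by (simp add: power2_diff)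
    finally have "norm (w x) \<le> 1 + (norm (w x))\<^sup>2" using norm_ge_zero[of "w x"] by linarith
    then show ?thesis using True by simp
  qed (use z in simp)
  show 1: "integrable lborel w"
  proof (rule Bochner_Integration.integrable_bound)
    show "integrable lborel (\<lambda>x. indicat_real disk x + (norm (w x))\<^sup>2)" using i 2 by auto
    show "AE x in lborel. norm (w x) \<le> norm (indicat_real disk x + (norm (w x))\<^sup>2)"
      using le by (intro AE_I2) (simp add: order_trans[OF le])
  qed simp
  have "(LBINT z. norm (w z)) \<le> (LBINT x. indicat_real disk x + (norm (w x))\<^sup>2)"
    using 1 2 i le by (intro integral_mono) auto
  also have "\<dots> = measure lborel disk + (LBINT z. (norm (w z))\<^sup>2)" using i 2 by simp
  finally show "(LBINT z. norm (w z)) \<le> measure lborel disk + (LBINT z. (norm (w z))\<^sup>2)" .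
qed

lemma lebesgue_on_disk_lborel:
  fixes F F' :: "complex \<Rightarrow> 'b::euclidean_space"
  assumes F: "F \<in> borel_measurable (lebesgue_on disk)" and F': "F' \<in> borel_measurable borel"
    and z: "\<And>z. z \<notin> disk \<Longrightarrow> F' z = 0" and AE: "AE z in lborel. z \<in> disk \<longrightarrow> F z = F' z"
  shows "integrable (lebesgue_on disk) F \<longleftrightarrow> integrable lborel F'"
    "(LINT z|lebesgue_on disk. F z) = (LBINT z. F' z)"
proof -
  have d: "disk \<inter> space lebesgue \<in> sets lebesgue" by simp
  have m: "(\<lambda>z. indicator disk z *\<^sub>R F z) \<in> borel_measurable lebesgue"
    using F borel_measurable_restrict_space_iff[OF d, of F] by simp
  have m': "F' \<in> borel_measurable lebesgue" using F' by (intro measurable_completion) simp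
  have ae: "AE z in lebesgue. indicator disk z *\<^sub>R F z = F' z"
    by (rule AE_completion) (use AE z in \<open>auto simp: indicator_def elim!: eventually_mono\<close>)
  have "integrable (lebesgue_on disk) F \<longleftrightarrow> integrable lebesgue (\<lambda>z. indicator disk z *\<^sub>R F z)"
    by (rule integrable_restrict_space[OF d])
  also have "\<dots> \<longleftrightarrow> integrable lebesgue F'" by (rule integrable_cong_AE[OF m m' ae])
  also have "\<dots> \<longleftrightarrow> integrable lborel F'" by (rule integrable_completion) (use F' in simp)
  finally show "integrable (lebesgue_on disk) F \<longleftrightarrow> integrable lborel F'" .
  have "(LINT z|lebesgue_on disk. F z) = (LINT z|lebesgue. indicator disk z *\<^sub>R F z)"
    by (rule integral_restrict_space[OF d])
  also have "\<dots> = (LINT z|lebesgue. F' z)" by (rule integral_cong_AE[OF m m' ae])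
  also have "\<dots> = (LBINT z. F' z)" by (rule integral_completion) (use F' in simp)
  finally show "(LINT z|lebesgue_on disk. F z) = (LBINT z. F' z)" .
qed

text \<open>
  Replaces a Lebesgue measurable function on the disk by a Borel function on the plane that vanishes off the disk,
  for which products of Borel measures and translations can be used.
\<close>

definition borel_version :: "(complex \<Rightarrow> 'b::euclidean_space) \<Rightarrow> (complex \<Rightarrow> 'b) \<Rightarrow> bool"
  where "borel_version w w' \<longleftrightarrow> w \<in> borel_measurable (lebesgue_on disk) \<and> w' \<in> borel_measurable borel \<and>
    (\<forall>z. z \<notin> disk \<longrightarrow> w' z = 0) \<and> (AE z in lborel. z \<in> disk \<longrightarrow> w z = w' z)"

lemma borel_version_refl: "w \<in> borel_measurable borel \<Longrightarrow> (\<And>z. z \<notin> disk \<Longrightarrow> w z = 0) \<Longrightarrow> borel_version w w"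
  unfolding borel_version_def
  by (auto intro!: measurable_restrict_space1 measurable_completion)

lemma borel_version_exists:
  fixes w :: "complex \<Rightarrow> 'b::euclidean_space"
  assumes w: "w \<in> borel_measurable (lebesgue_on disk)"
  shows "\<exists>w'. borel_version w w'"
proof -
  have d: "disk \<inter> space lebesgue \<in> sets lebesgue" by simp
  define u where "u z = indicator disk z *\<^sub>R w z" for z
  have u: "u \<in> borel_measurable lebesgue"
    unfolding u_def using w borel_measurable_restrict_space_iff[OF d, of w] by simp
  have "\<exists>g\<in>borel_measurable lborel. AE z in lborel. u z \<bullet> b = g z" for b
    using u by (intro completion_ex_borel_measurable_real) simp
  then obtain g where g: "\<And>b. g b \<in> borel_measurable lborel" "\<And>b. AE z in lborel. u z \<bullet> b = g b z" by metis
  have [measurable]: "g b \<in> borel_measurable borel" for b using g(1)[of b] by simp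
  define w' where "w' z = indicator disk z *\<^sub>R (\<Sum>b\<in>Basis. g b z *\<^sub>R b)" for z
  have "AE z in lborel. \<forall>b\<in>Basis. u z \<bullet> b = g b z" using g(2) by (intro AE_finite_allI) auto
  then have "AE z in lborel. z \<in> disk \<longrightarrow> w z = w' z"
  proof eventually_elim
    case (elim z)
    have "u z = (\<Sum>b\<in>Basis. (u z \<bullet> b) *\<^sub>R b)" by (simp add: euclidean_representation)
    also have "\<dots> = (\<Sum>b\<in>Basis. g b z *\<^sub>R b)" using elim by (intro sum.cong) auto
    finally show ?case by (auto simp: w'_def u_def)
  qed
  moreover have "w' \<in> borel_measurable borel"
    unfolding w'_def by (intro borel_measurable_scaleR borel_measurable_sum borel_measurable_indicator) auto
  ultimately show ?thesis using w by (intro exI[of _ w']) (auto simp: borel_version_def w'_def)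
qed

lemma borel_version_integral:
  assumes b: "borel_version w w'" and \<phi>: "\<phi> \<in> borel_measurable borel"
  shows "(LINT z|lebesgue_on disk. \<phi> z *\<^sub>R w z) = (LBINT z. \<phi> z *\<^sub>R w' z)"
proof (rule lebesgue_on_disk_lborel(2))
  have \<phi>': "\<phi> \<in> borel_measurable (lebesgue_on disk)"
    using \<phi> by (intro measurable_restrict_space1 measurable_completion) simp
  show "(\<lambda>z. \<phi> z *\<^sub>R w z) \<in> borel_measurable (lebesgue_on disk)"
    using b \<phi>' by (auto simp: borel_version_def)
qed (use b \<phi> in \<open>auto simp: borel_version_def elim!: eventually_mono\<close>)

lemma borel_version_L2:
  assumes b: "borel_version w w'"
  shows "w \<in> L2_disk \<longleftrightarrow> sq_integrable w'" "(LINT z|lebesgue_on disk. (norm (w z))\<^sup>2) = (LBINT z. (norm (w' z))\<^sup>2)"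
proof -
  have a: "(\<lambda>z. (norm (w z))\<^sup>2) \<in> borel_measurable (lebesgue_on disk)" "(\<lambda>z. (norm (w' z))\<^sup>2) \<in> borel_measurable borel"
     "\<And>z. z \<notin> disk \<Longrightarrow> (norm (w' z))\<^sup>2 = 0" "AE z in lborel. z \<in> disk \<longrightarrow> (norm (w z))\<^sup>2 = (norm (w' z))\<^sup>2"
    using b by (auto simp: borel_version_def elim!: eventually_mono)
  show "w \<in> L2_disk \<longleftrightarrow> sq_integrable w'"
    using lebesgue_on_disk_lborel(1)[OF a] b by (auto simp: L2_disk_def sq_integrable_def borel_version_def)
  show "(LINT z|lebesgue_on disk. (norm (w z))\<^sup>2) = (LBINT z. (norm (w' z))\<^sup>2)"
    by (rule lebesgue_on_disk_lborel(2)[OF a])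
qed

text \<open>
  The weak derivative of order \<open>(a, b)\<close> for functions on the plane that vanish off the disk.
\<close>

definition weak_deriv :: "nat \<Rightarrow> nat \<Rightarrow> (complex \<Rightarrow> 'b::euclidean_space) \<Rightarrow> (complex \<Rightarrow> 'b) \<Rightarrow> bool"
  where "weak_deriv a b v w \<longleftrightarrow> (\<forall>\<phi>. smooth_supp (ball 0 1) \<phi> \<longrightarrow>
    (LBINT z. pds UNIV a b \<phi> z *\<^sub>R v z) = (- 1) ^ (a + b) *\<^sub>R (LBINT z. \<phi> z *\<^sub>R w z))"

lemma weak_pds_iff:
  assumes v: "borel_version v v'" and w: "borel_version w w'"
  shows "weak_pds a b v w \<longleftrightarrow> weak_deriv a b v' w'"
proof -
  have "(LINT z|lebesgue_on disk. pds UNIV a b \<phi> z *\<^sub>R v z) = (LBINT z. pds UNIV a b \<phi> z *\<^sub>R v' z)"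
    "(LINT z|lebesgue_on disk. \<phi> z *\<^sub>R w z) = (LBINT z. \<phi> z *\<^sub>R w' z)" if "smooth_supp (ball 0 1) \<phi>" for \<phi>
    using smooth_supp_measurable[OF that] smooth_supp_measurable[OF smooth_supp_pds[OF that]]
    by (auto intro!: borel_version_integral v w)
  then show ?thesis unfolding weak_pds_def weak_deriv_def test_function_iff by simp
qed

text \<open>
  The functions on the plane that represent continuous functions on the closed disk.
\<close>

definition cont_disk :: "(complex \<Rightarrow> 'b::euclidean_space) \<Rightarrow> bool"
  where "cont_disk v \<longleftrightarrow> continuous_on disk v \<and> (\<forall>z. z \<notin> disk \<longrightarrow> v z = 0)"

lemma cont_disk_measurable: "cont_disk v \<Longrightarrow> v \<in> borel_measurable borel"
proof -
  assume v: "cont_disk v"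
  have "(\<lambda>x. indicator disk x *\<^sub>R v x) \<in> borel_measurable borel"
    using v by (intro borel_measurable_continuous_on_indicator) (auto simp: cont_disk_def)
  moreover have "(\<lambda>x. indicator disk x *\<^sub>R v x) = v" using v by (auto simp: cont_disk_def indicator_def fun_eq_iff)
  ultimately show ?thesis by simp
qed

lemma cont_disk_borel_version: "cont_disk v \<Longrightarrow> borel_version v v"
  using cont_disk_measurable by (intro borel_version_refl) (auto simp: cont_disk_def)

lemma cont_disk_sq_integrable: assumes "cont_disk v" shows "sq_integrable v"
proof -
  have "integrable lborel (\<lambda>x. indicator disk x *\<^sub>R (norm (v x))\<^sup>2)"
    using assms by (intro borel_integrable_compact) (auto simp: cont_disk_def intro!: continuous_intros)
  moreover have "(\<lambda>x. indicator disk x *\<^sub>R (norm (v x))\<^sup>2) = (\<lambda>x. (norm (v x))\<^sup>2)" using assms by (auto simp: cont_disk_def indicator_def fun_eq_iff)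
  ultimately show ?thesis using assms cont_disk_measurable[OF assms] by (auto simp: sq_integrable_def cont_disk_def)
qed

lemma sobolev_iff:
  "v \<in> sobolev k \<longleftrightarrow> cont_disk v \<and> (\<forall>a b. a + b \<le> k \<longrightarrow> (\<exists>w. sq_integrable w \<and> weak_deriv a b v w))"
proof (cases "cont_disk v")
  case True
  have "(\<exists>w\<in>L2_disk. weak_pds a b v w) \<longleftrightarrow> (\<exists>w. sq_integrable w \<and> weak_deriv a b v w)" for a b
  proof
    assume "\<exists>w\<in>L2_disk. weak_pds a b v w"
    then obtain w where w: "w \<in> L2_disk" "weak_pds a b v w" by blast
    then obtain w' where w': "borel_version w w'" using borel_version_exists[of w] by (auto simp: L2_disk_def)
    then show "\<exists>w. sq_integrable w \<and> weak_deriv a b v w"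
      using w borel_version_L2(1)[OF w'] weak_pds_iff[OF cont_disk_borel_version[OF True] w'] by blast
  next
    assume "\<exists>w. sq_integrable w \<and> weak_deriv a b v w"
    then obtain w where w: "sq_integrable w" "weak_deriv a b v w" by blast
    then have w': "borel_version w w" by (intro borel_version_refl) (auto simp: sq_integrable_def)
    then show "\<exists>w\<in>L2_disk. weak_pds a b v w"
      using w borel_version_L2(1)[OF w'] weak_pds_iff[OF cont_disk_borel_version[OF True] w'] by blast
  qed
  then show ?thesis using True by (simp add: sobolev_def cont_disk_def)
qed (auto simp: sobolev_def cont_disk_def)

lemma smooth_supp_mult_integrable:
  fixes w :: "complex \<Rightarrow> 'b::euclidean_space"
  assumes "smooth_supp \<Omega> \<phi>" "integrable lborel w"
  shows "integrable lborel (\<lambda>z. \<phi> z *\<^sub>R w z)"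
proof -
  obtain C where C: "\<And>z. \<bar>\<phi> z\<bar> \<le> C" using smooth_supp_bounded[OF assms(1)] by blast
  show ?thesis by (rule integrable_bounded_mult[OF assms(2) _ C]) (use smooth_supp_measurable[OF assms(1)] in simp)
qed

lemma weak_deriv_linear:
  assumes v: "integrable lborel v" "integrable lborel w" "weak_deriv a b v w" and v': "integrable lborel v'" "integrable lborel w'" "weak_deriv a b v' w'"
  shows "weak_deriv a b (\<lambda>z. c *\<^sub>R v z + d *\<^sub>R v' z) (\<lambda>z. c *\<^sub>R w z + d *\<^sub>R w' z)"
  unfolding weak_deriv_def
proof (intro allI impI)
  fix \<phi> assume p: "smooth_supp (ball 0 1) \<phi>"
  have e: "(LBINT z. \<psi> z *\<^sub>R (c *\<^sub>R f z + d *\<^sub>R g z)) = c *\<^sub>R (LBINT z. \<psi> z *\<^sub>R f z) + d *\<^sub>R (LBINT z. \<psi> z *\<^sub>R g z)"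
    if "smooth_supp (ball 0 1) \<psi>" "integrable lborel f" "integrable lborel g" for \<psi> and f g :: "complex \<Rightarrow> 'a"
  proof -
    have "(LBINT z. \<psi> z *\<^sub>R (c *\<^sub>R f z + d *\<^sub>R g z)) = (LBINT z. c *\<^sub>R (\<psi> z *\<^sub>R f z) + d *\<^sub>R (\<psi> z *\<^sub>R g z))"
      by (simp add: scaleR_add_right mult.commute)
    then show ?thesis using smooth_supp_mult_integrable[OF that(1,2)] smooth_supp_mult_integrable[OF that(1,3)] by (simp del: scaleR_scaleR)
  qed
  show "(LBINT z. pds UNIV a b \<phi> z *\<^sub>R (c *\<^sub>R v z + d *\<^sub>R v' z)) = (- 1) ^ (a + b) *\<^sub>R (LBINT z. \<phi> z *\<^sub>R (c *\<^sub>R w z + d *\<^sub>R w' z))"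
  proof -
    have 1: "(LBINT z. pds UNIV a b \<phi> z *\<^sub>R v z) = (- 1) ^ (a + b) *\<^sub>R (LBINT z. \<phi> z *\<^sub>R w z)"
      "(LBINT z. pds UNIV a b \<phi> z *\<^sub>R v' z) = (- 1) ^ (a + b) *\<^sub>R (LBINT z. \<phi> z *\<^sub>R w' z)"
      using v(3) v'(3) p by (auto simp: weak_deriv_def)
    show ?thesis
      unfolding e[OF smooth_supp_pds[OF p] v(1) v'(1)] e[OF p v(2) v'(2)] 1
      by (simp add: scaleR_add_right mult.commute)
  qed
qed

text \<open>
  By the fundamental lemma on the open disk; the bounding circle is a null set, and outside both functions vanish.
\<close>

lemma weak_deriv_unique:
  assumes w: "sq_integrable w" "weak_deriv a b v w" and w': "sq_integrable w'" "weak_deriv a b v w'"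
  shows "AE z in lborel. w z = w' z"
proof -
  have i: "integrable lborel w" "integrable lborel w'" using w w' sq_integrable_imp_integrable by auto
  have "AE z in lborel. z \<in> ball 0 1 \<longrightarrow> w z - w' z = 0"
  proof (rule fundamental_lemma)
    show "integrable lborel (\<lambda>z. w z - w' z)" using i by simp
    fix \<phi> :: "complex \<Rightarrow> real" and K
    assume "\<And>k. Ck_on k UNIV \<phi>" "compact K" "K \<subseteq> ball 0 1" "\<And>z. z \<notin> K \<Longrightarrow> \<phi> z = 0"
    then have p: "smooth_supp (ball 0 1) \<phi>" by (auto simp: smooth_supp_def)
    have "(- 1) ^ (a + b) *\<^sub>R (LBINT z. \<phi> z *\<^sub>R w z) = ((- 1) ^ (a + b) *\<^sub>R (LBINT z. \<phi> z *\<^sub>R w' z))"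
      by (rule trans[OF w(2)[unfolded weak_deriv_def, rule_format, OF p, symmetric] w'(2)[unfolded weak_deriv_def, rule_format, OF p]])
    then have "(LBINT z. \<phi> z *\<^sub>R w z) = (LBINT z. \<phi> z *\<^sub>R w' z)" by simp
    then show "(LBINT z. \<phi> z *\<^sub>R (w z - w' z)) = 0"
      using smooth_supp_mult_integrable[OF p i(1)] smooth_supp_mult_integrable[OF p i(2)] by (simp add: scaleR_diff_right)
  qed simp
  then show ?thesis using AE_not_sphere
  proof eventually_elim
    case (elim z)
    then show ?case using w w' by (cases "z \<in> disk") (auto simp: sq_integrable_def)
  qed
qed

lemma weak_deriv_cong_AE:
  assumes "AE z in lborel. w z = w' z" "w \<in> borel_measurable borel" "w' \<in> borel_measurable borel" "weak_deriv a b v w"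
  shows "weak_deriv a b v w'"
proof -
  have "(LBINT z. \<phi> z *\<^sub>R w z) = (LBINT z. \<phi> z *\<^sub>R w' z)" if "smooth_supp (ball 0 1) \<phi>" for \<phi>
    using assms smooth_supp_measurable[OF that] by (intro integral_cong_AE) (auto elim!: eventually_mono)
  then show ?thesis using assms(4) by (simp add: weak_deriv_def)
qed

text \<open>
  By uniqueness of weak derivatives the norm may be computed from any choice of Borel representatives.
\<close>

lemma sobolev_norm_eq:
  assumes v: "v \<in> sobolev k" and W: "\<And>a b. a + b \<le> k \<Longrightarrow> sq_integrable (W a b) \<and> weak_deriv a b v (W a b)"
  shows "sobolev_norm k v = sqrt (\<Sum>(a, b)\<in>{(a, b). a + b \<le> k}. LBINT z. (norm (W a b z))\<^sup>2)"
proof -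
  have cv: "cont_disk v" using v by (simp add: sobolev_iff)
  have "(LINT z|lebesgue_on disk. (norm ((SOME w. w \<in> L2_disk \<and> weak_pds a b v w) z))\<^sup>2) = (LBINT z. (norm (W a b z))\<^sup>2)" if ab: "a + b \<le> k" for a b
  proof -
    define s where "s = (SOME w. w \<in> L2_disk \<and> weak_pds a b v w)"
    have "\<exists>w. w \<in> L2_disk \<and> weak_pds a b v w" using v ab unfolding sobolev_def by blast
    then have s: "s \<in> L2_disk" "weak_pds a b v s" unfolding s_def by (metis (mono_tags, lifting) someI_ex)+
    obtain s' where s': "borel_version s s'" using borel_version_exists[of s] s by (auto simp: L2_disk_def)
    have "sq_integrable s'" "weak_deriv a b v s'" using s borel_version_L2(1)[OF s'] weak_pds_iff[OF cont_disk_borel_version[OF cv] s'] by auto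
    then have ae: "AE z in lborel. s' z = W a b z" using W[OF ab] by (intro weak_deriv_unique) auto
    have "(LINT z|lebesgue_on disk. (norm (s z))\<^sup>2) = (LBINT z. (norm (s' z))\<^sup>2)" by (rule borel_version_L2(2)[OF s'])
    also have "\<dots> = (LBINT z. (norm (W a b z))\<^sup>2)"
      using ae \<open>sq_integrable s'\<close> W[OF ab] by (intro integral_cong_AE) (auto simp: sq_integrable_def elim!: eventually_mono)
    finally show ?thesis by (simp add: s_def)
  qed
  then show ?thesis using v unfolding sobolev_norm_def by (auto intro!: arg_cong[of _ _ sqrt] sum.cong)
qed

lemma sobolev_reps:
  assumes "v \<in> sobolev k"
  obtains W where "\<And>a b. a + b \<le> k \<Longrightarrow> sq_integrable (W a b) \<and> weak_deriv a b v (W a b)"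
proof -
  have "\<forall>a b. \<exists>w. a + b \<le> k \<longrightarrow> sq_integrable w \<and> weak_deriv a b v w" using assms by (auto simp: sobolev_iff)
  then show thesis using that by metis
qed

lemma sq_integrable_linear:
  assumes "sq_integrable u" "sq_integrable v" shows "sq_integrable (\<lambda>z. c *\<^sub>R u z + d *\<^sub>R v z)"
  unfolding sq_integrable_def
proof (intro conjI)
  have [measurable]: "u \<in> borel_measurable borel" "v \<in> borel_measurable borel" using assms by (auto simp: sq_integrable_def)
  show "(\<lambda>z. c *\<^sub>R u z + d *\<^sub>R v z) \<in> borel_measurable borel" by measurable
  show "integrable lborel (\<lambda>z. (norm (c *\<^sub>R u z + d *\<^sub>R v z))\<^sup>2)"
  proof (rule Bochner_Integration.integrable_bound)
    show "integrable lborel (\<lambda>z. 2 * c\<^sup>2 * (norm (u z))\<^sup>2 + 2 * d\<^sup>2 * (norm (v z))\<^sup>2)"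
      using assms by (auto simp: sq_integrable_def)
    have "(norm (c *\<^sub>R u z + d *\<^sub>R v z))\<^sup>2 \<le> 2 * c\<^sup>2 * (norm (u z))\<^sup>2 + 2 * d\<^sup>2 * (norm (v z))\<^sup>2" for z
    proof -
      have "(norm (c *\<^sub>R u z + d *\<^sub>R v z))\<^sup>2 \<le> (norm (c *\<^sub>R u z) + norm (d *\<^sub>R v z))\<^sup>2"
        by (intro power_mono norm_triangle_ineq) auto
      also have "\<dots> \<le> 2 * (norm (c *\<^sub>R u z))\<^sup>2 + 2 * (norm (d *\<^sub>R v z))\<^sup>2"
        using zero_le_power2[of "norm (c *\<^sub>R u z) - norm (d *\<^sub>R v z)"] by (simp add: power2_sum power2_diff)
      also have "\<dots> = 2 * c\<^sup>2 * (norm (u z))\<^sup>2 + 2 * d\<^sup>2 * (norm (v z))\<^sup>2" by (simp add: power_mult_distrib)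
      finally show ?thesis .
    qed
    then show "AE z in lborel. norm ((norm (c *\<^sub>R u z + d *\<^sub>R v z))\<^sup>2) \<le> norm (2 * c\<^sup>2 * (norm (u z))\<^sup>2 + 2 * d\<^sup>2 * (norm (v z))\<^sup>2)"
      by (intro AE_I2) (simp add: abs_of_nonneg)
  qed measurable
qed (use assms in \<open>auto simp: sq_integrable_def\<close>)

lemma sobolev_linear:
  assumes u: "u \<in> sobolev k" and v: "v \<in> sobolev k"
  shows "(\<lambda>z. c *\<^sub>R u z + d *\<^sub>R v z) \<in> sobolev k"
  unfolding sobolev_iff
proof (intro conjI allI impI)
  have cu: "cont_disk u" and cv: "cont_disk v" using u v by (auto simp: sobolev_iff)
  then show "cont_disk (\<lambda>z. c *\<^sub>R u z + d *\<^sub>R v z)" by (auto simp: cont_disk_def intro!: continuous_intros)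
  fix a b assume "a + b \<le> k"
  then obtain w w' where "sq_integrable w" "weak_deriv a b u w" "sq_integrable w'" "weak_deriv a b v w'" using u v unfolding sobolev_iff by meson
  note w = this
  note i = sq_integrable_imp_integrable(1)[OF cont_disk_sq_integrable[OF cu]] sq_integrable_imp_integrable(1)[OF cont_disk_sq_integrable[OF cv]]
    sq_integrable_imp_integrable(1)[OF w(1)] sq_integrable_imp_integrable(1)[OF w(3)]
  show "\<exists>w. sq_integrable w \<and> weak_deriv a b (\<lambda>z. c *\<^sub>R u z + d *\<^sub>R v z) w"
    using sq_integrable_linear[OF w(1,3)] weak_deriv_linear[OF i(1,3) w(2) i(2,4) w(4)] by blast
qed

lemma sobolev_zero: "(\<lambda>_. 0) \<in> sobolev k"
  unfolding sobolev_iff by (auto simp: cont_disk_def sq_integrable_def weak_deriv_def intro!: exI[of _ "\<lambda>_. 0"])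

text \<open>
  The triangle inequality of an \<open>L\<^sup>2\<close> norm follows from the pointwise inequality
  \<open>\<bar>x + y\<bar>\<^sup>2 \<le> (1 + t) \<bar>x\<bar>\<^sup>2 + (1 + 1 / t) \<bar>y\<bar>\<^sup>2\<close> by choosing the best \<open>t\<close>, namely \<open>\<surd>(B / A)\<close>; \<open>A\<close> and \<open>B\<close> are made positive first.
\<close>

lemma sqrt_triangle_from_AMGM:
  fixes S A B :: real
  assumes A: "0 \<le> A" and B: "0 \<le> B" and S: "\<And>t. t > 0 \<Longrightarrow> S \<le> (1 + t) * A + (1 + 1/t) * B"
  shows "sqrt S \<le> sqrt A + sqrt B"
proof (rule field_le_epsilon)
  fix e :: real assume e: "0 < e"
  define d where "d = (e / 2)\<^sup>2"
  have d: "d > 0" "sqrt d = e / 2" using e by (simp_all add: d_def)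
  define a b where "a = sqrt (A + d)" and "b = sqrt (B + d)"
  have ab: "a > 0" "b > 0" "a * a = A + d" "b * b = B + d" using A B d by (simp_all add: a_def b_def)
  have "S \<le> (1 + b / a) * A + (1 + 1 / (b / a)) * B" using ab by (intro S) simp
  also have "\<dots> \<le> (1 + b / a) * (a * a) + (1 + 1 / (b / a)) * (b * b)"
    using ab d by (intro add_mono mult_left_mono) (auto simp: add_nonneg_nonneg)
  also have "\<dots> = (a + b)\<^sup>2" using ab(1,2) by (simp add: field_simps power2_eq_square)
  finally have "sqrt S \<le> a + b" using ab by (intro real_le_lsqrt) auto
  also have "\<dots> \<le> (sqrt A + sqrt d) + (sqrt B + sqrt d)"
    unfolding a_def b_def using A B d by (intro add_mono sqrt_add_le_add_sqrt) auto
  also have "\<dots> = sqrt A + sqrt B + e" using d by simp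
  finally show "sqrt S \<le> sqrt A + sqrt B + e" .
qed

lemma finite_orders: "finite {(a, b). a + b \<le> (k::nat)}"
  by (rule finite_subset[of _ "{..k} \<times> {..k}"]) auto

lemma sobolev_norm_properties:
  assumes u: "u \<in> sobolev k" and v: "v \<in> sobolev k"
  shows "sobolev_norm k (\<lambda>z. u z + v z) \<le> sobolev_norm k u + sobolev_norm k v"
    "sobolev_norm k (\<lambda>z. c *\<^sub>R u z) = \<bar>c\<bar> * sobolev_norm k u"
    "sobolev_norm k u = 0 \<Longrightarrow> u = (\<lambda>_. 0)"
proof -
  let ?I = "{(a, b). a + b \<le> k}"
  obtain W where W: "\<And>a b. a + b \<le> k \<Longrightarrow> sq_integrable (W a b) \<and> weak_deriv a b u (W a b)" using sobolev_reps[OF u] by blast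
  obtain X where X: "\<And>a b. a + b \<le> k \<Longrightarrow> sq_integrable (X a b) \<and> weak_deriv a b v (X a b)" using sobolev_reps[OF v] by blast
  have cu: "cont_disk u" and cv: "cont_disk v" using u v by (auto simp: sobolev_iff)
  have iu: "integrable lborel u" "integrable lborel v" using cu cv by (auto intro: sq_integrable_imp_integrable cont_disk_sq_integrable)
  define A where "A = (\<Sum>(a, b)\<in>?I. LBINT z. (norm (W a b z))\<^sup>2)"
  define B where "B = (\<Sum>(a, b)\<in>?I. LBINT z. (norm (X a b z))\<^sup>2)"
  have AB: "0 \<le> A" "0 \<le> B" unfolding A_def B_def by (auto intro!: sum_nonneg)
  have nu: "sobolev_norm k u = sqrt A" and nv: "sobolev_norm k v = sqrt B"
    using sobolev_norm_eq[OF u W] sobolev_norm_eq[OF v X] by (auto simp: A_def B_def)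
  have "sq_integrable (\<lambda>z. 1 *\<^sub>R W a b z + 1 *\<^sub>R X a b z) \<and> weak_deriv a b (\<lambda>z. 1 *\<^sub>R u z + 1 *\<^sub>R v z) (\<lambda>z. 1 *\<^sub>R W a b z + 1 *\<^sub>R X a b z)" if "a + b \<le> k" for a b
    using W[OF that] X[OF that] iu by (intro conjI sq_integrable_linear weak_deriv_linear) (auto intro: sq_integrable_imp_integrable)
  from sobolev_norm_eq[OF sobolev_linear[OF u v, of 1 1] this]
  have ns: "sobolev_norm k (\<lambda>z. u z + v z) = sqrt (\<Sum>(a, b)\<in>?I. LBINT z. (norm (W a b z + X a b z))\<^sup>2)" by simp
  have sc: "sobolev_norm k (\<lambda>z. c *\<^sub>R u z) = \<bar>c\<bar> * sobolev_norm k u"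
  proof -
    have "sq_integrable (\<lambda>z. c *\<^sub>R W a b z + 0 *\<^sub>R W a b z) \<and> weak_deriv a b (\<lambda>z. c *\<^sub>R u z + 0 *\<^sub>R u z) (\<lambda>z. c *\<^sub>R W a b z + 0 *\<^sub>R W a b z)" if "a + b \<le> k" for a b
      using W[OF that] iu by (intro conjI sq_integrable_linear weak_deriv_linear) (auto intro: sq_integrable_imp_integrable)
    from sobolev_norm_eq[OF sobolev_linear[OF u u, of c 0] this]
    have "sobolev_norm k (\<lambda>z. c *\<^sub>R u z) = sqrt (\<Sum>(a, b)\<in>?I. LBINT z. c\<^sup>2 * (norm (W a b z))\<^sup>2)"
      by (simp add: power_mult_distrib)
    also have "\<dots> = sqrt (c\<^sup>2 * A)" by (simp add: A_def sum_distrib_left case_prod_unfold)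
    finally show ?thesis by (simp add: nu real_sqrt_mult)
  qed
  then show "sobolev_norm k (\<lambda>z. c *\<^sub>R u z) = \<bar>c\<bar> * sobolev_norm k u" .
  show "sobolev_norm k (\<lambda>z. u z + v z) \<le> sobolev_norm k u + sobolev_norm k v"
    unfolding ns nu nv
  proof (rule sqrt_triangle_from_AMGM[OF AB])
    fix t :: real assume t: "t > 0"
    have pt: "(norm (x + y))\<^sup>2 \<le> (1 + t) * (norm x)\<^sup>2 + (1 + 1/t) * (norm y)\<^sup>2" for x y :: 'a
    proof -
      have "(norm (x + y))\<^sup>2 \<le> (norm x + norm y)\<^sup>2" by (intro power_mono norm_triangle_ineq) auto
      also have "\<dots> \<le> (1 + t) * (norm x)\<^sup>2 + (1 + 1/t) * (norm y)\<^sup>2"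
      proof -
        have "0 \<le> (t * norm x - norm y)\<^sup>2 / t" using t by simp
        also have "\<dots> = t * (norm x)\<^sup>2 + (norm y)\<^sup>2 / t - 2 * norm x * norm y"
          using t by (simp add: power2_eq_square field_simps)
        finally show ?thesis by (simp add: power2_sum algebra_simps)
      qed
      finally show ?thesis .
    qed
    have "(\<Sum>(a, b)\<in>?I. LBINT z. (norm (W a b z + X a b z))\<^sup>2) \<le>
       (\<Sum>(a, b)\<in>?I. (1 + t) * (LBINT z. (norm (W a b z))\<^sup>2) + (1 + 1/t) * (LBINT z. (norm (X a b z))\<^sup>2))"
    proof (intro sum_mono, clarsimp)
      fix a b assume ab: "a + b \<le> k"
      have i: "integrable lborel (\<lambda>z. (norm (W a b z))\<^sup>2)" "integrable lborel (\<lambda>z. (norm (X a b z))\<^sup>2)"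
        "integrable lborel (\<lambda>z. (norm (1 *\<^sub>R W a b z + 1 *\<^sub>R X a b z))\<^sup>2)"
        using W[OF ab] X[OF ab] sq_integrable_linear[of "W a b" "X a b" 1 1] by (auto simp: sq_integrable_def)
      have "(LBINT z. (norm (W a b z + X a b z))\<^sup>2) \<le> (LBINT z. (1 + t) * (norm (W a b z))\<^sup>2 + (1 + 1/t) * (norm (X a b z))\<^sup>2)"
        using i pt by (intro integral_mono) auto
      then show "(LBINT z. (norm (W a b z + X a b z))\<^sup>2) \<le> (1 + t) * (LBINT z. (norm (W a b z))\<^sup>2) + (1 + 1/t) * (LBINT z. (norm (X a b z))\<^sup>2)"
        using i by simp
    qed
    also have "\<dots> = (1 + t) * A + (1 + 1/t) * B"
      by (simp add: A_def B_def case_prod_unfold sum.distrib sum_distrib_left)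
    finally show "(\<Sum>(a, b)\<in>?I. LBINT z. (norm (W a b z + X a b z))\<^sup>2) \<le> (1 + t) * A + (1 + 1/t) * B" .
  qed
  assume "sobolev_norm k u = 0"
  then have "A = 0" using AB nu by simp
  then have "(LBINT z. (norm (W 0 0 z))\<^sup>2) = 0"
    unfolding A_def by (subst (asm) sum_nonneg_eq_0_iff) (auto simp: finite_orders)
  then have "AE z in lborel. (norm (W 0 0 z))\<^sup>2 = 0"
    using W[of 0 0] by (subst (asm) integral_nonneg_eq_0_iff_AE) (auto simp: sq_integrable_def)
  moreover have "AE z in lborel. W 0 0 z = u z"
    by (rule weak_deriv_unique[of "W 0 0" 0 0 u]) (use W[of 0 0] cont_disk_sq_integrable[OF cu] in \<open>auto simp: weak_deriv_def pds_def\<close>)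
  ultimately have ae: "AE z in lborel. z \<in> ball 0 1 \<longrightarrow> u z = 0" by eventually_elim auto
  have "u z = 0" if "z \<in> ball 0 1" for z
    by (rule AE_open_eq[OF open_ball _ _ ae that]) (use cu in \<open>auto simp: cont_disk_def intro: continuous_on_subset\<close>)
  then have "u z = 0" if "z \<in> closure (ball 0 1)" for z
    using continuous_constant_on_closure[of "ball 0 1" u 0 z] cu that by (auto simp: cont_disk_def)
  then show "u = (\<lambda>_. 0)" using cu by (auto simp: cont_disk_def fun_eq_iff)
qed

section \<open>Sobolev functions are differentiable up to the boundary\<close>

text \<open>
  Also at boundary points the closed disk contains segments in two independent directions: a linear map that
  vanishes on all \<open>y - p\<close> with \<open>y\<close> in the disk vanishes.
\<close>

lemma disk_derivative_unique:
  fixes f :: "complex \<Rightarrow> 'b::real_normed_vector"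
  assumes D: "(f has_derivative D) (at p within disk)" and D': "(f has_derivative D') (at p within disk)" and p: "p \<in> disk"
  shows "D = D'"
proof -
  define L where "L h = D h - D' h" for h
  have "((\<lambda>x. f x - f x) has_derivative L) (at p within disk)"
    unfolding L_def by (rule has_derivative_diff[OF D D'])
  then have L: "((\<lambda>x. 0::'b) has_derivative L) (at p within disk)" by simp
  then interpret L: bounded_linear L by (rule has_derivative_bounded_linear)
  have 0: "L (y - p) = 0" if y: "y \<in> disk" for y
  proof (rule ccontr)
    assume n: "L (y - p) \<noteq> 0"
    then have yp: "norm (y - p) > 0" using L.zero by auto
    define e where "e = norm (L (y - p)) / (2 * norm (y - p))"
    have e: "e > 0" using n yp by (simp add: e_def)
    obtain d where d: "d > 0" "\<And>x. x \<in> disk \<Longrightarrow> norm (x - p) < d \<Longrightarrow> norm (L (x - p)) \<le> e * norm (x - p)"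
      using L e unfolding has_derivative_within_alt by auto
    define t where "t = min 1 (d / (2 * norm (y - p)))"
    have t: "0 < t" "t \<le> 1" "t * norm (y - p) < d"
    proof -
      show "0 < t" "t \<le> 1" using d(1) yp by (auto simp: t_def)
      have "t * norm (y - p) \<le> d / (2 * norm (y - p)) * norm (y - p)" using yp by (intro mult_right_mono) (auto simp: t_def)
      also have "\<dots> < d" using yp d(1) by (simp add: field_simps)
      finally show "t * norm (y - p) < d" .
    qed
    have "(1 - t) *\<^sub>R p + t *\<^sub>R y \<in> disk" using t p y by (intro convexD[OF convex_cball]) auto
    moreover have "(1 - t) *\<^sub>R p + t *\<^sub>R y - p = t *\<^sub>R (y - p)" by (simp add: algebra_simps)
    ultimately have "norm (L (t *\<^sub>R (y - p))) \<le> e * norm (t *\<^sub>R (y - p))"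
      using d(2)[of "(1 - t) *\<^sub>R p + t *\<^sub>R y"] t by simp
    then have "norm (L (y - p)) \<le> e * norm (y - p)" using t by (simp add: L.scaleR)
    also have "\<dots> = norm (L (y - p)) / 2" using yp by (simp add: e_def)
    finally show False using n by simp
  qed
  have "L 1 = 0" "L \<i> = 0"
    using 0[of 1] 0[of 0] 0[of \<i>] L.diff[of 1 p] L.diff[of \<i> p] L.diff[of 0 p] L.zero by auto
  moreover have "L h = Re h *\<^sub>R L 1 + Im h *\<^sub>R L \<i>" for h
  proof -
    have "L (Re h *\<^sub>R 1 + Im h *\<^sub>R \<i>) = Re h *\<^sub>R L 1 + Im h *\<^sub>R L \<i>" unfolding L.add L.scaleR ..
    moreover have "Re h *\<^sub>R 1 + Im h *\<^sub>R \<i> = h" by (simp add: complex_eq_iff)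
    ultimately show ?thesis by metis
  qed
  ultimately have "L h = 0" for h by (metis add_0 scaleR_zero_right)
  then show ?thesis by (auto simp: L_def fun_eq_iff)
qed

lemma pd_disk_eq:
  assumes D: "(f has_derivative D) (at p within disk)" and p: "p \<in> disk"
  shows "pd disk e f p = D e"
proof -
  have "(f has_derivative frechet_derivative f (at p within disk)) (at p within disk)"
    using D by (auto simp: frechet_derivative_works[symmetric] differentiable_def)
  from disk_derivative_unique[OF this D p] show ?thesis using p by (simp add: pd_def)
qed

lemma weak_deriv_imp_weak_dir_1:
  assumes "integrable lborel w" "integrable lborel w1" "weak_deriv a b v w" "weak_deriv (Suc a) b v w1"
  shows "weak_dir 1 w w1"
  unfolding weak_dir_def
proof (intro conjI allI impI assms(1,2))
  fix \<phi> assume c: "smooth_supp (ball 0 1) \<phi>"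
  have "(LBINT z. pds UNIV (Suc a) b \<phi> z *\<^sub>R v z) = (- 1) ^ (a + b) *\<^sub>R (LBINT z. pd UNIV 1 \<phi> z *\<^sub>R w z)"
    using assms(3) smooth_supp_pd[OF c, of 1] by (simp add: weak_deriv_def pds_pd_1[OF c, symmetric])
  moreover have "(LBINT z. pds UNIV (Suc a) b \<phi> z *\<^sub>R v z) = (- 1) ^ (Suc a + b) *\<^sub>R (LBINT z. \<phi> z *\<^sub>R w1 z)"
    using assms(4) c by (simp add: weak_deriv_def)
  ultimately have "(- 1) ^ (a + b) *\<^sub>R (LBINT z. pd UNIV 1 \<phi> z *\<^sub>R w z) = (- 1) ^ (a + b) *\<^sub>R (- (LBINT z. \<phi> z *\<^sub>R w1 z))"
    by simp
  then show "(LBINT z. pd UNIV 1 \<phi> z *\<^sub>R w z) = - (LBINT z. \<phi> z *\<^sub>R w1 z)"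
    by (simp only: scaleR_cancel_left) simp
qed

lemma weak_deriv_imp_weak_dir_i:
  assumes "integrable lborel w" "integrable lborel w1" "weak_deriv a b v w" "weak_deriv a (Suc b) v w1"
  shows "weak_dir \<i> w w1"
  unfolding weak_dir_def
proof (intro conjI allI impI assms(1,2))
  fix \<phi> assume c: "smooth_supp (ball 0 1) \<phi>"
  have "(LBINT z. pds UNIV a (Suc b) \<phi> z *\<^sub>R v z) = (- 1) ^ (a + b) *\<^sub>R (LBINT z. pd UNIV \<i> \<phi> z *\<^sub>R w z)"
    using assms(3) smooth_supp_pd[OF c, of \<i>] by (simp add: weak_deriv_def pds_pd_i[symmetric])
  moreover have "(LBINT z. pds UNIV a (Suc b) \<phi> z *\<^sub>R v z) = (- 1) ^ (Suc a + b) *\<^sub>R (LBINT z. \<phi> z *\<^sub>R w1 z)"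
    using assms(4) c by (simp add: weak_deriv_def)
  ultimately have "(- 1) ^ (a + b) *\<^sub>R (LBINT z. pd UNIV \<i> \<phi> z *\<^sub>R w z) = (- 1) ^ (a + b) *\<^sub>R (- (LBINT z. \<phi> z *\<^sub>R w1 z))"
    by simp
  then show "(LBINT z. pd UNIV \<i> \<phi> z *\<^sub>R w z) = - (LBINT z. \<phi> z *\<^sub>R w1 z)"
    by (simp only: scaleR_cancel_left) simp
qed

lemma pds_10: "pds S (Suc 0) 0 f = pd S 1 f" and pds_01: "pds S 0 (Suc 0) f = pd S \<i> f"
  by (simp_all add: pds_def)

text \<open>
  A weak derivative of \<open>v\<close> of higher order is a weak derivative of the first derivative of \<open>v\<close>.
\<close>

lemma weak_deriv_shift_1:
  assumes g: "weak_deriv 1 0 v g" and w: "weak_deriv (Suc c) d v w" shows "weak_deriv c d g w"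
  unfolding weak_deriv_def
proof (intro allI impI)
  fix \<phi> assume p: "smooth_supp (ball 0 1) \<phi>"
  have "(LBINT z. pds UNIV (Suc c) d \<phi> z *\<^sub>R v z) = - (LBINT z. pds UNIV c d \<phi> z *\<^sub>R g z)"
    using g[unfolded weak_deriv_def, rule_format, OF smooth_supp_pds[OF p, of c d]] by (simp add: pds_10 pd_1_pds)
  moreover have "(LBINT z. pds UNIV (Suc c) d \<phi> z *\<^sub>R v z) = (- 1) ^ (Suc c + d) *\<^sub>R (LBINT z. \<phi> z *\<^sub>R w z)"
    using w p by (simp add: weak_deriv_def)
  ultimately show "(LBINT z. pds UNIV c d \<phi> z *\<^sub>R g z) = (- 1) ^ (c + d) *\<^sub>R (LBINT z. \<phi> z *\<^sub>R w z)"
    by simp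
qed

lemma weak_deriv_shift_i:
  assumes g: "weak_deriv 0 1 v g" and w: "weak_deriv c (Suc d) v w" shows "weak_deriv c d g w"
  unfolding weak_deriv_def
proof (intro allI impI)
  fix \<phi> assume p: "smooth_supp (ball 0 1) \<phi>"
  have "(LBINT z. pds UNIV c (Suc d) \<phi> z *\<^sub>R v z) = - (LBINT z. pds UNIV c d \<phi> z *\<^sub>R g z)"
    using g[unfolded weak_deriv_def, rule_format, OF smooth_supp_pds[OF p, of c d]] by (simp add: pds_01 pd_i_pds[OF p])
  moreover have "(LBINT z. pds UNIV c (Suc d) \<phi> z *\<^sub>R v z) = (- 1) ^ (Suc c + d) *\<^sub>R (LBINT z. \<phi> z *\<^sub>R w z)"
    using w p by (simp add: weak_deriv_def)
  ultimately show "(LBINT z. pds UNIV c d \<phi> z *\<^sub>R g z) = (- 1) ^ (c + d) *\<^sub>R (LBINT z. \<phi> z *\<^sub>R w z)"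
    by simp
qed

text \<open>
  The representative is extended by 0 off the closed disk; the circle where it may differ from \<open>W 0 0\<close> is a null set.
\<close>

lemma continuous_representative:
  fixes W :: "nat \<Rightarrow> nat \<Rightarrow> complex \<Rightarrow> 'b::euclidean_space"
  assumes W: "weak_jet W" and z: "\<And>x. x \<notin> disk \<Longrightarrow> W 0 0 x = 0"
  obtains g where "cont_disk g" "AE x in lborel. W 0 0 x = g x" "\<And>x. norm (g x) \<le> 320 * jet_L1_norm W"
proof -
  obtain G where G: "continuous_on disk G" "\<And>x. norm (G x) \<le> 320 * jet_L1_norm W" "AE x in lborel. x \<in> ball 0 1 \<longrightarrow> W 0 0 x = G x"
    using glue_representatives[OF local_representative[OF W]] by blast
  have S: "0 \<le> 320 * jet_L1_norm W" using G(2)[of 0] norm_ge_zero order_trans by blast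
  define g where "g x = (if x \<in> disk then G x else 0)" for x
  have "continuous_on disk g" using G(1) by (subst continuous_on_cong[OF refl, of _ _ G]) (auto simp: g_def)
  then have "cont_disk g" by (auto simp: cont_disk_def g_def)
  moreover have "AE x in lborel. W 0 0 x = g x"
    using G(3) AE_not_sphere by eventually_elim (use z in \<open>auto simp: g_def\<close>)
  moreover have "norm (g x) \<le> 320 * jet_L1_norm W" for x using G(2)[of x] S by (simp add: g_def)
  ultimately show thesis by (rule that)
qed

lemma weak_jet_reps:
  assumes W: "\<And>a b. a + b \<le> 2 \<Longrightarrow> sq_integrable (W a b) \<and> weak_deriv (p + a) (q + b) v (W a b)"
  shows "weak_jet W"
proof -
  have i: "integrable lborel (W a b)" if "a + b \<le> 2" for a b using W[OF that] sq_integrable_imp_integrable by blast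
  have "weak_dir 1 (W a b) (W (Suc a) b)" "weak_dir \<i> (W a b) (W a (Suc b))" if "a + b \<le> 1" for a b
    using that W[of a b] W[of "Suc a" b] W[of a "Suc b"] i[of a b] i[of "Suc a" b] i[of a "Suc b"]
    by (auto intro: weak_deriv_imp_weak_dir_1[of _ _ "p + a" "q + b" v] weak_deriv_imp_weak_dir_i[of _ _ "p + a" "q + b" v])
  from this[of 0 0] this[of 1 0] this[of 0 1] show ?thesis by (simp add: weak_jet_def numeral_2_eq_2)
qed

text \<open>
  For \<open>k \<ge> 2\<close> the first weak derivatives of \<open>v\<close> have weak derivatives up to order two, so they have continuous
  representatives.
\<close>

lemma sobolev_step:
  assumes v: "v \<in> sobolev (Suc k)" and k: "2 \<le> k"
  obtains g1 g2 where "g1 \<in> sobolev k" "g2 \<in> sobolev k" "weak_deriv 1 0 v g1" "weak_deriv 0 1 v g2"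
proof -
  obtain W where W: "\<And>a b. a + b \<le> Suc k \<Longrightarrow> sq_integrable (W a b) \<and> weak_deriv a b v (W a b)" using sobolev_reps[OF v] by blast
  have "weak_jet (\<lambda>a b. W (Suc a) b)" by (rule weak_jet_reps[of _ 1 0 v]) (use W k in auto)
  then obtain g1 where g1: "cont_disk g1" "AE x in lborel. W 1 0 x = g1 x"
    by (rule continuous_representative) (use W[of 1 0] in \<open>auto simp: sq_integrable_def\<close>)
  have "weak_jet (\<lambda>a b. W a (Suc b))" by (rule weak_jet_reps[of _ 0 1 v]) (use W k in auto)
  then obtain g2 where g2: "cont_disk g2" "AE x in lborel. W 0 1 x = g2 x"
    by (rule continuous_representative) (use W[of 0 1] in \<open>auto simp: sq_integrable_def\<close>)
  have w1: "weak_deriv 1 0 v g1" using weak_deriv_cong_AE[OF g1(2)] W[of 1 0] cont_disk_measurable[OF g1(1)] by (auto simp: sq_integrable_def)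
  have w2: "weak_deriv 0 1 v g2" using weak_deriv_cong_AE[OF g2(2)] W[of 0 1] cont_disk_measurable[OF g2(1)] by (auto simp: sq_integrable_def)
  have "g1 \<in> sobolev k"
    unfolding sobolev_iff
  proof (intro conjI allI impI g1)
    fix a b assume "a + b \<le> k"
    then show "\<exists>w. sq_integrable w \<and> weak_deriv a b g1 w" using W[of "Suc a" b] weak_deriv_shift_1[OF w1] by auto
  qed
  moreover have "g2 \<in> sobolev k"
    unfolding sobolev_iff
  proof (intro conjI allI impI g2)
    fix a b assume "a + b \<le> k"
    then show "\<exists>w. sq_integrable w \<and> weak_deriv a b g2 w" using W[of a "Suc b"] weak_deriv_shift_i[OF w2] by auto
  qed
  ultimately show thesis using w1 w2 by (rule that)
qed

text \<open>
  The line formula writes the increment of \<open>v\<close> as the integral of the gradient along the segment, first for almost every starting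
  point; both sides of the estimate are continuous, so it holds for every starting point. Only points of the open disk are
  covered.
\<close>

lemma weak_gradient_estimate:
  fixes v g1 g2 :: "complex \<Rightarrow> 'b::euclidean_space"
  assumes v: "cont_disk v" and g: "cont_disk g1" "cont_disk g2" and w: "weak_deriv 1 0 v g1" "weak_deriv 0 1 v g2"
    and \<delta>: "\<And>z. z \<in> disk \<Longrightarrow> dist z p < \<delta> \<Longrightarrow> norm (g1 z - g1 p) \<le> e \<and> norm (g2 z - g2 p) \<le> e"
    and xy: "x \<in> ball 0 1 \<inter> ball p \<delta>" "y \<in> ball 0 1 \<inter> ball p \<delta>"
  shows "norm (v y - v x - (Re (y - x) *\<^sub>R g1 p + Im (y - x) *\<^sub>R g2 p)) \<le> 2 * e * norm (y - x)"
proof -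
  define h where "h = y - x"
  define wh where "wh z = Re h *\<^sub>R g1 z + Im h *\<^sub>R g2 z" for z
  define B where "B = ball 0 1 \<inter> ball p \<delta>"
  have cB: "convex B" unfolding B_def by (intro convex_Int convex_ball)
  define \<Omega> where "\<Omega> = B \<inter> (\<lambda>z. z + h) -` B"
  have O: "open \<Omega>" unfolding \<Omega>_def B_def
    by (intro open_Int open_ball open_vimage continuous_intros)
  have seg: "z + s *\<^sub>R h \<in> B" if "z \<in> \<Omega>" "0 \<le> s" "s \<le> 1" for z s
  proof -
    have "(1 - s) *\<^sub>R z + s *\<^sub>R (z + h) \<in> B" using that by (intro convexD[OF cB]) (auto simp: \<Omega>_def)
    then show ?thesis by (simp add: algebra_simps)
  qed
  have i: "integrable lborel v" "integrable lborel g1" "integrable lborel g2"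
    using v g by (auto intro: sq_integrable_imp_integrable cont_disk_sq_integrable)
  have "weak_dir 1 v g1" "weak_dir \<i> v g2"
    using i w by (auto simp: weak_dir_def weak_deriv_def pds_def)
  from weak_dir_combine_directions[OF this, of h] have wd: "weak_dir h v wh" by (simp add: wh_def[abs_def])
  have cv: "continuous_on disk v" and cg: "continuous_on disk g1" "continuous_on disk g2" using v g by (auto simp: cont_disk_def)
  have Bd: "B \<subseteq> disk" by (auto simp: B_def)
  have "AE z in lborel. z \<in> \<Omega> \<longrightarrow> norm (v (z + h) - v z - wh p) \<le> 2 * e * norm h"
    using line_formula[OF wd O, of 1 0]
  proof (rule AE_mp, goal_cases)
    case 1 then show ?case using seg Bd by (auto simp: B_def)
  next
    case 2
    show ?case
    proof (intro AE_I2 impI)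
      fix z assume z: "z \<in> \<Omega>" and eq: "z \<in> \<Omega> \<longrightarrow> (1 + 0) *\<^sub>R v (z + h) - 1 *\<^sub>R v z =
        (LBINT s. indicator {0..1} s *\<^sub>R (0 *\<^sub>R v (z + s *\<^sub>R h) + (1 + 0 * s) *\<^sub>R wh (z + s *\<^sub>R h)))"
      have "continuous_on {0..1} (\<lambda>s::real. wh (z + s *\<^sub>R h))"
        unfolding wh_def using seg[OF z] Bd
        by (intro continuous_intros continuous_on_compose2[OF cg(1)] continuous_on_compose2[OF cg(2)]) auto
      then have j: "integrable lborel (\<lambda>s. indicator {0..1} s *\<^sub>R wh (z + s *\<^sub>R h))"
        by (intro borel_integrable_compact) auto
      have j1: "integrable lborel (indicat_real {0..1::real})" by (intro integrable_real_indicator) auto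
      have j2: "integrable lborel (\<lambda>s::real. indicat_real {0..1::real} s *\<^sub>R wh p)" by (intro integrable_scaleR_left j1)
      have j3: "(LBINT s. indicat_real {0..1::real} s *\<^sub>R wh p) = wh p"
        using integral_scaleR_left[OF j1, of "wh p"] by simp
      have "v (z + h) - v z - wh p = (LBINT s. indicator {0..1} s *\<^sub>R wh (z + s *\<^sub>R h)) - (LBINT s. indicat_real {0..1::real} s *\<^sub>R wh p)"
        using eq z j3 by simp
      also have "\<dots> = (LBINT s. indicator {0..1} s *\<^sub>R (wh (z + s *\<^sub>R h) - wh p))"
        using j j2 by (simp add: scaleR_diff_right)
      finally have "norm (v (z + h) - v z - wh p) \<le> (LBINT s. norm (indicator {0..1} s *\<^sub>R (wh (z + s *\<^sub>R h) - wh p)))"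
        using integral_norm_bound by metis
      also have "\<dots> \<le> (LBINT s. indicat_real {0..1::real} s * (2 * e * norm h))"
      proof (rule integral_mono)
        show "integrable lborel (\<lambda>s. norm (indicator {0..1} s *\<^sub>R (wh (z + s *\<^sub>R h) - wh p)))"
          using Bochner_Integration.integrable_diff[OF j j2] by (intro integrable_norm) (simp add: scaleR_diff_right)
        fix s :: real
        show "norm (indicator {0..1} s *\<^sub>R (wh (z + s *\<^sub>R h) - wh p)) \<le> indicat_real {0..1::real} s * (2 * e * norm h)"
        proof (cases "0 \<le> s \<and> s \<le> 1")
          case True
          define q where "q = z + s *\<^sub>R h"
          have q: "q \<in> disk" "dist q p < \<delta>" using seg[OF z, of s] True by (auto simp: q_def B_def dist_commute)
          have "wh q - wh p = Re h *\<^sub>R (g1 q - g1 p) + Im h *\<^sub>R (g2 q - g2 p)" by (simp add: wh_def algebra_simps)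
          also have "norm \<dots> \<le> norm h * e + norm h * e"
            using \<delta>[OF q] abs_Re_le_cmod[of h] abs_Im_le_cmod[of h]
            by (intro norm_triangle_le add_mono) (auto intro!: mult_mono)
          finally show ?thesis using True by (simp add: q_def mult_ac)
        qed auto
      qed (use j1 in simp)
      also have "\<dots> = 2 * e * norm h" by simp
      finally show "norm (v (z + h) - v z - wh p) \<le> 2 * e * norm h" .
    qed
  qed
  then have "norm (v (x + h) - v x - wh p) \<le> 2 * e * norm h"
  proof (rule AE_open_le[OF O, rotated])
    show "x \<in> \<Omega>" using xy by (auto simp: \<Omega>_def B_def h_def)
    show "continuous_on \<Omega> (\<lambda>z. norm (v (z + h) - v z - wh p))"
      using Bd by (intro continuous_intros continuous_on_compose2[OF cv]) (auto simp: \<Omega>_def)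
  qed
  then show ?thesis by (simp add: h_def wh_def)
qed

text \<open>
  At a boundary point the estimate is obtained by shrinking \<open>p\<close> and \<open>y\<close> radially into the open disk and passing to the
  limit.
\<close>

lemma weak_gradient_imp_derivative:
  fixes v g1 g2 :: "complex \<Rightarrow> 'b::euclidean_space"
  assumes v: "cont_disk v" and g: "cont_disk g1" "cont_disk g2" and w: "weak_deriv 1 0 v g1" "weak_deriv 0 1 v g2" and p: "p \<in> disk"
  shows "(v has_derivative (\<lambda>h. Re h *\<^sub>R g1 p + Im h *\<^sub>R g2 p)) (at p within disk)"
  unfolding has_derivative_within_alt
proof (intro conjI allI impI)
  show "bounded_linear (\<lambda>h. Re h *\<^sub>R g1 p + Im h *\<^sub>R g2 p)"
    by (intro bounded_linear_add bounded_linear_scaleR_left[THEN bounded_linear_compose] bounded_linear_Re bounded_linear_Im)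
  fix e :: real assume "0 < e"
  then have e2: "e / 2 > 0" by simp
  have c: "continuous (at p within disk) g1" "continuous (at p within disk) g2"
    using g p by (auto simp: cont_disk_def continuous_on_eq_continuous_within)
  obtain d1 where d1: "d1 > 0" "\<And>z. z \<in> disk \<Longrightarrow> dist z p < d1 \<Longrightarrow> dist (g1 z) (g1 p) < e / 2"
    using c(1) e2 unfolding continuous_within_eps_delta by metis
  obtain d2 where d2: "d2 > 0" "\<And>z. z \<in> disk \<Longrightarrow> dist z p < d2 \<Longrightarrow> dist (g2 z) (g2 p) < e / 2"
    using c(2) e2 unfolding continuous_within_eps_delta by metis
  define \<delta> where "\<delta> = min d1 d2"
  have \<delta>: "norm (g1 z - g1 p) \<le> e / 2 \<and> norm (g2 z - g2 p) \<le> e / 2" if "z \<in> disk" "dist z p < \<delta>" for z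
    using d1(2)[of z] d2(2)[of z] that by (auto simp: \<delta>_def dist_norm intro: less_imp_le)
  have "norm (v y - v p - (Re (y - p) *\<^sub>R g1 p + Im (y - p) *\<^sub>R g2 p)) \<le> e * norm (y - p)"
    if y: "y \<in> disk" "norm (y - p) < \<delta>" for y
  proof -
    \<comment> \<open>Radial shrinking factors.\<close>
    define t where "t n = 1 - inverse (real (Suc n))" for n
    have t: "t \<longlonglongrightarrow> 1" unfolding t_def using tendsto_diff[OF tendsto_const LIMSEQ_inverse_real_of_nat] by simp
    have t01: "0 \<le> t n" "t n < 1" for n by (auto simp: t_def field_simps)
    have tb: "t n *\<^sub>R z \<in> ball 0 1" "t n *\<^sub>R z \<in> disk" if "z \<in> disk" for z :: complex and n
    proof -
      have "t n * norm z \<le> t n * 1" using that t01 by (intro mult_left_mono) auto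
      then show "t n *\<^sub>R z \<in> ball 0 1" "t n *\<^sub>R z \<in> disk" using t01[of n] by auto
    qed
    have lim: "(\<lambda>n. t n *\<^sub>R z) \<longlonglongrightarrow> z" for z :: complex using tendsto_scaleR[OF t tendsto_const, of z] by simp
    have cv: "(\<lambda>n. v (t n *\<^sub>R z)) \<longlonglongrightarrow> v z" if "z \<in> disk" for z :: complex
      using v that tb(2)[OF that] by (intro continuous_on_tendsto_compose[OF _ lim]) (auto simp: cont_disk_def)
    have ev: "\<forall>\<^sub>F n in sequentially. t n *\<^sub>R z \<in> ball p \<delta>" if "dist z p < \<delta>" for z :: complex
      using topological_tendstoD[OF lim[of z] open_ball[of p \<delta>]] that by (auto simp: dist_commute)
    have "p \<in> disk" "dist p p < \<delta>" "dist y p < \<delta>" using p y d1(1) d2(1) by (auto simp: \<delta>_def dist_norm)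
    have "(\<lambda>n. 2 * (e / 2) * norm (t n *\<^sub>R y - t n *\<^sub>R p) - norm (v (t n *\<^sub>R y) - v (t n *\<^sub>R p) - (Re (t n *\<^sub>R y - t n *\<^sub>R p) *\<^sub>R g1 p + Im (t n *\<^sub>R y - t n *\<^sub>R p) *\<^sub>R g2 p)))
      \<longlonglongrightarrow> 2 * (e / 2) * norm (y - p) - norm (v y - v p - (Re (y - p) *\<^sub>R g1 p + Im (y - p) *\<^sub>R g2 p))"
      by (intro tendsto_intros lim cv p y)
    moreover have "\<forall>\<^sub>F n in sequentially. 0 \<le> 2 * (e / 2) * norm (t n *\<^sub>R y - t n *\<^sub>R p) - norm (v (t n *\<^sub>R y) - v (t n *\<^sub>R p) - (Re (t n *\<^sub>R y - t n *\<^sub>R p) *\<^sub>R g1 p + Im (t n *\<^sub>R y - t n *\<^sub>R p) *\<^sub>R g2 p))"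
      using ev[OF \<open>dist p p < \<delta>\<close>] ev[OF \<open>dist y p < \<delta>\<close>]
    proof eventually_elim
      case (elim n)
      then show ?case
        using weak_gradient_estimate[OF v g w \<delta>, where x = "t n *\<^sub>R p" and y = "t n *\<^sub>R y"] tb(1)[OF p, of n] tb(1)[OF y(1), of n] by simp
    qed
    ultimately have "0 \<le> 2 * (e / 2) * norm (y - p) - norm (v y - v p - (Re (y - p) *\<^sub>R g1 p + Im (y - p) *\<^sub>R g2 p))"
      by (intro tendsto_lowerbound[OF _ _ sequentially_bot]) auto
    then show ?thesis by simp
  qed
  then show "\<exists>d>0. \<forall>y\<in>disk. norm (y - p) < d \<longrightarrow> norm (v y - v p - (Re (y - p) *\<^sub>R g1 p + Im (y - p) *\<^sub>R g2 p)) \<le> e * norm (y - p)"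
    using d1(1) d2(1) by (intro exI[of _ \<delta>]) (auto simp: \<delta>_def)
qed

text \<open>
  The induction step of the embedding: differentiation takes \<open>H\<^sup>k\<^sup>+\<^sup>1\<close> to \<open>H\<^sup>k\<close> and shifts the orders of weak
  derivatives.
\<close>

lemma sobolev_pd:
  assumes v: "v \<in> sobolev (Suc k)" and k: "2 \<le> k"
  shows "v differentiable_on disk" "pd disk 1 v \<in> sobolev k" "pd disk \<i> v \<in> sobolev k"
    "weak_deriv (Suc c) d v w \<Longrightarrow> weak_deriv c d (pd disk 1 v) w" "weak_deriv c (Suc d) v w \<Longrightarrow> weak_deriv c d (pd disk \<i> v) w"
proof -
  obtain g1 g2 where g: "g1 \<in> sobolev k" "g2 \<in> sobolev k" "weak_deriv 1 0 v g1" "weak_deriv 0 1 v g2" using sobolev_step[OF v k] .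
  have c: "cont_disk v" "cont_disk g1" "cont_disk g2" using v g by (auto simp: sobolev_iff)
  note D = weak_gradient_imp_derivative[OF c g(3,4)]
  show "v differentiable_on disk" unfolding differentiable_on_def differentiable_def using D by blast
  have "pd disk 1 v x = g1 x" "pd disk \<i> v x = g2 x" for x
    using pd_disk_eq[OF D, of x 1] pd_disk_eq[OF D, of x \<i>] c by (cases "x \<in> disk"; auto simp: pd_def cont_disk_def)+
  then have e: "pd disk 1 v = g1" "pd disk \<i> v = g2" by auto
  show "pd disk 1 v \<in> sobolev k" "pd disk \<i> v \<in> sobolev k" unfolding e by (rule g)+
  show "weak_deriv (Suc c) d v w \<Longrightarrow> weak_deriv c d (pd disk 1 v) w" "weak_deriv c (Suc d) v w \<Longrightarrow> weak_deriv c d (pd disk \<i> v) w"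
    unfolding e by (rule weak_deriv_shift_1[OF g(3)] weak_deriv_shift_i[OF g(4)], assumption)+
qed

lemma sobolev_Ck_on: "v \<in> sobolev (2 + j) \<Longrightarrow> Ck_on j disk v"
proof (induction j arbitrary: v)
  case 0 then show ?case by (simp add: sobolev_def)
next
  case (Suc j)
  then have v: "v \<in> sobolev (Suc (2 + j))" by simp
  show ?case using sobolev_pd(1-3)[OF v] Suc.IH by auto
qed

lemma sobolev_Ck_space: "v \<in> sobolev (2 + j) \<Longrightarrow> v \<in> Ck_space j"
  using sobolev_Ck_on by (auto simp: Ck_space_def sobolev_def)

lemma sobolev_pds:
  assumes v: "v \<in> sobolev (2 + n + a + b)"
  shows "pds disk a b v \<in> sobolev (2 + n) \<and> (\<forall>c d w. weak_deriv (c + a) (d + b) v w \<longrightarrow> weak_deriv c d (pds disk a b v) w)"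
proof -
  have 1: "(pd disk \<i> ^^ b) v \<in> sobolev (2 + m) \<and> (\<forall>c d w. weak_deriv c (d + b) v w \<longrightarrow> weak_deriv c d ((pd disk \<i> ^^ b) v) w)"
    if "v \<in> sobolev (2 + m + b)" for m using that
  proof (induction b arbitrary: m)
    case (Suc b)
    then have IH: "(pd disk \<i> ^^ b) v \<in> sobolev (Suc (2 + m))" "\<And>c d w. weak_deriv c (d + b) v w \<Longrightarrow> weak_deriv c d ((pd disk \<i> ^^ b) v) w"
      using Suc.IH[of "Suc m"] by auto
    have "weak_deriv c d (pd disk \<i> ((pd disk \<i> ^^ b) v)) w" if "weak_deriv c (d + Suc b) v w" for c d w
      using that IH(2)[of c "Suc d" w] by (intro sobolev_pd(5)[OF IH(1)]) auto
    then show ?case using sobolev_pd(3)[OF IH(1)] by auto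
  qed simp
  define u where "u = (pd disk \<i> ^^ b) v"
  have 2: "(pd disk 1 ^^ a) u \<in> sobolev (2 + m) \<and> (\<forall>c d w. weak_deriv (c + a) d u w \<longrightarrow> weak_deriv c d ((pd disk 1 ^^ a) u) w)"
    if "u \<in> sobolev (2 + m + a)" for m using that
  proof (induction a arbitrary: m)
    case (Suc a)
    then have IH: "(pd disk 1 ^^ a) u \<in> sobolev (Suc (2 + m))" "\<And>c d w. weak_deriv (c + a) d u w \<Longrightarrow> weak_deriv c d ((pd disk 1 ^^ a) u) w"
      using Suc.IH[of "Suc m"] by auto
    have "weak_deriv c d (pd disk 1 ((pd disk 1 ^^ a) u)) w" if "weak_deriv (c + Suc a) d u w" for c d w
      using that IH(2)[of "Suc c" d w] by (intro sobolev_pd(4)[OF IH(1)]) auto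
    then show ?case using sobolev_pd(2)[OF IH(1)] by auto
  qed simp
  have "u \<in> sobolev (2 + n + a)" using 1[of "n + a"] v by (simp add: u_def add_ac)
  from 2[OF this] show ?thesis using 1[of "n + a"] v by (simp add: u_def pds_def add_ac)
qed

section \<open>The Sobolev inequality\<close>

lemma sum_orders_2: "(\<Sum>(c, d)\<in>{(c, d). c + d \<le> (2::nat)}. f c d :: real) = f 0 0 + f 1 0 + f 0 1 + f 2 0 + f 1 1 + f 0 2"
proof -
  have "{(c, d). c + d \<le> (2::nat)} = {(0,0), (1,0), (0,1), (2,0), (1,1), (0,2)}" by auto
  then show ?thesis by simp
qed

text \<open>
  The continuous representative produced by the parallelogram formulas must be \<open>v\<close> itself, so the bound applies to \<open>v\<close>.
\<close>

lemma sup_bound_H2: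
  assumes v: "cont_disk v" and W: "\<And>c d. c + d \<le> 2 \<Longrightarrow> sq_integrable (W c d) \<and> weak_deriv c d v (W c d)"
  shows "norm (v x) \<le> 320 * (6 * measure lborel disk + (\<Sum>(c, d)\<in>{(c, d). c + d \<le> 2}. LBINT z. (norm (W c d z))\<^sup>2))"
proof -
  have "weak_jet W" by (rule weak_jet_reps[of _ 0 0 v]) (use W in auto)
  then obtain g where g: "cont_disk g" "AE x in lborel. W 0 0 x = g x" "\<And>x. norm (g x) \<le> 320 * jet_L1_norm W"
    by (rule continuous_representative) (use W[of 0 0] in \<open>auto simp: sq_integrable_def\<close>)
  have "AE x in lborel. W 0 0 x = v x"
    by (rule weak_deriv_unique[of _ 0 0 v]) (use W[of 0 0] cont_disk_sq_integrable[OF v] in \<open>auto simp: weak_deriv_def pds_def\<close>)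
  then have ae: "AE x in lborel. x \<in> ball 0 1 \<longrightarrow> v x = g x" using g(2) by eventually_elim auto
  have cv: "continuous_on disk v" "continuous_on disk g" using v g by (auto simp: cont_disk_def)
  have eq: "v z = g z" if "z \<in> ball 0 1" for z
    by (rule AE_open_eq[OF open_ball _ _ ae that]) (use cv in \<open>auto intro: continuous_on_subset\<close>)
  have "v z - g z = 0" if "z \<in> disk" for z
    using continuous_constant_on_closure[of "ball 0 1" "\<lambda>z. v z - g z" 0 z] cv eq that by (auto intro!: continuous_intros)
  then have "v x = g x" using v g by (cases "x \<in> disk") (auto simp: cont_disk_def)
  then have "norm (v x) \<le> 320 * jet_L1_norm W" using g(3) by simp
  also have "jet_L1_norm W \<le> 6 * measure lborel disk + (\<Sum>(c, d)\<in>{(c, d). c + d \<le> 2}. LBINT z. (norm (W c d z))\<^sup>2)"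
  proof -
    have i: "integrable lborel (\<lambda>z. norm (W c d z))" "(LBINT z. norm (W c d z)) \<le> measure lborel disk + (LBINT z. (norm (W c d z))\<^sup>2)"
      if "c + d \<le> 2" for c d using W[OF that] sq_integrable_imp_integrable by auto
    have "jet_L1_norm W = (\<Sum>(c, d)\<in>{(c, d). c + d \<le> 2}. LBINT z. norm (W c d z))"
      unfolding sum_orders_2 jet_L1_norm_def using i(1) by simp
    then show ?thesis
      using i(2)[of 0 0] i(2)[of 1 0] i(2)[of 0 1] i(2)[of 2 0] i(2)[of 1 1] i(2)[of 0 2] unfolding sum_orders_2 by simp
  qed
  finally show ?thesis by simp
qed

definition sobolev_const :: real where "sobolev_const = 320 * (6 * measure lborel disk + 1)"

text \<open>
  The inhomogeneous bound for \<open>v / n\<close>.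
\<close>

lemma sup_bound_H2_scaled:
  assumes v: "cont_disk v" and W: "\<And>c d. c + d \<le> 2 \<Longrightarrow> sq_integrable (W c d) \<and> weak_deriv c d v (W c d)"
    and n: "(\<Sum>(c, d)\<in>{(c, d). c + d \<le> 2}. LBINT z. (norm (W c d z))\<^sup>2) \<le> n\<^sup>2" "0 < n"
  shows "norm (v x) \<le> sobolev_const * n"
proof -
  define u where "u z = (1 / n) *\<^sub>R v z + 0 *\<^sub>R v z" for z
  define X where "X c d z = (1 / n) *\<^sub>R W c d z + 0 *\<^sub>R W c d z" for c d z
  have cu: "cont_disk u" using v by (auto simp: cont_disk_def u_def intro!: continuous_intros)
  have X: "sq_integrable (X c d) \<and> weak_deriv c d u (X c d)" if "c + d \<le> 2" for c d
    unfolding X_def u_def using W[OF that] sq_integrable_imp_integrable(1)[OF cont_disk_sq_integrable[OF v]]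
    by (intro conjI sq_integrable_linear weak_deriv_linear) (auto intro: sq_integrable_imp_integrable)
  have "(LBINT z. (norm (X c d z))\<^sup>2) = (LBINT z. (norm (W c d z))\<^sup>2) / n\<^sup>2" for c d
    by (simp add: X_def power_divide)
  then have "(\<Sum>(c, d)\<in>{(c, d). c + d \<le> 2}. LBINT z. (norm (X c d z))\<^sup>2) = (\<Sum>(c, d)\<in>{(c, d). c + d \<le> 2}. LBINT z. (norm (W c d z))\<^sup>2) / n\<^sup>2"
    by (simp add: sum_divide_distrib case_prod_unfold)
  also have "\<dots> \<le> 1" using n by (simp add: divide_le_eq)
  finally have "norm (u x) \<le> sobolev_const" using sup_bound_H2[OF cu X, of x] by (simp add: sobolev_const_def)
  then show ?thesis using n(2) by (simp add: u_def field_simps)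
qed

lemma sobolev_norm_nonneg: "0 \<le> sobolev_norm k v"
  by (auto simp: sobolev_norm_def intro!: sum_nonneg)

text \<open>
  The second-order family belonging to the derivative of order \<open>(a, b)\<close> is a part of the family belonging to \<open>v\<close>.
  The number \<open>n\<close> is taken slightly larger than the norm, so that it is positive.
\<close>

lemma pds_bound:
  assumes v: "v \<in> sobolev (2 + j)" and ab: "a + b \<le> j"
  shows "norm (pds disk a b v x) \<le> sobolev_const * sobolev_norm (2 + j) v"
proof (rule field_le_epsilon)
  fix e :: real assume e: "0 < e"
  have K: "sobolev_const > 0" by (simp add: sobolev_const_def add_nonneg_pos)
  define n where "n = sobolev_norm (2 + j) v + e / sobolev_const"
  have n: "0 < n" "sobolev_norm (2 + j) v \<le> n" using e K sobolev_norm_nonneg[of "2 + j" v] by (auto simp: n_def add_nonneg_pos)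
  obtain W where W: "\<And>a b. a + b \<le> 2 + j \<Longrightarrow> sq_integrable (W a b) \<and> weak_deriv a b v (W a b)" using sobolev_reps[OF v] by blast
  have "v \<in> sobolev (2 + (j - a - b) + a + b)" using v ab by (simp add: add_ac)
  from sobolev_pds[OF this]
  have p: "pds disk a b v \<in> sobolev (2 + (j - a - b))" "\<And>c d w. weak_deriv (c + a) (d + b) v w \<Longrightarrow> weak_deriv c d (pds disk a b v) w" by auto
  have nn: "(\<Sum>(c, d)\<in>{(c, d). c + d \<le> 2 + j}. LBINT z. (norm (W c d z))\<^sup>2) = (sobolev_norm (2 + j) v)\<^sup>2"
    using sobolev_norm_eq[OF v W] by (auto intro!: real_sqrt_pow2[symmetric] sum_nonneg)
  have "norm (pds disk a b v x) \<le> sobolev_const * n"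
  proof (rule sup_bound_H2_scaled[where W = "\<lambda>c d. W (c + a) (d + b)"])
    show "cont_disk (pds disk a b v)" using p(1) by (simp add: sobolev_iff)
    show "sq_integrable (W (c + a) (d + b)) \<and> weak_deriv c d (pds disk a b v) (W (c + a) (d + b))" if "c + d \<le> 2" for c d
      using W[of "c + a" "d + b"] p(2)[of c d "W (c + a) (d + b)"] that ab by auto
    have "(\<Sum>(c, d)\<in>{(c, d). c + d \<le> 2}. LBINT z. (norm (W (c + a) (d + b) z))\<^sup>2)
      = (\<Sum>(c, d)\<in>(\<lambda>(c, d). (c + a, d + b)) ` {(c, d). c + d \<le> 2}. LBINT z. (norm (W c d z))\<^sup>2)"
      by (subst sum.reindex) (auto simp: inj_on_def case_prod_unfold)
    also have "\<dots> \<le> (\<Sum>(c, d)\<in>{(c, d). c + d \<le> 2 + j}. LBINT z. (norm (W c d z))\<^sup>2)"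
      using ab by (intro sum_mono2 finite_orders) auto
    also have "\<dots> \<le> n\<^sup>2" unfolding nn using n sobolev_norm_nonneg[of "2 + j" v] by (intro power_mono) auto
    finally show "(\<Sum>(c, d)\<in>{(c, d). c + d \<le> 2}. LBINT z. (norm (W (c + a) (d + b) z))\<^sup>2) \<le> n\<^sup>2" .
  qed (rule n)
  also have "\<dots> = sobolev_const * sobolev_norm (2 + j) v + e" using K by (simp add: n_def distrib_left)
  finally show "norm (pds disk a b v x) \<le> sobolev_const * sobolev_norm (2 + j) v + e" .
qed

lemma Ck_norm_le_sobolev_norm:
  assumes v: "v \<in> sobolev (2 + j)"
  shows "Ck_norm j v \<le> (real (card {(a, b). a + b \<le> j}) * sobolev_const) * sobolev_norm (2 + j) v"
proof -
  have "Ck_norm j v = (\<Sum>(a, b)\<in>{(a, b). a + b \<le> j}. SUP z\<in>disk. norm (pds disk a b v z))"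
    using sobolev_Ck_space[OF v] by (simp add: Ck_norm_def)
  also have "\<dots> \<le> (\<Sum>(a, b)\<in>{(a, b). a + b \<le> j}. sobolev_const * sobolev_norm (2 + j) v)"
    by (intro sum_mono) (auto simp del: add_2_eq_Suc intro!: cSUP_least pds_bound[OF v])
  finally show ?thesis by (simp add: case_prod_unfold)
qed

section \<open>The spaces \<open>C\<^sup>k\<close> and the scale of Sobolev spaces\<close>

lemma pd_disk_comb:
  assumes f: "f differentiable_on disk" and g: "g differentiable_on disk"
  shows "pd disk e (\<lambda>z. c *\<^sub>R f z + d *\<^sub>R g z) = (\<lambda>z. c *\<^sub>R pd disk e f z + d *\<^sub>R pd disk e g z)"
proof
  fix z
  show "pd disk e (\<lambda>z. c *\<^sub>R f z + d *\<^sub>R g z) z = c *\<^sub>R pd disk e f z + d *\<^sub>R pd disk e g z"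
  proof (cases "z \<in> disk")
    case True
    note D = has_derivative_pd[OF f True] has_derivative_pd[OF g True]
    from pd_disk_eq[OF has_derivative_add[OF has_derivative_scaleR_right[OF D(1), of c] has_derivative_scaleR_right[OF D(2), of d]] True, where e = e]
      pd_disk_eq[OF D(1) True, of e] pd_disk_eq[OF D(2) True, of e]
    show ?thesis by simp
  qed (simp add: pd_def)
qed

lemma Ck_on_disk_comb:
  fixes f g :: "complex \<Rightarrow> 'b::real_normed_vector"
  shows "Ck_on k disk f \<Longrightarrow> Ck_on k disk g \<Longrightarrow> Ck_on k disk (\<lambda>z. c *\<^sub>R f z + d *\<^sub>R g z)"
proof (induction k arbitrary: f g)
  case 0 then show ?case by (auto intro!: continuous_intros)
next
  case (Suc k)
  then have df: "f differentiable_on disk" and dg: "g differentiable_on disk" by auto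
  have "(\<lambda>z. c *\<^sub>R f z + d *\<^sub>R g z) differentiable_on disk"
    unfolding differentiable_on_def
  proof
    fix z :: complex assume z: "z \<in> disk"
    show "(\<lambda>z. c *\<^sub>R f z + d *\<^sub>R g z) differentiable (at z within disk)"
      by (rule differentiableI[OF has_derivative_add[OF has_derivative_scaleR_right[OF has_derivative_pd[OF df z]]
            has_derivative_scaleR_right[OF has_derivative_pd[OF dg z]]]])
  qed
  moreover have "Ck_on k disk (\<lambda>z. c *\<^sub>R pd disk e f z + d *\<^sub>R pd disk e g z)" if "e = 1 \<or> e = \<i>" for e
    using Suc.prems that by (intro Suc.IH) auto
  ultimately show ?case by (simp add: pd_disk_comb[OF df dg])
qed

lemma Ck_on_funpow_pd_disk:
  assumes e: "e = 1 \<or> e = \<i>"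
  shows "Ck_on (n + a) disk f \<Longrightarrow> Ck_on n disk ((pd disk e ^^ a) f)"
proof (induction a arbitrary: n)
  case (Suc a)
  then have "Ck_on (Suc n) disk ((pd disk e ^^ a) f)" by (simp del: Ck_on.simps)
  then show ?case using e by auto
qed simp

lemma funpow_pd_disk_comb:
  fixes f g :: "complex \<Rightarrow> 'b::real_normed_vector"
  assumes e: "e = 1 \<or> e = \<i>"
  shows "Ck_on (n + a) disk f \<Longrightarrow> Ck_on (n + a) disk g \<Longrightarrow>
      (pd disk e ^^ a) (\<lambda>z. c *\<^sub>R f z + d *\<^sub>R g z) = (\<lambda>z. c *\<^sub>R (pd disk e ^^ a) f z + d *\<^sub>R (pd disk e ^^ a) g z)"
proof (induction a arbitrary: n)
  case (Suc a)
  then have "Ck_on (Suc n) disk ((pd disk e ^^ a) f)" "Ck_on (Suc n) disk ((pd disk e ^^ a) g)"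
    using Ck_on_funpow_pd_disk[OF e, of "Suc n" a] by (auto simp del: Ck_on.simps)
  then have "(pd disk e ^^ a) f differentiable_on disk" "(pd disk e ^^ a) g differentiable_on disk" by simp_all
  moreover have "(pd disk e ^^ a) (\<lambda>z. c *\<^sub>R f z + d *\<^sub>R g z) = (\<lambda>z. c *\<^sub>R (pd disk e ^^ a) f z + d *\<^sub>R (pd disk e ^^ a) g z)"
    using Suc.IH[of "Suc n"] Suc.prems by (simp del: Ck_on.simps)
  ultimately show ?case by (simp add: pd_disk_comb)
qed simp

lemma pds_disk:
  fixes f :: "complex \<Rightarrow> 'b::real_normed_vector"
  assumes ab: "a + b \<le> k" and f: "Ck_on k disk f"
  shows "continuous_on disk (pds disk a b f)"
    "Ck_on k disk g \<Longrightarrow> pds disk a b (\<lambda>z. c *\<^sub>R f z + d *\<^sub>R g z) = (\<lambda>z. c *\<^sub>R pds disk a b f z + d *\<^sub>R pds disk a b g z)"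
proof -
  have f': "Ck_on (0 + a + b) disk f" using Ck_on_le[OF f ab] by simp
  have i: "Ck_on (0 + a) disk ((pd disk \<i> ^^ b) f)" by (rule Ck_on_funpow_pd_disk[OF _ f']) simp
  have "Ck_on 0 disk (pds disk a b f)" unfolding pds_def by (rule Ck_on_funpow_pd_disk[OF _ i]) simp
  then show "continuous_on disk (pds disk a b f)" by simp
  assume "Ck_on k disk g"
  then have g': "Ck_on (0 + a + b) disk g" using Ck_on_le[OF _ ab] by simp
  have j: "Ck_on (0 + a) disk ((pd disk \<i> ^^ b) g)" by (rule Ck_on_funpow_pd_disk[OF _ g']) simp
  have "(pd disk \<i> ^^ b) (\<lambda>z. c *\<^sub>R f z + d *\<^sub>R g z) = (\<lambda>z. c *\<^sub>R (pd disk \<i> ^^ b) f z + d *\<^sub>R (pd disk \<i> ^^ b) g z)"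
    by (rule funpow_pd_disk_comb[OF _ f' g']) simp
  then show "pds disk a b (\<lambda>z. c *\<^sub>R f z + d *\<^sub>R g z) = (\<lambda>z. c *\<^sub>R pds disk a b f z + d *\<^sub>R pds disk a b g z)"
    unfolding pds_def using funpow_pd_disk_comb[OF _ i j, of 1 c d] by simp
qed

text \<open>
  Suprema over the compact disk are finite because the derivatives are continuous there.
\<close>

lemma norm_on_Ck_space: "norm_on (Ck_space k) (Ck_norm k :: (complex \<Rightarrow> 'b::real_normed_vector) \<Rightarrow> real)"
proof -
  let ?X = "Ck_space k :: (complex \<Rightarrow> 'b) set" and ?I = "{(a, b). a + b \<le> k}"
  define s where "s a b v = (SUP z\<in>disk. norm (pds disk a b (v :: complex \<Rightarrow> 'b) z))" for a b v
  have nX: "Ck_norm k v = (\<Sum>(a, b)\<in>?I. s a b v)" if "v \<in> ?X" for v using that by (simp add: Ck_norm_def s_def)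
  have comb: "(\<lambda>z. c *\<^sub>R u z + d *\<^sub>R v z) \<in> ?X" if "u \<in> ?X" "v \<in> ?X" for u v c d
    using that Ck_on_disk_comb[of k u v c d] by (auto simp: Ck_space_def)
  have zero: "(\<lambda>_. 0) \<in> ?X"
  proof -
    have "Ck_on k disk (\<lambda>_. 0 :: 'b)"
    proof (induction k)
      case (Suc k)
      have "pd disk e (\<lambda>_. 0 :: 'b) = (\<lambda>_. 0)" for e
        using pd_disk_eq[OF has_derivative_const] by (auto simp: pd_def fun_eq_iff)
      then show ?case using Suc by simp
    qed simp
    then show ?thesis by (simp add: Ck_space_def)
  qed
  have bdd: "bdd_above ((\<lambda>z. norm (pds disk a b v z)) ` disk)" if "v \<in> ?X" "a + b \<le> k" for v a b
  proof -
    have "compact ((\<lambda>z. norm (pds disk a b v z)) ` disk)"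
      using pds_disk(1)[OF that(2)] that(1) by (intro compact_continuous_image continuous_intros) (auto simp: Ck_space_def)
    then show ?thesis by (intro bounded_imp_bdd_above compact_imp_bounded)
  qed
  have le: "norm (pds disk a b v z) \<le> s a b v" if "v \<in> ?X" "a + b \<le> k" "z \<in> disk" for v a b z
    unfolding s_def by (intro cSUP_upper that bdd)
  have s0: "0 \<le> s a b v" if "v \<in> ?X" "a + b \<le> k" for v a b
    by (rule order_trans[OF norm_ge_zero le[OF that, of 0]]) simp
  have pc: "pds disk a b (\<lambda>z. c *\<^sub>R u z + d *\<^sub>R v z) = (\<lambda>z. c *\<^sub>R pds disk a b u z + d *\<^sub>R pds disk a b v z)"
    if "u \<in> ?X" "v \<in> ?X" "a + b \<le> k" for a b c d u v
    using that by (intro pds_disk(2)) (auto simp: Ck_space_def)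
  have sc: "s a b (\<lambda>z. c *\<^sub>R u z + d *\<^sub>R v z) \<le> \<bar>c\<bar> * s a b u + \<bar>d\<bar> * s a b v" if uv: "u \<in> ?X" "v \<in> ?X" "a + b \<le> k" for a b c d u v
    unfolding s_def[of a b "\<lambda>z. c *\<^sub>R u z + d *\<^sub>R v z"] pc[OF that]
    using le[OF uv(1,3)] le[OF uv(2,3)]
    by (intro cSUP_least) (auto intro!: norm_triangle_le add_mono mult_left_mono)
  have nc: "Ck_norm k (\<lambda>z. c *\<^sub>R u z + d *\<^sub>R v z) \<le> \<bar>c\<bar> * Ck_norm k u + \<bar>d\<bar> * Ck_norm k v" if uv: "u \<in> ?X" "v \<in> ?X" for u v c d
  proof -
    have "Ck_norm k (\<lambda>z. c *\<^sub>R u z + d *\<^sub>R v z) \<le> (\<Sum>(a, b)\<in>?I. \<bar>c\<bar> * s a b u + \<bar>d\<bar> * s a b v)"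
      unfolding nX[OF comb[OF uv]] using sc[OF uv] by (intro sum_mono) auto
    then show ?thesis by (simp add: nX uv case_prod_unfold sum.distrib sum_distrib_left)
  qed
  have sm: "Ck_norm k (c *\<^sub>R v) \<le> \<bar>c\<bar> * Ck_norm k v" if "v \<in> ?X" for c and v :: "complex \<Rightarrow> 'b"
    using nc[OF that that, of c 0] by (simp add: scaleR_fun_def)
  have sX: "c *\<^sub>R v \<in> ?X" if "v \<in> ?X" for c v using comb[OF that that, of c 0] by (simp add: scaleR_fun_def)
  have hom: "Ck_norm k (c *\<^sub>R v) = \<bar>c\<bar> * Ck_norm k v" if v: "v \<in> ?X" for c v
  proof (cases "c = 0")
    case True
    have "0 \<le> Ck_norm k (c *\<^sub>R v)" using nX[OF sX[OF v]] s0[OF sX[OF v]] by (auto intro!: sum_nonneg)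
    then show ?thesis using sm[OF v, of c] True by simp
  next
    case False
    have "Ck_norm k v \<le> \<bar>1 / c\<bar> * Ck_norm k (c *\<^sub>R v)" using sm[OF sX[OF v, of c], of "1 / c"] False by simp
    then have "\<bar>c\<bar> * Ck_norm k v \<le> Ck_norm k (c *\<^sub>R v)" using False by (simp add: field_simps)
    then show ?thesis using sm[OF v, of c] by simp
  qed
  show ?thesis
    unfolding norm_on_def
  proof (intro conjI ballI allI impI)
    show "subspace ?X"
      unfolding subspace_def using zero sX comb[of _ _ 1 1] by (auto simp: zero_fun_def plus_fun_def)
    show "0 \<le> Ck_norm k x" for x :: "complex \<Rightarrow> 'b"
      using nX[of x] s0[of x] by (cases "x \<in> ?X") (auto simp: Ck_norm_def[of k x] intro!: sum_nonneg)
    show "Ck_norm k (- x) = Ck_norm k x" for x :: "complex \<Rightarrow> 'b"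
    proof (cases "x \<in> ?X")
      case True
      then show ?thesis using hom[OF True, of "- 1"] by simp
    next
      case False
      then have "- x \<notin> ?X" using sX[of "- x" "- 1"] by auto
      then show ?thesis using False by (simp add: Ck_norm_def)
    qed
    fix x assume x: "x \<in> ?X"
    show "Ck_norm k (c *\<^sub>R x) = \<bar>c\<bar> * Ck_norm k x" for c by (rule hom[OF x])
    show "Ck_norm k (x + y) \<le> Ck_norm k x + Ck_norm k y" if "y \<in> ?X" for y
      using nc[OF x that, of 1 1] by (simp add: plus_fun_def)
    show "x = 0" if "Ck_norm k x = 0"
    proof
      fix z
      have "\<forall>p\<in>?I. (case p of (a, b) \<Rightarrow> s a b x) = 0"
        using that unfolding nX[OF x] by (subst (asm) sum_nonneg_eq_0_iff) (auto simp: finite_orders s0[OF x])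
      then have "s 0 0 x = 0" by auto
      then have "z \<in> disk \<Longrightarrow> x z = 0" using le[OF x, of 0 0 z] by (simp add: pds_def)
      then show "x z = 0 z" using x by (auto simp: Ck_space_def)
    qed
  qed
qed

lemma norm_on_sobolev: "norm_on (sobolev k) (sobolev_norm k :: (complex \<Rightarrow> 'b::euclidean_space) \<Rightarrow> real)"
  unfolding norm_on_def
proof (intro conjI ballI allI impI)
  have sX: "c *\<^sub>R v \<in> sobolev k" if "v \<in> sobolev k" for c and v :: "complex \<Rightarrow> 'b"
    using sobolev_linear[OF that that, of c 0] by (simp add: scaleR_fun_def)
  show "subspace (sobolev k :: (complex \<Rightarrow> 'b) set)"
    unfolding subspace_def using sobolev_zero sX sobolev_linear[of _ k _ 1 1] by (auto simp: zero_fun_def plus_fun_def)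
  show "0 \<le> sobolev_norm k x" for x :: "complex \<Rightarrow> 'b" by (rule sobolev_norm_nonneg)
  show "sobolev_norm k (- x) = sobolev_norm k x" for x :: "complex \<Rightarrow> 'b"
  proof (cases "x \<in> sobolev k")
    case True
    then show ?thesis using sobolev_norm_properties(2)[OF True True, of "- 1"] by (simp add: fun_Compl_def)
  next
    case False
    then have "- x \<notin> sobolev k" using sX[of "- x" "- 1"] by auto
    then show ?thesis using False by (simp add: sobolev_norm_def)
  qed
  fix x :: "complex \<Rightarrow> 'b" assume x: "x \<in> sobolev k"
  show "sobolev_norm k (c *\<^sub>R x) = \<bar>c\<bar> * sobolev_norm k x" for c
    using sobolev_norm_properties(2)[OF x x, of c] by (simp add: scaleR_fun_def)
  show "sobolev_norm k (x + y) \<le> sobolev_norm k x + sobolev_norm k y" if "y \<in> sobolev k" for y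
    using sobolev_norm_properties(1)[OF x that] by (simp add: plus_fun_def)
  show "x = 0" if "sobolev_norm k x = 0"
    using sobolev_norm_properties(3)[OF x x that] by (simp add: zero_fun_def)
qed

lemma sobolev_nested:
  assumes v: "v \<in> sobolev (Suc k)"
  shows "v \<in> sobolev k" "sobolev_norm k v \<le> sobolev_norm (Suc k) v"
proof -
  show k: "v \<in> sobolev k" using v by (auto simp: sobolev_def)
  obtain W where W: "\<And>a b. a + b \<le> Suc k \<Longrightarrow> sq_integrable (W a b) \<and> weak_deriv a b v (W a b)" using sobolev_reps[OF v] by blast
  have "(\<Sum>(a, b)\<in>{(a, b). a + b \<le> k}. LBINT z. (norm (W a b z))\<^sup>2) \<le> (\<Sum>(a, b)\<in>{(a, b). a + b \<le> Suc k}. LBINT z. (norm (W a b z))\<^sup>2)"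
    by (intro sum_mono2 finite_orders) auto
  then show "sobolev_norm k v \<le> sobolev_norm (Suc k) v"
    using sobolev_norm_eq[OF v W] sobolev_norm_eq[OF k, of W] W by simp
qed

lemma normed_scale_H3: "normed_scale (H3_sc :: (complex \<Rightarrow> real ^ 'n) sc)"
  unfolding normed_scale_def H3_sc_def
  using sobolev_nested[of _ "3 + _"] by (auto simp: norm_on_sobolev)

text \<open>
  Composition of a \<open>C\<^sup>k\<close> map with a bounded linear inclusion: the same derivatives work, with every bound multiplied by a power of the
  norm \<open>C\<close> of the inclusion.
\<close>

lemma Ck_map_restrict:
  fixes f :: "'a::real_vector \<Rightarrow> 'b::real_normed_vector"
  assumes f: "Ck_map k X n U f" and n: "\<And>x. 0 \<le> n x" "\<And>x. 0 \<le> n' x" and X': "X' \<subseteq> X" and sub: "subspace X'" and C: "\<And>x. x \<in> X' \<Longrightarrow> n x \<le> C * n' x" "1 \<le> C"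
  shows "Ck_map k X' n' (U \<inter> X') f"
proof -
  obtain F where F: "(\<forall>v\<in>U. F 0 v [] = f v) \<and> (\<forall>j\<le>k. \<forall>v\<in>U. bmultilinear_on j X n (F j v)) \<and>
    (\<forall>j<k. \<forall>v\<in>U. \<forall>e>0. \<exists>d>0. \<forall>h\<in>X. v + h \<in> U \<and> n h < d \<longrightarrow>
          (\<forall>hs. length hs = j \<and> set hs \<subseteq> X \<longrightarrow> norm (F j (v + h) hs - F j v hs - F (Suc j) v (h # hs)) \<le> e * n h * prod_list (map n hs))) \<and>
    (\<forall>v\<in>U. \<forall>e>0. \<exists>d>0. \<forall>w\<in>U. n (w - v) < d \<longrightarrow>
          (\<forall>hs. length hs = k \<and> set hs \<subseteq> X \<longrightarrow> norm (F k w hs - F k v hs) \<le> e * prod_list (map n hs)))"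
    using f unfolding Ck_map_def by (rule exE)
  note F0 = F[THEN conjunct1, rule_format] and F1 = F[THEN conjunct2, THEN conjunct1, rule_format]
    and F2 = F[THEN conjunct2, THEN conjunct2, THEN conjunct1] and F3 = F[THEN conjunct2, THEN conjunct2, THEN conjunct2]
  have P: "prod_list (map n hs) \<le> C ^ length hs * prod_list (map n' hs)" if "set hs \<subseteq> X'" for hs
    using that
  proof (induction hs)
    case (Cons a hs)
    then have "n a * prod_list (map n hs) \<le> (C * n' a) * (C ^ length hs * prod_list (map n' hs))"
      using C n by (intro mult_mono) (auto intro!: prod_list_nonneg mult_nonneg_nonneg)
    then show ?case by (simp add: mult_ac)
  qed simp
  have p0: "0 \<le> prod_list (map n' hs)" "0 \<le> prod_list (map n hs)" for hs using n by (auto intro!: prod_list_nonneg)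
  show ?thesis
    unfolding Ck_map_def
  proof (intro exI[of _ F] conjI allI ballI impI)
    show "F 0 v [] = f v" if "v \<in> U \<inter> X'" for v using that F0 by auto
    show "bmultilinear_on j X' n' (F j v)" if "j \<le> k" "v \<in> U \<inter> X'" for j v
    proof -
      have b: "bmultilinear_on j X n (F j v)" using that F1 by auto
      obtain B where B: "0 \<le> B" "\<And>hs. length hs = j \<Longrightarrow> set hs \<subseteq> X \<Longrightarrow> norm (F j v hs) \<le> B * prod_list (map n hs)"
        using bmultilinear_bound[OF b n(1)] by blast
      have "norm (F j v hs) \<le> (B * C ^ j) * prod_list (map n' hs)" if "length hs = j" "set hs \<subseteq> X'" for hs
      proof -
        have "norm (F j v hs) \<le> B * prod_list (map n hs)" using that X' by (intro B(2)) auto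
        also have "\<dots> \<le> B * (C ^ j * prod_list (map n' hs))" using mult_left_mono[OF P[OF that(2)] B(1)] that(1) by simp
        finally show ?thesis by (simp add: mult.assoc)
      qed
      then have ex: "\<exists>B. \<forall>hs. length hs = j \<and> set hs \<subseteq> X' \<longrightarrow> norm (F j v hs) \<le> B * prod_list (map n' hs)" by blast
      show ?thesis unfolding bmultilinear_on_def
      proof (intro conjI allI impI ex)
        fix hs i x y c assume "length hs = j \<and> set hs \<subseteq> X' \<and> i < j \<and> x \<in> X' \<and> y \<in> X'"
        then have *: "length hs = j" "set hs \<subseteq> X" "i < j" "x \<in> X" "y \<in> X" using X' by auto
        show "F j v (hs[i := x + y]) = F j v (hs[i := x]) + F j v (hs[i := y])" by (rule bmultilinear_add[OF b *])
        show "F j v (hs[i := c *\<^sub>R x]) = c *\<^sub>R F j v (hs[i := x])" by (rule bmultilinear_scale[OF b *(1-4)])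
      qed
    qed
  next
    fix j v and e :: real assume j: "j < k" and v: "v \<in> U \<inter> X'" and e: "0 < e"
    have Cj: "0 < C ^ Suc j" "0 < C" using C(2) by auto
    define e' where "e' = e / C ^ Suc j"
    have e': "0 < e'" "e' * C ^ Suc j = e" using e Cj by (simp_all add: e'_def)
    obtain d where d: "d > 0" "\<And>h hs. h \<in> X \<Longrightarrow> v + h \<in> U \<Longrightarrow> n h < d \<Longrightarrow> length hs = j \<Longrightarrow> set hs \<subseteq> X \<Longrightarrow>
       norm (F j (v + h) hs - F j v hs - F (Suc j) v (h # hs)) \<le> e' * n h * prod_list (map n hs)"
      using F2[rule_format, OF j _ e'(1), of v] v by blast
    have "norm (F j (v + h) hs - F j v hs - F (Suc j) v (h # hs)) \<le> e * n' h * prod_list (map n' hs)"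
      if h: "h \<in> X'" "v + h \<in> U \<inter> X'" "n' h < d / C" "length hs = j" "set hs \<subseteq> X'" for h hs
    proof -
      have "n h \<le> C * n' h" by (rule C(1)[OF h(1)])
      also have "\<dots> < d" using h(3) Cj by (simp add: field_simps)
      finally have "norm (F j (v + h) hs - F j v hs - F (Suc j) v (h # hs)) \<le> e' * n h * prod_list (map n hs)"
        using h X' by (intro d(2)) auto
      also have "\<dots> \<le> e' * (C * n' h) * (C ^ j * prod_list (map n' hs))"
        using C(1)[OF h(1)] P[OF h(5)] e' Cj n h(4) by (intro mult_mono mult_left_mono p0) auto
      also have "\<dots> = (e' * C ^ Suc j) * n' h * prod_list (map n' hs)" by simp
      finally show ?thesis by (simp only: e'(2))
    qed
    then show "\<exists>d>0. \<forall>h\<in>X'. v + h \<in> U \<inter> X' \<and> n' h < d \<longrightarrow>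
          (\<forall>hs. length hs = j \<and> set hs \<subseteq> X' \<longrightarrow> norm (F j (v + h) hs - F j v hs - F (Suc j) v (h # hs)) \<le> e * n' h * prod_list (map n' hs))"
      using d(1) Cj by (intro exI[of _ "d / C"]) auto
  next
    fix v and e :: real assume v: "v \<in> U \<inter> X'" and e: "0 < e"
    have Ck: "0 < C ^ k" "0 < C" using C(2) by auto
    define e' where "e' = e / C ^ k"
    have e': "0 < e'" "e' * C ^ k = e" using e Ck by (simp_all add: e'_def)
    obtain d where d: "d > 0" "\<And>w hs. w \<in> U \<Longrightarrow> n (w - v) < d \<Longrightarrow> length hs = k \<Longrightarrow> set hs \<subseteq> X \<Longrightarrow>
       norm (F k w hs - F k v hs) \<le> e' * prod_list (map n hs)"
      using F3[rule_format, OF _ e'(1), of v] v by blast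
    have "norm (F k w hs - F k v hs) \<le> e * prod_list (map n' hs)"
      if w: "w \<in> U \<inter> X'" "w - v \<in> X'" "n' (w - v) < d / C" "length hs = k" "set hs \<subseteq> X'" for w hs
    proof -
      have "n (w - v) \<le> C * n' (w - v)" by (rule C(1)[OF w(2)])
      also have "\<dots> < d" using w(3) Ck by (simp add: field_simps)
      finally have "norm (F k w hs - F k v hs) \<le> e' * prod_list (map n hs)" using w X' by (intro d(2)) auto
      also have "\<dots> \<le> e' * (C ^ k * prod_list (map n' hs))" using P[OF w(5)] e' w(4) by (intro mult_left_mono) auto
      also have "\<dots> = (e' * C ^ k) * prod_list (map n' hs)" by simp
      finally show ?thesis by (simp only: e'(2))
    qed
    then show "\<exists>d>0. \<forall>w\<in>U \<inter> X'. n' (w - v) < d \<longrightarrow>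
          (\<forall>hs. length hs = k \<and> set hs \<subseteq> X' \<longrightarrow> norm (F k w hs - F k v hs) \<le> e * prod_list (map n' hs))"
      using d(1) Ck v sub by (intro exI[of _ "d / C"]) (auto simp: subspace_diff)
  qed
qed

section \<open>sc-smoothness of the intersection point\<close>

text \<open>
  On level \<open>m\<close> the Sobolev embedding into \<open>C\<^sup>m\<^sup>+\<^sup>1\<close> turns the assumed differentiability in the \<open>C\<^sup>m\<^sup>+\<^sup>1\<close> topology into that of class \<open>C\<^sup>m\<^sup>+\<^sup>1\<close> on
  \<open>E\<^sub>m\<close>; on level 0 it also gives openness of \<open>U\<close> in \<open>H\<^sup>3\<close>.
\<close>

theorem theorem1p25:
  fixes u :: "complex \<Rightarrow> real ^ 'n"
    and H :: "(real ^ 'n) set"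
    and U :: "(complex \<Rightarrow> real ^ 'n) set"
    and \<epsilon> :: real
    and z :: "(complex \<Rightarrow> real ^ 'n) \<Rightarrow> complex"
  assumes "u \<in> sc_infty H3_sc"
    and "u 0 = 0"
    and "inj (frechet_derivative u (at 0))"
    and "alg_complement H (range (frechet_derivative u (at 0)))"
    and "openin (norm_top (Ck_space 1) (Ck_norm 1)) U"
    and "u \<in> U"
    and "0 < \<epsilon>" and "\<epsilon> < 1"
    and "\<And>v. v \<in> U \<Longrightarrow> z v \<in> ball 0 \<epsilon> \<and> v (z v) \<in> H"
    and "\<And>v w. v \<in> U \<Longrightarrow> w \<in> ball 0 \<epsilon> \<Longrightarrow> v w \<in> H \<Longrightarrow> w = z v"
    and "\<And>v. v \<in> U \<Longrightarrow> transversal (range (frechet_derivative v (at (z v)))) H"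
    and "Ck_map 1 (Ck_space 1) (Ck_norm 1) U z"
    and "\<And>k. k \<ge> 1 \<Longrightarrow> Ck_map k (Ck_space k) (Ck_norm k) (U \<inter> Ck_space k) z"
  shows "sc_smooth H3_sc (U \<inter> level H3_sc 0) const_sc UNIV z"
proof (rule sc_smooth_of_Ck_levels[OF normed_scale_H3])
  let ?E = "H3_sc :: (complex \<Rightarrow> real ^ 'n) sc"
  define C where "C m = max 1 (real (card {(a, b). a + b \<le> Suc m}) * sobolev_const)" for m
  have L: "level ?E m = sobolev (2 + Suc m)" "lnorm ?E m = sobolev_norm (2 + Suc m)" for m
    by (simp_all add: H3_sc_def numeral_3_eq_3)
  have emb: "v \<in> Ck_space (Suc m)" "Ck_norm (Suc m) v \<le> C m * lnorm ?E m v" if "v \<in> level ?E m" for v m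
  proof -
    have v: "v \<in> sobolev (2 + Suc m)" using that by (simp add: L)
    show "v \<in> Ck_space (Suc m)" by (rule sobolev_Ck_space[OF v])
    have "Ck_norm (Suc m) v \<le> (real (card {(a, b). a + b \<le> Suc m}) * sobolev_const) * lnorm ?E m v"
      using Ck_norm_le_sobolev_norm[OF v] by (simp add: L)
    also have "\<dots> \<le> C m * lnorm ?E m v"
      by (intro mult_right_mono) (auto simp: C_def L sobolev_norm_nonneg)
    finally show "Ck_norm (Suc m) v \<le> C m * lnorm ?E m v" .
  qed
  show "U \<inter> level ?E 0 \<subseteq> level ?E 0" by simp
  show "\<exists>r>0. \<forall>y\<in>level ?E 0. lnorm ?E 0 (y - x) < r \<longrightarrow> y \<in> U \<inter> level ?E 0" if x: "x \<in> U \<inter> level ?E 0" for x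
  proof -
    have "U \<subseteq> Ck_space 1 \<and> (\<forall>x\<in>U. \<exists>r>0. \<forall>y\<in>Ck_space 1. Ck_norm 1 (y - x) < r \<longrightarrow> y \<in> U)"
      using assms(5) by (simp add: openin_norm_top[OF norm_on_Ck_space])
    then obtain r where r: "r > 0" "\<And>y. y \<in> Ck_space 1 \<Longrightarrow> Ck_norm 1 (y - x) < r \<Longrightarrow> y \<in> U" using x by blast
    have C0: "C 0 > 0" by (simp add: C_def)
    have "y \<in> U" if y: "y \<in> level ?E 0" "lnorm ?E 0 (y - x) < r / C 0" for y
    proof (rule r(2))
      show "y \<in> Ck_space 1" using emb(1)[OF y(1)] by simp
      have "y - x \<in> level ?E 0"
        using y x by (intro subspace_diff[OF norm_onD(1)[OF normed_scale_norm_on[OF normed_scale_H3]]]) auto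
      then have "Ck_norm 1 (y - x) \<le> C 0 * lnorm ?E 0 (y - x)" using emb(2)[of "y - x" 0] by simp
      also have "\<dots> < r" using y(2) C0 by (simp add: field_simps)
      finally show "Ck_norm 1 (y - x) < r" .
    qed
    then show ?thesis using r(1) C0 by (intro exI[of _ "r / C 0"]) auto
  qed
  show "Ck_map (Suc m) (level ?E m) (lnorm ?E m) ((U \<inter> level ?E 0) \<inter> level ?E m) z" for m
  proof -
    have "Ck_map (Suc m) (level ?E m) (lnorm ?E m) ((U \<inter> Ck_space (Suc m)) \<inter> level ?E m) z"
    proof (rule Ck_map_restrict[OF assms(13)])
      show "subspace (level ?E m)" by (rule norm_onD(1)[OF normed_scale_norm_on[OF normed_scale_H3]])
      show "level ?E m \<subseteq> Ck_space (Suc m)" using emb(1) by blast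
      show "Ck_norm (Suc m) x \<le> C m * lnorm ?E m x" if "x \<in> level ?E m" for x by (rule emb(2)[OF that])
      show "0 \<le> Ck_norm (Suc m) x" for x :: "complex \<Rightarrow> real ^ 'n" by (rule norm_onD(2)[OF norm_on_Ck_space])
      show "0 \<le> lnorm ?E m x" for x by (rule norm_onD(2)[OF normed_scale_norm_on[OF normed_scale_H3]])
      show "1 \<le> C m" by (simp add: C_def)
    qed simp
    moreover have "(U \<inter> Ck_space (Suc m)) \<inter> level ?E m = (U \<inter> level ?E 0) \<inter> level ?E m"
      using emb(1)[of _ m] normed_scale_mono[OF normed_scale_H3, of 0 m] by blast
    ultimately show ?thesis by simp
  qed
qed

end
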